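(* Let $q\in(0,1]$. Let $\boldsymbol X,\boldsymbol Y$ be Lévy processes on $\mathbb R^d$ with characteristic triplets $(\boldsymbol\gamma_{\boldsymbol X},\boldsymbol\Sigma_{\boldsymbol X}\boldsymbol\Sigma_{\boldsymbol X}^\top,\nu_{\boldsymbol X})$ and $(\boldsymbol\gamma_{\boldsymbol Y},\boldsymbol\Sigma_{\boldsymbol Y}\boldsymbol\Sigma_{\boldsymbol Y}^\top,\nu_{\boldsymbol Y})$ whose Lévy measures admit radial decompositions with respect to a common probability measure $\sigma$ on $\mathbb S^{d-1}$, $$\nu_{\boldsymbol X}(B)=\int_{\mathbb S^{d-1}}\int_0^\infty\mathbf 1_B(x\boldsymbol v)\rho_{\boldsymbol X}(\mathrm dx,\boldsymbol v)\sigma(\mathrm d\boldsymbol v),\qquad\nu_{\boldsymbol Y}(B)=\int_{\mathbb S^{d-1}}\int_0^\infty\mathbf 1_B(x\boldsymbol v)\rho_{\boldsymbol Y}(\mathrm dx,\boldsymbol v)\sigma(\mathrm d\boldsymbol v),\quad B\in\mathcal B(\mathbb R^d\setminus\{\boldsymbol 0\}).$$ For any $\varepsilon\in(0,\infty)$ (where $\varepsilon=\infty$ is also allowed when $\boldsymbol X$ and $\boldsymbol Y$ are of finite variation), the comonotonically coupled big-jump components satisfy $$\mathbb E\Big[\sup_{t\in[0,1]}|\boldsymbol L^{\boldsymbol X}_t-\boldsymbol L^{\boldsymbol Y}_t|^q\Big]\le\int_{(0,\varepsilon)\times\mathbb S^{d-1}}|\rho^\leftarrow_{\boldsymbol X}(x,\boldsymbol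 v)-\rho^\leftarrow_{\boldsymbol Y}(x,\boldsymbol v)|^q\,\mathrm dx\,\sigma(\mathrm d\boldsymbol v).$$ In particular, $$\begin{aligned}\mathcal W_q(\boldsymbol X,\boldsymbol Y)\le{}&|\boldsymbol\varpi_{\boldsymbol X}-\boldsymbol\varpi_{\boldsymbol Y}|^q+\Big(4\int_{[\varepsilon,\infty)\times\mathbb S^{d-1}}(\rho^\leftarrow_{\boldsymbol X}(x,\boldsymbol v)-\rho^\leftarrow_{\boldsymbol Y}(x,\boldsymbol v))^2\,\mathrm dx\,\sigma(\mathrm d\boldsymbol v)\Big)^{q/2}\\&+2^qd^{q/2}|\boldsymbol\Sigma_{\boldsymbol X}-\boldsymbol\Sigma_{\boldsymbol Y}|^q+\int_{(0,\varepsilon)\times\mathbb S^{d-1}}|\rho^\leftarrow_{\boldsymbol X}(x,\boldsymbol v)-\rho^\leftarrow_{\boldsymbol Y}(x,\boldsymbol v)|^q\,\mathrm dx\,\sigma(\mathrm d\boldsymbol v).\end{aligned}$$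
   Context: $|\cdot|$ is the Euclidean norm for vectors and the Frobenius norm for matrices; $\mathbb S^{d-1}$ is the unit sphere in $\mathbb R^d$ ($\mathbb S^0=\{-1,1\}$). Characteristic triplets are with respect to the cutoff $\mathbf 1_{\{|\boldsymbol w|<1\}}$. Right-hand sides may be infinite. The families $\{\rho_{\boldsymbol X}(\cdot,\boldsymbol v)\}_{\boldsymbol v}$, $\{\rho_{\boldsymbol Y}(\cdot,\boldsymbol v)\}_{\boldsymbol v}$ are measurable families of Lévy measures on $(0,\infty)$, and $u\mapsto\rho^\leftarrow_{\boldsymbol X}(u,\boldsymbol v)$ is the right-continuous inverse of $x\mapsto\rho_{\boldsymbol X}([x,\infty),\boldsymbol v)$, i.e. $\rho^\leftarrow_{\boldsymbol X}(u,\boldsymbol v)=\sup\{x>0:\rho_{\boldsymbol X}([x,\infty),\boldsymbol v)>u\}$ ($\sup\emptyset=0$); similarly for $\boldsymbol Y$. Comonotonic coupling: let $(U_n)$ be iid uniform on $[0,1]$, $(\Gamma_n)$ the partial sums of iid standard exponential variables, $(\boldsymbol V_n)$ iid with law $\sigma$, all three sequences independent. Let $\Xi=\sum_n\delta_{(U_n,\Gamma_n,\boldsymbol V_n)}$, a Poisson random measure on $[0,1]\times(0,\infty)\times\mathbb S^{d-1}$ with mean measure $\mathrm{Leb}\otimes\mathrm{Leb}\otimes\sigma$, and let $\widetilde\Xi$ be its compensated version. Set $$\boldsymbol M^{\boldsymbol X}_t=\int_{[0,t]\times[\varepsilon,\infty)\times\mathbb S^{d-1}}\boldsymbol v\rho^\leftarrow_{\boldsymbol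 X}(x,\boldsymbol v)\widetilde\Xi(\mathrm ds,\mathrm dx,\mathrm d\boldsymbol v),\qquad\boldsymbol L^{\boldsymbol X}_t=\int_{[0,t]\times(0,\varepsilon)\times\mathbb S^{d-1}}\boldsymbol v\rho^\leftarrow_{\boldsymbol X}(x,\boldsymbol v)\Xi(\mathrm ds,\mathrm dx,\mathrm d\boldsymbol v),$$ and define $\boldsymbol M^{\boldsymbol Y},\boldsymbol L^{\boldsymbol Y}$ in the same way (with the same $\Xi$) from $\rho^\leftarrow_{\boldsymbol Y}$. The vectors $\boldsymbol\varpi_{\boldsymbol X},\boldsymbol\varpi_{\boldsymbol Y}\in\mathbb R^d$ (depending on $\varepsilon$) are the drifts such that $\boldsymbol X$ has the law of $\boldsymbol\varpi_{\boldsymbol X}t+\boldsymbol\Sigma_{\boldsymbol X}\boldsymbol B_t+\boldsymbol M^{\boldsymbol X}_t+\boldsymbol L^{\boldsymbol X}_t$ and $\boldsymbol Y$ that of $\boldsymbol\varpi_{\boldsymbol Y}t+\boldsymbol\Sigma_{\boldsymbol Y}\boldsymbol B_t+\boldsymbol M^{\boldsymbol Y}_t+\boldsymbol L^{\boldsymbol Y}_t$, with $\boldsymbol B$ a standard Brownian motion on $\mathbb R^d$ independent of $\Xi$. For $q\in(0,1]$, $\mathcal W_q(\boldsymbol X,\boldsymbol Y)=\inf\mathbb E[\sup_{t\in[0,1]}|\boldsymbol X'_t-\boldsymbol Y'_t|^q]$, the infimum over all couplings of the process laws on $[0,1]$. *)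

theory Defs
  imports "HOL-Probability.Probability"
begin

section \<open>Levy processes and characteristic triplets\<close>

definition cadlag_on :: "real set \<Rightarrow> (real \<Rightarrow> 'b::topological_space) \<Rightarrow> bool" where
  "cadlag_on T f \<longleftrightarrow>
     (\<forall>t\<in>T. (f \<longlongrightarrow> f t) (at t within T \<inter> {t<..}) \<and>
            (\<exists>l. (f \<longlongrightarrow> l) (at t within T \<inter> {..<t})))"

definition independent_increments ::
  "'a measure \<Rightarrow> (real \<Rightarrow> 'a \<Rightarrow> real^'d) \<Rightarrow> bool" where
  "independent_increments P X \<longleftrightarrow>
     (\<forall>(ts :: nat \<Rightarrow> real) n. mono ts \<and> 0 \<le> ts 0 \<longrightarrow>
        prob_space.indep_vars P (\<lambda>_. borel)
          (\<lambda>k \<omega>. X (ts (Suc k)) \<omega> - X (ts k) \<omega>) {..<n})"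

text \<open>Stochastic continuity is not listed separately: it follows from stationarity of the
  increments and right-continuity at time 0.\<close>

definition levy_process :: "'a measure \<Rightarrow> (real \<Rightarrow> 'a \<Rightarrow> real^'d) \<Rightarrow> bool" where
  "levy_process P X \<longleftrightarrow>
     prob_space P \<and>
     (\<forall>t\<ge>0. X t \<in> borel_measurable P) \<and>
     (AE \<omega> in P. X 0 \<omega> = 0) \<and>
     independent_increments P X \<and>
     (\<forall>s\<ge>0. \<forall>t\<ge>0. distr P borel (\<lambda>\<omega>. X (s + t) \<omega> - X s \<omega>) = distr P borel (X t)) \<and>
     (AE \<omega> in P. cadlag_on {0..} (\<lambda>t. X t \<omega>))"

definition levy_measure :: "(real^'d) measure \<Rightarrow> bool" where
  "levy_measure \<nu> \<longleftrightarrow>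
     sets \<nu> = sets borel \<and> emeasure \<nu> {0} = 0 \<and>
     (\<integral>\<^sup>+w. ennreal (min 1 ((norm w)\<^sup>2)) \<partial>\<nu>) < \<infinity>"

definition levy_exponent ::
  "real^'d \<Rightarrow> real^'d^'d \<Rightarrow> (real^'d) measure \<Rightarrow> real^'d \<Rightarrow> complex" where
  "levy_exponent \<gamma> A \<nu> u =
     \<i> * complex_of_real (u \<bullet> \<gamma>) - complex_of_real (u \<bullet> (A *v u)) / 2 +
     (CLINT w|\<nu>. exp (\<i> * complex_of_real (u \<bullet> w)) - 1
                  - \<i> * complex_of_real (u \<bullet> w) * indicator {w. norm w < 1} w)"

definition has_characteristic_triplet ::
  "'a measure \<Rightarrow> (real \<Rightarrow> 'a \<Rightarrow> real^'d) \<Rightarrow> real^'d \<Rightarrow> real^'d^'d \<Rightarrow> (real^'d) measure \<Rightarrow> bool" where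
  "has_characteristic_triplet P X \<gamma> A \<nu> \<longleftrightarrow>
     levy_measure \<nu> \<and>
     (\<forall>t\<ge>0. \<forall>u. (CLINT \<omega>|P. exp (\<i> * complex_of_real (u \<bullet> X t \<omega>)))
                 = exp (complex_of_real t * levy_exponent \<gamma> A \<nu> u))"

definition bounded_variation_on_Icc :: "real \<Rightarrow> (real \<Rightarrow> 'b::real_normed_vector) \<Rightarrow> bool" where
  "bounded_variation_on_Icc T f \<longleftrightarrow>
     (\<exists>K. \<forall>(ts :: nat \<Rightarrow> real) n. mono ts \<and> range ts \<subseteq> {0..T} \<longrightarrow>
        (\<Sum>k<n. norm (f (ts (Suc k)) - f (ts k))) \<le> K)"

definition finite_variation :: "'a measure \<Rightarrow> (real \<Rightarrow> 'a \<Rightarrow> real^'d) \<Rightarrow> bool" where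
  "finite_variation P X \<longleftrightarrow> (AE \<omega> in P. \<forall>T\<ge>0. bounded_variation_on_Icc T (\<lambda>t. X t \<omega>))"

definition standard_brownian_motion :: "'a measure \<Rightarrow> (real \<Rightarrow> 'a \<Rightarrow> real^'d) \<Rightarrow> bool" where
  "standard_brownian_motion P B \<longleftrightarrow>
     prob_space P \<and>
     (\<forall>t\<ge>0. B t \<in> borel_measurable P) \<and>
     (AE \<omega> in P. B 0 \<omega> = 0) \<and>
     independent_increments P B \<and>
     (\<forall>s t. 0 \<le> s \<and> s < t \<longrightarrow>
        prob_space.indep_vars P (\<lambda>_. borel) (\<lambda>i \<omega>. (B t \<omega> - B s \<omega>) $ i) UNIV \<and>
        (\<forall>i. distributed P lborel (\<lambda>\<omega>. (B t \<omega> - B s \<omega>) $ i)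
               (\<lambda>x. ennreal (normal_density 0 (sqrt (t - s)) x)))) \<and>
     (AE \<omega> in P. continuous_on {0..} (\<lambda>t. B t \<omega>))"

section \<open>Radial decompositions and inverse tails\<close>

text \<open>Probability measures on the unit sphere are measures on the trace of the Borel
  \<open>\<sigma>\<close>-algebra, so that their space is the sphere itself.\<close>

definition sphere_prob :: "(real^'d) measure \<Rightarrow> bool" where
  "sphere_prob \<sigma> \<longleftrightarrow> prob_space \<sigma> \<and> sets \<sigma> = sets (restrict_space borel (sphere 0 1))"

definition radial_levy_family ::
  "(real^'d) measure \<Rightarrow> (real^'d \<Rightarrow> real measure) \<Rightarrow> bool" where
  "radial_levy_family \<sigma> \<rho> \<longleftrightarrow>
     (\<forall>v\<in>sphere 0 1.
        sets (\<rho> v) = sets (restrict_space borel {0<..}) \<and>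
        (\<integral>\<^sup>+x. ennreal (min 1 (x\<^sup>2)) \<partial>\<rho> v) < \<infinity>) \<and>
     (\<forall>B\<in>sets (restrict_space borel {0<..}). (\<lambda>v. emeasure (\<rho> v) B) \<in> borel_measurable \<sigma>)"

definition radial_decomposition ::
  "(real^'d) measure \<Rightarrow> (real^'d) measure \<Rightarrow> (real^'d \<Rightarrow> real measure) \<Rightarrow> bool" where
  "radial_decomposition \<nu> \<sigma> \<rho> \<longleftrightarrow>
     radial_levy_family \<sigma> \<rho> \<and>
     (\<forall>B\<in>sets borel. 0 \<notin> B \<longrightarrow>
        emeasure \<nu> B = (\<integral>\<^sup>+v. (\<integral>\<^sup>+x. indicator B (x *\<^sub>R v) \<partial>\<rho> v) \<partial>\<sigma>))"

text \<open>Inserting 0 only implements the convention that the supremum of the empty set is 0.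
  For \<open>u > 0\<close> the set is bounded above, so the real supremum is the intended one; values at
  \<open>u \<le> 0\<close> are irrelevant.\<close>

definition inverse_tail :: "(real^'d \<Rightarrow> real measure) \<Rightarrow> real \<Rightarrow> real^'d \<Rightarrow> real" where
  "inverse_tail \<rho> u v = Sup (insert 0 {x. 0 < x \<and> emeasure (\<rho> v) {x..} > ennreal u})"

section \<open>The comonotonic coupling\<close>

abbreviation generated_sets :: "'a measure \<Rightarrow> ('a \<Rightarrow> 'b) \<Rightarrow> 'b measure \<Rightarrow> 'a set set" where
  "generated_sets P Z N \<equiv> sets (vimage_algebra (space P) Z N)"

text \<open>The index starts at 0, so \<open>arrival E n\<close> is the sum of \<open>n + 1\<close> exponential variables.\<close>

definition arrival :: "(nat \<Rightarrow> 'a \<Rightarrow> real) \<Rightarrow> nat \<Rightarrow> 'a \<Rightarrow> real" where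
  "arrival E n \<omega> = (\<Sum>k\<le>n. E k \<omega>)"

definition coupling_sequences ::
  "'a measure \<Rightarrow> (real^'d) measure \<Rightarrow> (nat \<Rightarrow> 'a \<Rightarrow> real) \<Rightarrow> (nat \<Rightarrow> 'a \<Rightarrow> real) \<Rightarrow>
   (nat \<Rightarrow> 'a \<Rightarrow> real^'d) \<Rightarrow> bool" where
  "coupling_sequences P \<sigma> U E V \<longleftrightarrow>
     prob_space P \<and>
     prob_space.indep_vars P (\<lambda>_. borel) U UNIV \<and>
     (\<forall>n. distr P borel (U n) = uniform_measure lborel {0..1}) \<and>
     prob_space.indep_vars P (\<lambda>_. borel) E UNIV \<and>
     (\<forall>n. distributed P lborel (E n) (\<lambda>x. ennreal (exponential_density 1 x))) \<and>
     prob_space.indep_vars P (\<lambda>_. \<sigma>) V UNIV \<and>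
     (\<forall>n. distr P \<sigma> (V n) = \<sigma>) \<and>
     prob_space.indep_sets P
       (\<lambda>k. [generated_sets P (\<lambda>\<omega> n. U n \<omega>) (Pi\<^sub>M UNIV (\<lambda>_. borel)),
             generated_sets P (\<lambda>\<omega> n. arrival E n \<omega>) (Pi\<^sub>M UNIV (\<lambda>_. borel)),
             generated_sets P (\<lambda>\<omega> n. V n \<omega>) (Pi\<^sub>M UNIV (\<lambda>_. \<sigma>))] ! k)
       {..<3::nat}"

abbreviation mark_space :: "(real^'d) measure \<Rightarrow> (real \<times> real \<times> (real^'d)) measure" where
  "mark_space \<sigma> \<equiv> borel \<Otimes>\<^sub>M (borel \<Otimes>\<^sub>M \<sigma>)"

text \<open>\<open>\<Xi>(\<omega>)\<close> is the sum over \<open>n\<close> of the Dirac masses at \<open>(U\<^sub>n(\<omega>), \<Gamma>\<^sub>n(\<omega>), V\<^sub>n(\<omega>))\<close>, written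
  as the push-forward of counting measure on the index set.\<close>

definition jump_measure ::
  "(real^'d) measure \<Rightarrow> (nat \<Rightarrow> 'a \<Rightarrow> real) \<Rightarrow> (nat \<Rightarrow> 'a \<Rightarrow> real) \<Rightarrow> (nat \<Rightarrow> 'a \<Rightarrow> real^'d) \<Rightarrow>
   'a \<Rightarrow> (real \<times> real \<times> (real^'d)) measure" where
  "jump_measure \<sigma> U \<Gamma> V \<omega> =
     distr (count_space UNIV) (mark_space \<sigma>) (\<lambda>n. (U n \<omega>, \<Gamma> n \<omega>, V n \<omega>))"

abbreviation mean_measure :: "(real^'d) measure \<Rightarrow> (real \<times> real \<times> (real^'d)) measure" where
  "mean_measure \<sigma> \<equiv> lborel \<Otimes>\<^sub>M (lborel \<Otimes>\<^sub>M \<sigma>)"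

definition big_jump_part ::
  "('a \<Rightarrow> (real \<times> real \<times> (real^'d)) measure) \<Rightarrow> (real^'d \<Rightarrow> real measure) \<Rightarrow> ereal \<Rightarrow>
   real \<Rightarrow> 'a \<Rightarrow> real^'d" where
  "big_jump_part \<Xi> \<rho> \<epsilon> t \<omega> =
     set_lebesgue_integral (\<Xi> \<omega>)
       ({0..t} \<times> {x. 0 < x \<and> ereal x < \<epsilon>} \<times> sphere 0 1)
       (\<lambda>(s, x, v). inverse_tail \<rho> x v *\<^sub>R v)"

text \<open>The truncation of the compensated integral to levels in \<open>[\<epsilon>, n]\<close>, where the mean measure
  is finite and the integrals against \<open>\<Xi>\<close> and against its mean can be taken separately.\<close>

definition compensated_truncation ::
  "('a \<Rightarrow> (real \<times> real \<times> (real^'d)) measure) \<Rightarrow> (real^'d) measure \<Rightarrow> (real^'d \<Rightarrow> real measure) \<Rightarrow>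
   ereal \<Rightarrow> nat \<Rightarrow> real \<Rightarrow> 'a \<Rightarrow> real^'d" where
  "compensated_truncation \<Xi> \<sigma> \<rho> \<epsilon> n t \<omega> =
     (let A = {0..t} \<times> {x. 0 < x \<and> \<epsilon> \<le> ereal x \<and> x \<le> real n} \<times> sphere 0 1;
          f = (\<lambda>(s, x, v). inverse_tail \<rho> x v *\<^sub>R v)
      in set_lebesgue_integral (\<Xi> \<omega>) A f - set_lebesgue_integral (mean_measure \<sigma>) A f)"

text \<open>\<open>M\<close> is (a version of) the process of integrals of \<open>v \<rho>\<^sup>\<leftarrow>(x, v)\<close> over
  \<open>[0,t] \<times> [\<epsilon>,\<infinity>) \<times> S\<close> against the compensated measure.  The first clause is the usual
  necessary and sufficient condition for an integrand \<open>f\<close> to be integrable against a compensated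
  Poisson measure, namely that \<open>min |f| |f|\<^sup>2\<close> is integrable against the mean measure; it holds
  whenever \<open>f\<close> is square integrable.  Under it the truncated integrals are well defined and
  converge in probability.\<close>

definition is_compensated_small_jump_part ::
  "'a measure \<Rightarrow> ('a \<Rightarrow> (real \<times> real \<times> (real^'d)) measure) \<Rightarrow> (real^'d) measure \<Rightarrow>
   (real^'d \<Rightarrow> real measure) \<Rightarrow> ereal \<Rightarrow> (real \<Rightarrow> 'a \<Rightarrow> real^'d) \<Rightarrow> bool" where
  "is_compensated_small_jump_part P \<Xi> \<sigma> \<rho> \<epsilon> M \<longleftrightarrow>
     (\<integral>\<^sup>+(x, v) \<in> {x. 0 < x \<and> \<epsilon> \<le> ereal x} \<times> sphere 0 1.
        ennreal (min (inverse_tail \<rho> x v) ((inverse_tail \<rho> x v)\<^sup>2)) \<partial>(lborel \<Otimes>\<^sub>M \<sigma>)) < \<infinity> \<and>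
     (\<forall>t\<in>{0..1}.
        M t \<in> borel_measurable P \<and>
        (\<forall>\<delta>>0. (\<lambda>n. measure P {\<omega> \<in> space P.
                      dist (compensated_truncation \<Xi> \<sigma> \<rho> \<epsilon> n t \<omega>) (M t \<omega>) > \<delta>})
                \<longlonglongrightarrow> 0))"

text \<open>Independence of \<open>B\<close> and the random measure \<open>\<Xi>\<close>; the \<open>\<sigma>\<close>-algebra of \<open>\<Xi>\<close> is generated by
  the variables \<open>\<Xi>(A)\<close>, \<open>A\<close> measurable.\<close>

definition independent_of_jump_measure ::
  "'a measure \<Rightarrow> (real^'d) measure \<Rightarrow> ('a \<Rightarrow> (real \<times> real \<times> (real^'d)) measure) \<Rightarrow>
   (real \<Rightarrow> 'a \<Rightarrow> real^'d) \<Rightarrow> bool" where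
  "independent_of_jump_measure P \<sigma> \<Xi> B \<longleftrightarrow>
     prob_space.indep_set P
       (generated_sets P (\<lambda>\<omega>. \<lambda>t\<in>{0..}. B t \<omega>) (Pi\<^sub>M {0..} (\<lambda>_. borel)))
       (generated_sets P (\<lambda>\<omega>. \<lambda>A\<in>sets (mark_space \<sigma>). emeasure (\<Xi> \<omega>) A)
          (Pi\<^sub>M (sets (mark_space \<sigma>)) (\<lambda>_. borel)))"

section \<open>Path laws and the Wasserstein distance\<close>

text \<open>The law of a process on \<open>[0,1]\<close>, determined by its finite-dimensional distributions.\<close>

definition path_law :: "'a measure \<Rightarrow> (real \<Rightarrow> 'a \<Rightarrow> real^'d) \<Rightarrow> (real \<Rightarrow> real^'d) measure" where
  "path_law P X = distr P (Pi\<^sub>M {0..1} (\<lambda>_. borel)) (\<lambda>\<omega>. \<lambda>t\<in>{0..1}. X t \<omega>)"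

text \<open>The Skorokhod space \<open>D[0,1]\<close>; its Borel \<open>\<sigma>\<close>-algebra is the trace of the product
  \<open>\<sigma>\<close>-algebra.\<close>

definition cadlag_space :: "(real \<Rightarrow> real^'d) measure" where
  "cadlag_space = restrict_space (Pi\<^sub>M {0..1} (\<lambda>_. borel)) {x. cadlag_on {0..1} x}"

text \<open>Couplings live on \<open>D[0,1] \<times> D[0,1]\<close>, so that the supremum over \<open>[0,1]\<close> is measurable.
  The marginals are compared on the product \<open>\<sigma>\<close>-algebra because Levy processes are only assumed
  to have cadlag paths almost surely.\<close>

definition couplings ::
  "(real \<Rightarrow> real^'d) measure \<Rightarrow> (real \<Rightarrow> real^'d) measure \<Rightarrow>
   ((real \<Rightarrow> (real^'d)) \<times> (real \<Rightarrow> (real^'d))) measure set" where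
  "couplings \<mu> \<nu> =
     {\<pi>. prob_space \<pi> \<and> sets \<pi> = sets (cadlag_space \<Otimes>\<^sub>M cadlag_space) \<and>
         distr \<pi> (Pi\<^sub>M {0..1} (\<lambda>_. borel)) fst = \<mu> \<and>
         distr \<pi> (Pi\<^sub>M {0..1} (\<lambda>_. borel)) snd = \<nu>}"

definition wasserstein ::
  "real \<Rightarrow> (real \<Rightarrow> real^'d) measure \<Rightarrow> (real \<Rightarrow> real^'d) measure \<Rightarrow> ennreal" where
  "wasserstein q \<mu> \<nu> =
     (INF \<pi>\<in>couplings \<mu> \<nu>. \<integral>\<^sup>+(x, y). (SUP t\<in>{0..1}. ennreal (norm (x t - y t) powr q)) \<partial>\<pi>)"

text \<open>Powers with positive real exponent on \<open>[0,\<infinity>]\<close>.\<close>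

definition ennreal_power :: "ennreal \<Rightarrow> real \<Rightarrow> ennreal" where
  "ennreal_power a p = (if a = \<infinity> then \<infinity> else ennreal (enn2real a powr p))"

end

theory Submission
  imports Defs
begin

text \<open>The jumps of \<open>L\<^sup>X\<close> and \<open>L\<^sup>Y\<close> in the coupling sit at the same points of \<open>\<Xi>\<close>, and
  \<open>x \<mapsto> x\<^sup>q\<close> is subadditive, so \<open>\<bar>L\<^sup>X\<^sub>t - L\<^sup>Y\<^sub>t\<bar>\<^sup>q\<close> is at most the sum over all points of the \<open>q\<close>-th powers
  of the differences of the jumps; Campbell's formula computes the expectation of this sum.
  Campbell's formula, and the second moments of compensated sums, follow from the Mecke formula,
  which for a sequence of arrival times is a statement about inserting one point into a sequence of
  exponential gaps.  The integrability that makes \<open>L\<^sup>X\<close> well defined when \<open>\<epsilon> = \<infinity>\<close> is that of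
  \<open>min 1 \<bar>w\<bar>\<close> against the Levy measure of a process of finite variation.

  For the distance of the full processes, Doob's \<open>L\<^sup>2\<close> inequality is applied on dyadic grids to the
  Gaussian part and to the compensated small jumps, and Jensen's inequality passes from exponent 2
  to exponent \<open>q\<close>.  The coupled processes need not have cadlag paths, but their laws on \<open>[0,1]\<close> are
  those of cadlag processes, which forces cadlag versions read off from the values at dyadic times.\<close>

section \<open>Powers and suprema\<close>

text \<open>The small-jump parts are prescribed only at each fixed time, up to null sets and as
  limits in probability, so a supremum over all times is out of reach for the coupled processes
  themselves. All estimates are therefore made on finite grids with constants independent of the
  grid, and only the versions carry the supremum over [0,1]. Doob's inequality enters through a
  pathwise inequality whose single probabilistic input is that the next increment is orthogonal to
  one weight. For Brownian motion this is independence; for Poisson sums it holds because deleting a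
  point with a later time does not change earlier values, so that neither filtrations nor
  conditional expectations occur. A further obstacle is that Bochner integrals take the default
  value 0 where they diverge, which is incompatible with linearity: the almost sure convergence of
  the big-jump series has to be known before the difference of two of them is written as one series.
  The factor 4 is Doob's constant for exponent 2; the dimension is the second moment of Brownian
  motion at time 1.\<close>

lemma powr_add_le:
  fixes a b q :: real
  assumes "0 \<le> a" "0 \<le> b" "0 < q" "q \<le> 1"
  shows "(a + b) powr q \<le> a powr q + b powr q"
proof (cases "a + b = 0")
  case True
  with assms show ?thesis by auto
next
  case False
  define s where "s = a + b"
  with False assms have s: "s > 0" by auto
  \<comment> \<open>A share \<open>c / s\<close> lies in [0,1], where an exponent at most 1 does not
    decrease it; the two shares of \<open>s\<close> add up to 1.\<close>
  have *: "c / s * s powr q \<le> c powr q" if "0 \<le> c" "c \<le> s" for c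
  proof (cases "c = 0")
    case False
    have "c / s = (c / s) powr 1"
      using that s by simp
    also have "\<dots> \<le> (c / s) powr q"
      using that s assms by (intro powr_mono') auto
    finally have "c / s * s powr q \<le> (c / s) powr q * s powr q"
      by (intro mult_right_mono) auto
    also have "\<dots> = c powr q"
      using that s by (simp add: powr_divide)
    finally show ?thesis .
  qed simp
  have "s powr q = a / s * s powr q + b / s * s powr q"
    using s unfolding distrib_right[symmetric] add_divide_distrib[symmetric] s_def by simp
  also have "\<dots> \<le> a powr q + b powr q"
    using assms by (intro add_mono *) (auto simp: s_def)
  finally show ?thesis by (simp add: s_def)
qed

lemma powr_norm_sum_le:
  fixes f :: "'i \<Rightarrow> 'b::real_normed_vector"
  assumes "0 < q" "q \<le> 1"
  shows "norm (sum f A) powr q \<le> (\<Sum>i\<in>A. norm (f i) powr q)"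
proof (induction A rule: infinite_finite_induct)
  case (insert x F)
  have "norm (sum f (insert x F)) powr q \<le> (norm (f x) + norm (sum f F)) powr q"
    using assms insert by (intro powr_mono2) (auto intro: norm_triangle_ineq)
  also have "\<dots> \<le> norm (f x) powr q + norm (sum f F) powr q"
    using assms by (intro powr_add_le) auto
  finally show ?case using insert by simp
qed (use assms in auto)

text \<open>Finite subadditivity survives the limit of partial sums. Where the series is not
  absolutely convergent the left side is 0 by the convention for Bochner integrals.\<close>

lemma powr_norm_lebesgue_integral_nat_le:
  fixes f :: "nat \<Rightarrow> 'b::{banach, second_countable_topology}"
  assumes "0 < q" "q \<le> 1"
  shows "ennreal (norm (\<integral>n. f n \<partial>count_space UNIV) powr q)
    \<le> (\<integral>\<^sup>+n. ennreal (norm (f n) powr q) \<partial>count_space UNIV)"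
proof (cases "integrable (count_space UNIV) f")
  case True
  have lim: "(\<lambda>n. \<Sum>i<n. f i) \<longlonglongrightarrow> (\<integral>n. f n \<partial>count_space UNIV)"
    using sums_integral_count_space_nat[OF True] by (simp add: sums_def)
  have "(\<lambda>n. ennreal (norm (\<Sum>i<n. f i) powr q))
      \<longlonglongrightarrow> ennreal (norm (\<integral>n. f n \<partial>count_space UNIV) powr q)"
    using assms by (intro tendsto_ennrealI tendsto_powr' tendsto_norm lim tendsto_const) auto
  then show ?thesis
  proof (rule LIMSEQ_le_const2, intro exI allI impI)
    fix n :: nat
    have "ennreal (norm (\<Sum>i<n. f i) powr q) \<le> ennreal (\<Sum>i<n. norm (f i) powr q)"
      using assms by (intro ennreal_leI powr_norm_sum_le)
    also have "\<dots> = (\<Sum>i<n. ennreal (norm (f i) powr q))"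
      by simp
    also have "\<dots> \<le> (\<integral>\<^sup>+n. ennreal (norm (f n) powr q) \<partial>count_space UNIV)"
      unfolding nn_integral_count_space_nat by (rule sum_le_suminf) auto
    finally show "ennreal (norm (\<Sum>i<n. f i) powr q)
      \<le> (\<integral>\<^sup>+n. ennreal (norm (f n) powr q) \<partial>count_space UNIV)" .
  qed
qed (use assms in \<open>simp add: not_integrable_integral_eq\<close>)

text \<open>A concave function lies below its tangent, and the right side is the tangent at
  \<open>c\<close>. It comes from Young's inequality with weights \<open>p\<close> and
  \<open>1 - p\<close>, divided by \<open>c powr (1 - p)\<close>.\<close>

lemma powr_le_tangent:
  fixes y c p :: real
  assumes "0 \<le> y" "0 < c" "0 < p" "p < 1"
  shows "y powr p \<le> (1 - p) * c powr p + p * c powr (p - 1) * y"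
proof -
  have "(y powr p) * (c powr (1 - p)) \<le> p * y + (1 - p) * c"
    using Youngs_inequality_0[of p "1 - p" y c] assms by (cases "y = 0") auto
  then have "(y powr p) * (c powr (1 - p)) * c powr (p - 1) \<le> (p * y + (1 - p) * c) * c powr (p - 1)"
    by (intro mult_right_mono) auto
  also have "(y powr p) * (c powr (1 - p)) * c powr (p - 1) = y powr p"
    using assms by (simp add: mult.assoc powr_add[symmetric])
  also have "(p * y + (1 - p) * c) * c powr (p - 1) = (1 - p) * (c * c powr (p - 1)) + p * c powr (p - 1) * y"
    by (simp add: algebra_simps)
  also have "c * c powr (p - 1) = c powr p"
    using assms by (simp add: powr_mult_base)
  finally show ?thesis .
qed

text \<open>Jensen's inequality by integrating a tangent. Its base point is the bound
  \<open>C\<close> instead of the mean, which is harmless since the slope is nonnegative. At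
  \<open>C = 0\<close> there is no tangent, but then \<open>g\<close> vanishes almost
  everywhere.\<close>

lemma (in prob_space) nn_integral_powr_le:
  fixes g :: "'a \<Rightarrow> real"
  assumes [measurable]: "g \<in> borel_measurable M"
    and g: "\<And>x. 0 \<le> g x" and p: "0 < p" "p < 1" and C: "0 \<le> C"
    and le: "(\<integral>\<^sup>+x. ennreal (g x) \<partial>M) \<le> ennreal C"
  shows "(\<integral>\<^sup>+x. ennreal (g x powr p) \<partial>M) \<le> ennreal (C powr p)"
proof (cases "C = 0")
  case True
  then have "(\<integral>\<^sup>+x. ennreal (g x) \<partial>M) = 0"
    using le by simp
  then have "AE x in M. ennreal (g x) = 0"
    by (subst (asm) nn_integral_0_iff_AE) auto
  then have "AE x in M. ennreal (g x powr p) = 0"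
    by eventually_elim (use g p in \<open>auto simp: ennreal_eq_0_iff powr_eq_0_iff intro: antisym\<close>)
  then have "(\<integral>\<^sup>+x. ennreal (g x powr p) \<partial>M) = 0"
    by (subst nn_integral_0_iff_AE) auto
  then show ?thesis by simp
next
  case False
  with C have C: "C > 0" by simp
  have "(\<integral>\<^sup>+x. ennreal (g x powr p) \<partial>M)
      \<le> (\<integral>\<^sup>+x. ennreal ((1 - p) * C powr p) + ennreal (p * C powr (p - 1)) * ennreal (g x) \<partial>M)"
    using powr_le_tangent[OF g C p] p g
    by (intro nn_integral_mono)
       (auto simp: ennreal_mult'[symmetric] ennreal_plus[symmetric] simp del: ennreal_plus
             intro!: ennreal_leI)
  also have "\<dots> = ennreal ((1 - p) * C powr p) + ennreal (p * C powr (p - 1)) * (\<integral>\<^sup>+x. ennreal (g x) \<partial>M)"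
    by (subst nn_integral_add) (auto simp: nn_integral_cmult emeasure_space_1)
  also have "\<dots> \<le> ennreal ((1 - p) * C powr p) + ennreal (p * C powr (p - 1)) * ennreal C"
    by (intro add_left_mono mult_left_mono le) auto
  also have "\<dots> = ennreal ((1 - p) * C powr p + p * (C * C powr (p - 1)))"
    using p C by (simp add: ennreal_mult'[symmetric] ennreal_plus[symmetric] mult_ac del: ennreal_plus)
  also have "(1 - p) * C powr p + p * (C * C powr (p - 1)) = C powr p"
    using C by (simp add: powr_mult_base algebra_simps)
  finally show ?thesis .
qed

section \<open>Doob's maximal inequality\<close>

fun running_max :: "(nat \<Rightarrow> real) \<Rightarrow> nat \<Rightarrow> real" where
  "running_max s 0 = s 0"
| "running_max s (Suc n) = max (running_max s n) (s (Suc n))"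

lemma running_max_ge: "k \<le> n \<Longrightarrow> s k \<le> running_max s n"
  by (induction n) (auto simp: le_Suc_eq le_max_iff_disj)

lemma running_max_le_sum:
  assumes "\<And>k. 0 \<le> s k"
  shows "running_max s n \<le> (\<Sum>k\<le>n. s k)"
proof (induction n)
  case (Suc n)
  have "0 \<le> (\<Sum>k\<le>n. s k)" using assms by (intro sum_nonneg)
  then show ?case using Suc assms[of "Suc n"] by auto
qed auto

lemma running_max_measurable [measurable]:
  assumes "\<And>k. (\<lambda>x. f x k) \<in> borel_measurable M"
  shows "(\<lambda>x. running_max (f x) n) \<in> borel_measurable M"
  using assms by (induction n) auto

text \<open>Summation by parts. The maximum \<open>m\<close> moves only at steps where it becomes
  equal to \<open>s\<close>, so the sum of \<open>s\<close> against the increments of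
  \<open>m\<close> is about half the square of \<open>m\<close>; the discretisation error is half of
  \<open>(s' - m)\<^sup>2\<close> and has the favourable sign.\<close>

lemma running_max_sum_by_parts:
  "(\<Sum>i<n. running_max s i * (s (Suc i) - s i)) + (running_max s n)\<^sup>2 / 2
    \<le> running_max s n * s n - (s 0)\<^sup>2 / 2"
proof (induction n)
  case 0
  then show ?case by (simp add: power2_eq_square)
next
  case (Suc n)
  define m where "m = running_max s n"
  define s' where "s' = s (Suc n)"
  have "m * (s' - s n) + (max m s')\<^sup>2 / 2 - m\<^sup>2 / 2 \<le> max m s' * s' - m * s n"
  proof (cases "s' \<le> m")
    case False
    have "0 \<le> (s' - m)\<^sup>2" by simp
    with False show ?thesis by (simp add: max_def power2_eq_square algebra_simps)
  qed (simp add: max_def algebra_simps)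
  with Suc show ?case by (simp add: m_def s'_def)
qed

text \<open>The pathwise form of Doob's inequality: for a martingale the sum has mean 0. The
  constant 4 results from completing the square in
  \<open>(running_max s n - 2 * s n)\<^sup>2\<close>.\<close>

lemma running_max_square_le:
  "(running_max s n)\<^sup>2 + 4 * (\<Sum>i<n. running_max s i * (s (Suc i) - s i)) \<le> 4 * (s n)\<^sup>2"
proof -
  have "0 \<le> (running_max s n - 2 * s n)\<^sup>2" by simp
  then have "4 * (running_max s n * s n) \<le> (running_max s n)\<^sup>2 + 4 * (s n)\<^sup>2"
    by (simp add: power2_eq_square algebra_simps)
  moreover have "0 \<le> (s 0)\<^sup>2" by simp
  ultimately show ?thesis using running_max_sum_by_parts[of s n] by argo
qed

text \<open>The direction \<open>sgn x\<close> is a subgradient of the norm at \<open>x\<close>.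
  This replaces increments of the norm by expressions linear in the increments of the
  vector.\<close>

lemma norm_diff_ge_inner_sgn:
  fixes x y :: "'b::real_inner"
  shows "norm y - norm x \<ge> sgn x \<bullet> (y - x)"
proof (cases "x = 0")
  case False
  have "sgn x \<bullet> y \<le> norm (sgn x) * norm y"
    by (rule norm_cauchy_schwarz)
  moreover have "sgn x \<bullet> x = norm x"
    using False by (simp add: sgn_div_norm power2_norm_eq_inner[symmetric] power2_eq_square)
  ultimately show ?thesis
    using False by (simp add: inner_diff_right norm_sgn)
qed simp

text \<open>The running maximum of \<open>norm \<circ> S\<close> times the direction of \<open>S\<close> is the only weight against which
  the increments have to be orthogonal, because the pathwise inequality above is linear in
  them.\<close>

lemma (in prob_space) doob_L2:
  fixes S :: "nat \<Rightarrow> 'a \<Rightarrow> 'b::{euclidean_space}"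
  assumes [measurable]: "\<And>k. S k \<in> borel_measurable M"
    and orth: "\<And>i. i < n \<Longrightarrow>
      has_bochner_integral M
        (\<lambda>\<omega>. running_max (\<lambda>k. norm (S k \<omega>)) i * (sgn (S i \<omega>) \<bullet> (S (Suc i) \<omega> - S i \<omega>))) 0"
  shows "(\<integral>\<^sup>+\<omega>. ennreal ((running_max (\<lambda>k. norm (S k \<omega>)) n)\<^sup>2) \<partial>M)
    \<le> 4 * (\<integral>\<^sup>+\<omega>. ennreal ((norm (S n \<omega>))\<^sup>2) \<partial>M)"
proof (cases "(\<integral>\<^sup>+\<omega>. ennreal ((norm (S n \<omega>))\<^sup>2) \<partial>M) = \<infinity>")
  case True
  then show ?thesis by (simp add: ennreal_mult_top)
next
  case False
  define m where "m = (\<lambda>i \<omega>. running_max (\<lambda>k. norm (S k \<omega>)) i)"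
  have m0: "0 \<le> m i \<omega>" for i \<omega>
    using running_max_ge[of 0 i "\<lambda>k. norm (S k \<omega>)"] norm_ge_zero[of "S 0 \<omega>"] unfolding m_def by linarith
  have [measurable]: "m i \<in> borel_measurable M" for i
    unfolding m_def by measurable
  define H where "H = (\<lambda>\<omega>. \<Sum>i<n. m i \<omega> * (sgn (S i \<omega>) \<bullet> (S (Suc i) \<omega> - S i \<omega>)))"
  have H: "has_bochner_integral M H 0"
    using has_bochner_integral_sum[of "{..<n}" M _ "\<lambda>_. 0", OF orth]
    by (simp add: H_def m_def)
  have iS: "integrable M (\<lambda>\<omega>. (norm (S n \<omega>))\<^sup>2)"
    using False by (intro integrableI_nonneg) (auto simp: top.not_eq_extremum)
  have pw: "(m n \<omega>)\<^sup>2 \<le> 4 * (norm (S n \<omega>))\<^sup>2 - 4 * H \<omega>" for \<omega>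
  proof -
    have "H \<omega> \<le> (\<Sum>i<n. m i \<omega> * (norm (S (Suc i) \<omega>) - norm (S i \<omega>)))"
      unfolding H_def by (intro sum_mono mult_left_mono norm_diff_ge_inner_sgn m0)
    with running_max_square_le[of "\<lambda>k. norm (S k \<omega>)" n] show ?thesis
      by (simp add: m_def)
  qed
  have bi: "has_bochner_integral M (\<lambda>\<omega>. 4 * (norm (S n \<omega>))\<^sup>2 - 4 * H \<omega>)
      (4 * (\<integral>\<omega>. (norm (S n \<omega>))\<^sup>2 \<partial>M) - 4 * 0)"
    by (intro has_bochner_integral_diff has_bochner_integral_mult_right has_bochner_integral_integrable iS H)
  have "(\<integral>\<^sup>+\<omega>. ennreal ((m n \<omega>)\<^sup>2) \<partial>M) \<le> (\<integral>\<^sup>+\<omega>. ennreal (4 * (norm (S n \<omega>))\<^sup>2 - 4 * H \<omega>) \<partial>M)"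
    using pw by (intro nn_integral_mono ennreal_leI)
  also have "\<dots> = ennreal (4 * (\<integral>\<omega>. (norm (S n \<omega>))\<^sup>2 \<partial>M))"
    using bi pw order_trans[OF zero_le_power2 pw]
    by (subst nn_integral_eq_integral) (auto simp: has_bochner_integral_iff)
  also have "\<dots> = 4 * (\<integral>\<^sup>+\<omega>. ennreal ((norm (S n \<omega>))\<^sup>2) \<partial>M)"
    using iS by (subst nn_integral_eq_integral) (auto simp: ennreal_mult)
  finally show ?thesis by (simp add: m_def)
qed

section \<open>Mecke's formula for marked arrival times\<close>

text \<open>The starting level \<open>x\<close> is a parameter because inductions restart the
  sequence after its first gap.\<close>

definition arrival_level :: "real \<Rightarrow> (nat \<Rightarrow> real \<times> 'w) \<Rightarrow> nat \<Rightarrow> real" where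
  "arrival_level x s n = x + (\<Sum>j<n. fst (s j))"

text \<open>Level 0 is the start and carries no point; hence point \<open>k\<close> sits at level
  \<open>k + 1\<close>, while its mark has index \<open>k\<close>.\<close>

definition marked_points :: "real \<Rightarrow> (nat \<Rightarrow> real \<times> 'w) \<Rightarrow> nat \<Rightarrow> real \<times> 'w" where
  "marked_points x s k = (arrival_level x s (Suc k), snd (s k))"

text \<open>The increasing enumeration of the indices other than \<open>n\<close>; composing a
  sequence with it deletes the entry at \<open>n\<close>.\<close>

definition skip :: "nat \<Rightarrow> nat \<Rightarrow> nat" where
  "skip n k = (if k < n then k else Suc k)"

lemma arrival_level_0 [simp]: "arrival_level x s 0 = x"
  by (simp add: arrival_level_def)

lemma arrival_level_Suc [simp]: "arrival_level x s (Suc n) = arrival_level x s n + fst (s n)"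
  by (simp add: arrival_level_def)

lemma arrival_level_case_nat:
  "arrival_level x (case_nat p s) (Suc n) = arrival_level (x + fst p) s n"
  by (induction n) simp_all

lemma marked_points_case_nat:
  "marked_points x (case_nat p s) = case_nat (x + fst p, snd p) (marked_points (x + fst p) s)"
  by (rule ext) (auto simp: marked_points_def arrival_level_case_nat simp del: arrival_level_Suc
      split: nat.split)

lemma marked_points_case_nat_Suc [simp]:
  "marked_points x (case_nat p s) (Suc k) = marked_points (x + fst p) s k"
  by (simp add: marked_points_case_nat)

lemma marked_points_case_nat_0 [simp]:
  "marked_points x (case_nat p s) 0 = (x + fst p, snd p)"
  by (simp add: marked_points_case_nat)

lemma comp_skip_0: "(\<lambda>k. f (skip 0 k)) = (\<lambda>k. f (Suc k))"
  by (simp add: skip_def)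

lemma case_nat_comp_skip_Suc: "(\<lambda>k. case_nat p f (skip (Suc n) k)) = case_nat p (\<lambda>k. f (skip n k))"
  by (rule ext) (auto simp: skip_def split: nat.split)

lemma inj_skip: "inj (skip n)"
  by (auto simp: inj_on_def skip_def split: if_splits)

lemma range_skip: "range (skip n) = - {n}"
proof -
  have "k \<in> range (skip n)" if "k \<noteq> n" for k
    by (rule image_eqI[of _ _ "if k < n then k else k - 1"]) (use that in \<open>auto simp: skip_def\<close>)
  then show ?thesis by (auto simp: skip_def split: if_splits)
qed

abbreviation exp_law :: "real measure" where
  "exp_law \<equiv> density lborel (\<lambda>x. ennreal (exponential_density 1 x))"

lemma measurable_app2:
  assumes "(\<lambda>(x, y). F x y) \<in> A \<Otimes>\<^sub>M B \<rightarrow>\<^sub>M C" "f \<in> N \<rightarrow>\<^sub>M A" "g \<in> N \<rightarrow>\<^sub>M B"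
  shows "(\<lambda>t. F (f t) (g t)) \<in> N \<rightarrow>\<^sub>M C"
  using measurable_compose[OF measurable_Pair[OF assms(2,3)] assms(1)] by simp

lemma pred_in_interval [measurable (raw)]:
  fixes f g h :: "'n \<Rightarrow> real"
  assumes [measurable]: "f \<in> borel_measurable N" "g \<in> borel_measurable N" "h \<in> borel_measurable N"
  shows "Measurable.pred N (\<lambda>t. h t \<in> {f t..<g t})"
  unfolding atLeastLessThan_iff by measurable

lemma prob_space_exp_law: "prob_space exp_law"
  by (rule prob_space_exponential_density) simp

locale marked_gaps = prob_space \<mu> for \<mu> :: "'w measure"
begin

sublocale gap: prob_space exp_law
  by (rule prob_space_exp_law)

sublocale gap_mark: pair_prob_space exp_law \<mu> ..

sublocale gaps: sequence_space "exp_law \<Otimes>\<^sub>M \<mu>" ..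

abbreviation point_space :: "(real \<times> 'w) measure" where
  "point_space \<equiv> borel \<Otimes>\<^sub>M \<mu>"

abbreviation points_space :: "(nat \<Rightarrow> real \<times> 'w) measure" where
  "points_space \<equiv> \<Pi>\<^sub>M k\<in>UNIV. point_space"

lemma sets_gap_mark [measurable_cong]: "sets (exp_law \<Otimes>\<^sub>M \<mu>) = sets point_space"
  by (intro sets_pair_measure_cong) simp_all

lemma sets_gaps [measurable_cong]: "sets gaps.S = sets points_space"
  by (intro sets_PiM_cong sets_gap_mark) simp_all

lemma measurable_arrival_level [measurable]:
  assumes [measurable]: "f \<in> borel_measurable N" "g \<in> N \<rightarrow>\<^sub>M points_space"
  shows "(\<lambda>t. arrival_level (f t) (g t) n) \<in> borel_measurable N"
  unfolding arrival_level_def by measurable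

lemma measurable_marked_points' [measurable]:
  assumes [measurable]: "f \<in> borel_measurable N" "g \<in> N \<rightarrow>\<^sub>M points_space"
  shows "(\<lambda>t. marked_points (f t) (g t) n) \<in> N \<rightarrow>\<^sub>M point_space"
  unfolding marked_points_def by measurable

lemma measurable_marked_points [measurable]:
  assumes [measurable]: "f \<in> borel_measurable N" "g \<in> N \<rightarrow>\<^sub>M points_space"
  shows "(\<lambda>t. marked_points (f t) (g t)) \<in> N \<rightarrow>\<^sub>M points_space"
proof -
  have "(\<lambda>t n. marked_points (f t) (g t) n) \<in> N \<rightarrow>\<^sub>M points_space"
    by (rule measurable_abs_UNIV) measurable
  then show ?thesis by simp
qed

lemma measurable_comp_skip [measurable]:
  assumes [measurable]: "g \<in> N \<rightarrow>\<^sub>M points_space"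
  shows "(\<lambda>t k. g t (skip n k)) \<in> N \<rightarrow>\<^sub>M points_space"
  by (rule measurable_abs_UNIV) measurable

text \<open>The renewal property: an iid sequence is its first entry followed by an independent copy
  of itself.\<close>

lemma nn_integral_gaps_peel:
  assumes [measurable]: "f \<in> borel_measurable points_space"
  shows "(\<integral>\<^sup>+s. f s \<partial>gaps.S) = (\<integral>\<^sup>+e. \<integral>\<^sup>+w. \<integral>\<^sup>+s. f (case_nat (e, w) s) \<partial>gaps.S \<partial>\<mu> \<partial>exp_law)"
proof -
  have "(\<integral>\<^sup>+s. f s \<partial>gaps.S)
      = (\<integral>\<^sup>+s. f s \<partial>distr ((exp_law \<Otimes>\<^sub>M \<mu>) \<Otimes>\<^sub>M gaps.S) gaps.S (\<lambda>(p, s). case_nat p s))"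
    by (simp add: gaps.PiM_iter)
  also have "\<dots> = (\<integral>\<^sup>+(p, s). f (case_nat p s) \<partial>((exp_law \<Otimes>\<^sub>M \<mu>) \<Otimes>\<^sub>M gaps.S))"
    by (subst nn_integral_distr) (auto simp: split_beta')
  also have "\<dots> = (\<integral>\<^sup>+p. \<integral>\<^sup>+s. f (case_nat p s) \<partial>gaps.S \<partial>(exp_law \<Otimes>\<^sub>M \<mu>))"
    by (subst gaps.P.nn_integral_fst[symmetric]) auto
  also have "\<dots> = (\<integral>\<^sup>+e. \<integral>\<^sup>+w. \<integral>\<^sup>+s. f (case_nat (e, w) s) \<partial>gaps.S \<partial>\<mu> \<partial>exp_law)"
    by (subst nn_integral_fst[symmetric]) auto
  finally show ?thesis .
qed

lemma nn_integral_exp_law: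
  assumes [measurable]: "f \<in> borel_measurable borel"
  shows "(\<integral>\<^sup>+e. f e \<partial>exp_law) = (\<integral>\<^sup>+e. ennreal (exp (- e)) * indicator {0..} e * f e \<partial>lborel)"
  by (subst nn_integral_density)
     (auto simp: exponential_density_def intro!: nn_integral_cong split: split_indicator)

text \<open>The pair of a first gap and its sum with the next gap has density \<open>exp (- r)\<close> on
  \<open>0 \<le> e \<le> r\<close>.\<close>

lemma nn_integral_two_gaps:
  assumes [measurable]: "(\<lambda>(y, r). Q y r) \<in> borel_measurable (borel \<Otimes>\<^sub>M borel)"
  shows "(\<integral>\<^sup>+e. \<integral>\<^sup>+e'. Q (x + e) (x + e + e') \<partial>exp_law \<partial>exp_law)
    = (\<integral>\<^sup>+r. \<integral>\<^sup>+y. indicator {x..<x + r} y * Q y (x + r) \<partial>lborel \<partial>exp_law)"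
proof -
  note Q = measurable_app2[OF assms]
  have [measurable]: "(\<lambda>y. Q y c) \<in> borel_measurable borel" "(\<lambda>r. Q c r) \<in> borel_measurable borel" for c
    by (rule Q; measurable)+
  have [measurable]: "(\<lambda>p. Q (x + snd p) (x + fst p)) \<in> borel_measurable (lborel \<Otimes>\<^sub>M lborel)"
    "(\<lambda>p. Q (x + fst p) (x + fst p + snd p)) \<in> borel_measurable (lborel \<Otimes>\<^sub>M lborel)"
    "(\<lambda>p. Q (snd p) (x + fst p)) \<in> borel_measurable (borel \<Otimes>\<^sub>M lborel)"
    by (rule Q; measurable)+
  have *: "ennreal (exp (- (e + e'))) = ennreal (exp (- e)) * ennreal (exp (- e'))" for e e' :: real
    by (simp add: exp_add[symmetric] ennreal_mult[symmetric])
  have "(\<integral>\<^sup>+e. \<integral>\<^sup>+e'. Q (x + e) (x + e + e') \<partial>exp_law \<partial>exp_law)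
      = (\<integral>\<^sup>+e. \<integral>\<^sup>+e'. ennreal (exp (- (e + e'))) * indicator {0..} e * indicator {0..} e'
                  * Q (x + e) (x + e + e') \<partial>lborel \<partial>lborel)"
    unfolding * by (subst (1 2) nn_integral_exp_law; (measurable)?)
      (simp add: nn_integral_cmult[symmetric] mult_ac)
  also have "\<dots> = (\<integral>\<^sup>+e. \<integral>\<^sup>+r. ennreal (exp (- r)) * indicator {0..} e * indicator {0<..} (r - e)
                  * Q (x + e) (x + r) \<partial>lborel \<partial>lborel)"
  proof (rule nn_integral_cong)
    fix e :: real
    have "(\<integral>\<^sup>+e'. ennreal (exp (- (e + e'))) * indicator {0..} e * indicator {0..} e'
            * Q (x + e) (x + e + e') \<partial>lborel)
        = (\<integral>\<^sup>+e'. ennreal (exp (- (e + 1 * e'))) * indicator {0..} e * indicator {e..} (e + 1 * e')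
            * Q (x + e) (x + (e + 1 * e')) \<partial>lborel)"
      by (intro nn_integral_cong) (auto split: split_indicator simp: add.assoc)
    also have "\<dots> = (\<integral>\<^sup>+r. ennreal (exp (- r)) * indicator {0..} e * indicator {e..} r
                  * Q (x + e) (x + r) \<partial>lborel)"
      by (subst nn_integral_real_affine[where c = 1 and t = e]) auto
    \<comment> \<open>Replacing \<open>e \<le> r\<close> by \<open>e < r\<close> costs only the null
      set \<open>r = e\<close>. Half-open intervals are preferred because those between consecutive
      levels will be disjoint.\<close>
    also have "\<dots> = (\<integral>\<^sup>+r. ennreal (exp (- r)) * indicator {0..} e * indicator {0<..} (r - e)
                  * Q (x + e) (x + r) \<partial>lborel)"
      using AE_lborel_singleton[of e]
      by (intro nn_integral_cong_AE) (auto split: split_indicator)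
    finally show "(\<integral>\<^sup>+e'. ennreal (exp (- (e + e'))) * indicator {0..} e * indicator {0..} e'
            * Q (x + e) (x + e + e') \<partial>lborel)
        = (\<integral>\<^sup>+r. ennreal (exp (- r)) * indicator {0..} e * indicator {0<..} (r - e)
                  * Q (x + e) (x + r) \<partial>lborel)" .
  qed
  also have "\<dots> = (\<integral>\<^sup>+r. \<integral>\<^sup>+e. ennreal (exp (- r)) * indicator {0..} e * indicator {0<..} (r - e)
                  * Q (x + e) (x + r) \<partial>lborel \<partial>lborel)"
    by (rule lborel_pair.Fubini') (simp add: split_beta')
  also have "\<dots> = (\<integral>\<^sup>+r. \<integral>\<^sup>+y. ennreal (exp (- r)) * indicator {0..} r
                  * (indicator {x..<x + r} y * Q y (x + r)) \<partial>lborel \<partial>lborel)"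
  proof (rule nn_integral_cong)
    fix r :: real
    have "(\<integral>\<^sup>+y. ennreal (exp (- r)) * indicator {0..} r * (indicator {x..<x + r} y * Q y (x + r)) \<partial>lborel)
       = (\<integral>\<^sup>+e. ennreal (exp (- r)) * indicator {0..} r * (indicator {x..<x + r} (x + 1 * e)
            * Q (x + 1 * e) (x + r)) \<partial>lborel)"
      by (subst nn_integral_real_affine[where c = 1 and t = x]) auto
    also have "\<dots> = (\<integral>\<^sup>+e. ennreal (exp (- r)) * indicator {0..} e * indicator {0<..} (r - e)
                  * Q (x + e) (x + r) \<partial>lborel)"
      by (intro nn_integral_cong) (auto split: split_indicator)
    finally show "(\<integral>\<^sup>+e. ennreal (exp (- r)) * indicator {0..} e * indicator {0<..} (r - e)
                  * Q (x + e) (x + r) \<partial>lborel)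
        = (\<integral>\<^sup>+y. ennreal (exp (- r)) * indicator {0..} r
                  * (indicator {x..<x + r} y * Q y (x + r)) \<partial>lborel)" ..
  qed
  also have "\<dots> = (\<integral>\<^sup>+r. \<integral>\<^sup>+y. indicator {x..<x + r} y * Q y (x + r) \<partial>lborel \<partial>exp_law)"
  proof -
    have [measurable]: "(\<lambda>r. \<integral>\<^sup>+y. indicator {x..<x + r} y * Q y (x + r) \<partial>lborel) \<in> borel_measurable borel"
      by (rule lborel.borel_measurable_nn_integral) (simp add: split_beta')
    show ?thesis
      by (subst nn_integral_exp_law) (simp_all add: nn_integral_cmult)
  qed
  finally show ?thesis .
qed

text \<open>Deleting point \<open>n\<close> merges the gaps on both sides of it, and inserting a
  point at \<open>y\<close> into the merged gap undoes this. The density \<open>exp (- r)\<close> of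
  a gap and its successor depends on their sum only, so the inserted point is spread by Lebesgue
  measure over the merged gap, whose remaining density is that of a single exponential gap. The case
  \<open>n = 0\<close> is this computation; the induction step restarts after the first
  point.\<close>

lemma palm_term:
  assumes [measurable]: "(\<lambda>(p, z). F p z) \<in> borel_measurable (point_space \<Otimes>\<^sub>M points_space)"
  shows "(\<integral>\<^sup>+s. F (marked_points x s n) (\<lambda>k. marked_points x s (skip n k)) \<partial>gaps.S)
    = (\<integral>\<^sup>+s. \<integral>\<^sup>+y. \<integral>\<^sup>+w. indicator {arrival_level x s n..<arrival_level x s (Suc n)} y
         * F (y, w) (marked_points x s) \<partial>\<mu> \<partial>lborel \<partial>gaps.S)"
  using assms
proof (induction n arbitrary: x F)
  case 0
  note [measurable] = 0
  \<comment> \<open>The contribution of a deleted point at level \<open>y\<close> whose successor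
    sits at level \<open>r\<close>, with both marks and the points after \<open>r\<close> integrated
    out.\<close>
  define Q where "Q = (\<lambda>y r. \<integral>\<^sup>+w. \<integral>\<^sup>+w'. \<integral>\<^sup>+s. F (y, w) (case_nat (r, w') (marked_points r s)) \<partial>gaps.S \<partial>\<mu> \<partial>\<mu>)"
  have [measurable]: "(\<lambda>(y, r). Q y r) \<in> borel_measurable (borel \<Otimes>\<^sub>M borel)"
    unfolding Q_def split_beta' by measurable
  have "(\<integral>\<^sup>+s. F (marked_points x s 0) (\<lambda>k. marked_points x s (skip 0 k)) \<partial>gaps.S)
      = (\<integral>\<^sup>+e. \<integral>\<^sup>+w. \<integral>\<^sup>+s. F (x + e, w) (marked_points (x + e) s) \<partial>gaps.S \<partial>\<mu> \<partial>exp_law)"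
    by (subst nn_integral_gaps_peel, measurable) (simp add: comp_skip_0)
  also have "\<dots> = (\<integral>\<^sup>+e. \<integral>\<^sup>+w. \<integral>\<^sup>+e'. \<integral>\<^sup>+w'. \<integral>\<^sup>+s. F (x + e, w)
            (case_nat (x + e + e', w') (marked_points (x + e + e') s)) \<partial>gaps.S \<partial>\<mu> \<partial>exp_law \<partial>\<mu> \<partial>exp_law)"
  proof (rule nn_integral_cong, rule nn_integral_cong)
    fix e w assume [measurable]: "w \<in> space \<mu>"
    show "(\<integral>\<^sup>+s. F (x + e, w) (marked_points (x + e) s) \<partial>gaps.S)
        = (\<integral>\<^sup>+e'. \<integral>\<^sup>+w'. \<integral>\<^sup>+s. F (x + e, w)
            (case_nat (x + e + e', w') (marked_points (x + e + e') s)) \<partial>gaps.S \<partial>\<mu> \<partial>exp_law)"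
      by (subst nn_integral_gaps_peel, measurable) (simp add: marked_points_case_nat)
  qed
  also have "\<dots> = (\<integral>\<^sup>+e. \<integral>\<^sup>+e'. Q (x + e) (x + e + e') \<partial>exp_law \<partial>exp_law)"
    unfolding Q_def
    by (rule nn_integral_cong, rule gap_mark.Fubini') measurable
  also have "\<dots> = (\<integral>\<^sup>+r. \<integral>\<^sup>+y. indicator {x..<x + r} y * Q y (x + r) \<partial>lborel \<partial>exp_law)"
    by (rule nn_integral_two_gaps) measurable
  also have "\<dots> = (\<integral>\<^sup>+r. \<integral>\<^sup>+w'. \<integral>\<^sup>+s. \<integral>\<^sup>+y. \<integral>\<^sup>+w. indicator {x..<x + r} y
            * F (y, w) (case_nat (x + r, w') (marked_points (x + r) s)) \<partial>\<mu> \<partial>lborel \<partial>gaps.S \<partial>\<mu> \<partial>exp_law)"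
  proof (rule nn_integral_cong)
    fix r :: real
    interpret lm: pair_sigma_finite lborel \<mu> ..
    interpret ls: pair_sigma_finite lborel gaps.S ..
    interpret ms: pair_sigma_finite \<mu> gaps.S ..
    interpret mm: pair_sigma_finite \<mu> \<mu> ..
    let ?H = "\<lambda>y w w' s. indicator {x..<x + r} y * F (y, w) (case_nat (x + r, w') (marked_points (x + r) s))"
    have "(\<integral>\<^sup>+y. indicator {x..<x + r} y * Q y (x + r) \<partial>lborel)
        = (\<integral>\<^sup>+y. \<integral>\<^sup>+w. \<integral>\<^sup>+w'. \<integral>\<^sup>+s. ?H y w w' s \<partial>gaps.S \<partial>\<mu> \<partial>\<mu> \<partial>lborel)"
      unfolding Q_def by (rule nn_integral_cong) (simp split: split_indicator)
    also have "\<dots> = (\<integral>\<^sup>+y. \<integral>\<^sup>+w'. \<integral>\<^sup>+w. \<integral>\<^sup>+s. ?H y w w' s \<partial>gaps.S \<partial>\<mu> \<partial>\<mu> \<partial>lborel)"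
      by (rule nn_integral_cong, rule mm.Fubini') measurable
    also have "\<dots> = (\<integral>\<^sup>+y. \<integral>\<^sup>+w'. \<integral>\<^sup>+s. \<integral>\<^sup>+w. ?H y w w' s \<partial>\<mu> \<partial>gaps.S \<partial>\<mu> \<partial>lborel)"
      by (rule nn_integral_cong, rule nn_integral_cong, rule ms.Fubini'[symmetric]) measurable
    also have "\<dots> = (\<integral>\<^sup>+w'. \<integral>\<^sup>+y. \<integral>\<^sup>+s. \<integral>\<^sup>+w. ?H y w w' s \<partial>\<mu> \<partial>gaps.S \<partial>lborel \<partial>\<mu>)"
      by (rule lm.Fubini'[symmetric]) measurable
    also have "\<dots> = (\<integral>\<^sup>+w'. \<integral>\<^sup>+s. \<integral>\<^sup>+y. \<integral>\<^sup>+w. ?H y w w' s \<partial>\<mu> \<partial>lborel \<partial>gaps.S \<partial>\<mu>)"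
      by (rule nn_integral_cong, rule ls.Fubini'[symmetric]) measurable
    finally show "(\<integral>\<^sup>+y. indicator {x..<x + r} y * Q y (x + r) \<partial>lborel)
       = (\<integral>\<^sup>+w'. \<integral>\<^sup>+s. \<integral>\<^sup>+y. \<integral>\<^sup>+w. ?H y w w' s \<partial>\<mu> \<partial>lborel \<partial>gaps.S \<partial>\<mu>)" .
  qed
  also have "\<dots> = (\<integral>\<^sup>+s. \<integral>\<^sup>+y. \<integral>\<^sup>+w. indicator {arrival_level x s 0..<arrival_level x s (Suc 0)} y
         * F (y, w) (marked_points x s) \<partial>\<mu> \<partial>lborel \<partial>gaps.S)"
    by (rule sym, subst nn_integral_gaps_peel, measurable)
       (simp add: marked_points_case_nat)
  finally show ?case .
next
  case (Suc n)
  note [measurable] = Suc.prems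
  have "(\<integral>\<^sup>+s. F (marked_points x s (Suc n)) (\<lambda>k. marked_points x s (skip (Suc n) k)) \<partial>gaps.S)
     = (\<integral>\<^sup>+e. \<integral>\<^sup>+w0. \<integral>\<^sup>+s. F (marked_points (x + e) s n)
          (case_nat (x + e, w0) (\<lambda>k. marked_points (x + e) s (skip n k))) \<partial>gaps.S \<partial>\<mu> \<partial>exp_law)"
    by (subst nn_integral_gaps_peel, measurable)
       (simp add: marked_points_case_nat case_nat_comp_skip_Suc)
  also have "\<dots> = (\<integral>\<^sup>+e. \<integral>\<^sup>+w0. \<integral>\<^sup>+s. \<integral>\<^sup>+y. \<integral>\<^sup>+w.
         indicator {arrival_level (x + e) s n..<arrival_level (x + e) s (Suc n)} y
         * F (y, w) (case_nat (x + e, w0) (marked_points (x + e) s)) \<partial>\<mu> \<partial>lborel \<partial>gaps.S \<partial>\<mu> \<partial>exp_law)"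
  proof (rule nn_integral_cong, rule nn_integral_cong)
    fix e w0 assume [measurable]: "w0 \<in> space \<mu>"
    show "(\<integral>\<^sup>+s. F (marked_points (x + e) s n)
          (case_nat (x + e, w0) (\<lambda>k. marked_points (x + e) s (skip n k))) \<partial>gaps.S)
       = (\<integral>\<^sup>+s. \<integral>\<^sup>+y. \<integral>\<^sup>+w.
         indicator {arrival_level (x + e) s n..<arrival_level (x + e) s (Suc n)} y
         * F (y, w) (case_nat (x + e, w0) (marked_points (x + e) s)) \<partial>\<mu> \<partial>lborel \<partial>gaps.S)"
    proof -
      have "(\<lambda>(p, z). F p (case_nat (x + e, w0) z)) \<in> borel_measurable (point_space \<Otimes>\<^sub>M points_space)"
        by measurable
      from Suc.IH[OF this, of "x + e"] show ?thesis .
    qed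
  qed
  also have "\<dots> = (\<integral>\<^sup>+s. \<integral>\<^sup>+y. \<integral>\<^sup>+w.
         indicator {arrival_level x s (Suc n)..<arrival_level x s (Suc (Suc n))} y
         * F (y, w) (marked_points x s) \<partial>\<mu> \<partial>lborel \<partial>gaps.S)"
    by (rule sym, subst nn_integral_gaps_peel, measurable)
       (simp add: marked_points_case_nat arrival_level_case_nat del: arrival_level_Suc)
  finally show ?case .
qed

lemma space_gaps: "space gaps.S = space points_space"
  by (rule sets_eq_imp_space_eq[OF sets_gaps])

lemma AE_gaps_nonneg: "AE s in gaps.S. \<forall>n. 0 \<le> fst (s n)"
proof -
  have e: "AE e in exp_law. 0 \<le> e"
    by (rule AE_density[THEN iffD2]) (simp, rule AE_I2, simp add: exponential_density_def)
  have "AE p in exp_law \<Otimes>\<^sub>M \<mu>. 0 \<le> fst p"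
  proof (rule gap_mark.AE_pair_measure)
    show "{p \<in> space (exp_law \<Otimes>\<^sub>M \<mu>). 0 \<le> fst p} \<in> sets (exp_law \<Otimes>\<^sub>M \<mu>)"
    proof -
      have "{0..} \<in> sets exp_law" by simp
      from measurable_sets[OF measurable_fst this, of \<mu>] show ?thesis
        by (rule back_subst[where P = "\<lambda>A. A \<in> sets _"]) auto
    qed
    show "AE e in exp_law. AE w in \<mu>. 0 \<le> fst (e, w)"
      using e by eventually_elim (rule AE_I2, simp only: fst_conv)
  qed
  then have "AE s in gaps.S. 0 \<le> fst (s n)" for n
    by (rule gaps.AE_component[OF UNIV_I])
  then show ?thesis
    unfolding AE_all_countable by (rule allI)
qed

lemma arrival_level_mono:
  assumes "\<And>n. 0 \<le> fst (s n)" "m \<le> n"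
  shows "arrival_level x s m \<le> arrival_level x s n"
  using assms by (auto simp: arrival_level_def intro!: sum_mono2)

lemma suminf_indicator_levels:
  assumes "\<And>n. 0 \<le> fst (s n)"
  shows "(\<Sum>n. indicator {arrival_level x s n..<arrival_level x s (Suc n)} y :: ennreal)
    = indicator (\<Union>n. {arrival_level x s n..<arrival_level x s (Suc n)}) y"
proof (rule suminf_indicator)
  let ?I = "\<lambda>n. {arrival_level x s n..<arrival_level x s (Suc n)}"
  have *: "?I m \<inter> ?I n = {}" if "m < n" for m n
  proof -
    have "arrival_level x s (Suc m) \<le> arrival_level x s n"
      using assms that by (intro arrival_level_mono) simp_all
    then show ?thesis by (auto simp del: arrival_level_Suc)
  qed
  have "?I m \<inter> ?I n = {}" if "m \<noteq> n" for m n
  proof (cases "m < n")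
    case False
    with that have "?I n \<inter> ?I m = {}" by (intro *) simp
    then show ?thesis by (simp only: Int_commute)
  qed (rule *)
  then show "disjoint_family ?I"
    unfolding disjoint_family_on_def by blast
qed

text \<open>The union of the intervals is left as it stands: that it fills the half-line is itself
  derived from this identity.\<close>

lemma palm_sum:
  assumes [measurable]: "(\<lambda>(p, z). F p z) \<in> borel_measurable (point_space \<Otimes>\<^sub>M points_space)"
  shows "(\<Sum>n. \<integral>\<^sup>+s. F (marked_points x s n) (\<lambda>k. marked_points x s (skip n k)) \<partial>gaps.S)
    = (\<integral>\<^sup>+s. \<integral>\<^sup>+y. \<integral>\<^sup>+w. indicator (\<Union>n. {arrival_level x s n..<arrival_level x s (Suc n)}) y
         * F (y, w) (marked_points x s) \<partial>\<mu> \<partial>lborel \<partial>gaps.S)"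
proof -
  have "(\<Sum>n. \<integral>\<^sup>+s. F (marked_points x s n) (\<lambda>k. marked_points x s (skip n k)) \<partial>gaps.S)
      = (\<Sum>n. \<integral>\<^sup>+s. \<integral>\<^sup>+y. \<integral>\<^sup>+w. indicator {arrival_level x s n..<arrival_level x s (Suc n)} y
         * F (y, w) (marked_points x s) \<partial>\<mu> \<partial>lborel \<partial>gaps.S)"
    by (intro suminf_cong palm_term) measurable
  also have "\<dots> = (\<integral>\<^sup>+s. (\<Sum>n. \<integral>\<^sup>+y. \<integral>\<^sup>+w. indicator {arrival_level x s n..<arrival_level x s (Suc n)} y
         * F (y, w) (marked_points x s) \<partial>\<mu> \<partial>lborel) \<partial>gaps.S)"
    by (rule nn_integral_suminf[symmetric]) measurable
  also have "\<dots> = (\<integral>\<^sup>+s. \<integral>\<^sup>+y. \<integral>\<^sup>+w. indicator (\<Union>n. {arrival_level x s n..<arrival_level x s (Suc n)}) y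
         * F (y, w) (marked_points x s) \<partial>\<mu> \<partial>lborel \<partial>gaps.S)"
  proof (rule nn_integral_cong_AE)
    have "AE s in gaps.S. s \<in> space points_space"
      unfolding space_gaps[symmetric] by (rule AE_I2)
    then show "AE s in gaps.S. (\<Sum>n. \<integral>\<^sup>+y. \<integral>\<^sup>+w. indicator {arrival_level x s n..<arrival_level x s (Suc n)} y
         * F (y, w) (marked_points x s) \<partial>\<mu> \<partial>lborel)
       = (\<integral>\<^sup>+y. \<integral>\<^sup>+w. indicator (\<Union>n. {arrival_level x s n..<arrival_level x s (Suc n)}) y
         * F (y, w) (marked_points x s) \<partial>\<mu> \<partial>lborel)"
      using AE_gaps_nonneg
    proof eventually_elim
      case (elim s)
      let ?I = "\<lambda>n. {arrival_level x s n..<arrival_level x s (Suc n)}"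
      define H where "H = (\<lambda>y. \<integral>\<^sup>+w. F (y, w) (marked_points x s) \<partial>\<mu>)"
      have "marked_points x s \<in> space points_space"
        using measurable_space[OF measurable_marked_points[OF measurable_const[of x], of "\<lambda>s. s" points_space]] elim(1)
        by simp
      then have [measurable]: "H \<in> borel_measurable borel"
        unfolding H_def by measurable
      have *: "(\<integral>\<^sup>+w. indicator A y * F (y, w) (marked_points x s) \<partial>\<mu>) = indicator A y * H y" for A y
        by (auto simp: H_def split: split_indicator)
      have "(\<Sum>n. \<integral>\<^sup>+y. indicator (?I n) y * H y \<partial>lborel) = (\<integral>\<^sup>+y. (\<Sum>n. indicator (?I n) y * H y) \<partial>lborel)"
        by (rule nn_integral_suminf[symmetric]) measurable
      also have "\<dots> = (\<integral>\<^sup>+y. indicator (\<Union>n. ?I n) y * H y \<partial>lborel)"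
        using elim(2) by (simp add: suminf_indicator_levels ennreal_suminf_multc del: arrival_level_Suc)
      finally show ?case unfolding * .
    qed
  qed
  finally show ?thesis .
qed

text \<open>By \<open>palm_sum\<close> the expected number of points up to level \<open>k\<close> is
  at most the length of the interval from \<open>x\<close> to \<open>k\<close>. So the probabilities
  that point \<open>n\<close> lies below \<open>k\<close> are summable, and Borel-Cantelli
  applies.\<close>

lemma AE_arrival_level_unbounded: "AE s in gaps.S. \<forall>T. \<exists>n. T < arrival_level x s n"
proof -
  have "AE s in gaps.S. \<forall>\<^sub>F n in sequentially. real k < arrival_level x s (Suc n)" for k :: nat
  proof -
    define A where "A = (\<lambda>n. {s \<in> space points_space. arrival_level x s (Suc n) \<le> real k})"
    have "A n \<in> sets points_space" for n
      unfolding A_def by measurable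
    then have A: "A n \<in> sets gaps.S" for n
      by (simp only: sets_gaps)
    have "(\<Sum>n. emeasure gaps.S (A n))
        = (\<Sum>n. \<integral>\<^sup>+s. indicator {..real k} (fst (marked_points x s n)) \<partial>gaps.S)"
      by (intro suminf_cong, subst nn_integral_indicator[OF A, symmetric], intro nn_integral_cong)
         (auto simp: A_def marked_points_def space_gaps simp del: arrival_level_Suc split: split_indicator)
    also have "\<dots> = (\<integral>\<^sup>+s. \<integral>\<^sup>+y. \<integral>\<^sup>+w. indicator (\<Union>n. {arrival_level x s n..<arrival_level x s (Suc n)}) y
         * indicator {..real k} y \<partial>\<mu> \<partial>lborel \<partial>gaps.S)"
      using palm_sum[of "\<lambda>p z. indicator {..real k} (fst p)" x] by simp
    also have "\<dots> \<le> (\<integral>\<^sup>+s. \<integral>\<^sup>+y. \<integral>\<^sup>+w. indicator {x..real k} y \<partial>\<mu> \<partial>lborel \<partial>gaps.S)"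
    proof (intro nn_integral_mono_AE)
      show "AE s in gaps.S. (\<integral>\<^sup>+y. \<integral>\<^sup>+w. indicator (\<Union>n. {arrival_level x s n..<arrival_level x s (Suc n)}) y
         * indicator {..real k} y \<partial>\<mu> \<partial>lborel) \<le> (\<integral>\<^sup>+y. \<integral>\<^sup>+w. indicator {x..real k} y \<partial>\<mu> \<partial>lborel)"
        using AE_gaps_nonneg
      proof eventually_elim
        case (elim s)
        have "x \<le> arrival_level x s n" for n
          using arrival_level_mono[of s 0 n x] elim by simp
        then show ?case
          by (intro nn_integral_mono) (auto split: split_indicator intro: order_trans simp del: arrival_level_Suc)
      qed
    qed
    also have "\<dots> < \<infinity>"
      by (simp add: emeasure_space_1 gaps.P.emeasure_space_1 less_top[symmetric] emeasure_lborel_Icc_eq)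
    finally have "(\<Sum>n. emeasure gaps.S (A n)) \<noteq> \<infinity>"
      by simp
    then have "AE s in gaps.S. \<forall>\<^sub>F n in sequentially. s \<in> space gaps.S - A n"
      by (intro borel_cantelli_AE1 A) (auto simp: gaps.P.emeasure_eq_measure intro: summable_suminf_not_top)
    then show ?thesis
      by eventually_elim (simp add: A_def not_le space_gaps del: arrival_level_Suc, elim eventually_mono, simp)
  qed
  then have "AE s in gaps.S. \<forall>k::nat. \<forall>\<^sub>F n in sequentially. real k < arrival_level x s (Suc n)"
    unfolding AE_all_countable by blast
  then show ?thesis
  proof eventually_elim
    case (elim s)
    show ?case
    proof
      fix T :: real
      obtain k :: nat where "T < real k" using reals_Archimedean2 by blast
      moreover obtain n where "real k < arrival_level x s (Suc n)"
        using elim[THEN spec, of k] by (auto simp: eventually_sequentially)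
      ultimately show "\<exists>n. T < arrival_level x s n" by (meson less_trans)
    qed
  qed
qed

lemma UN_levels:
  assumes "\<And>n. 0 \<le> fst (s n)" "\<And>T. \<exists>n. T < arrival_level x s n"
  shows "(\<Union>n. {arrival_level x s n..<arrival_level x s (Suc n)}) = {x..}"
proof (intro set_eqI iffI)
  fix y assume "y \<in> {x..}"
  define n where "n = (LEAST n. y < arrival_level x s n)"
  have n: "y < arrival_level x s n"
    unfolding n_def using assms(2)[of y] by (rule LeastI_ex)
  with \<open>y \<in> {x..}\<close> obtain m where m: "n = Suc m"
    by (cases n) auto
  then have "\<not> y < arrival_level x s m"
    unfolding n_def using not_less_Least[of m "\<lambda>n. y < arrival_level x s n"] by auto
  with n m show "y \<in> (\<Union>n. {arrival_level x s n..<arrival_level x s (Suc n)})"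
    by (auto simp del: arrival_level_Suc intro!: exI[of _ m])
next
  fix y assume "y \<in> (\<Union>n. {arrival_level x s n..<arrival_level x s (Suc n)})"
  then obtain n where "arrival_level x s n \<le> y" by auto
  moreover have "x \<le> arrival_level x s n"
    using arrival_level_mono[of s 0 n x] assms by simp
  ultimately show "y \<in> {x..}" by simp
qed

text \<open>The intervals between consecutive levels tile the half-line from \<open>x\<close> on, so
  summing over the deleted point turns their indicators into that of \<open>{x..}\<close>.\<close>

theorem mecke:
  assumes [measurable]: "(\<lambda>(p, z). F p z) \<in> borel_measurable (point_space \<Otimes>\<^sub>M points_space)"
  shows "(\<integral>\<^sup>+s. (\<Sum>n. F (marked_points x s n) (\<lambda>k. marked_points x s (skip n k))) \<partial>gaps.S)
    = (\<integral>\<^sup>+s. \<integral>\<^sup>+y. \<integral>\<^sup>+w. indicator {x..} y * F (y, w) (marked_points x s) \<partial>\<mu> \<partial>lborel \<partial>gaps.S)"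
proof -
  have "(\<integral>\<^sup>+s. (\<Sum>n. F (marked_points x s n) (\<lambda>k. marked_points x s (skip n k))) \<partial>gaps.S)
      = (\<Sum>n. \<integral>\<^sup>+s. F (marked_points x s n) (\<lambda>k. marked_points x s (skip n k)) \<partial>gaps.S)"
    by (rule nn_integral_suminf) measurable
  also have "\<dots> = (\<integral>\<^sup>+s. \<integral>\<^sup>+y. \<integral>\<^sup>+w. indicator (\<Union>n. {arrival_level x s n..<arrival_level x s (Suc n)}) y
         * F (y, w) (marked_points x s) \<partial>\<mu> \<partial>lborel \<partial>gaps.S)"
    by (rule palm_sum) measurable
  also have "\<dots> = (\<integral>\<^sup>+s. \<integral>\<^sup>+y. \<integral>\<^sup>+w. indicator {x..} y * F (y, w) (marked_points x s) \<partial>\<mu> \<partial>lborel \<partial>gaps.S)"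
    using AE_gaps_nonneg AE_arrival_level_unbounded[of x]
    by (intro nn_integral_cong_AE, eventually_elim) (simp add: UN_levels del: arrival_level_Suc)
  finally show ?thesis .
qed

end

section \<open>First and second moments of Poisson integrals\<close>

text \<open>Mecke's formula is the only property of the Poisson process that is carried along. The
  points form a sequence, not a random measure, so that one of them can be deleted by
  reindexing.\<close>

locale poisson_points = prob_space M + mark: prob_space \<mu>
  for M :: "'a measure" and \<mu> :: "'w measure" +
  fixes z :: "'a \<Rightarrow> nat \<Rightarrow> real \<times> 'w"
  assumes z_measurable [measurable]: "z \<in> M \<rightarrow>\<^sub>M (\<Pi>\<^sub>M k\<in>UNIV. borel \<Otimes>\<^sub>M \<mu>)"
    and mecke_formula: "\<And>F. (\<lambda>(p, s). F p s) \<in> borel_measurable ((borel \<Otimes>\<^sub>M \<mu>) \<Otimes>\<^sub>M (\<Pi>\<^sub>M k\<in>UNIV. borel \<Otimes>\<^sub>M \<mu>)) \<Longrightarrow>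
      (\<integral>\<^sup>+\<omega>. (\<Sum>n. F (z \<omega> n) (\<lambda>k. z \<omega> (skip n k))) \<partial>M)
      = (\<integral>\<^sup>+\<omega>. \<integral>\<^sup>+y. \<integral>\<^sup>+w. indicator {0..} y * F (y, w) (z \<omega>) \<partial>\<mu> \<partial>lborel \<partial>M)"
begin

abbreviation "point_space \<equiv> (borel \<Otimes>\<^sub>M \<mu> :: (real \<times> 'w) measure)"
abbreviation "points_space \<equiv> (\<Pi>\<^sub>M k\<in>(UNIV :: nat set). point_space)"

text \<open>Levels range over all reals, since arrival times are nonnegative only almost surely; the
  density confines the measure to the half-line.\<close>

definition intensity :: "(real \<times> 'w) measure" where
  "intensity = density lborel (indicator {0..}) \<Otimes>\<^sub>M \<mu>"

definition points_law :: "(nat \<Rightarrow> real \<times> 'w) measure" where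
  "points_law = distr M points_space z"

text \<open>A Bochner integral over counting measure: the value is 0 where the series is not
  absolutely convergent, and measurability in \<open>s\<close> holds for every measurable
  \<open>h\<close>.\<close>

definition total :: "(real \<times> 'w \<Rightarrow> real) \<Rightarrow> (nat \<Rightarrow> real \<times> 'w) \<Rightarrow> real" where
  "total h s = (\<integral>n. h (s n) \<partial>count_space UNIV)"

lemma sets_intensity [measurable_cong]: "sets intensity = sets point_space"
  unfolding intensity_def by (intro sets_pair_measure_cong) simp_all

lemma sets_points_law [measurable_cong]: "sets points_law = sets points_space"
  by (simp add: points_law_def)

sublocale halfline: sigma_finite_measure "density lborel (indicator {0::real..})"
  by (rule sigma_finite_measure.sigma_finite_iff_density_finite[OF sigma_finite_lborel, THEN iffD2]) (auto split: split_indicator)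

sublocale intensity: sigma_finite_measure intensity
proof -
  interpret pair_sigma_finite "density lborel (indicator {0::real..})" \<mu> ..
  show "sigma_finite_measure intensity"
    unfolding intensity_def by (rule sigma_finite_measure_axioms)
qed

sublocale points_law: prob_space points_law
  unfolding points_law_def by (rule prob_space_distr) measurable

sublocale point_pair: pair_sigma_finite intensity points_law ..

sublocale counting: sigma_finite_measure "count_space (UNIV :: nat set)"
  by (rule sigma_finite_measure_count_space)

sublocale indexed: pair_sigma_finite M "count_space (UNIV :: nat set)" ..

lemma nn_integral_intensity:
  assumes [measurable]: "f \<in> borel_measurable point_space"
  shows "(\<integral>\<^sup>+p. f p \<partial>intensity) = (\<integral>\<^sup>+y. \<integral>\<^sup>+w. indicator {0..} y * f (y, w) \<partial>\<mu> \<partial>lborel)"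
proof -
  have [measurable]: "f \<in> borel_measurable (density lborel (indicator {0..}) \<Otimes>\<^sub>M \<mu>)"
    using assms measurable_cong_sets[OF sets_intensity refl] unfolding intensity_def by blast
  have "(\<integral>\<^sup>+p. f p \<partial>intensity) = (\<integral>\<^sup>+y. \<integral>\<^sup>+w. f (y, w) \<partial>\<mu> \<partial>density lborel (indicator {0..}))"
    unfolding intensity_def by (rule mark.nn_integral_fst[symmetric]) measurable
  also have "\<dots> = (\<integral>\<^sup>+y. indicator {0..} y * (\<integral>\<^sup>+w. f (y, w) \<partial>\<mu>) \<partial>lborel)"
    by (rule nn_integral_density) measurable
  also have "\<dots> = (\<integral>\<^sup>+y. \<integral>\<^sup>+w. indicator {0..} y * f (y, w) \<partial>\<mu> \<partial>lborel)"
    by (rule nn_integral_cong) (auto split: split_indicator)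
  finally show ?thesis .
qed

lemma measurable_index [measurable]:
  "(\<lambda>x. z (fst x) (snd x)) \<in> M \<Otimes>\<^sub>M count_space UNIV \<rightarrow>\<^sub>M point_space"
  by (rule measurable_compose_countable[where f = "\<lambda>i x. z (fst x) i" and g = snd]) measurable

lemma measurable_skip_index [measurable]:
  "(\<lambda>x k. z (fst x) (skip (snd x) k)) \<in> M \<Otimes>\<^sub>M count_space UNIV \<rightarrow>\<^sub>M points_space"
proof (rule measurable_abs_UNIV)
  fix k
  show "(\<lambda>x. z (fst x) (skip (snd x) k)) \<in> M \<Otimes>\<^sub>M count_space UNIV \<rightarrow>\<^sub>M point_space"
    by (rule measurable_compose_countable[where f = "\<lambda>i x. z (fst x) (skip i k)" and g = snd]) measurable
qed

text \<open>Mecke's formula as an identity of measures: choosing an index by counting measure and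
  splitting off that point gives the product of the intensity and the law of the sequence. In this
  form it also serves signed integrands, through Fubini's theorem.\<close>

lemma mecke_distr:
  "distr (M \<Otimes>\<^sub>M count_space UNIV) (point_space \<Otimes>\<^sub>M points_space)
      (\<lambda>x. (z (fst x) (snd x), \<lambda>k. z (fst x) (skip (snd x) k)))
    = intensity \<Otimes>\<^sub>M points_law" (is "distr ?P ?Q ?T = ?R")
proof (rule measure_eqI)
  show sets: "sets (distr ?P ?Q ?T) = sets ?R"
    by (simp, intro sets_pair_measure_cong) (simp_all add: sets_intensity sets_points_law)
  fix A assume "A \<in> sets (distr ?P ?Q ?T)"
  then have [measurable]: "A \<in> sets ?Q" by simp
  have "emeasure (distr ?P ?Q ?T) A = (\<integral>\<^sup>+q. indicator A q \<partial>distr ?P ?Q ?T)"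
    by simp
  also have "\<dots> = (\<integral>\<^sup>+x. indicator A (?T x) \<partial>?P)"
    by (rule nn_integral_distr) measurable
  also have "\<dots> = (\<integral>\<^sup>+\<omega>. \<integral>\<^sup>+n. indicator A (?T (\<omega>, n)) \<partial>count_space UNIV \<partial>M)"
    by (rule counting.nn_integral_fst[symmetric]) measurable
  also have "\<dots> = (\<integral>\<^sup>+\<omega>. (\<Sum>n. indicator A (z \<omega> n, \<lambda>k. z \<omega> (skip n k))) \<partial>M)"
    by (simp add: nn_integral_count_space_nat)
  also have "\<dots> = (\<integral>\<^sup>+\<omega>. \<integral>\<^sup>+y. \<integral>\<^sup>+w. indicator {0..} y * indicator A ((y, w), z \<omega>) \<partial>\<mu> \<partial>lborel \<partial>M)"
    by (rule mecke_formula[of "\<lambda>p s. indicator A (p, s)"]) measurable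
  also have "\<dots> = (\<integral>\<^sup>+\<omega>. \<integral>\<^sup>+p. indicator A (p, z \<omega>) \<partial>intensity \<partial>M)"
    by (rule nn_integral_cong, subst nn_integral_intensity) measurable
  also have "\<dots> = (\<integral>\<^sup>+s. \<integral>\<^sup>+p. indicator A (p, s) \<partial>intensity \<partial>points_law)"
    unfolding points_law_def by (rule nn_integral_distr[symmetric]) measurable
  also have "\<dots> = (\<integral>\<^sup>+p. \<integral>\<^sup>+s. indicator A (p, s) \<partial>points_law \<partial>intensity)"
    by (rule point_pair.Fubini') measurable
  also have "\<dots> = (\<integral>\<^sup>+q. indicator A q \<partial>(intensity \<Otimes>\<^sub>M points_law))"
    by (rule points_law.nn_integral_fst) measurable
  also have "\<dots> = emeasure ?R A"
    using \<open>A \<in> sets (distr ?P ?Q ?T)\<close> unfolding sets by simp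
  finally show "emeasure (distr ?P ?Q ?T) A = emeasure ?R A" .
qed

lemma campbell_formula:
  assumes [measurable]: "f \<in> borel_measurable point_space"
  shows "(\<integral>\<^sup>+\<omega>. (\<Sum>n. f (z \<omega> n)) \<partial>M) = (\<integral>\<^sup>+p. f p \<partial>intensity)"
  using mecke_formula[of "\<lambda>p s. f p"] by (simp add: nn_integral_intensity emeasure_space_1)

text \<open>On the product measure the two factors are integrable separately, hence so is their
  product, and its integral factorises. Pulling back along \<open>mecke_distr\<close> also yields
  the absolute convergence of the sum.\<close>

lemma mecke_product:
  fixes h :: "real \<times> 'w \<Rightarrow> real" and g :: "(nat \<Rightarrow> real \<times> 'w) \<Rightarrow> real"
  assumes [measurable]: "g \<in> borel_measurable points_space"
    and h: "integrable intensity h" and g: "integrable M (\<lambda>\<omega>. g (z \<omega>))"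
  shows "has_bochner_integral M (\<lambda>\<omega>. \<integral>n. h (z \<omega> n) * g (\<lambda>k. z \<omega> (skip n k)) \<partial>count_space UNIV)
      ((\<integral>p. h p \<partial>intensity) * (\<integral>\<omega>. g (z \<omega>) \<partial>M))" (is ?A)
    and "AE \<omega> in M. integrable (count_space UNIV) (\<lambda>n. h (z \<omega> n) * g (\<lambda>k. z \<omega> (skip n k)))" (is ?B)
proof -
  let ?T = "\<lambda>x. (z (fst x) (snd x), \<lambda>k. z (fst x) (skip (snd x) k))"
  let ?f = "\<lambda>q. h (fst q) * g (snd q)"
  have [measurable]: "h \<in> borel_measurable point_space"
    using borel_measurable_integrable[OF h] measurable_cong_sets[OF sets_intensity refl] by blast
  have gl: "integrable points_law g"
    unfolding points_law_def by (rule integrable_distr_eq[where f = g and g = z, THEN iffD2]; (rule g | measurable))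
  have gl': "integral\<^sup>L points_law g = (\<integral>\<omega>. g (z \<omega>) \<partial>M)"
    unfolding points_law_def by (rule integral_distr) measurable
  have int: "integrable (intensity \<Otimes>\<^sub>M points_law) ?f"
    by (rule point_pair.Fubini_integrable) (use h gl in \<open>auto simp: abs_mult\<close>)
  have val: "(\<integral>q. ?f q \<partial>(intensity \<Otimes>\<^sub>M points_law)) = (\<integral>p. h p \<partial>intensity) * (\<integral>\<omega>. g (z \<omega>) \<partial>M)"
    by (subst point_pair.integral_fst'[OF int, symmetric]) (simp add: gl')
  have int': "integrable (M \<Otimes>\<^sub>M count_space UNIV) (\<lambda>x. ?f (?T x))"
    using int unfolding mecke_distr[symmetric] by (subst (asm) integrable_distr_eq) measurable
  have val': "(\<integral>x. ?f (?T x) \<partial>(M \<Otimes>\<^sub>M count_space UNIV)) = (\<integral>p. h p \<partial>intensity) * (\<integral>\<omega>. g (z \<omega>) \<partial>M)"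
    unfolding val[symmetric] mecke_distr[symmetric] by (rule integral_distr[symmetric]) measurable
  show ?B
    using indexed.AE_integrable_fst'[OF int'] by simp
  show ?A
    using indexed.integrable_fst'[OF int'] indexed.integral_fst'[OF int'] val'
    by (simp add: has_bochner_integral_iff)
qed

lemma borel_measurable_total [measurable]:
  assumes [measurable]: "h \<in> borel_measurable point_space"
  shows "total h \<in> borel_measurable points_space"
proof -
  have "(\<lambda>x. h (fst x (snd x))) \<in> borel_measurable (points_space \<Otimes>\<^sub>M count_space UNIV)"
    by (rule measurable_compose_countable[where f = "\<lambda>i x. h (fst x i)" and g = snd]) measurable
  then show ?thesis
    unfolding total_def[abs_def] by (intro counting.borel_measurable_lebesgue_integral) (simp add: split_beta')
qed

lemma total_expectation:
  assumes h: "integrable intensity h"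
  shows "has_bochner_integral M (\<lambda>\<omega>. total h (z \<omega>)) (\<integral>p. h p \<partial>intensity)"
    and AE_integrable_total: "AE \<omega> in M. integrable (count_space UNIV) (\<lambda>n. h (z \<omega> n))"
proof -
  have "(\<lambda>_. 1::real) \<in> borel_measurable points_space" "integrable M (\<lambda>\<omega>. 1::real)"
    by simp_all
  note * = mecke_product[OF this(1) h this(2)]
  show "has_bochner_integral M (\<lambda>\<omega>. total h (z \<omega>)) (\<integral>p. h p \<partial>intensity)"
    using *(1) unfolding total_def by (simp add: prob_space)
  show "AE \<omega> in M. integrable (count_space UNIV) (\<lambda>n. h (z \<omega> n))"
    using *(2) by simp
qed

text \<open>A stand-in for independence over disjoint regions. Since \<open>g\<close> does not react
  to the deletion of a point where \<open>h\<close> is nonzero, the sum in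
  \<open>mecke_product\<close> collapses to \<open>total h\<close> times \<open>g\<close>, and the
  mean of the product is the product of the means.\<close>

lemma total_orthogonal:
  assumes [measurable]: "g \<in> borel_measurable points_space"
    and h: "integrable intensity h" and g: "integrable M (\<lambda>\<omega>. g (z \<omega>))"
    and ign: "\<And>s n. h (s n) \<noteq> 0 \<Longrightarrow> g (\<lambda>k. s (skip n k)) = g s"
  shows "has_bochner_integral M (\<lambda>\<omega>. g (z \<omega>) * (total h (z \<omega>) - (\<integral>p. h p \<partial>intensity))) 0"
proof -
  have *: "h (z \<omega> n) * g (\<lambda>k. z \<omega> (skip n k)) = h (z \<omega> n) * g (z \<omega>)" for \<omega> n
    by (cases "h (z \<omega> n) = 0") (auto dest: ign)
  have "has_bochner_integral M (\<lambda>\<omega>. total h (z \<omega>) * g (z \<omega>))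
      ((\<integral>p. h p \<partial>intensity) * (\<integral>\<omega>. g (z \<omega>) \<partial>M))"
    using mecke_product(1)[OF assms(1) h g] unfolding * total_def by simp
  moreover have "has_bochner_integral M (\<lambda>\<omega>. (\<integral>p. h p \<partial>intensity) * g (z \<omega>))
      ((\<integral>p. h p \<partial>intensity) * (\<integral>\<omega>. g (z \<omega>) \<partial>M))"
    using g by (intro has_bochner_integral_mult_right has_bochner_integral_integrable)
  ultimately have "has_bochner_integral M (\<lambda>\<omega>. total h (z \<omega>) * g (z \<omega>) - (\<integral>p. h p \<partial>intensity) * g (z \<omega>)) 0"
    using has_bochner_integral_diff by fastforce
  then show ?thesis
    by (simp add: algebra_simps)
qed

lemma total_remove:
  assumes "integrable (count_space UNIV) (\<lambda>n. h (s n))"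
  shows "total h s = h (s n) + total h (\<lambda>k. s (skip n k))"
proof -
  have *: "Infinite_Set_Sum.abs_summable_on (\<lambda>n. h (s n)) A" for A
    by (rule Infinite_Set_Sum.abs_summable_on_subset[of _ UNIV])
       (simp_all add: Infinite_Set_Sum.abs_summable_on_def assms)
  have "total h s = infsetsum (\<lambda>n. h (s n)) UNIV"
    by (simp add: total_def infsetsum_def)
  also have "\<dots> = h (s n) + infsetsum (\<lambda>n. h (s n)) (- {n})"
    using infsetsum_Un_disjoint[OF *[of "{n}"] *[of "- {n}"]] by (simp add: Compl_partition)
  also have "infsetsum (\<lambda>n. h (s n)) (- {n}) = infsetsum (\<lambda>k. h (s (skip n k))) UNIV"
    unfolding range_skip[symmetric] using inj_skip by (rule infsetsum_reindex)
  also have "\<dots> = total h (\<lambda>k. s (skip n k))"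
    by (simp add: total_def infsetsum_def)
  finally show ?thesis .
qed

text \<open>Dropping a zero term changes neither convergence nor value, so both sides agree even
  where the default value 0 is taken. The condition \<open>ign\<close> of
  \<open>total_orthogonal\<close> can therefore be verified for every sequence.\<close>

lemma total_skip:
  assumes "h (s n) = 0"
  shows "total h (\<lambda>k. s (skip n k)) = total h s"
proof -
  have "total h (\<lambda>k. s (skip n k)) = infsetsum (\<lambda>k. h (s (skip n k))) UNIV"
    by (simp add: total_def infsetsum_def)
  also have "\<dots> = infsetsum (\<lambda>n. h (s n)) (- {n})"
    unfolding range_skip[symmetric] using inj_skip by (rule infsetsum_reindex[symmetric])
  also have "\<dots> = infsetsum (\<lambda>n. h (s n)) UNIV"
    using assms by (intro infsetsum_cong_neutral) auto
  also have "\<dots> = total h s"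
    by (simp add: total_def infsetsum_def)
  finally show ?thesis .
qed

text \<open>The square of a sum is the sum of the squares plus the sum over ordered pairs of
  distinct points. Mecke's formula with \<open>g = total h\<close> gives the latter the mean
  \<open>c * c\<close>, which centring removes.\<close>

lemma total_variance:
  assumes h: "integrable intensity h" and h2: "integrable intensity (\<lambda>p. (h p)\<^sup>2)"
  shows "has_bochner_integral M (\<lambda>\<omega>. (total h (z \<omega>) - (\<integral>p. h p \<partial>intensity))\<^sup>2) (\<integral>p. (h p)\<^sup>2 \<partial>intensity)"
proof -
  have [measurable]: "h \<in> borel_measurable point_space"
    using borel_measurable_integrable[OF h] measurable_cong_sets[OF sets_intensity refl] by blast
  define c where "c = (\<integral>p. h p \<partial>intensity)"
  have E: "has_bochner_integral M (\<lambda>\<omega>. total h (z \<omega>)) c"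
    unfolding c_def by (rule total_expectation(1)[OF h])
  have iE: "integrable M (\<lambda>\<omega>. total h (z \<omega>))" and vE: "(\<integral>\<omega>. total h (z \<omega>) \<partial>M) = c"
    using E by (auto simp: has_bochner_integral_iff)
  have th: "total h \<in> borel_measurable points_space"
    by measurable
  note mp = mecke_product[OF th h iE]
  let ?R = "\<lambda>\<omega>. \<integral>n. h (z \<omega> n) * total h (\<lambda>k. z \<omega> (skip n k)) \<partial>count_space UNIV"
  have "AE \<omega> in M. (total h (z \<omega>))\<^sup>2 = total (\<lambda>p. (h p)\<^sup>2) (z \<omega>) + ?R \<omega>"
    using mp(2) AE_integrable_total[OF h] AE_integrable_total[OF h2]
  proof eventually_elim
    case (elim \<omega>)
    have "(total h (z \<omega>))\<^sup>2 = (\<integral>n. h (z \<omega> n) * total h (z \<omega>) \<partial>count_space UNIV)"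
      by (simp add: total_def power2_eq_square)
    also have "\<dots> = (\<integral>n. (h (z \<omega> n))\<^sup>2 + h (z \<omega> n) * total h (\<lambda>k. z \<omega> (skip n k)) \<partial>count_space UNIV)"
      by (intro Bochner_Integration.integral_cong refl)
         (subst total_remove[OF elim(2)], simp add: power2_eq_square algebra_simps)
    also have "\<dots> = total (\<lambda>p. (h p)\<^sup>2) (z \<omega>) + ?R \<omega>"
      unfolding total_def using elim by (intro Bochner_Integration.integral_add) (simp_all add: total_def)
    finally show ?case .
  qed
  moreover have sq: "has_bochner_integral M (\<lambda>\<omega>. total (\<lambda>p. (h p)\<^sup>2) (z \<omega>) + ?R \<omega>) ((\<integral>p. (h p)\<^sup>2 \<partial>intensity) + c * c)"
    using has_bochner_integral_add[OF total_expectation(1)[OF h2] mp(1)] by (simp add: vE c_def)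
  ultimately have "has_bochner_integral M (\<lambda>\<omega>. (total h (z \<omega>))\<^sup>2) ((\<integral>p. (h p)\<^sup>2 \<partial>intensity) + c * c)"
    by (subst has_bochner_integral_cong_AE) (use sq in \<open>auto simp: has_bochner_integral_iff\<close>)
  from has_bochner_integral_add[OF has_bochner_integral_diff[OF this has_bochner_integral_mult_right[OF E, of "2 * c"]]
      has_bochner_integral_integrable[of M "\<lambda>_. c * c"]]
  have "has_bochner_integral M (\<lambda>\<omega>. (total h (z \<omega>))\<^sup>2 - 2 * c * total h (z \<omega>) + c * c) (\<integral>p. (h p)\<^sup>2 \<partial>intensity)"
    by (simp add: prob_space)
  then show ?thesis
    by (simp add: c_def[symmetric] power2_diff power2_eq_square algebra_simps)
qed

end

section \<open>The law of the coupling sequences\<close>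

text \<open>The three value spaces differ, so independence is given through rectangle events.
  Uniqueness of product measures is applied twice: to the last two variables conditioned on the
  first, and then to the first against the pair.\<close>

lemma (in prob_space) distr_triple:
  assumes [measurable]: "X \<in> M \<rightarrow>\<^sub>M A" "Y \<in> M \<rightarrow>\<^sub>M B" "Z \<in> M \<rightarrow>\<^sub>M C"
    and indep: "\<And>a b c. a \<in> sets A \<Longrightarrow> b \<in> sets B \<Longrightarrow> c \<in> sets C \<Longrightarrow>
      emeasure M (X -` a \<inter> space M \<inter> (Y -` b \<inter> space M) \<inter> (Z -` c \<inter> space M))
      = emeasure M (X -` a \<inter> space M) * (emeasure M (Y -` b \<inter> space M) * emeasure M (Z -` c \<inter> space M))"
  shows "distr M (A \<Otimes>\<^sub>M (B \<Otimes>\<^sub>M C)) (\<lambda>\<omega>. (X \<omega>, Y \<omega>, Z \<omega>))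
    = distr M A X \<Otimes>\<^sub>M (distr M B Y \<Otimes>\<^sub>M distr M C Z)"
proof -
  interpret X: prob_space "distr M A X" by (rule prob_space_distr) measurable
  interpret Y: prob_space "distr M B Y" by (rule prob_space_distr) measurable
  interpret Z: prob_space "distr M C Z" by (rule prob_space_distr) measurable
  interpret YZ: pair_prob_space "distr M B Y" "distr M C Z" ..
  have YZ: "emeasure (distr M B Y \<Otimes>\<^sub>M distr M C Z) D * emeasure M (X -` a \<inter> space M)
      = emeasure M (X -` a \<inter> space M \<inter> ((\<lambda>\<omega>. (Y \<omega>, Z \<omega>)) -` D \<inter> space M))"
    if a: "a \<in> sets A" and D: "D \<in> sets (B \<Otimes>\<^sub>M C)" for a D
  proof (cases "emeasure M (X -` a \<inter> space M) = 0")
    case True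
    have "emeasure M (X -` a \<inter> space M \<inter> ((\<lambda>\<omega>. (Y \<omega>, Z \<omega>)) -` D \<inter> space M)) \<le> emeasure M (X -` a \<inter> space M)"
      using a by (intro emeasure_mono) auto
    with True show ?thesis by simp
  next
    case False
    have one: "emeasure M (X -` a \<inter> space M) / emeasure M (X -` a \<inter> space M) = 1"
      using False by (intro ennreal_divide_self) (auto simp: less_top[symmetric])
    \<comment> \<open>The conditional probability given that \<open>X\<close> lies in
      \<open>a\<close>; under it the pair of \<open>Y\<close> and \<open>Z\<close> still has the
      product law.\<close>
    define N where "N = uniform_measure M (X -` a \<inter> space M)"
    have Xa: "X -` a \<inter> space M \<in> sets M" using a by measurable
    have [measurable_cong]: "sets N = sets M" by (simp add: N_def)
    interpret N: prob_space N
      unfolding N_def using False by (intro prob_space_uniform_measure) auto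
    have "distr M B Y \<Otimes>\<^sub>M distr M C Z = distr N (B \<Otimes>\<^sub>M C) (\<lambda>\<omega>. (Y \<omega>, Z \<omega>))"
    proof (rule pair_measure_eqI)
      show "sets (distr M B Y \<Otimes>\<^sub>M distr M C Z) = sets (distr N (B \<Otimes>\<^sub>M C) (\<lambda>\<omega>. (Y \<omega>, Z \<omega>)))"
        unfolding sets_distr by (rule sets_pair_measure_cong) simp_all
      fix b c assume "b \<in> sets (distr M B Y)" "c \<in> sets (distr M C Z)"
      then have bc [measurable]: "b \<in> sets B" "c \<in> sets C" by auto
      have "emeasure (distr N (B \<Otimes>\<^sub>M C) (\<lambda>\<omega>. (Y \<omega>, Z \<omega>))) (b \<times> c)
          = emeasure N ((Y -` b \<inter> space M) \<inter> (Z -` c \<inter> space M))"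
        by (subst emeasure_distr, measurable) (auto intro!: arg_cong2[where f = emeasure] simp: N_def)
      also have "\<dots> = emeasure M (X -` a \<inter> space M \<inter> (Y -` b \<inter> space M) \<inter> (Z -` c \<inter> space M)) / emeasure M (X -` a \<inter> space M)"
      proof -
        have "Y -` b \<inter> space M \<inter> (Z -` c \<inter> space M) \<in> sets M"
          by measurable
        then show ?thesis
          unfolding N_def using Xa by (subst emeasure_uniform_measure) (simp_all add: Int_assoc)
      qed
      also have "\<dots> = emeasure M (Y -` b \<inter> space M) * emeasure M (Z -` c \<inter> space M)"
        unfolding indep[OF a bc] mult.commute[of "emeasure M (X -` a \<inter> space M)"] ennreal_times_divide[symmetric]
        by (simp only: one mult_1_right)
      finally show "emeasure (distr M B Y) b * emeasure (distr M C Z) c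
          = emeasure (distr N (B \<Otimes>\<^sub>M C) (\<lambda>\<omega>. (Y \<omega>, Z \<omega>))) (b \<times> c)"
        using bc by (simp add: emeasure_distr)
    qed (rule Y.sigma_finite_measure_axioms Z.sigma_finite_measure_axioms)+
    then have "emeasure (distr M B Y \<Otimes>\<^sub>M distr M C Z) D = emeasure N ((\<lambda>\<omega>. (Y \<omega>, Z \<omega>)) -` D \<inter> space M)"
      using D by (simp add: emeasure_distr N_def)
    also have "\<dots> = emeasure M (X -` a \<inter> space M \<inter> ((\<lambda>\<omega>. (Y \<omega>, Z \<omega>)) -` D \<inter> space M)) / emeasure M (X -` a \<inter> space M)"
      unfolding N_def using Xa D by (subst emeasure_uniform_measure) auto
    finally show ?thesis
      by (simp only: ennreal_divide_times one mult_1_right)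
  qed
  show ?thesis
  proof (rule pair_measure_eqI[symmetric])
    show "sets (distr M A X \<Otimes>\<^sub>M (distr M B Y \<Otimes>\<^sub>M distr M C Z))
        = sets (distr M (A \<Otimes>\<^sub>M (B \<Otimes>\<^sub>M C)) (\<lambda>\<omega>. (X \<omega>, Y \<omega>, Z \<omega>)))"
      unfolding sets_distr by (intro sets_pair_measure_cong) simp_all
    fix a D assume a: "a \<in> sets (distr M A X)" and D: "D \<in> sets (distr M B Y \<Otimes>\<^sub>M distr M C Z)"
    have a' [measurable]: "a \<in> sets A" using a by simp
    have "sets (distr M B Y \<Otimes>\<^sub>M distr M C Z) = sets (B \<Otimes>\<^sub>M C)"
      by (intro sets_pair_measure_cong) simp_all
    with D have D' [measurable]: "D \<in> sets (B \<Otimes>\<^sub>M C)" by blast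
    have "emeasure (distr M (A \<Otimes>\<^sub>M (B \<Otimes>\<^sub>M C)) (\<lambda>\<omega>. (X \<omega>, Y \<omega>, Z \<omega>))) (a \<times> D)
        = emeasure M (X -` a \<inter> space M \<inter> ((\<lambda>\<omega>. (Y \<omega>, Z \<omega>)) -` D \<inter> space M))"
      by (subst emeasure_distr, measurable) (auto intro!: arg_cong2[where f = emeasure])
    then show "emeasure (distr M A X) a * emeasure (distr M B Y \<Otimes>\<^sub>M distr M C Z) D
        = emeasure (distr M (A \<Otimes>\<^sub>M (B \<Otimes>\<^sub>M C)) (\<lambda>\<omega>. (X \<omega>, Y \<omega>, Z \<omega>))) (a \<times> D)"
      using YZ[OF a' D'] by (simp add: emeasure_distr mult.commute)
  qed (rule X.sigma_finite_measure_axioms YZ.sigma_finite_measure_axioms)+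
qed

section \<open>Zipping two independent sequences\<close>

context pair_prob_space
begin

interpretation S1: sequence_space M1 ..
interpretation S2: sequence_space M2 ..
interpretation S12: sequence_space "M1 \<Otimes>\<^sub>M M2" ..

lemma nn_integral_sequence_peel1:
  assumes [measurable]: "f \<in> borel_measurable S1.S"
  shows "(\<integral>\<^sup>+s. f s \<partial>S1.S) = (\<integral>\<^sup>+x. \<integral>\<^sup>+s. f (case_nat x s) \<partial>S1.S \<partial>M1)"
  by (subst S1.PiM_iter[symmetric], subst nn_integral_distr)
     (auto simp: split_beta' S1.P.nn_integral_fst[symmetric])

lemma nn_integral_sequence_peel2:
  assumes [measurable]: "f \<in> borel_measurable S2.S"
  shows "(\<integral>\<^sup>+s. f s \<partial>S2.S) = (\<integral>\<^sup>+x. \<integral>\<^sup>+s. f (case_nat x s) \<partial>S2.S \<partial>M2)"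
  by (subst S2.PiM_iter[symmetric], subst nn_integral_distr)
     (auto simp: split_beta' S2.P.nn_integral_fst[symmetric])

text \<open>Factor \<open>j\<close> involves only entry \<open>j\<close> of each sequence, so an
  induction step peels the first entry off both sequences and splits off one factor.\<close>

lemma nn_integral_prod_sequences:
  assumes "\<And>j. f j \<in> borel_measurable (M1 \<Otimes>\<^sub>M M2)"
  shows "(\<integral>\<^sup>+a. \<integral>\<^sup>+b. (\<Prod>j<n. f j (a j, b j)) \<partial>S2.S \<partial>S1.S) = (\<Prod>j<n. \<integral>\<^sup>+p. f j p \<partial>(M1 \<Otimes>\<^sub>M M2))"
  using assms
proof (induction n arbitrary: f)
  case 0
  then show ?case by (simp add: S1.P.emeasure_space_1 S2.P.emeasure_space_1)
next
  case (Suc n)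
  note [measurable] = Suc.prems
  interpret S1M2: pair_sigma_finite S1.S M2 ..
  let ?H = "\<lambda>a b. \<Prod>j<n. f (Suc j) (a j, b j)"
  have "(\<integral>\<^sup>+a. \<integral>\<^sup>+b. (\<Prod>j<Suc n. f j (a j, b j)) \<partial>S2.S \<partial>S1.S)
      = (\<integral>\<^sup>+x. \<integral>\<^sup>+a. \<integral>\<^sup>+b. f 0 (x, b 0) * (\<Prod>j<n. f (Suc j) (a j, b (Suc j))) \<partial>S2.S \<partial>S1.S \<partial>M1)"
    by (subst nn_integral_sequence_peel1, measurable) (simp add: prod.lessThan_Suc_shift del: prod.lessThan_Suc)
  also have "\<dots> = (\<integral>\<^sup>+x. \<integral>\<^sup>+a. \<integral>\<^sup>+y. f 0 (x, y) * (\<integral>\<^sup>+b. ?H a b \<partial>S2.S) \<partial>M2 \<partial>S1.S \<partial>M1)"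
  proof (rule nn_integral_cong, rule nn_integral_cong)
    fix x a assume [measurable]: "x \<in> space M1" "a \<in> space S1.S"
    have [measurable]: "(\<lambda>b. f (Suc j) (a j, b j)) \<in> borel_measurable S2.S" for j
    proof -
      have [measurable]: "a j \<in> space M1"
        using \<open>a \<in> space S1.S\<close> by (auto simp: space_PiM)
      show ?thesis by measurable
    qed
    show "(\<integral>\<^sup>+b. f 0 (x, b 0) * (\<Prod>j<n. f (Suc j) (a j, b (Suc j))) \<partial>S2.S)
        = (\<integral>\<^sup>+y. f 0 (x, y) * (\<integral>\<^sup>+b. ?H a b \<partial>S2.S) \<partial>M2)"
    proof -
      have [measurable]: "(\<lambda>b. f (Suc j) (a j, b (Suc j))) \<in> borel_measurable S2.S" for j
      proof -
        have [measurable]: "a j \<in> space M1"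
          using \<open>a \<in> space S1.S\<close> by (auto simp: space_PiM)
        show ?thesis by measurable
      qed
      show ?thesis
        by (subst nn_integral_sequence_peel2, measurable) (simp add: nn_integral_cmult)
    qed
  qed
  also have "\<dots> = (\<integral>\<^sup>+x. \<integral>\<^sup>+y. \<integral>\<^sup>+a. f 0 (x, y) * (\<integral>\<^sup>+b. ?H a b \<partial>S2.S) \<partial>S1.S \<partial>M2 \<partial>M1)"
    by (rule nn_integral_cong, rule S1M2.Fubini'[symmetric]) measurable
  also have "\<dots> = (\<integral>\<^sup>+x. \<integral>\<^sup>+y. f 0 (x, y) * (\<integral>\<^sup>+a. \<integral>\<^sup>+b. ?H a b \<partial>S2.S \<partial>S1.S) \<partial>M2 \<partial>M1)"
    by (rule nn_integral_cong, rule nn_integral_cong, rule nn_integral_cmult) measurable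
  also have "\<dots> = (\<integral>\<^sup>+x. \<integral>\<^sup>+y. f 0 (x, y) \<partial>M2 \<partial>M1) * (\<integral>\<^sup>+a. \<integral>\<^sup>+b. ?H a b \<partial>S2.S \<partial>S1.S)"
  proof -
    have "(\<integral>\<^sup>+x. \<integral>\<^sup>+y. f 0 (x, y) * K \<partial>M2 \<partial>M1) = (\<integral>\<^sup>+x. \<integral>\<^sup>+y. f 0 (x, y) \<partial>M2 \<partial>M1) * K" for K
    proof -
      have "(\<integral>\<^sup>+x. \<integral>\<^sup>+y. f 0 (x, y) * K \<partial>M2 \<partial>M1) = (\<integral>\<^sup>+x. (\<integral>\<^sup>+y. f 0 (x, y) \<partial>M2) * K \<partial>M1)"
        by (rule nn_integral_cong, rule nn_integral_multc) measurable
      also have "\<dots> = (\<integral>\<^sup>+x. \<integral>\<^sup>+y. f 0 (x, y) \<partial>M2 \<partial>M1) * K"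
        by (rule nn_integral_multc) measurable
      finally show ?thesis .
    qed
    then show ?thesis .
  qed
  also have "\<dots> = (\<integral>\<^sup>+p. f 0 p \<partial>(M1 \<Otimes>\<^sub>M M2)) * (\<Prod>j<n. \<integral>\<^sup>+p. f (Suc j) p \<partial>(M1 \<Otimes>\<^sub>M M2))"
  proof (rule arg_cong2[where f = "(*)"])
    show "(\<integral>\<^sup>+x. \<integral>\<^sup>+y. f 0 (x, y) \<partial>M2 \<partial>M1) = (\<integral>\<^sup>+p. f 0 p \<partial>(M1 \<Otimes>\<^sub>M M2))"
      by (rule M2.nn_integral_fst) measurable
    show "(\<integral>\<^sup>+a. \<integral>\<^sup>+b. ?H a b \<partial>S2.S \<partial>S1.S) = (\<Prod>j<n. \<integral>\<^sup>+p. f (Suc j) p \<partial>(M1 \<Otimes>\<^sub>M M2))"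
      by (rule Suc.IH) measurable
  qed
  finally show ?case
    by (simp add: prod.lessThan_Suc_shift del: prod.lessThan_Suc)
qed

lemma distr_zip_sequences:
  "distr (S1.S \<Otimes>\<^sub>M S2.S) S12.S (\<lambda>(a, b) n. (a n, b n)) = S12.S"
proof (rule S12.PiM_eq)
  let ?T = "\<lambda>(a, b) n. (a n, b n)"
  have T [measurable]: "?T \<in> S1.S \<Otimes>\<^sub>M S2.S \<rightarrow>\<^sub>M S12.S"
    unfolding split_beta' by (rule measurable_abs_UNIV) measurable
  show "sets (distr (S1.S \<Otimes>\<^sub>M S2.S) S12.S ?T) = sets S12.S" by simp
  fix J :: "nat set" and F assume J: "finite J" and F: "\<And>j. j \<in> J \<Longrightarrow> F j \<in> sets (M1 \<Otimes>\<^sub>M M2)"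
  \<comment> \<open>Factor 1 outside \<open>J\<close> lets the product run over an initial segment
    of the indices, as the peeling induction demands.\<close>
  define f where "f = (\<lambda>j p. if j \<in> J then indicator (F j) p else 1 :: ennreal)"
  have [measurable]: "f j \<in> borel_measurable (M1 \<Otimes>\<^sub>M M2)" for j
    using F by (cases "j \<in> J") (auto simp: f_def)
  obtain n where n: "J \<subseteq> {..<n}"
    using finite_nat_iff_bounded J by blast
  let ?E = "prod_emb UNIV (\<lambda>_. M1 \<Otimes>\<^sub>M M2) J (\<Pi>\<^sub>E j\<in>J. F j)"
  have E: "?E \<in> sets S12.S"
    by (rule sets_PiM_I) (use J F in auto)
  have "emeasure (distr (S1.S \<Otimes>\<^sub>M S2.S) S12.S ?T) ?E
      = (\<integral>\<^sup>+s. indicator ?E s \<partial>distr (S1.S \<Otimes>\<^sub>M S2.S) S12.S ?T)"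
    using E by simp
  also have "\<dots> = (\<integral>\<^sup>+x. indicator ?E (?T x) \<partial>(S1.S \<Otimes>\<^sub>M S2.S))"
    by (rule nn_integral_distr[OF T]) (use E in simp)
  also have "\<dots> = (\<integral>\<^sup>+x. (\<Prod>j<n. f j (fst x j, snd x j)) \<partial>(S1.S \<Otimes>\<^sub>M S2.S))"
  proof (rule nn_integral_cong)
    fix x assume x: "x \<in> space (S1.S \<Otimes>\<^sub>M S2.S)"
    have "?T x \<in> ?E \<longleftrightarrow> (\<forall>j\<in>J. (fst x j, snd x j) \<in> F j)"
      using x by (simp add: prod_emb_def space_pair_measure space_PiM split_beta' mem_Times_iff PiE_iff)
    moreover have "(\<Prod>j<n. f j (fst x j, snd x j)) = (\<Prod>j\<in>J. indicator (F j) (fst x j, snd x j))"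
      using n by (simp add: prod.mono_neutral_cong_right[of "{..<n}" J] f_def)
    moreover have "(\<Prod>j\<in>J. indicator (F j) (fst x j, snd x j) :: ennreal)
        = (if \<forall>j\<in>J. (fst x j, snd x j) \<in> F j then 1 else 0)"
      using J by (auto simp: prod_zero_iff indicator_def)
    ultimately show "indicator ?E (?T x) = (\<Prod>j<n. f j (fst x j, snd x j))"
      by (simp add: indicator_def)
  qed
  also have "\<dots> = (\<integral>\<^sup>+a. \<integral>\<^sup>+b. (\<Prod>j<n. f j (a j, b j)) \<partial>S2.S \<partial>S1.S)"
  proof -
    have "(\<integral>\<^sup>+x. (\<Prod>j<n. f j (fst x j, snd x j)) \<partial>(S1.S \<Otimes>\<^sub>M S2.S))
        = (\<integral>\<^sup>+a. \<integral>\<^sup>+b. (\<Prod>j<n. f j (fst (a, b) j, snd (a, b) j)) \<partial>S2.S \<partial>S1.S)"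
      by (rule S2.P.nn_integral_fst[symmetric]) measurable
    then show ?thesis by (simp only: fst_conv snd_conv)
  qed
  also have "\<dots> = (\<Prod>j<n. \<integral>\<^sup>+p. f j p \<partial>(M1 \<Otimes>\<^sub>M M2))"
    by (rule nn_integral_prod_sequences) measurable
  also have "\<dots> = (\<Prod>j\<in>J. emeasure (M1 \<Otimes>\<^sub>M M2) (F j))"
    using n F by (simp add: prod.mono_neutral_cong_right[of "{..<n}" J] f_def emeasure_space_1)
  finally show "emeasure (distr (S1.S \<Otimes>\<^sub>M S2.S) S12.S ?T) ?E = (\<Prod>j\<in>J. emeasure (M1 \<Otimes>\<^sub>M M2) (F j))" .
qed

end

text \<open>Independence is assumed for the arrival times, whereas the gaps are to be treated; this
  map recovers the gaps from the arrival times measurably.\<close>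

lemma measurable_increments:
  "(\<lambda>s n. case n of 0 \<Rightarrow> s 0 | Suc m \<Rightarrow> s (Suc m) - s m)
    \<in> (\<Pi>\<^sub>M n\<in>UNIV. borel :: real measure) \<rightarrow>\<^sub>M (\<Pi>\<^sub>M n\<in>(UNIV :: nat set). borel)"
proof (rule measurable_abs_UNIV)
  fix n :: nat
  show "(\<lambda>s. case n of 0 \<Rightarrow> s 0 | Suc m \<Rightarrow> s (Suc m) - s m) \<in> borel_measurable (\<Pi>\<^sub>M n\<in>UNIV. borel :: real measure)"
    by (cases n) simp_all
qed

text \<open>The three independent iid sequences become one iid sequence of triples, consisting of a
  gap and a mark that pairs time and direction. This is the canonical setting of Mecke's
  formula.\<close>

lemma coupling_sequences_law:
  fixes \<sigma> :: "(real^'d) measure"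
  assumes "sphere_prob \<sigma>" and cs: "coupling_sequences P \<sigma> U E V"
  shows "(\<lambda>\<omega> n. (E n \<omega>, U n \<omega>, V n \<omega>))
      \<in> P \<rightarrow>\<^sub>M (\<Pi>\<^sub>M n\<in>UNIV. exp_law \<Otimes>\<^sub>M (uniform_measure lborel {0..1} \<Otimes>\<^sub>M \<sigma>))"
    and "distr P (\<Pi>\<^sub>M n\<in>UNIV. exp_law \<Otimes>\<^sub>M (uniform_measure lborel {0..1} \<Otimes>\<^sub>M \<sigma>))
        (\<lambda>\<omega> n. (E n \<omega>, U n \<omega>, V n \<omega>))
      = (\<Pi>\<^sub>M n\<in>UNIV. exp_law \<Otimes>\<^sub>M (uniform_measure lborel {0..1} \<Otimes>\<^sub>M \<sigma>))"
proof -
  define uni :: "real measure" where "uni = uniform_measure lborel {0..1}"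
  have [measurable_cong]: "sets uni = sets borel" by (simp add: uni_def)
  interpret P: prob_space P using cs by (simp add: coupling_sequences_def)
  interpret sig: prob_space \<sigma> using assms by (simp add: sphere_prob_def)
  interpret uni: prob_space uni
    unfolding uni_def by (rule prob_space_uniform_measure) auto
  interpret ex: prob_space exp_law by (rule prob_space_exp_law)
  interpret us: pair_prob_space uni \<sigma> ..
  interpret eus: pair_prob_space exp_law "uni \<Otimes>\<^sub>M \<sigma>" ..
  let ?B = "\<Pi>\<^sub>M n\<in>(UNIV :: nat set). borel :: real measure"
  let ?S = "\<Pi>\<^sub>M n\<in>(UNIV :: nat set). \<sigma>"
  let ?arr = "\<lambda>\<omega> n. arrival E n \<omega>" and ?E = "\<lambda>\<omega> n. E n \<omega>" and ?U = "\<lambda>\<omega> n. U n \<omega>" and ?V = "\<lambda>\<omega> n. V n \<omega>"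
  have iU: "P.indep_vars (\<lambda>_. borel) U UNIV" and dU: "distr P borel (U n) = uni"
    and iE: "P.indep_vars (\<lambda>_. borel) E UNIV" and dE: "distributed P lborel (E n) (\<lambda>x. ennreal (exponential_density 1 x))"
    and iV: "P.indep_vars (\<lambda>_. \<sigma>) V UNIV" and dV: "distr P \<sigma> (V n) = \<sigma>" for n
    using cs by (simp_all add: coupling_sequences_def uni_def)
  have iS: "P.indep_sets (\<lambda>k. [generated_sets P ?U ?B, generated_sets P ?arr ?B, generated_sets P ?V ?S] ! k) {..<3}"
    using cs by (simp add: coupling_sequences_def)
  have [measurable]: "U n \<in> borel_measurable P" "E n \<in> borel_measurable P" "V n \<in> P \<rightarrow>\<^sub>M \<sigma>" for n
    using iU iE iV by (simp_all add: P.indep_vars_def)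
  have [measurable]: "arrival E n \<in> borel_measurable P" for n
    unfolding arrival_def[abs_def] by measurable
  have mU [measurable]: "?U \<in> P \<rightarrow>\<^sub>M ?B" and mE [measurable]: "?E \<in> P \<rightarrow>\<^sub>M ?B"
    and mA [measurable]: "?arr \<in> P \<rightarrow>\<^sub>M ?B" and mV [measurable]: "?V \<in> P \<rightarrow>\<^sub>M ?S"
    by (rule measurable_abs_UNIV; measurable)+
  have lU: "distr P ?B ?U = (\<Pi>\<^sub>M n\<in>UNIV. uni)"
    using P.indep_vars_iff_distr_eq_PiM[THEN iffD1, OF _ _ iU] by (simp add: dU restrict_UNIV)
  have lV: "distr P ?S ?V = (\<Pi>\<^sub>M n\<in>UNIV. \<sigma>)"
    using P.indep_vars_iff_distr_eq_PiM[THEN iffD1, OF _ _ iV] by (simp add: dV restrict_UNIV)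
  have "distr P borel (E n) = exp_law" for n
  proof -
    have "distr P borel (E n) = distr P lborel (E n)"
      by (rule distr_cong) simp_all
    also have "\<dots> = exp_law"
      by (rule distributed_distr_eq_density[OF dE])
    finally show ?thesis .
  qed
  then have lE: "distr P ?B ?E = (\<Pi>\<^sub>M n\<in>UNIV. exp_law)"
    using P.indep_vars_iff_distr_eq_PiM[THEN iffD1, OF _ _ iE] by (simp add: restrict_UNIV)
  have triple: "distr P (?B \<Otimes>\<^sub>M (?B \<Otimes>\<^sub>M ?S)) (\<lambda>\<omega>. (?E \<omega>, ?U \<omega>, ?V \<omega>))
    = distr P ?B ?E \<Otimes>\<^sub>M (distr P ?B ?U \<Otimes>\<^sub>M distr P ?S ?V)"
  proof (rule P.distr_triple[OF mE mU mV])
    fix a b c assume a: "a \<in> sets ?B" and b: "b \<in> sets ?B" and c: "c \<in> sets ?S"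
    define g :: "(nat \<Rightarrow> real) \<Rightarrow> nat \<Rightarrow> real"
      where "g = (\<lambda>s n. case n of 0 \<Rightarrow> s 0 | Suc m \<Rightarrow> s (Suc m) - s m)"
    have g: "g (?arr \<omega>) = ?E \<omega>" for \<omega>
      by (rule ext) (simp add: g_def arrival_def split: nat.split)
    have ga: "g -` a \<in> sets ?B"
      using measurable_sets[OF measurable_increments a] unfolding g_def by (simp add: space_PiM)
    have "?arr -` (g -` a) = ?E -` a"
      by (auto simp: g)
    then have a': "?E -` a \<inter> space P \<in> generated_sets P ?arr ?B"
      using in_vimage_algebra[OF ga, of ?arr "space P"] by simp
    have b': "?U -` b \<inter> space P \<in> generated_sets P ?U ?B" and c': "?V -` c \<inter> space P \<in> generated_sets P ?V ?S"
      using b c by (auto intro: in_vimage_algebra)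
    define A where "A = (\<lambda>k::nat. [?U -` b \<inter> space P, ?E -` a \<inter> space P, ?V -` c \<inter> space P] ! k)"
    have three: "{..<3::nat} = {0, 1, 2}" by auto
    have "P.prob (\<Inter>k\<in>{..<3}. A k) = (\<Prod>k\<in>{..<3}. P.prob (A k))"
      by (rule P.indep_setsD[OF iS]) (use a' b' c' in \<open>auto simp: A_def three\<close>)
    then have "P.prob ((?U -` b \<inter> space P) \<inter> ((?E -` a \<inter> space P) \<inter> (?V -` c \<inter> space P)))
        = P.prob (?U -` b \<inter> space P) * (P.prob (?E -` a \<inter> space P) * P.prob (?V -` c \<inter> space P))"
      by (simp add: three A_def)
    moreover have "(?U -` b \<inter> space P) \<inter> ((?E -` a \<inter> space P) \<inter> (?V -` c \<inter> space P))
        = (?E -` a \<inter> space P) \<inter> (?U -` b \<inter> space P) \<inter> (?V -` c \<inter> space P)" by blast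
    ultimately show "emeasure P (?E -` a \<inter> space P \<inter> (?U -` b \<inter> space P) \<inter> (?V -` c \<inter> space P))
      = emeasure P (?E -` a \<inter> space P) * (emeasure P (?U -` b \<inter> space P) * emeasure P (?V -` c \<inter> space P))"
      by (simp add: P.emeasure_eq_measure ennreal_mult[symmetric] mult_ac)
  qed
  let ?Es = "\<Pi>\<^sub>M n\<in>(UNIV :: nat set). exp_law" and ?Us = "\<Pi>\<^sub>M n\<in>(UNIV :: nat set). uni"
  let ?USs = "\<Pi>\<^sub>M n\<in>(UNIV :: nat set). uni \<Otimes>\<^sub>M \<sigma>"
  let ?EUSs = "\<Pi>\<^sub>M n\<in>(UNIV :: nat set). exp_law \<Otimes>\<^sub>M (uni \<Otimes>\<^sub>M \<sigma>)"
  have [measurable_cong]: "sets ?Es = sets ?B" "sets ?Us = sets ?B"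
    by (rule sets_PiM_cong; simp add: uni_def)+
  have zip1: "(\<lambda>(a, b) n. (a n, b n)) \<in> ?Us \<Otimes>\<^sub>M ?S \<rightarrow>\<^sub>M ?USs"
    unfolding split_beta' by (rule measurable_abs_UNIV) measurable
  have zip2: "(\<lambda>(a, b) n. (a n, b n)) \<in> ?Es \<Otimes>\<^sub>M ?USs \<rightarrow>\<^sub>M ?EUSs"
    unfolding split_beta' by (rule measurable_abs_UNIV) measurable
  have id_zip: "(\<lambda>(a, bc). (a, (\<lambda>(b, c) n. (b n, c n)) bc)) \<in> ?Es \<Otimes>\<^sub>M (?Us \<Otimes>\<^sub>M ?S) \<rightarrow>\<^sub>M ?Es \<Otimes>\<^sub>M ?USs"
    unfolding split_beta'[where f = "\<lambda>a bc. (a, _ a bc)"]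
    using zip1 by measurable
  interpret USs: prob_space ?USs by (rule prob_space_PiM) (rule us.prob_space_axioms)
  have m3: "(\<lambda>\<omega>. (?E \<omega>, ?U \<omega>, ?V \<omega>)) \<in> P \<rightarrow>\<^sub>M ?Es \<Otimes>\<^sub>M (?Us \<Otimes>\<^sub>M ?S)"
    by measurable
  \<comment> \<open>The chain runs from the target law back to \<open>P\<close>: zip gaps with
    marks, zip times with directions, and replace the product of the three sequence laws by the
    joint law.\<close>
  have "?EUSs = distr (?Es \<Otimes>\<^sub>M ?USs) ?EUSs (\<lambda>(a, b) n. (a n, b n))"
    by (rule eus.distr_zip_sequences[symmetric])
  also have "?Es \<Otimes>\<^sub>M ?USs = distr ?Es ?Es (\<lambda>a. a) \<Otimes>\<^sub>M distr (?Us \<Otimes>\<^sub>M ?S) ?USs (\<lambda>(a, b) n. (a n, b n))"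
    by (simp add: us.distr_zip_sequences distr_id)
  also have "\<dots> = distr (?Es \<Otimes>\<^sub>M (?Us \<Otimes>\<^sub>M ?S)) (?Es \<Otimes>\<^sub>M ?USs) (\<lambda>(a, bc). (a, (\<lambda>(b, c) n. (b n, c n)) bc))"
    by (rule pair_measure_distr)
       (simp, rule zip1, simp add: us.distr_zip_sequences, rule USs.sigma_finite_measure_axioms)
  also have "?Es \<Otimes>\<^sub>M (?Us \<Otimes>\<^sub>M ?S) = distr P (?B \<Otimes>\<^sub>M (?B \<Otimes>\<^sub>M ?S)) (\<lambda>\<omega>. (?E \<omega>, ?U \<omega>, ?V \<omega>))"
    unfolding triple lE lU lV ..
  also have "\<dots> = distr P (?Es \<Otimes>\<^sub>M (?Us \<Otimes>\<^sub>M ?S)) (\<lambda>\<omega>. (?E \<omega>, ?U \<omega>, ?V \<omega>))"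
    by (rule distr_cong) (auto intro!: sets_pair_measure_cong sets_PiM_cong simp: uni_def)
  also have "distr \<dots> (?Es \<Otimes>\<^sub>M ?USs) (\<lambda>(a, bc). (a, (\<lambda>(b, c) n. (b n, c n)) bc))
      = distr P (?Es \<Otimes>\<^sub>M ?USs) ((\<lambda>(a, bc). (a, (\<lambda>(b, c) n. (b n, c n)) bc)) \<circ> (\<lambda>\<omega>. (?E \<omega>, ?U \<omega>, ?V \<omega>)))"
    by (rule distr_distr[OF id_zip m3])
  also have "distr \<dots> ?EUSs (\<lambda>(a, b) n. (a n, b n))
      = distr P ?EUSs ((\<lambda>(a, b) n. (a n, b n)) \<circ> ((\<lambda>(a, bc). (a, (\<lambda>(b, c) n. (b n, c n)) bc)) \<circ> (\<lambda>\<omega>. (?E \<omega>, ?U \<omega>, ?V \<omega>))))"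
    by (rule distr_distr[OF zip2 measurable_comp[OF m3 id_zip]])
  also have "((\<lambda>(a, b) n. (a n, b n)) \<circ> ((\<lambda>(a, bc). (a, (\<lambda>(b, c) n. (b n, c n)) bc)) \<circ> (\<lambda>\<omega>. (?E \<omega>, ?U \<omega>, ?V \<omega>))))
      = (\<lambda>\<omega> n. (E n \<omega>, U n \<omega>, V n \<omega>))"
    by (simp add: fun_eq_iff)
  finally show "distr P (\<Pi>\<^sub>M n\<in>UNIV. exp_law \<Otimes>\<^sub>M (uniform_measure lborel {0..1} \<Otimes>\<^sub>M \<sigma>))
        (\<lambda>\<omega> n. (E n \<omega>, U n \<omega>, V n \<omega>))
      = (\<Pi>\<^sub>M n\<in>UNIV. exp_law \<Otimes>\<^sub>M (uniform_measure lborel {0..1} \<Otimes>\<^sub>M \<sigma>))"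
    unfolding uni_def by (rule sym)
  show "(\<lambda>\<omega> n. (E n \<omega>, U n \<omega>, V n \<omega>))
      \<in> P \<rightarrow>\<^sub>M (\<Pi>\<^sub>M n\<in>UNIV. exp_law \<Otimes>\<^sub>M (uniform_measure lborel {0..1} \<Otimes>\<^sub>M \<sigma>))"
    unfolding uni_def[symmetric] by (rule measurable_abs_UNIV) measurable
qed

section \<open>Small jumps of processes of finite variation\<close>

text \<open>The truncated series \<open>\<Sum>\<^sub>k 2\<^sup>-\<^sup>k (1 - cos (2\<^sup>k x))\<close> is comparable to \<open>min 1 \<bar>x\<bar>\<close>, and its expectations
  are read off the characteristic function.\<close>

definition cos_series :: "nat \<Rightarrow> real \<Rightarrow> real" where
  "cos_series K x = (\<Sum>k<K. (1 / 2) ^ k * (1 - cos (2 ^ k * x)))"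

lemma cos_series_Suc: "cos_series (Suc K) x = (1 - cos x) + cos_series K (2 * x) / 2"
  by (simp add: cos_series_def sum.lessThan_Suc_shift sum_divide_distrib mult_ac del: sum.lessThan_Suc)

lemma one_minus_cos_le: "1 - cos x \<le> x\<^sup>2 / 2" for x :: real
proof -
  have "1 - cos x = 2 * (sin (x / 2))\<^sup>2"
    using cos_double_sin[of "x / 2"] by simp
  also have "(sin (x / 2))\<^sup>2 \<le> (x / 2)\<^sup>2"
    using abs_sin_x_le_abs_x[of "x / 2"] by (simp only: abs_le_square_iff)
  then have "2 * (sin (x / 2))\<^sup>2 \<le> 2 * (x / 2)\<^sup>2" by simp
  also have "\<dots> = x\<^sup>2 / 2" by (simp add: power2_eq_square)
  finally show ?thesis .
qed

lemma cos_series_le_4: "cos_series K x \<le> 4"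
proof (induction K arbitrary: x)
  case (Suc K)
  have "1 - cos x \<le> 2" using cos_ge_minus_one[of x] by simp
  with Suc[of "2 * x"] show ?case unfolding cos_series_Suc by linarith
qed (simp add: cos_series_def)

text \<open>A bound linear in \<open>x\<close> is not reproduced by the recursion, which doubles the
  argument. The correction is chosen so that it is: half of
  \<open>5 * (2 * x) - (2 * x)\<^sup>2 / 2\<close> plus the error \<open>x\<^sup>2 / 2\<close> of
  the new term is \<open>5 * x - x\<^sup>2 / 2\<close>. Above 1 the uniform bound 4 is already
  smaller.\<close>

lemma cos_series_le_quadratic: "0 \<le> x \<Longrightarrow> x \<le> 2 \<Longrightarrow> cos_series K x \<le> 5 * x - x\<^sup>2 / 2"
proof (induction K arbitrary: x)
  case 0
  have "x * x \<le> 2 * x" using 0 by (intro mult_right_mono)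
  with 0 show ?case by (simp add: cos_series_def power2_eq_square)
next
  case (Suc K)
  show ?case
  proof (cases "x \<le> 1")
    case True
    then have "cos_series K (2 * x) \<le> 5 * (2 * x) - (2 * x)\<^sup>2 / 2"
      using Suc by (intro Suc.IH) auto
    with one_minus_cos_le[of x] show ?thesis
      unfolding cos_series_Suc by (simp add: power2_eq_square field_simps)
  next
    case False
    have "0 \<le> (x - 1) * (2 - x)" using False Suc by (intro mult_nonneg_nonneg) auto
    with False have "4 \<le> 5 * x - x\<^sup>2 / 2"
      by (simp add: power2_eq_square algebra_simps)
    with cos_series_le_4[of "Suc K" x] show ?thesis by linarith
  qed
qed

lemma cos_series_le: "cos_series K x \<le> 5 * min 1 \<bar>x\<bar>"
proof -
  have "cos_series K \<bar>x\<bar> = cos_series K x"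
    by (cases "0 \<le> x") (simp_all add: cos_series_def)
  moreover have "cos_series K \<bar>x\<bar> \<le> 5 * \<bar>x\<bar>" if "\<bar>x\<bar> \<le> 1"
  proof -
    have "cos_series K \<bar>x\<bar> \<le> 5 * \<bar>x\<bar> - \<bar>x\<bar>\<^sup>2 / 2"
      using that by (intro cos_series_le_quadratic) auto
    moreover have "0 \<le> \<bar>x\<bar>\<^sup>2" by simp
    ultimately show ?thesis by linarith
  qed
  ultimately show ?thesis
    using cos_series_le_4[of K x] by (cases "\<bar>x\<bar> \<le> 1") auto
qed

lemma dyadic_scale:
  fixes x :: real
  assumes "0 < x" "x \<le> 1"
  obtains k :: nat where "1 / 2 < 2 ^ k * x" "2 ^ k * x \<le> 1"
proof -
  obtain n :: nat where n: "1 / x < 2 ^ n"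
    using real_arch_pow[of 2 "1 / x"] by auto
  define k where "k = (LEAST k. 1 / 2 < 2 ^ k * x)"
  have "1 / 2 < 2 ^ n * x" using n assms by (simp add: field_simps)
  then have 1: "1 / 2 < 2 ^ k * x" unfolding k_def by (rule LeastI)
  have "2 ^ k * x \<le> 1"
  proof (cases k)
    case 0 then show ?thesis using assms by simp
  next
    case (Suc m)
    then have "\<not> 1 / 2 < 2 ^ m * x"
      using not_less_Least[of m "\<lambda>k. 1 / 2 < 2 ^ k * x"] unfolding k_def by auto
    then show ?thesis using Suc by simp
  qed
  with 1 show ?thesis by (rule that)
qed

text \<open>A single term suffices: the one for which \<open>2 ^ k\<close> moves the modulus of
  \<open>x\<close> into the interval from 1/2 to 1. There the cosine is at most
  \<open>cos (1 / 2)\<close>, and the weight is at least the modulus of \<open>x\<close>.\<close>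

lemma cos_series_term_ge:
  fixes x :: real
  assumes "\<bar>x\<bar> \<le> 1"
  shows "\<exists>k. (1 - cos (1 / 2)) * \<bar>x\<bar> \<le> (1 / 2) ^ k * (1 - cos (2 ^ k * x))"
proof (cases "x = 0")
  case False
  with assms obtain k :: nat where k: "1 / 2 < 2 ^ k * \<bar>x\<bar>" "2 ^ k * \<bar>x\<bar> \<le> 1"
    using dyadic_scale[of "\<bar>x\<bar>"] by auto
  have "cos (2 ^ k * \<bar>x\<bar>) \<le> cos (1 / 2)"
    using k pi_ge_two by (intro cos_monotone_0_pi_le) auto
  moreover have "cos (2 ^ k * \<bar>x\<bar>) = cos (2 ^ k * x)"
    by (cases "0 \<le> x") simp_all
  moreover have "\<bar>x\<bar> \<le> (1 / 2) ^ k"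
    using k by (simp add: power_one_over field_simps)
  ultimately have "\<bar>x\<bar> * (1 - cos (1 / 2)) \<le> (1 / 2) ^ k * (1 - cos (2 ^ k * x))"
    by (intro mult_mono) auto
  then show ?thesis by (auto simp: mult.commute)
qed simp

lemma min_one_le_exp: "0 \<le> x \<Longrightarrow> min 1 x \<le> 2 * (1 - exp (- x))" for x :: real
proof -
  assume x: "0 \<le> x"
  show ?thesis
  proof (cases "x \<le> 1")
    case True
    have "exp (- x) \<le> 1 / (1 + x)"
      using x exp_ge_add_one_self[of x] by (simp add: exp_minus inverse_eq_divide frac_le)
    moreover have "1 / (1 + x) \<le> 1 - x / 2"
    proof -
      have "0 \<le> x * (1 - x)" using x True by simp
      then show ?thesis using x by (simp add: field_simps)
    qed
    ultimately show ?thesis using True by simp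
  next
    case False
    have "exp (- x) \<le> 1 / (1 + x)"
      using x exp_ge_add_one_self[of x] by (simp add: exp_minus inverse_eq_divide frac_le)
    also have "\<dots> \<le> 1 / 2" using False by (intro frac_le) auto
    finally show ?thesis using False by simp
  qed
qed

text \<open>Excludes the default value 0 of the integral in \<open>levy_exponent\<close>. Inside the
  unit ball the second-order Taylor bound applies, outside it the bound 2;
  \<open>2 + (norm u)\<^sup>2\<close> dominates both factors.\<close>

lemma levy_integrand_integrable:
  assumes "levy_measure \<nu>"
  shows "integrable \<nu> (\<lambda>w. exp (\<i> * complex_of_real (u \<bullet> w)) - 1
      - \<i> * complex_of_real (u \<bullet> w) * indicator {w. norm w < 1} w)"
proof (rule Bochner_Integration.integrable_bound)
  have [measurable_cong]: "sets \<nu> = sets borel"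
    using assms by (simp add: levy_measure_def)
  let ?b = "\<lambda>w::real^'a. (2 + (norm u)\<^sup>2) * min 1 ((norm w)\<^sup>2)"
  show "integrable \<nu> ?b"
  proof (intro integrable_mult_right integrableI_nonneg)
    show "(\<integral>\<^sup>+w. ennreal (min 1 ((norm w)\<^sup>2)) \<partial>\<nu>) < \<infinity>"
      using assms by (simp add: levy_measure_def)
  qed auto
  show "(\<lambda>w. exp (\<i> * complex_of_real (u \<bullet> w)) - 1
      - \<i> * complex_of_real (u \<bullet> w) * indicator {w. norm w < 1} w) \<in> borel_measurable \<nu>"
    by measurable
  show "AE w in \<nu>. norm (exp (\<i> * complex_of_real (u \<bullet> w)) - 1
      - \<i> * complex_of_real (u \<bullet> w) * indicator {w. norm w < 1} w) \<le> norm (?b w)"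
  proof (rule AE_I2)
    fix w :: "real^'a"
    show "norm (exp (\<i> * complex_of_real (u \<bullet> w)) - 1
      - \<i> * complex_of_real (u \<bullet> w) * indicator {w. norm w < 1} w) \<le> norm (?b w)"
    proof (cases "norm w < 1")
      case True
      have "norm (exp (\<i> * complex_of_real (u \<bullet> w)) - 1 - \<i> * complex_of_real (u \<bullet> w)) \<le> (u \<bullet> w)\<^sup>2 / 2"
        using iexp_approx1[of "u \<bullet> w" 1] by (simp add: power2_eq_square diff_diff_eq)
      also have "\<dots> \<le> (norm u * norm w)\<^sup>2 / 2"
        using Cauchy_Schwarz_ineq2[of u w] power_mono[of "\<bar>u \<bullet> w\<bar>" "norm u * norm w" 2] by simp
      also have "\<dots> \<le> (2 + (norm u)\<^sup>2) * (norm w)\<^sup>2"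
        by (simp add: power_mult_distrib algebra_simps)
      also have "(norm w)\<^sup>2 = min 1 ((norm w)\<^sup>2)"
        using True by (simp add: abs_square_le_1 power_le_one)
      finally show ?thesis using True by simp
    next
      case False
      have "norm (exp (\<i> * complex_of_real (u \<bullet> w)) - 1) \<le> norm (exp (\<i> * complex_of_real (u \<bullet> w))) + norm (1::complex)"
        by (rule norm_triangle_ineq4)
      also have "\<dots> = 2" by simp
      also have "2 \<le> 2 + (norm u)\<^sup>2" by simp
      also have "\<dots> = ?b w"
      proof -
        have "1 \<le> (norm w)\<^sup>2" using False by simp
        then show ?thesis by simp
      qed
      finally show ?thesis using False by simp
    qed
  qed
qed

text \<open>Drift and compensator are purely imaginary, and the Gaussian part contributes half the
  squared norm of \<open>transpose S *v u\<close>, which may be dropped.\<close>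

lemma Re_levy_exponent_le:
  fixes u :: "real^'d" and S :: "real^'d^'d"
  assumes "levy_measure \<nu>"
  shows "(\<integral>\<^sup>+w. ennreal (1 - cos (u \<bullet> w)) \<partial>\<nu>) \<le> ennreal (- Re (levy_exponent \<gamma> (S ** transpose S) \<nu> u))"
proof -
  have [measurable_cong]: "sets \<nu> = sets borel"
    using assms by (simp add: levy_measure_def)
  let ?F = "\<lambda>w. exp (\<i> * complex_of_real (u \<bullet> w)) - 1
      - \<i> * complex_of_real (u \<bullet> w) * indicator {w. norm w < 1} w"
  note int = levy_integrand_integrable[OF assms, of u]
  have Re: "Re (?F w) = cos (u \<bullet> w) - 1" for w
    by (simp add: Re_exp indicator_def)
  have int': "integrable \<nu> (\<lambda>w. cos (u \<bullet> w) - 1)"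
    using integrable_Re[OF int] unfolding Re .
  have "Re (CLINT w|\<nu>. ?F w) = (\<integral>w. cos (u \<bullet> w) - 1 \<partial>\<nu>)"
    unfolding integral_Re[OF int, symmetric] Re ..
  moreover have "u \<bullet> ((S ** transpose S) *v u) = (transpose S *v u) \<bullet> (transpose S *v u)"
    by (simp add: matrix_vector_mul_assoc[symmetric] dot_lmul_matrix[symmetric] vector_transpose_matrix)
  ultimately have "- Re (levy_exponent \<gamma> (S ** transpose S) \<nu> u)
      = (transpose S *v u) \<bullet> (transpose S *v u) / 2 + (\<integral>w. 1 - cos (u \<bullet> w) \<partial>\<nu>)"
    using int' by (simp add: levy_exponent_def Bochner_Integration.integral_minus[symmetric] del: Bochner_Integration.integral_minus)
  moreover have "(\<integral>\<^sup>+w. ennreal (1 - cos (u \<bullet> w)) \<partial>\<nu>) = ennreal (\<integral>w. 1 - cos (u \<bullet> w) \<partial>\<nu>)"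
    using integrable_minus[OF int'] by (intro nn_integral_eq_integral) auto
  ultimately show ?thesis
    by (simp add: ennreal_leI)
qed

text \<open>The derivative of \<open>exp (h * z)\<close> at 0 along \<open>1 / (n + 1)\<close>. It
  reads the exponent off the characteristic function at small times.\<close>

lemma tendsto_scaled_exp:
  fixes z :: complex
  shows "(\<lambda>n. real (Suc n) * (1 - Re (exp (complex_of_real (1 / real (Suc n)) * z)))) \<longlonglongrightarrow> - Re z"
proof -
  have "((\<lambda>h. (exp (h * z) - exp (0 * z)) / h) \<longlongrightarrow> z) (at 0)"
  proof -
    have "((\<lambda>h. exp (h * z)) has_field_derivative z) (at 0)"
      by (auto intro!: derivative_eq_intros)
    then show ?thesis by (simp add: has_field_derivative_iff)
  qed
  moreover have "filterlim (\<lambda>n. complex_of_real (1 / real (Suc n))) (at 0) sequentially"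
  proof (rule filterlim_atI)
    have "(\<lambda>n. complex_of_real (1 / real (Suc n))) \<longlonglongrightarrow> complex_of_real 0"
      by (intro tendsto_of_real LIMSEQ_Suc[OF lim_1_over_n])
    then show "(\<lambda>n. complex_of_real (1 / real (Suc n))) \<longlonglongrightarrow> 0" by simp
  qed (simp del: of_nat_Suc of_real_divide)
  ultimately have "(\<lambda>n. (exp (complex_of_real (1 / real (Suc n)) * z) - exp (0 * z)) / complex_of_real (1 / real (Suc n))) \<longlonglongrightarrow> z"
    by (rule filterlim_compose)
  then have "(\<lambda>n. - Re ((exp (complex_of_real (1 / real (Suc n)) * z) - exp (0 * z)) / complex_of_real (1 / real (Suc n)))) \<longlonglongrightarrow> - Re z"
    by (intro tendsto_minus tendsto_Re)
  moreover have "- Re ((w - exp (0 * z)) / complex_of_real (1 / real (Suc n))) = real (Suc n) * (1 - Re w)" for w n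
  proof -
    have "(w - exp (0 * z)) / complex_of_real (1 / real (Suc n)) = complex_of_real (real (Suc n)) * (w - 1)"
      by (simp del: of_nat_Suc)
    then show ?thesis by (simp del: of_nat_Suc add: algebra_simps)
  qed
  ultimately show ?thesis by simp
qed

text \<open>Let \<open>V n\<close> be the variation of the path along the grid of mesh
  \<open>1 / (n + 1)\<close>. By independence and stationarity the mean of
  \<open>exp (- V n)\<close> is the power \<open>n + 1\<close> of the mean \<open>a\<close> for a
  single increment. Finite variation keeps these means above some \<open>c > 0\<close>, and
  \<open>1 - a \<le> - ln a\<close> turns this into the bound \<open>- ln c\<close>.\<close>

lemma finite_variation_scaled_bound:
  fixes X :: "real \<Rightarrow> 'a \<Rightarrow> real^'d"
  assumes X: "levy_process P X" and fv: "finite_variation P X"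
  obtains C where "\<And>n. real (Suc n) * (1 - (\<integral>\<omega>. exp (- norm (X (1 / real (Suc n)) \<omega>)) \<partial>P)) \<le> C"
proof -
  interpret prob_space P using X by (simp add: levy_process_def)
  have mX [measurable]: "X t \<in> borel_measurable P" if "0 \<le> t" for t
    using X that by (simp add: levy_process_def)
  define D where "D = (\<lambda>n k \<omega>. X (real (Suc k) / real (Suc n)) \<omega> - X (real k / real (Suc n)) \<omega>)"
  have [measurable]: "D n k \<in> borel_measurable P" for n k
    unfolding D_def by (rule borel_measurable_diff; rule mX; simp)
  define V where "V = (\<lambda>n \<omega>. \<Sum>k<Suc n. norm (D n k \<omega>))"
  have [measurable]: "V n \<in> borel_measurable P" for n
    unfolding V_def by measurable
  have V0: "0 \<le> V n \<omega>" for n \<omega>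
    unfolding V_def by (intro sum_nonneg) simp
  \<comment> \<open>A lower bound for all grids at once, positive wherever the path has finite
    variation; the infimum is countable, hence measurable.\<close>
  define W where "W = (\<lambda>\<omega>. INF n. exp (- V n \<omega>))"
  have bdd: "bdd_below (range (\<lambda>n. exp (- V n \<omega>)))" for \<omega>
    by (rule bdd_belowI[of _ 0]) auto
  have [measurable]: "W \<in> borel_measurable P"
    unfolding W_def using bdd by (intro borel_measurable_cINF) auto
  have W_le: "W \<omega> \<le> exp (- V n \<omega>)" for n \<omega>
    unfolding W_def by (rule cINF_lower[OF bdd]) simp
  have W0: "0 \<le> W \<omega>" for \<omega>
    unfolding W_def by (rule cINF_greatest) auto
  have W1: "W \<omega> \<le> 1" for \<omega>
    using W_le[of \<omega> 0] V0[of 0 \<omega>] by (meson exp_le_one_iff neg_le_0_iff_le order_trans)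
  have Wpos: "AE \<omega> in P. 0 < W \<omega>"
    using fv unfolding finite_variation_def
  proof eventually_elim
    case (elim \<omega>)
    from elim[rule_format, of 1] have "bounded_variation_on_Icc 1 (\<lambda>t. X t \<omega>)" by simp
    then obtain K where K: "\<And>ts n. mono ts \<Longrightarrow> range ts \<subseteq> {0..1} \<Longrightarrow>
        (\<Sum>k<n. norm (X (ts (Suc k)) \<omega> - X (ts k) \<omega>)) \<le> K"
      unfolding bounded_variation_on_Icc_def by blast
    have "V n \<omega> \<le> K" for n
    proof -
      \<comment> \<open>The definition of bounded variation quantifies over infinite monotone
        sequences in the interval, so the grid stays at 1 after its last time.\<close>
      define ts where "ts = (\<lambda>k. min 1 (real k / real (Suc n)))"
      have "mono ts" unfolding ts_def
        by (intro monoI min.mono divide_right_mono) auto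
      moreover have "range ts \<subseteq> {0..1}" by (auto simp: ts_def)
      ultimately have "(\<Sum>k<Suc n. norm (X (ts (Suc k)) \<omega> - X (ts k) \<omega>)) \<le> K" by (rule K)
      moreover have "ts k = real k / real (Suc n)" if "k \<le> Suc n" for k
        using that by (simp add: ts_def del: of_nat_Suc)
      ultimately show ?thesis by (simp add: V_def D_def)
    qed
    then have "exp (- K) \<le> W \<omega>"
      unfolding W_def by (intro cINF_greatest) auto
    then show ?case using exp_gt_zero[of "- K"] by linarith
  qed
  have iW: "integrable P W"
    by (rule integrable_const_bound[of _ 1]) (use W0 W1 in auto)
  define c where "c = (\<integral>\<omega>. W \<omega> \<partial>P)"
  have "c \<noteq> 0"
  proof
    assume "c = 0"
    then have "AE \<omega> in P. W \<omega> = 0"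
      unfolding c_def using integral_nonneg_eq_0_iff_AE[OF iW] W0 by auto
    with Wpos have "AE \<omega> in P. False" by eventually_elim simp
    then show False by simp
  qed
  moreover have "0 \<le> c" unfolding c_def by (intro Bochner_Integration.integral_nonneg W0)
  ultimately have c: "0 < c" by simp
  have "real (Suc n) * (1 - (\<integral>\<omega>. exp (- norm (X (1 / real (Suc n)) \<omega>)) \<partial>P)) \<le> - ln c" for n
  proof -
    define a where "a = (\<integral>\<omega>. exp (- norm (X (1 / real (Suc n)) \<omega>)) \<partial>P)"
    have incr: "(\<integral>\<omega>. exp (- norm (D n k \<omega>)) \<partial>P) = a" for k
    proof -
      have t: "0 \<le> real k / real (Suc n)" "0 \<le> 1 / real (Suc n)" by simp_all
      have st: "\<And>s t. 0 \<le> s \<Longrightarrow> 0 \<le> t \<Longrightarrow> distr P borel (\<lambda>\<omega>. X (s + t) \<omega> - X s \<omega>) = distr P borel (X t)"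
        using X by (simp add: levy_process_def)
      have "real (Suc k) / real (Suc n) = real k / real (Suc n) + 1 / real (Suc n)"
        by (simp add: add_divide_distrib)
      then have "distr P borel (D n k) = distr P borel (X (1 / real (Suc n)))"
        unfolding D_def using st[OF t] by simp
      moreover have "(\<integral>y. exp (- norm y) \<partial>distr P borel f) = (\<integral>\<omega>. exp (- norm (f \<omega>)) \<partial>P)"
        if "f \<in> borel_measurable P" for f :: "'a \<Rightarrow> real^'d"
        by (rule integral_distr[OF that]) measurable
      ultimately show ?thesis
        using mX[OF t(2)] unfolding a_def by (metis \<open>\<And>n k. D n k \<in> borel_measurable P\<close>)
    qed
    have ind: "indep_vars (\<lambda>_. borel) (D n) {..<Suc n}"
    proof -
      have ii: "\<And>ts m. mono ts \<Longrightarrow> 0 \<le> ts 0 \<Longrightarrow>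
          indep_vars (\<lambda>_. borel) (\<lambda>k \<omega>. X (ts (Suc k)) \<omega> - X (ts k) \<omega>) {..<m}"
        using X by (simp add: levy_process_def independent_increments_def)
      have "mono (\<lambda>k. real k / real (Suc n))"
        by (intro monoI divide_right_mono) auto
      from ii[OF this, of "Suc n"] show ?thesis
        unfolding D_def by simp
    qed
    have ind': "indep_vars (\<lambda>_. borel) (\<lambda>k \<omega>. exp (- norm (D n k \<omega>))) {..<Suc n}"
      using indep_vars_compose2[OF ind, of "\<lambda>_ y. exp (- norm y)" "\<lambda>_. borel"] by simp
    have ie: "integrable P (\<lambda>\<omega>. exp (- norm (D n k \<omega>)))" for k
      by (rule integrable_const_bound[of _ 1]) auto
    have iV: "integrable P (\<lambda>\<omega>. exp (- V n \<omega>))"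
      by (rule integrable_const_bound[of _ 1]) (use V0 in auto)
    have "c \<le> (\<integral>\<omega>. exp (- V n \<omega>) \<partial>P)"
      unfolding c_def by (rule integral_mono[OF iW iV W_le])
    also have "\<dots> = (\<integral>\<omega>. (\<Prod>k<Suc n. exp (- norm (D n k \<omega>))) \<partial>P)"
      by (simp add: V_def exp_sum[symmetric] sum_negf[symmetric] del: sum.lessThan_Suc prod.lessThan_Suc)
    also have "\<dots> = (\<Prod>k<Suc n. \<integral>\<omega>. exp (- norm (D n k \<omega>)) \<partial>P)"
      by (rule indep_vars_lebesgue_integral[OF _ ind']) (auto intro: ie)
    also have "\<dots> = a ^ Suc n"
      unfolding incr by simp
    finally have ca: "c \<le> a ^ Suc n" .
    have a0: "0 \<le> a" unfolding a_def by (intro Bochner_Integration.integral_nonneg) simp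
    have "a \<noteq> 0" using ca c by auto
    with a0 have a: "0 < a" by simp
    have "1 - a \<le> - ln a" using ln_le_minus_one[OF a] by simp
    then have "real (Suc n) * (1 - a) \<le> real (Suc n) * (- ln a)"
      by (intro mult_left_mono) auto
    also have "\<dots> = - ln (a ^ Suc n)" using a by (simp add: ln_realpow del: power_Suc)
    also have "\<dots> \<le> - ln c" using c ca a by simp
    finally show ?thesis by (simp add: a_def)
  qed
  then show ?thesis by (rule that)
qed

lemma single_le_suminf:
  fixes f :: "nat \<Rightarrow> ennreal"
  shows "f k \<le> suminf f"
  using sum_le_suminf[of f "{k}"] by simp

text \<open>At small times the mean of \<open>cos_series\<close> of a coordinate is controlled by
  that of \<open>1 - exp (- norm (X t))\<close>. Rescaled by \<open>n + 1\<close>, the latter stays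
  bounded, while the former tends to a weighted sum of exponents at dyadic multiples of a basis
  vector. Each exponent dominates a Levy integral of \<open>1 - cos\<close>, and the series of these
  is comparable to the modulus of the coordinate.\<close>

lemma finite_variation_small_jumps:
  fixes X :: "real \<Rightarrow> 'a \<Rightarrow> real^'d" and S :: "real^'d^'d"
  assumes X: "levy_process P X" and ct: "has_characteristic_triplet P X \<gamma> (S ** transpose S) \<nu>"
    and fv: "finite_variation P X"
  shows "(\<integral>\<^sup>+w. ennreal (min 1 (norm w)) \<partial>\<nu>) < \<infinity>"
proof -
  interpret prob_space P using X by (simp add: levy_process_def)
  have mX [measurable]: "X t \<in> borel_measurable P" if "0 \<le> t" for t
    using X that by (simp add: levy_process_def)
  have lm: "levy_measure \<nu>" using ct by (simp add: has_characteristic_triplet_def)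
  then have [measurable_cong]: "sets \<nu> = sets borel"
    by (simp add: levy_measure_def)
  define \<psi> where "\<psi> = levy_exponent \<gamma> (S ** transpose S) \<nu>"
  obtain C where C: "\<And>n. real (Suc n) * (1 - (\<integral>\<omega>. exp (- norm (X (1 / real (Suc n)) \<omega>)) \<partial>P)) \<le> C"
    using finite_variation_scaled_bound[OF X fv] by blast
  have cf: "(\<integral>\<omega>. cos (u \<bullet> X t \<omega>) \<partial>P) = Re (exp (complex_of_real t * \<psi> u))" if "0 \<le> t" for t u
  proof -
    have int: "integrable P (\<lambda>\<omega>. exp (\<i> * complex_of_real (u \<bullet> X t \<omega>)))"
      by (rule integrable_const_bound[of _ 1]) (use mX[OF that] in auto)
    have "(CLINT \<omega>|P. exp (\<i> * complex_of_real (u \<bullet> X t \<omega>))) = exp (complex_of_real t * \<psi> u)"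
      using ct that by (simp add: has_characteristic_triplet_def \<psi>_def)
    then have "Re (CLINT \<omega>|P. exp (\<i> * complex_of_real (u \<bullet> X t \<omega>))) = Re (exp (complex_of_real t * \<psi> u))"
      by simp
    then show ?thesis
      unfolding integral_Re[OF int, symmetric] by (simp add: Re_exp)
  qed
  \<comment> \<open>The factor 10 is 5 from \<open>cos_series_le\<close> times 2 from
    \<open>min_one_le_exp\<close>.\<close>
  have bound: "(\<Sum>k<K. (1 / 2) ^ k * (- Re (\<psi> (2 ^ k *\<^sub>R axis i 1)))) \<le> 10 * C" for K i
  proof (rule LIMSEQ_le_const2)
    show "(\<lambda>n. \<Sum>k<K. (1 / 2) ^ k * (real (Suc n) * (1 - Re (exp (complex_of_real (1 / real (Suc n)) * \<psi> (2 ^ k *\<^sub>R axis i 1))))))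
        \<longlonglongrightarrow> (\<Sum>k<K. (1 / 2) ^ k * (- Re (\<psi> (2 ^ k *\<^sub>R axis i 1))))"
      by (intro tendsto_sum tendsto_mult tendsto_const tendsto_scaled_exp)
    show "\<exists>N. \<forall>n\<ge>N. (\<Sum>k<K. (1 / 2) ^ k * (real (Suc n) * (1 - Re (exp (complex_of_real (1 / real (Suc n)) * \<psi> (2 ^ k *\<^sub>R axis i 1)))))) \<le> 10 * C"
    proof (intro exI allI impI)
      fix n :: nat
      define t where "t = 1 / real (Suc n)"
      have t: "0 \<le> t" by (simp add: t_def)
      note [measurable] = mX[OF t]
      have icos: "integrable P (\<lambda>\<omega>. cos (f \<omega>))" if [measurable]: "f \<in> borel_measurable P" for f :: "'a \<Rightarrow> real"
        by (rule integrable_const_bound[of _ 1]) auto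
      have eq: "Re (exp (complex_of_real t * \<psi> (2 ^ k *\<^sub>R axis i 1))) = (\<integral>\<omega>. cos (2 ^ k * (X t \<omega> $ i)) \<partial>P)" for k
        unfolding cf[OF t, symmetric] by (simp add: inner_axis' del: scaleR_power)
      have i0: "integrable P (\<lambda>\<omega>. cos (2 ^ k * (X t \<omega> $ i)))" for k
      proof (rule icos)
        have "(\<lambda>\<omega>. X t \<omega> $ i) \<in> borel_measurable P"
          by (rule measurable_compose[OF mX[OF t]]) (intro borel_measurable_continuous_onI continuous_intros)
        then show "(\<lambda>\<omega>. 2 ^ k * (X t \<omega> $ i)) \<in> borel_measurable P" by simp
      qed
      have i1: "integrable P (\<lambda>\<omega>. 1 - cos (2 ^ k * (X t \<omega> $ i)))" for k
        by (rule Bochner_Integration.integrable_diff) (simp_all add: i0)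
      have e1: "(\<integral>\<omega>. 1 - cos (2 ^ k * (X t \<omega> $ i)) \<partial>P) = 1 - (\<integral>\<omega>. cos (2 ^ k * (X t \<omega> $ i)) \<partial>P)" for k
        by (subst Bochner_Integration.integral_diff) (simp_all add: i0 prob_space)
      have iexp: "integrable P (\<lambda>\<omega>. exp (- norm (X t \<omega>)))"
        by (rule integrable_const_bound[of _ 1]) auto
      have "(\<Sum>k<K. (1 / 2) ^ k * (1 - (\<integral>\<omega>. cos (2 ^ k * (X t \<omega> $ i)) \<partial>P)))
          = (\<integral>\<omega>. cos_series K (X t \<omega> $ i) \<partial>P)"
        unfolding cos_series_def
        by (simp add: i1 e1)
      also have "\<dots> \<le> (\<integral>\<omega>. 10 * (1 - exp (- norm (X t \<omega>))) \<partial>P)"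
      proof (rule integral_mono)
        show "integrable P (\<lambda>\<omega>. cos_series K (X t \<omega> $ i))"
          unfolding cos_series_def by (simp add: i1)
        show "integrable P (\<lambda>\<omega>. 10 * (1 - exp (- norm (X t \<omega>))))"
          using iexp by simp
        fix \<omega>
        have "cos_series K (X t \<omega> $ i) \<le> 5 * min 1 \<bar>X t \<omega> $ i\<bar>" by (rule cos_series_le)
        also have "\<dots> \<le> 5 * min 1 (norm (X t \<omega>))"
          using component_le_norm_cart[of "X t \<omega>" i] by simp
        also have "\<dots> \<le> 5 * (2 * (1 - exp (- norm (X t \<omega>))))"
          by (intro mult_left_mono min_one_le_exp) auto
        finally show "cos_series K (X t \<omega> $ i) \<le> 10 * (1 - exp (- norm (X t \<omega>)))" by simp
      qed
      also have "\<dots> = 10 * (1 - (\<integral>\<omega>. exp (- norm (X t \<omega>)) \<partial>P))"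
        using iexp by (simp add: prob_space)
      finally have "real (Suc n) * (\<Sum>k<K. (1 / 2) ^ k * (1 - (\<integral>\<omega>. cos (2 ^ k * (X t \<omega> $ i)) \<partial>P)))
          \<le> real (Suc n) * (10 * (1 - (\<integral>\<omega>. exp (- norm (X t \<omega>)) \<partial>P)))"
        by (intro mult_left_mono) auto
      also have "\<dots> = 10 * (real (Suc n) * (1 - (\<integral>\<omega>. exp (- norm (X t \<omega>)) \<partial>P)))"
        by (simp only: mult.left_commute)
      also have "\<dots> \<le> 10 * C"
        using C[of n] unfolding t_def by (intro mult_left_mono) auto
      finally show "(\<Sum>k<K. (1 / 2) ^ k * (real (Suc n) * (1 - Re (exp (complex_of_real (1 / real (Suc n)) * \<psi> (2 ^ k *\<^sub>R axis i 1)))))) \<le> 10 * C"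
        unfolding t_def[symmetric] eq by (simp add: sum_distrib_left mult_ac del: of_nat_Suc)
    qed
  qed
  define h where "h = (\<lambda>i (w::real^'d). \<Sum>k. ennreal ((1 / 2) ^ k * (1 - cos (2 ^ k * (w $ i)))))"
  have [measurable]: "h i \<in> borel_measurable borel" for i
    unfolding h_def by measurable
  have h: "(\<integral>\<^sup>+w. h i w \<partial>\<nu>) \<le> ennreal (10 * C)" for i
  proof -
    have "(\<integral>\<^sup>+w. h i w \<partial>\<nu>) = (\<Sum>k. \<integral>\<^sup>+w. ennreal ((1 / 2) ^ k * (1 - cos (2 ^ k * (w $ i)))) \<partial>\<nu>)"
      unfolding h_def by (rule nn_integral_suminf) measurable
    also have "\<dots> \<le> ennreal (10 * C)"
    proof (rule suminf_le_const)
      fix K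
      \<comment> \<open>Required because \<open>ennreal\<close> cuts off negative numbers: only for
        nonnegative terms does it commute with the sum.\<close>
      have nonneg: "0 \<le> - Re (\<psi> u)" for u
      proof (rule ccontr)
        assume neg: "\<not> 0 \<le> - Re (\<psi> u)"
        have "(\<lambda>n. real (Suc n) * (1 - Re (exp (complex_of_real (1 / real (Suc n)) * \<psi> u)))) \<longlonglongrightarrow> - Re (\<psi> u)"
          by (rule tendsto_scaled_exp)
        moreover have "0 \<le> real (Suc n) * (1 - Re (exp (complex_of_real (1 / real (Suc n)) * \<psi> u)))" for n
        proof -
          have t: "0 \<le> 1 / real (Suc n)" by simp
          have "integrable P (\<lambda>\<omega>. cos (u \<bullet> X (1 / real (Suc n)) \<omega>))"
            by (rule integrable_const_bound[of _ 1]) (use mX[OF t] in auto)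
          then have "(\<integral>\<omega>. cos (u \<bullet> X (1 / real (Suc n)) \<omega>) \<partial>P) \<le> (\<integral>\<omega>. 1 \<partial>P)"
            by (rule integral_mono) simp_all
          then have "Re (exp (complex_of_real (1 / real (Suc n)) * \<psi> u)) \<le> 1"
            unfolding cf[OF t] by (simp add: prob_space)
          then show ?thesis by (intro mult_nonneg_nonneg) simp_all
        qed
        ultimately have "0 \<le> - Re (\<psi> u)" by (intro LIMSEQ_le_const) auto
        with neg show False by simp
      qed
      have "(\<Sum>k<K. \<integral>\<^sup>+w. ennreal ((1 / 2) ^ k * (1 - cos (2 ^ k * (w $ i)))) \<partial>\<nu>)
          \<le> (\<Sum>k<K. ennreal ((1 / 2) ^ k * (- Re (\<psi> (2 ^ k *\<^sub>R axis i 1)))))"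
      proof (rule sum_mono)
        fix k
        have "(\<integral>\<^sup>+w. ennreal ((1 / 2) ^ k * (1 - cos (2 ^ k * (w $ i)))) \<partial>\<nu>)
            = ennreal ((1 / 2) ^ k) * (\<integral>\<^sup>+w. ennreal (1 - cos ((2 ^ k *\<^sub>R axis i 1) \<bullet> w)) \<partial>\<nu>)"
          by (subst nn_integral_cmult[symmetric])
             (auto simp: ennreal_mult' inner_axis' simp del: scaleR_power)
        also have "\<dots> \<le> ennreal ((1 / 2) ^ k) * ennreal (- Re (\<psi> (2 ^ k *\<^sub>R axis i 1)))"
          unfolding \<psi>_def by (intro mult_left_mono Re_levy_exponent_le lm) simp
        also have "\<dots> = ennreal ((1 / 2) ^ k * (- Re (\<psi> (2 ^ k *\<^sub>R axis i 1))))"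
          by (rule ennreal_mult'[symmetric]) simp
        finally show "(\<integral>\<^sup>+w. ennreal ((1 / 2) ^ k * (1 - cos (2 ^ k * (w $ i)))) \<partial>\<nu>)
          \<le> ennreal ((1 / 2) ^ k * (- Re (\<psi> (2 ^ k *\<^sub>R axis i 1))))" .
      qed
      also have "\<dots> = ennreal (\<Sum>k<K. (1 / 2) ^ k * (- Re (\<psi> (2 ^ k *\<^sub>R axis i 1))))"
        by (rule sum_ennreal) (rule mult_nonneg_nonneg[OF _ nonneg], simp)
      also have "\<dots> \<le> ennreal (10 * C)"
        by (intro ennreal_leI bound)
      finally show "(\<Sum>k<K. \<integral>\<^sup>+w. ennreal ((1 / 2) ^ k * (1 - cos (2 ^ k * (w $ i)))) \<partial>\<nu>) \<le> ennreal (10 * C)" .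
    qed simp
    finally show ?thesis .
  qed
  define c where "c = 1 - cos (1 / 2 :: real)"
  have c: "0 < c"
    using cos_monotone_0_pi[of 0 "1 / 2"] pi_gt3 by (simp add: c_def)
  \<comment> \<open>The first summand handles jumps of norm at most 1; for larger ones both minima
    are 1 and the second summand suffices.\<close>
  have pw: "ennreal (min 1 (norm w)) \<le> ennreal (1 / c) * (\<Sum>i\<in>UNIV. h i w) + ennreal (min 1 ((norm w)\<^sup>2))" for w :: "real^'d"
  proof (cases "norm w \<le> 1")
    case True
    have "ennreal (norm w) \<le> ennreal (\<Sum>i\<in>UNIV. \<bar>w $ i\<bar>)"
      by (intro ennreal_leI norm_le_l1_cart)
    also have "\<dots> = (\<Sum>i\<in>UNIV. ennreal \<bar>w $ i\<bar>)" by simp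
    also have "\<dots> \<le> (\<Sum>i\<in>UNIV. ennreal (1 / c) * h i w)"
    proof (rule sum_mono)
      fix i
      have "\<bar>w $ i\<bar> \<le> 1" using True component_le_norm_cart[of w i] by linarith
      then obtain k where k: "c * \<bar>w $ i\<bar> \<le> (1 / 2) ^ k * (1 - cos (2 ^ k * (w $ i)))"
        using cos_series_term_ge unfolding c_def by blast
      have "ennreal (c * \<bar>w $ i\<bar>) \<le> ennreal ((1 / 2) ^ k * (1 - cos (2 ^ k * (w $ i))))"
        by (intro ennreal_leI k)
      also have "\<dots> \<le> h i w"
        unfolding h_def by (rule single_le_suminf)
      finally have le: "ennreal (c * \<bar>w $ i\<bar>) \<le> h i w" .
      have "ennreal \<bar>w $ i\<bar> = ennreal (1 / c) * ennreal (c * \<bar>w $ i\<bar>)"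
        using c by (simp add: ennreal_mult[symmetric])
      also have "\<dots> \<le> ennreal (1 / c) * h i w"
        by (rule mult_left_mono[OF le]) simp
      finally show "ennreal \<bar>w $ i\<bar> \<le> ennreal (1 / c) * h i w" .
    qed
    also have "\<dots> = ennreal (1 / c) * (\<Sum>i\<in>UNIV. h i w)" by (simp add: sum_distrib_left)
    finally show ?thesis using True by (simp add: add_increasing2)
  next
    case False
    then have "1 \<le> (norm w)\<^sup>2" by simp
    with False show ?thesis by (simp add: add_increasing)
  qed
  have "(\<integral>\<^sup>+w. ennreal (min 1 (norm w)) \<partial>\<nu>)
      \<le> (\<integral>\<^sup>+w. ennreal (1 / c) * (\<Sum>i\<in>UNIV. h i w) + ennreal (min 1 ((norm w)\<^sup>2)) \<partial>\<nu>)"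
    by (intro nn_integral_mono pw)
  also have "\<dots> = ennreal (1 / c) * (\<Sum>i\<in>UNIV. \<integral>\<^sup>+w. h i w \<partial>\<nu>) + (\<integral>\<^sup>+w. ennreal (min 1 ((norm w)\<^sup>2)) \<partial>\<nu>)"
    by (simp add: nn_integral_add nn_integral_cmult nn_integral_sum)
  also have "\<dots> < \<infinity>"
  proof -
    have "(\<Sum>i\<in>UNIV. \<integral>\<^sup>+w. h i w \<partial>\<nu>) \<le> (\<Sum>i\<in>(UNIV :: 'd set). ennreal (10 * C))"
      by (intro sum_mono h)
    also have "\<dots> < \<infinity>" by (simp add: ennreal_mult_less_top of_nat_less_top)
    finally show ?thesis
      using lm by (simp add: levy_measure_def ennreal_mult_less_top)
  qed
  finally show ?thesis .
qed

section \<open>Inverse tails\<close>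

text \<open>At levels \<open>u \<le> 0\<close> the supremum in \<open>inverse_tail\<close> may be
  over an unbounded set and then has no definite value. Setting it to 0 there gives a nonnegative
  measurable function on the whole product space.\<close>

definition tail_quantile :: "(real^'d \<Rightarrow> real measure) \<Rightarrow> real \<times> (real^'d) \<Rightarrow> real" where
  "tail_quantile \<rho> p = (if 0 < fst p then inverse_tail \<rho> (fst p) (snd p) else 0)"

context
  fixes \<sigma> :: "(real^'d) measure" and \<rho> :: "real^'d \<Rightarrow> real measure"
  assumes rf: "radial_levy_family \<sigma> \<rho>"
begin

lemma sets_radial: "v \<in> sphere 0 1 \<Longrightarrow> sets (\<rho> v) = sets (restrict_space borel {0<..})"
  using rf by (simp add: radial_levy_family_def)

lemma space_radial: "v \<in> sphere 0 1 \<Longrightarrow> space (\<rho> v) = {0<..}"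
  using sets_eq_imp_space_eq[OF sets_radial] by (simp add: space_restrict_space)

lemma Ici_sets: "0 < x \<Longrightarrow> {x..} \<in> sets (restrict_space borel {0::real<..})"
  by (subst sets_restrict_space_iff) auto

lemma tail_finite:
  assumes v: "v \<in> sphere 0 1" and x: "0 < x"
  shows "emeasure (\<rho> v) {x..} < \<infinity>"
proof -
  have "ennreal (min 1 (x\<^sup>2)) * emeasure (\<rho> v) {x..} = (\<integral>\<^sup>+y. ennreal (min 1 (x\<^sup>2)) * indicator {x..} y \<partial>\<rho> v)"
    using Ici_sets[OF x] v by (simp add: nn_integral_cmult_indicator sets_radial)
  also have "\<dots> \<le> (\<integral>\<^sup>+y. ennreal (min 1 (y\<^sup>2)) \<partial>\<rho> v)"
    using x by (intro nn_integral_mono)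
      (auto split: split_indicator intro!: ennreal_leI min.coboundedI2 power_mono)
  also have "\<dots> < \<infinity>"
    using rf v by (simp add: radial_levy_family_def)
  finally have "ennreal (min 1 (x\<^sup>2)) * emeasure (\<rho> v) {x..} < \<infinity>" .
  moreover have "ennreal (min 1 (x\<^sup>2)) \<noteq> 0" using x by (simp add: min_def)
  ultimately show ?thesis
    by (auto simp: ennreal_mult_less_top)
qed

lemma tail_antimono:
  assumes v: "v \<in> sphere 0 1" and "0 < x" "x \<le> y"
  shows "emeasure (\<rho> v) {y..} \<le> emeasure (\<rho> v) {x..}"
  using assms Ici_sets[of x] by (intro emeasure_mono) (auto simp: sets_radial)

lemma tail_tendsto_0:
  assumes v: "v \<in> sphere 0 1"
  shows "(\<lambda>n. emeasure (\<rho> v) {real (Suc n)..}) \<longlonglongrightarrow> 0"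
proof -
  have "(\<Inter>n. {real (Suc n)..}) = {}"
  proof (rule equals0I)
    fix x assume x: "x \<in> (\<Inter>n. {real (Suc n)..})"
    obtain n where "x < real n" using reals_Archimedean2 by blast
    moreover have "real (Suc n) \<le> x" using x by blast
    ultimately show False by simp
  qed
  moreover have "(\<lambda>n. emeasure (\<rho> v) {real (Suc n)..}) \<longlonglongrightarrow> emeasure (\<rho> v) (\<Inter>n. {real (Suc n)..})"
  proof (rule Lim_emeasure_decseq)
    show "range (\<lambda>n. {real (Suc n)..}) \<subseteq> sets (\<rho> v)"
      using v Ici_sets by (auto simp: sets_radial simp del: of_nat_Suc)
    show "decseq (\<lambda>n. {real (Suc n)..})" by (auto simp: decseq_def)
    show "emeasure (\<rho> v) {real (Suc n)..} \<noteq> \<infinity>" for n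
      using tail_finite[OF v, of "real (Suc n)"] by simp
  qed
  ultimately show ?thesis by simp
qed

text \<open>The tail tends to 0, so it falls below every \<open>u > 0\<close>; only with this bound
  is the real supremum meaningful.\<close>

lemma bdd_above_inverse_tail:
  assumes v: "v \<in> sphere 0 1" and u: "0 < u"
  shows "bdd_above (insert 0 {x. 0 < x \<and> emeasure (\<rho> v) {x..} > ennreal u})"
proof -
  have "\<forall>\<^sub>F n in sequentially. emeasure (\<rho> v) {real (Suc n)..} < ennreal u"
    using tail_tendsto_0[OF v] u by (intro order_tendstoD) auto
  then obtain n where n: "emeasure (\<rho> v) {real (Suc n)..} < ennreal u"
    by (auto simp: eventually_sequentially)
  have "x \<le> real (Suc n)" if "0 < x" "emeasure (\<rho> v) {x..} > ennreal u" for x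
  proof (rule ccontr)
    assume "\<not> x \<le> real (Suc n)"
    then have "emeasure (\<rho> v) {x..} \<le> emeasure (\<rho> v) {real (Suc n)..}"
      by (intro tail_antimono v) auto
    with that n show False by simp
  qed
  then show ?thesis
    by (intro bdd_aboveI[of _ "real (Suc n)"]) (auto simp del: of_nat_Suc)
qed

lemma tail_quantile_nonneg:
  assumes "snd p \<in> sphere 0 1"
  shows "0 \<le> tail_quantile \<rho> p"
  unfolding tail_quantile_def inverse_tail_def
  using assms by (auto intro!: cSup_upper bdd_above_inverse_tail)

text \<open>With \<open>r\<close> rational, superlevel sets of the quantile become countable unions
  of sets described by single tails, which is what joint measurability in level and direction rests
  on.\<close>

lemma less_tail_quantile_iff:
  assumes v: "v \<in> sphere 0 1" and u: "0 < u" and y: "0 \<le> y"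
  shows "y < tail_quantile \<rho> (u, v) \<longleftrightarrow> (\<exists>r\<in>\<rat>. y < r \<and> ennreal u < emeasure (\<rho> v) {r..})"
proof
  assume "y < tail_quantile \<rho> (u, v)"
  then obtain x where x: "0 < x" "emeasure (\<rho> v) {x..} > ennreal u" "y < x"
    using less_cSup_iff[OF _ bdd_above_inverse_tail[OF v u], of y] u y
    by (auto simp: tail_quantile_def inverse_tail_def)
  obtain r where r: "r \<in> \<rat>" "y < r" "r < x"
    using Rats_dense_in_real[OF x(3)] by auto
  then have "emeasure (\<rho> v) {x..} \<le> emeasure (\<rho> v) {r..}"
    using y by (intro tail_antimono v) auto
  with x r show "\<exists>r\<in>\<rat>. y < r \<and> ennreal u < emeasure (\<rho> v) {r..}"
    by (auto intro!: bexI[of _ r])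
next
  assume "\<exists>r\<in>\<rat>. y < r \<and> ennreal u < emeasure (\<rho> v) {r..}"
  then obtain r where "y < r" "ennreal u < emeasure (\<rho> v) {r..}" by blast
  then have "r \<le> tail_quantile \<rho> (u, v)"
    unfolding tail_quantile_def inverse_tail_def
    using u y by (auto intro!: cSup_upper bdd_above_inverse_tail v)
  with \<open>y < r\<close> show "y < tail_quantile \<rho> (u, v)" by simp
qed

lemma tail_quantile_measurable:
  assumes \<sigma>: "sphere_prob \<sigma>"
  shows "tail_quantile \<rho> \<in> borel_measurable (borel \<Otimes>\<^sub>M \<sigma>)"
proof (rule borel_measurableI_greater)
  have sp: "space \<sigma> = sphere 0 1"
    using \<sigma> sets_eq_imp_space_eq[of \<sigma> "restrict_space borel (sphere 0 1)"]
    by (simp add: sphere_prob_def space_restrict_space)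
  fix y :: real
  show "{p \<in> space (borel \<Otimes>\<^sub>M \<sigma>). y < tail_quantile \<rho> p} \<in> sets (borel \<Otimes>\<^sub>M \<sigma>)"
  proof (cases "y < 0")
    case True
    have "y < tail_quantile \<rho> p" if "p \<in> space (borel \<Otimes>\<^sub>M \<sigma>)" for p
      using tail_quantile_nonneg[of p] that True by (auto simp: space_pair_measure sp)
    then have "{p \<in> space (borel \<Otimes>\<^sub>M \<sigma>). y < tail_quantile \<rho> p} = space (borel \<Otimes>\<^sub>M \<sigma>)"
      by auto
    then show ?thesis by simp
  next
    case False
    then have y: "0 \<le> y" by simp
    have "{p \<in> space (borel \<Otimes>\<^sub>M \<sigma>). y < tail_quantile \<rho> p}
        = (\<Union>r\<in>{r\<in>\<rat>. y < r}. {p \<in> space (borel \<Otimes>\<^sub>M \<sigma>). 0 < fst p \<and> ennreal (fst p) < emeasure (\<rho> (snd p)) {r..}})"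
    proof (intro set_eqI)
      fix p :: "real \<times> (real^'d)"
      show "p \<in> {p \<in> space (borel \<Otimes>\<^sub>M \<sigma>). y < tail_quantile \<rho> p} \<longleftrightarrow>
        p \<in> (\<Union>r\<in>{r\<in>\<rat>. y < r}. {p \<in> space (borel \<Otimes>\<^sub>M \<sigma>). 0 < fst p \<and> ennreal (fst p) < emeasure (\<rho> (snd p)) {r..}})"
      proof (cases "0 < fst p \<and> snd p \<in> sphere 0 1")
        case True
        then show ?thesis
          using less_tail_quantile_iff[of "snd p" "fst p" y] y by auto
      next
        case False
        with y show ?thesis
          by (auto simp: tail_quantile_def space_pair_measure sp)
      qed
    qed
    also have "\<dots> \<in> sets (borel \<Otimes>\<^sub>M \<sigma>)"
    proof (rule sets.countable_UN'')
      show "countable {r\<in>\<rat>. y < r}"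
        using countable_rat by (rule countable_subset[rotated]) auto
      fix r assume "r \<in> {r\<in>\<rat>. y < r}"
      then have "{r..} \<in> sets (restrict_space borel {0<..})"
        using y by (intro Ici_sets) auto
      then have [measurable]: "(\<lambda>v. emeasure (\<rho> v) {r..}) \<in> borel_measurable \<sigma>"
        using rf by (simp add: radial_levy_family_def)
      show "{p \<in> space (borel \<Otimes>\<^sub>M \<sigma>). 0 < fst p \<and> ennreal (fst p) < emeasure (\<rho> (snd p)) {r..}} \<in> sets (borel \<Otimes>\<^sub>M \<sigma>)"
        by measurable
    qed
    finally show ?thesis .
  qed
qed

text \<open>One half of the fact that the quantile transports Lebesgue measure to
  \<open>\<rho> v\<close>: a level whose quantile exceeds \<open>y\<close> lies strictly below the
  tail at \<open>y\<close>.\<close>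

lemma emeasure_tail_quantile_le:
  assumes v: "v \<in> sphere 0 1" and y: "0 < y"
  shows "emeasure lborel {u. y < tail_quantile \<rho> (u, v)} \<le> emeasure (\<rho> v) {y..}"
proof -
  obtain a where a: "emeasure (\<rho> v) {y..} = ennreal a" "0 \<le> a"
    using tail_finite[OF v y] by (cases "emeasure (\<rho> v) {y..}") auto
  have "{u. y < tail_quantile \<rho> (u, v)} \<subseteq> {0<..<a}"
  proof
    fix u assume "u \<in> {u. y < tail_quantile \<rho> (u, v)}"
    then have less: "y < tail_quantile \<rho> (u, v)" by simp
    have u: "0 < u"
      using less y by (cases "0 < u") (auto simp: tail_quantile_def)
    obtain r where "y < r" "ennreal u < emeasure (\<rho> v) {r..}"
      using less less_tail_quantile_iff[OF v u, of y] y by auto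
    moreover have "emeasure (\<rho> v) {r..} \<le> ennreal a"
      unfolding a(1)[symmetric] using \<open>y < r\<close> y by (intro tail_antimono v) auto
    ultimately have "ennreal u < ennreal a" by (meson less_le_trans)
    then show "u \<in> {0<..<a}" using u by (simp add: ennreal_less_iff)
  qed
  then have "emeasure lborel {u. y < tail_quantile \<rho> (u, v)} \<le> emeasure lborel {0<..<a}"
    by (intro emeasure_mono) auto
  also have "\<dots> = ennreal a" using a by simp
  finally show ?thesis by (simp add: a)
qed

end

section \<open>Dyadic layers and integrability of the quantile\<close>

lemma dyadic_scale':
  fixes x :: real
  assumes "0 < x" "x \<le> 1"
  obtains k :: nat where "(1 / 2) ^ Suc k < x" "x \<le> (1 / 2) ^ k"
proof -
  obtain n :: nat where n: "(1 / 2) ^ n < x"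
    using real_arch_pow_inv[of x "1 / 2"] assms by auto
  define m where "m = (LEAST m. (1 / 2) ^ m < x)"
  have m: "(1 / 2) ^ m < x" unfolding m_def using n by (rule LeastI)
  with assms obtain k where k: "m = Suc k" by (cases m) auto
  then have "\<not> (1 / 2) ^ k < x"
    using not_less_Least[of k "\<lambda>m. (1 / 2) ^ m < x"] unfolding m_def by auto
  with m k show ?thesis by (intro that[of k]) auto
qed

text \<open>A dyadic layer-cake formula, exact up to a constant. Strict thresholds here and closed
  ones in \<open>dyadic_sum_le\<close> match the open superlevel sets and closed tails of
  \<open>emeasure_tail_quantile_le\<close>.\<close>

lemma min_one_le_dyadic_sum:
  fixes a :: real
  assumes "0 \<le> a"
  shows "ennreal (min 1 a) \<le> (\<Sum>k. ennreal ((1 / 2) ^ k) * indicator {y. (1 / 2) ^ Suc k < y} a)"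
proof -
  have single: "ennreal ((1 / 2) ^ k) * indicator {y. (1 / 2) ^ Suc k < y} a
      \<le> (\<Sum>k. ennreal ((1 / 2) ^ k) * indicator {y. (1 / 2) ^ Suc k < y} a)" for k
    by (rule single_le_suminf)
  show ?thesis
  proof (cases "a = 0 \<or> 1 < a")
    case True
    then show ?thesis using single[of 0] by auto
  next
    case False
    with assms obtain k where "(1 / 2) ^ Suc k < a" "a \<le> (1 / 2) ^ k"
      using dyadic_scale'[of a] by auto
    then have "ennreal (min 1 a) \<le> ennreal ((1 / 2) ^ k) * indicator {y. (1 / 2) ^ Suc k < y} a"
      by (auto intro!: ennreal_leI)
    with single[of k] show ?thesis by (rule order_trans[rotated])
  qed
qed

lemma dyadic_sum_le:
  fixes a :: real
  assumes "0 \<le> a"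
  shows "(\<Sum>k. ennreal ((1 / 2) ^ k) * indicator {y. (1 / 2) ^ Suc k \<le> y} a) \<le> 4 * ennreal (min 1 a)"
proof (rule suminf_le_const)
  fix n
  define b where "b = min 1 a"
  have ind: "indicator {y. (1 / 2) ^ Suc k \<le> y} a = (indicator {y. (1 / 2) ^ Suc k \<le> y} b :: real)" for k
    using power_le_one[of "1 / 2 :: real" "Suc k"] by (auto simp: b_def indicator_def)
  \<comment> \<open>The nonzero terms form a geometric progression that starts at the first
    \<open>k\<close> with \<open>(1 / 2) ^ Suc k \<le> b\<close>, so their sum is at most
    \<open>2 * (1 / 2) ^ k - 2 * (1 / 2) ^ n\<close>. The maximum with 0 covers the stage before
    that \<open>k\<close>.\<close>
  have "(\<Sum>k<n. (1 / 2) ^ k * indicator {y. (1 / 2) ^ Suc k \<le> y} b) \<le> max 0 (4 * b - 2 * (1 / 2) ^ n)"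
  proof (induction n)
    case (Suc n)
    show ?case
    proof (cases "(1 / 2) ^ Suc n \<le> b")
      case True
      then have "max 0 (4 * b - 2 * (1 / 2) ^ n) + (1 / 2) ^ n \<le> 4 * b - 2 * (1 / 2) ^ Suc n"
        by (simp add: max_def)
      with Suc True show ?thesis by simp
    next
      case False
      then have "max 0 (4 * b - 2 * (1 / 2) ^ n) = 0" by (simp add: max_def)
      with Suc False show ?thesis by simp
    qed
  qed simp
  also have "\<dots> \<le> 4 * b" using assms by (simp add: b_def)
  finally have "ennreal (\<Sum>k<n. (1 / 2) ^ k * indicator {y. (1 / 2) ^ Suc k \<le> y} a) \<le> ennreal (4 * b)"
    unfolding ind by (rule ennreal_leI)
  also have "ennreal (\<Sum>k<n. (1 / 2) ^ k * indicator {y. (1 / 2) ^ Suc k \<le> y} a)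
      = (\<Sum>k<n. ennreal ((1 / 2) ^ k) * indicator {y. (1 / 2) ^ Suc k \<le> y} a)"
    by (subst sum_ennreal[symmetric]) (auto intro!: sum.cong split: split_indicator)
  also have "ennreal (4 * b) = 4 * ennreal (min 1 a)"
    using assms by (simp add: b_def ennreal_mult)
  finally show "(\<Sum>k<n. ennreal ((1 / 2) ^ k) * indicator {y. (1 / 2) ^ Suc k \<le> y} a) \<le> 4 * ennreal (min 1 a)" .
qed simp

text \<open>The comparison is made layer by layer: in each direction the superlevel set of the
  quantile has at most the measure of the radial tail, and averaging radial tails over
  \<open>\<sigma>\<close> gives the tail of \<open>\<nu>\<close> in the norm.\<close>

lemma tail_quantile_min_one_le:
  fixes \<sigma> \<nu> :: "(real^'d) measure"
  assumes \<sigma>: "sphere_prob \<sigma>" and lm: "levy_measure \<nu>" and rd: "radial_decomposition \<nu> \<sigma> \<rho>"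
  shows "(\<integral>\<^sup>+p. ennreal (min 1 (tail_quantile \<rho> p)) \<partial>(lborel \<Otimes>\<^sub>M \<sigma>)) \<le> 4 * (\<integral>\<^sup>+w. ennreal (min 1 (norm w)) \<partial>\<nu>)"
proof -
  have rf: "radial_levy_family \<sigma> \<rho>" using rd by (simp add: radial_decomposition_def)
  interpret sig: prob_space \<sigma> using \<sigma> by (simp add: sphere_prob_def)
  interpret ls: pair_sigma_finite lborel \<sigma> ..
  have sp: "space \<sigma> = sphere 0 1"
    using \<sigma> sets_eq_imp_space_eq[of \<sigma> "restrict_space borel (sphere 0 1)"]
    by (simp add: sphere_prob_def space_restrict_space)
  have [measurable_cong]: "sets \<nu> = sets borel" using lm by (simp add: levy_measure_def)
  note [measurable] = tail_quantile_measurable[OF rf \<sigma>]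
  have tq: "tail_quantile \<rho> \<in> borel_measurable (lborel \<Otimes>\<^sub>M \<sigma>)" by measurable
  let ?A = "\<lambda>k. {y::real. (1 / 2) ^ Suc k < y}"
  have "(\<integral>\<^sup>+p. ennreal (min 1 (tail_quantile \<rho> p)) \<partial>(lborel \<Otimes>\<^sub>M \<sigma>))
      \<le> (\<integral>\<^sup>+p. (\<Sum>k. ennreal ((1 / 2) ^ k) * indicator (?A k) (tail_quantile \<rho> p)) \<partial>(lborel \<Otimes>\<^sub>M \<sigma>))"
    by (intro nn_integral_mono min_one_le_dyadic_sum tail_quantile_nonneg[OF rf])
       (auto simp: space_pair_measure sp)
  also have "\<dots> = (\<Sum>k. ennreal ((1 / 2) ^ k) * (\<integral>\<^sup>+p. indicator (?A k) (tail_quantile \<rho> p) \<partial>(lborel \<Otimes>\<^sub>M \<sigma>)))"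
    by (subst nn_integral_suminf) (auto simp: nn_integral_cmult)
  also have "\<dots> \<le> (\<Sum>k. ennreal ((1 / 2) ^ k) * emeasure \<nu> {w. (1 / 2) ^ Suc k \<le> norm w})"
  proof (intro suminf_le mult_left_mono)
    fix k
    define y :: real where "y = (1 / 2) ^ Suc k"
    have y: "0 < y" by (simp add: y_def)
    have "(\<integral>\<^sup>+p. indicator {z. y < z} (tail_quantile \<rho> p) \<partial>(lborel \<Otimes>\<^sub>M \<sigma>))
        = (\<integral>\<^sup>+v. \<integral>\<^sup>+u. indicator {z. y < z} (tail_quantile \<rho> (u, v)) \<partial>lborel \<partial>\<sigma>)"
      by (rule ls.nn_integral_snd[symmetric]) measurable
    also have "\<dots> \<le> (\<integral>\<^sup>+v. emeasure (\<rho> v) {y..} \<partial>\<sigma>)"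
    proof (rule nn_integral_mono)
      fix v assume v: "v \<in> space \<sigma>"
      have [measurable]: "(\<lambda>u. tail_quantile \<rho> (u, v)) \<in> borel_measurable lborel"
        using v by measurable
      have "(\<integral>\<^sup>+u. indicator {z. y < z} (tail_quantile \<rho> (u, v)) \<partial>lborel)
          = (\<integral>\<^sup>+u. indicator {u. y < tail_quantile \<rho> (u, v)} u \<partial>lborel)"
        by (intro nn_integral_cong) (simp add: indicator_def)
      also have "\<dots> = emeasure lborel {u. y < tail_quantile \<rho> (u, v)}"
        by (rule nn_integral_indicator) measurable
      also have "\<dots> \<le> emeasure (\<rho> v) {y..}"
        using v y by (intro emeasure_tail_quantile_le[OF rf]) (auto simp: sp)
      finally show "(\<integral>\<^sup>+u. indicator {z. y < z} (tail_quantile \<rho> (u, v)) \<partial>lborel) \<le> emeasure (\<rho> v) {y..}" .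
    qed
    also have "\<dots> = (\<integral>\<^sup>+v. (\<integral>\<^sup>+x. indicator {w. y \<le> norm w} (x *\<^sub>R v) \<partial>\<rho> v) \<partial>\<sigma>)"
    proof (rule nn_integral_cong)
      fix v assume v: "v \<in> space \<sigma>"
      then have v': "v \<in> sphere 0 1" by (simp add: sp)
      have "(\<integral>\<^sup>+x. indicator {w. y \<le> norm w} (x *\<^sub>R v) \<partial>\<rho> v) = (\<integral>\<^sup>+x. indicator {y..} x \<partial>\<rho> v)"
        using v' by (intro nn_integral_cong) (auto simp: space_radial[OF rf v'] indicator_def)
      also have "\<dots> = emeasure (\<rho> v) {y..}"
        using Ici_sets[OF rf y] by (simp add: sets_radial[OF rf v'])
      finally show "emeasure (\<rho> v) {y..} = (\<integral>\<^sup>+x. indicator {w. y \<le> norm w} (x *\<^sub>R v) \<partial>\<rho> v)" ..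
    qed
    also have "\<dots> = emeasure \<nu> {w. y \<le> norm w}"
    proof -
      have "{w::real^'d. y \<le> norm w} \<in> sets borel" by measurable
      moreover have "0 \<notin> {w::real^'d. y \<le> norm w}" using y by simp
      ultimately show ?thesis using rd by (simp add: radial_decomposition_def)
    qed
    finally show "(\<integral>\<^sup>+p. indicator (?A k) (tail_quantile \<rho> p) \<partial>(lborel \<Otimes>\<^sub>M \<sigma>)) \<le> emeasure \<nu> {w. (1 / 2) ^ Suc k \<le> norm w}"
      by (simp add: y_def)
  qed auto
  also have "\<dots> = (\<Sum>k. \<integral>\<^sup>+w. ennreal ((1 / 2) ^ k) * indicator {y. (1 / 2) ^ Suc k \<le> y} (norm w) \<partial>\<nu>)"
  proof (intro suminf_cong)
    fix k
    have "(\<integral>\<^sup>+w. ennreal ((1 / 2) ^ k) * indicator {y. (1 / 2) ^ Suc k \<le> y} (norm w) \<partial>\<nu>)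
        = (\<integral>\<^sup>+w. ennreal ((1 / 2) ^ k) * indicator {w. (1 / 2) ^ Suc k \<le> norm w} w \<partial>\<nu>)"
      by (intro nn_integral_cong) (simp add: indicator_def)
    also have "\<dots> = ennreal ((1 / 2) ^ k) * emeasure \<nu> {w. (1 / 2) ^ Suc k \<le> norm w}"
      by (rule nn_integral_cmult_indicator) measurable
    finally show "ennreal ((1 / 2) ^ k) * emeasure \<nu> {w. (1 / 2) ^ Suc k \<le> norm w}
        = (\<integral>\<^sup>+w. ennreal ((1 / 2) ^ k) * indicator {y. (1 / 2) ^ Suc k \<le> y} (norm w) \<partial>\<nu>)" ..
  qed
  also have "\<dots> = (\<integral>\<^sup>+w. (\<Sum>k. ennreal ((1 / 2) ^ k) * indicator {y. (1 / 2) ^ Suc k \<le> y} (norm w)) \<partial>\<nu>)"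
    by (rule nn_integral_suminf[symmetric]) measurable
  also have "\<dots> \<le> (\<integral>\<^sup>+w. 4 * ennreal (min 1 (norm w)) \<partial>\<nu>)"
    by (intro nn_integral_mono dyadic_sum_le) auto
  also have "\<dots> = 4 * (\<integral>\<^sup>+w. ennreal (min 1 (norm w)) \<partial>\<nu>)"
    by (rule nn_integral_cmult) measurable
  finally show ?thesis .
qed

section \<open>The comonotonic coupling\<close>

locale comonotonic_coupling =
  fixes P :: "'a measure" and \<sigma> :: "(real^'d) measure"
    and U E :: "nat \<Rightarrow> 'a \<Rightarrow> real" and V :: "nat \<Rightarrow> 'a \<Rightarrow> real^'d"
  assumes sphere: "sphere_prob \<sigma>" and coupling: "coupling_sequences P \<sigma> U E V"
begin

abbreviation uni :: "real measure" where
  "uni \<equiv> uniform_measure lborel {0..1}"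

abbreviation mark_law :: "(real \<times> (real^'d)) measure" where
  "mark_law \<equiv> uni \<Otimes>\<^sub>M \<sigma>"

text \<open>The level comes first and the mark is the pair of time and direction, as Mecke's formula
  expects; in \<open>\<Xi>\<close> the time comes first.\<close>

definition points :: "'a \<Rightarrow> nat \<Rightarrow> real \<times> real \<times> (real^'d)" where
  "points \<omega> n = (arrival E n \<omega>, U n \<omega>, V n \<omega>)"

abbreviation \<Xi> :: "'a \<Rightarrow> (real \<times> real \<times> (real^'d)) measure" where
  "\<Xi> \<equiv> jump_measure \<sigma> U (arrival E) V"

sublocale prob_space P
  using coupling by (simp add: coupling_sequences_def)

sublocale sig: prob_space \<sigma>
  using sphere by (simp add: sphere_prob_def)

sublocale uni: prob_space uni
  by (rule prob_space_uniform_measure) auto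

sublocale mark_pair: pair_prob_space uni \<sigma> ..

sublocale level_pair: pair_sigma_finite lborel \<sigma> ..

sublocale level_measure: sigma_finite_measure "lborel \<Otimes>\<^sub>M \<sigma> :: (real \<times> (real^'d)) measure"
  by (rule level_pair.sigma_finite_measure_axioms)

sublocale time_pair: pair_sigma_finite uni "lborel \<Otimes>\<^sub>M \<sigma> :: (real \<times> (real^'d)) measure" ..

sublocale mean_pair: pair_sigma_finite lborel "lborel \<Otimes>\<^sub>M \<sigma> :: (real \<times> (real^'d)) measure" ..

lemma space_sigma: "space \<sigma> = sphere 0 1"
  using sphere sets_eq_imp_space_eq[of \<sigma> "restrict_space borel (sphere 0 1)"]
  by (simp add: sphere_prob_def space_restrict_space)

lemma measurable_direction [measurable]: "(\<lambda>v. v) \<in> borel_measurable \<sigma>"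
proof -
  have "(\<lambda>v. v) \<in> borel_measurable (restrict_space borel (sphere (0::real^'d) 1))"
    by (rule measurable_restrict_space1) simp
  moreover have "sets \<sigma> = sets (restrict_space borel (sphere 0 1))"
    using sphere by (simp add: sphere_prob_def)
  ultimately show ?thesis
    using measurable_cong_sets by blast
qed

lemma measurable_direction_nth [measurable]: "(\<lambda>v. v $ c) \<in> borel_measurable \<sigma>"
  by (rule measurable_compose[OF measurable_direction]) (intro borel_measurable_continuous_onI continuous_intros)

lemma marked_points_eq: "marked_points 0 (\<lambda>n. (E n \<omega>, U n \<omega>, V n \<omega>)) = points \<omega>"
  by (rule ext)
     (simp add: marked_points_def points_def arrival_level_def arrival_def lessThan_Suc_atMost del: arrival_level_Suc)

sublocale gaps: marked_gaps mark_law
  by standard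

lemma points_measurable: "points \<in> P \<rightarrow>\<^sub>M gaps.points_space"
proof -
  have "(\<lambda>\<omega>. marked_points 0 (\<lambda>n. (E n \<omega>, U n \<omega>, V n \<omega>))) \<in> P \<rightarrow>\<^sub>M gaps.points_space"
    using coupling_sequences_law(1)[OF sphere coupling] gaps.sets_gaps
    by (intro gaps.measurable_marked_points measurable_const) (simp_all cong: measurable_cong_sets)
  then show ?thesis unfolding marked_points_eq by simp
qed

text \<open>Mecke's formula for the canonical gaps started at level 0 involves only their law, so
  \<open>coupling_sequences_law\<close> carries it over to \<open>P\<close>.\<close>

sublocale poisson_points P mark_law points
proof
  let ?T = "\<lambda>\<omega> n. (E n \<omega>, U n \<omega>, V n \<omega>)"
  show "points \<in> P \<rightarrow>\<^sub>M gaps.points_space" by (rule points_measurable)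
  fix F :: "real \<times> real \<times> (real^'d) \<Rightarrow> (nat \<Rightarrow> real \<times> real \<times> (real^'d)) \<Rightarrow> ennreal"
  assume F [measurable]: "(\<lambda>(p, s). F p s) \<in> borel_measurable (gaps.point_space \<Otimes>\<^sub>M gaps.points_space)"
  note T = coupling_sequences_law[OF sphere coupling]
  have eq: "(\<integral>\<^sup>+\<omega>. f (?T \<omega>) \<partial>P) = (\<integral>\<^sup>+s. f s \<partial>gaps.gaps.S)"
    if "f \<in> borel_measurable gaps.points_space" for f
  proof -
    have f: "f \<in> borel_measurable gaps.gaps.S"
      using that gaps.sets_gaps measurable_cong_sets by blast
    have "(\<integral>\<^sup>+\<omega>. f (?T \<omega>) \<partial>P) = (\<integral>\<^sup>+s. f s \<partial>distr P gaps.gaps.S ?T)"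
      by (rule nn_integral_distr[OF T(1), symmetric]) (use f in simp)
    then show ?thesis by (simp only: T(2))
  qed
  have "(\<integral>\<^sup>+\<omega>. (\<Sum>n. F (points \<omega> n) (\<lambda>k. points \<omega> (skip n k))) \<partial>P)
      = (\<integral>\<^sup>+s. (\<Sum>n. F (marked_points 0 s n) (\<lambda>k. marked_points 0 s (skip n k))) \<partial>gaps.gaps.S)"
    unfolding marked_points_eq[symmetric] by (rule eq) measurable
  also have "\<dots> = (\<integral>\<^sup>+s. \<integral>\<^sup>+y. \<integral>\<^sup>+w. indicator {0..} y * F (y, w) (marked_points 0 s) \<partial>mark_law \<partial>lborel \<partial>gaps.gaps.S)"
    by (rule gaps.mecke) measurable
  also have "\<dots> = (\<integral>\<^sup>+\<omega>. \<integral>\<^sup>+y. \<integral>\<^sup>+w. indicator {0..} y * F (y, w) (points \<omega>) \<partial>mark_law \<partial>lborel \<partial>P)"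
    unfolding marked_points_eq[symmetric] by (rule eq[symmetric]) measurable
  finally show "(\<integral>\<^sup>+\<omega>. (\<Sum>n. F (points \<omega> n) (\<lambda>k. points \<omega> (skip n k))) \<partial>P)
      = (\<integral>\<^sup>+\<omega>. \<integral>\<^sup>+y. \<integral>\<^sup>+w. indicator {0..} y * F (y, w) (points \<omega>) \<partial>mark_law \<partial>lborel \<partial>P)" .
qed

lemma U_measurable [measurable]: "U n \<in> borel_measurable P"
  and E_measurable [measurable]: "E n \<in> borel_measurable P"
  and V_measurable [measurable]: "V n \<in> P \<rightarrow>\<^sub>M \<sigma>"
  using coupling by (simp_all add: coupling_sequences_def indep_vars_def)

lemma arrival_measurable [measurable]: "arrival E n \<in> borel_measurable P"
  unfolding arrival_def[abs_def] by measurable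

lemma nn_integral_mark:
  assumes [measurable]: "f \<in> borel_measurable point_space"
  shows "(\<integral>\<^sup>+p. f p \<partial>intensity)
    = (\<integral>\<^sup>+u. \<integral>\<^sup>+p. indicator {0..} (fst p) * f (fst p, u, snd p) \<partial>(lborel \<Otimes>\<^sub>M \<sigma>) \<partial>uni)"
proof -
  interpret lu: pair_sigma_finite lborel uni ..
  have "(\<integral>\<^sup>+p. f p \<partial>intensity) = (\<integral>\<^sup>+x. \<integral>\<^sup>+w. indicator {0..} x * f (x, w) \<partial>mark_law \<partial>lborel)"
    by (rule nn_integral_intensity) measurable
  also have "\<dots> = (\<integral>\<^sup>+x. \<integral>\<^sup>+u. \<integral>\<^sup>+v. indicator {0..} x * f (x, u, v) \<partial>\<sigma> \<partial>uni \<partial>lborel)"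
    by (rule nn_integral_cong, rule sig.nn_integral_fst[symmetric]) measurable
  also have "\<dots> = (\<integral>\<^sup>+u. \<integral>\<^sup>+x. \<integral>\<^sup>+v. indicator {0..} x * f (x, u, v) \<partial>\<sigma> \<partial>lborel \<partial>uni)"
    by (rule lu.Fubini'[symmetric]) measurable
  also have "\<dots> = (\<integral>\<^sup>+u. \<integral>\<^sup>+p. indicator {0..} (fst p) * f (fst p, u, snd p) \<partial>(lborel \<Otimes>\<^sub>M \<sigma>) \<partial>uni)"
  proof (rule nn_integral_cong)
    fix u :: real
    have "(\<lambda>p. indicator {0..} (fst p) * f (fst p, u, snd p)) \<in> borel_measurable (lborel \<Otimes>\<^sub>M \<sigma>)"
      by measurable
    from sig.nn_integral_fst[OF this]
    show "(\<integral>\<^sup>+x. \<integral>\<^sup>+v. indicator {0..} x * f (x, u, v) \<partial>\<sigma> \<partial>lborel)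
        = (\<integral>\<^sup>+p. indicator {0..} (fst p) * f (fst p, u, snd p) \<partial>(lborel \<Otimes>\<^sub>M \<sigma>))"
      by simp
  qed
  finally show ?thesis .
qed

definition levels :: "(real \<times> (real^'d)) measure" where
  "levels = density (lborel \<Otimes>\<^sub>M \<sigma>) (\<lambda>p. indicator {0..} (fst p))"

lemma sets_levels [measurable_cong]: "sets levels = sets (borel \<Otimes>\<^sub>M \<sigma>)"
  by (simp add: levels_def cong: sets_pair_measure_cong)

sublocale levels: sigma_finite_measure levels
  unfolding levels_def
  by (rule sigma_finite_measure.sigma_finite_iff_density_finite[OF level_pair.sigma_finite_measure_axioms, THEN iffD2])
     (auto split: split_indicator)

sublocale time_levels: pair_sigma_finite uni levels ..

lemma measurable_time_levels: "measurable (uni \<Otimes>\<^sub>M levels) N = measurable (mark_space \<sigma>) N"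
  by (rule measurable_cong_sets[OF sets_pair_measure_cong refl]) (simp_all add: sets_levels)

text \<open>Moving the time to the front exhibits it as a separate factor of the intensity;
  integrals over a time window then factorise.\<close>

lemma intensity_eq_distr:
  "intensity = distr (uni \<Otimes>\<^sub>M levels) point_space (\<lambda>x. (fst (snd x), fst x, snd (snd x)))"
proof (rule measure_eqI)
  let ?T = "\<lambda>x. (fst (snd x), fst x, snd (snd x))"
  show "sets intensity = sets (distr (uni \<Otimes>\<^sub>M levels) point_space ?T)"
    by (simp add: sets_intensity)
  fix A assume "A \<in> sets intensity"
  then have [measurable]: "A \<in> sets point_space" by (simp add: sets_intensity)
  have "emeasure intensity A = (\<integral>\<^sup>+p. indicator A p \<partial>intensity)"
    using \<open>A \<in> sets intensity\<close> by simp
  also have "\<dots> = (\<integral>\<^sup>+u. \<integral>\<^sup>+p. indicator {0..} (fst p) * indicator A (fst p, u, snd p) \<partial>(lborel \<Otimes>\<^sub>M \<sigma>) \<partial>uni)"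
    by (rule nn_integral_mark) measurable
  also have "\<dots> = (\<integral>\<^sup>+u. \<integral>\<^sup>+p. indicator A (fst p, u, snd p) \<partial>levels \<partial>uni)"
    unfolding levels_def by (rule nn_integral_cong, rule nn_integral_density[symmetric]) measurable
  also have "\<dots> = (\<integral>\<^sup>+x. indicator A (?T x) \<partial>(uni \<Otimes>\<^sub>M levels))"
  proof -
    have "(\<lambda>x. indicator A (?T x) :: ennreal) \<in> borel_measurable (uni \<Otimes>\<^sub>M levels)"
      unfolding measurable_time_levels by measurable
    from levels.nn_integral_fst[OF this] show ?thesis by simp
  qed
  also have "\<dots> = (\<integral>\<^sup>+p. indicator A p \<partial>distr (uni \<Otimes>\<^sub>M levels) point_space ?T)"
  proof (rule nn_integral_distr[symmetric])
    show "?T \<in> uni \<Otimes>\<^sub>M levels \<rightarrow>\<^sub>M point_space"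
      unfolding measurable_time_levels by measurable
  qed simp
  also have "\<dots> = emeasure (distr (uni \<Otimes>\<^sub>M levels) point_space ?T) A"
    by (rule nn_integral_indicator) (use \<open>A \<in> sets intensity\<close> in \<open>simp add: sets_intensity\<close>)
  finally show "emeasure intensity A = emeasure (distr (uni \<Otimes>\<^sub>M levels) point_space ?T) A" .
qed

lemma integrable_levels:
  fixes \<phi> :: "real \<times> (real^'d) \<Rightarrow> 'b::{banach, second_countable_topology}"
  assumes \<phi>: "integrable (lborel \<Otimes>\<^sub>M \<sigma>) \<phi>" and 0: "\<And>x v. x \<le> 0 \<Longrightarrow> \<phi> (x, v) = 0"
  shows "has_bochner_integral levels \<phi> (\<integral>p. \<phi> p \<partial>(lborel \<Otimes>\<^sub>M \<sigma>))"
proof -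
  have eq: "indicator {0..} (fst p) *\<^sub>R \<phi> p = \<phi> p" for p
    using 0[of "fst p" "snd p"] by (auto split: split_indicator)
  have [measurable]: "\<phi> \<in> borel_measurable (lborel \<Otimes>\<^sub>M \<sigma>)"
    using \<phi> by (rule borel_measurable_integrable)
  have lev: "levels = density (lborel \<Otimes>\<^sub>M \<sigma>) (\<lambda>p. ennreal (indicator {0..} (fst p)))"
    by (simp add: levels_def ennreal_indicator)
  show ?thesis
    unfolding has_bochner_integral_iff lev
    by (subst integrable_density, measurable, subst integral_density, measurable)
       (auto simp: eq \<phi>)
qed

text \<open>Since \<open>\<phi>\<close> vanishes at nonpositive levels, the integral over the
  half-line of levels may be written over the whole line.\<close>

lemma intensity_product:
  fixes \<phi> :: "real \<times> (real^'d) \<Rightarrow> real"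
  assumes \<phi>: "integrable (lborel \<Otimes>\<^sub>M \<sigma>) \<phi>" and 0: "\<And>x v. x \<le> 0 \<Longrightarrow> \<phi> (x, v) = 0"
    and ab: "A \<in> sets borel"
  shows "has_bochner_integral intensity (\<lambda>p. indicator A (fst (snd p)) * \<phi> (fst p, snd (snd p)))
    (measure uni A * (\<integral>p. \<phi> p \<partial>(lborel \<Otimes>\<^sub>M \<sigma>)))"
proof -
  note lev = integrable_levels[OF \<phi> 0, unfolded has_bochner_integral_iff]
  have [measurable]: "\<phi> \<in> borel_measurable (borel \<Otimes>\<^sub>M \<sigma>)"
    using borel_measurable_integrable[OF \<phi>] by simp
  note [measurable] = ab
  let ?f = "\<lambda>x. indicator A (fst x) * \<phi> (snd x)"
  have int: "integrable (uni \<Otimes>\<^sub>M levels) ?f"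
  proof (rule time_levels.Fubini_integrable)
    show "?f \<in> borel_measurable (uni \<Otimes>\<^sub>M levels)"
      unfolding measurable_time_levels by measurable
    have "(\<lambda>x. \<integral>y. norm (?f (x, y)) \<partial>levels) = (\<lambda>x. indicator A x * (\<integral>y. \<bar>\<phi> y\<bar> \<partial>levels))"
      by (simp add: abs_mult)
    moreover have "integrable uni (indicator A :: real \<Rightarrow> real)"
    proof (rule integrable_real_indicator)
      show "A \<in> sets uni" using ab by simp
      show "emeasure uni A < \<infinity>"
        using uni.emeasure_finite[of A] by (simp only: less_top infinity_ennreal_def)
    qed
    ultimately show "integrable uni (\<lambda>x. \<integral>y. norm (?f (x, y)) \<partial>levels)"
      by simp
    show "AE x in uni. integrable levels (\<lambda>y. ?f (x, y))"
      using lev by auto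
  qed
  have val: "(\<integral>x. ?f x \<partial>(uni \<Otimes>\<^sub>M levels)) = measure uni A * (\<integral>p. \<phi> p \<partial>(lborel \<Otimes>\<^sub>M \<sigma>))"
    unfolding time_levels.integral_fst'[OF int, symmetric] using lev by simp
  show ?thesis
    unfolding has_bochner_integral_iff intensity_eq_distr
  proof (subst integrable_distr_eq)
    show T: "(\<lambda>x. (fst (snd x), fst x, snd (snd x))) \<in> uni \<Otimes>\<^sub>M levels \<rightarrow>\<^sub>M point_space"
      unfolding measurable_time_levels by measurable
    show f: "(\<lambda>p. indicator A (fst (snd p)) * \<phi> (fst p, snd (snd p))) \<in> borel_measurable point_space"
      by measurable
    show "integrable (uni \<Otimes>\<^sub>M levels) (\<lambda>x. indicator A (fst (snd (fst (snd x), fst x, snd (snd x)))) *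
          \<phi> (fst (fst (snd x), fst x, snd (snd x)), snd (snd (fst (snd x), fst x, snd (snd x))))) \<and>
        (\<integral>p. indicator A (fst (snd p)) * \<phi> (fst p, snd (snd p)) \<partial>distr (uni \<Otimes>\<^sub>M levels) point_space
          (\<lambda>x. (fst (snd x), fst x, snd (snd x)))) = measure uni A * (\<integral>p. \<phi> p \<partial>(lborel \<Otimes>\<^sub>M \<sigma>))"
      unfolding integral_distr[OF T f] using int val by simp
  qed
qed

lemma nn_integral_levels:
  assumes [measurable]: "f \<in> borel_measurable (borel \<Otimes>\<^sub>M \<sigma>)"
  shows "(\<integral>\<^sup>+p. f (fst p, snd (snd p)) \<partial>intensity) = (\<integral>\<^sup>+p. indicator {0..} (fst p) * f p \<partial>(lborel \<Otimes>\<^sub>M \<sigma>))"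
proof -
  have "(\<lambda>p. f (fst p, snd (snd p))) \<in> borel_measurable point_space" by measurable
  from nn_integral_mark[OF this] show ?thesis by (simp add: uni.emeasure_space_1)
qed

definition kernel :: "(real^'d \<Rightarrow> real measure) \<Rightarrow> real set \<Rightarrow> real \<Rightarrow> real \<times> real \<times> (real^'d) \<Rightarrow> real^'d" where
  "kernel \<rho> B t p = (indicator {0..t} (fst (snd p)) * (indicator B (fst p) * tail_quantile \<rho> (fst p, snd (snd p)))) *\<^sub>R snd (snd p)"

lemma set_integral_jump_measure:
  assumes rf: "radial_levy_family \<sigma> \<rho>" and [measurable]: "B \<in> sets borel" and \<omega>: "\<omega> \<in> space P"
  shows "set_lebesgue_integral (\<Xi> \<omega>) ({0..t} \<times> {x. 0 < x \<and> x \<in> B} \<times> sphere 0 1)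
      (\<lambda>(s, x, v). inverse_tail \<rho> x v *\<^sub>R v) = (\<integral>n. kernel \<rho> B t (points \<omega> n) \<partial>count_space UNIV)"
proof -
  note [measurable] = tail_quantile_measurable[OF rf sphere]
  let ?A = "{0..t} \<times> {x. 0 < x \<and> x \<in> B} \<times> sphere 0 1"
  let ?g = "\<lambda>y::real \<times> real \<times> (real^'d). (indicator {0..t} (fst y) * (indicator B (fst (snd y)) * tail_quantile \<rho> (snd y))) *\<^sub>R snd (snd y)"
  have V: "V n \<omega> \<in> space \<sigma>" for n
    using measurable_space[OF V_measurable \<omega>] .
  have m: "(\<lambda>n. (U n \<omega>, arrival E n \<omega>, V n \<omega>)) \<in> count_space UNIV \<rightarrow>\<^sub>M mark_space \<sigma>"
    by (rule measurable_count_space_eq1[THEN iffD2]) (auto simp: space_pair_measure V)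
  have "set_lebesgue_integral (\<Xi> \<omega>) ?A (\<lambda>(s, x, v). inverse_tail \<rho> x v *\<^sub>R v) = (\<integral>y. ?g y \<partial>\<Xi> \<omega>)"
    unfolding set_lebesgue_integral_def
  proof (rule Bochner_Integration.integral_cong)
    fix y assume "y \<in> space (\<Xi> \<omega>)"
    then have "snd (snd y) \<in> sphere 0 1"
      by (auto simp: jump_measure_def space_pair_measure space_sigma)
    then show "indicator ?A y *\<^sub>R (case y of (s, x, v) \<Rightarrow> inverse_tail \<rho> x v *\<^sub>R v) = ?g y"
      by (auto simp: tail_quantile_def indicator_def split: prod.split)
  qed simp
  also have "\<dots> = (\<integral>n. ?g (U n \<omega>, arrival E n \<omega>, V n \<omega>) \<partial>count_space UNIV)"
    unfolding jump_measure_def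
  proof (rule integral_distr[OF m])
    have "(\<lambda>y. tail_quantile \<rho> (snd y)) \<in> borel_measurable (mark_space \<sigma>)" by measurable
    then show "?g \<in> borel_measurable (mark_space \<sigma>)" by measurable
  qed
  finally show ?thesis by (simp add: kernel_def points_def)
qed

lemma measurable_kernel:
  assumes "radial_levy_family \<sigma> \<rho>" and [measurable]: "B \<in> sets borel"
  shows "kernel \<rho> B t \<in> borel_measurable point_space"
proof -
  note tq [measurable] = tail_quantile_measurable[OF assms(1) sphere]
  have [measurable]: "(\<lambda>p. tail_quantile \<rho> (fst p, snd (snd p))) \<in> borel_measurable point_space"
    by (rule measurable_compose[OF _ tq]) measurable
  have [measurable]: "(\<lambda>p::real \<times> real \<times> (real^'d). snd (snd p)) \<in> borel_measurable point_space"
    by measurable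
  show ?thesis unfolding kernel_def[abs_def] by measurable
qed

lemma measurable_kernel_sum:
  assumes "radial_levy_family \<sigma> \<rho>" "B \<in> sets borel"
  shows "(\<lambda>\<omega>. \<integral>n. kernel \<rho> B t (points \<omega> n) \<partial>count_space UNIV) \<in> borel_measurable P"
proof -
  have "(\<lambda>x. kernel \<rho> B t (points (fst x) (snd x))) \<in> borel_measurable (P \<Otimes>\<^sub>M count_space UNIV)"
    by (rule measurable_compose[OF measurable_index measurable_kernel[OF assms]])
  then show ?thesis
    by (intro counting.borel_measurable_lebesgue_integral) (simp add: split_beta')
qed

text \<open>The truncated terms have a finite mean sum by Campbell's formula, so their series
  converges almost surely. Its terms are eventually below 1, where truncation changes
  nothing.\<close>

lemma AE_quantile_summable:
  assumes rf: "radial_levy_family \<sigma> \<rho>" and [measurable]: "B \<in> sets borel"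
    and fin: "(\<integral>\<^sup>+p. indicator B (fst p) * ennreal (min 1 (tail_quantile \<rho> p)) \<partial>(lborel \<Otimes>\<^sub>M \<sigma>)) < \<infinity>"
  shows "AE \<omega> in P. summable (\<lambda>n. indicator B (arrival E n \<omega>) * tail_quantile \<rho> (arrival E n \<omega>, V n \<omega>))"
proof -
  note [measurable] = tail_quantile_measurable[OF rf sphere]
  let ?a = "\<lambda>\<omega> n. indicator B (arrival E n \<omega>) * tail_quantile \<rho> (arrival E n \<omega>, V n \<omega>)"
  let ?f = "\<lambda>p. indicator B (fst p) * ennreal (min 1 (tail_quantile \<rho> p))"
  have "(\<integral>\<^sup>+\<omega>. (\<Sum>n. ?f (arrival E n \<omega>, V n \<omega>)) \<partial>P) = (\<integral>\<^sup>+p. ?f (fst p, snd (snd p)) \<partial>intensity)"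
  proof -
    have "(\<lambda>p. ?f (fst p, snd (snd p))) \<in> borel_measurable point_space" by measurable
    from campbell_formula[OF this] show ?thesis unfolding points_def by (simp only: fst_conv snd_conv)
  qed
  also have "\<dots> = (\<integral>\<^sup>+p. indicator {0..} (fst p) * ?f p \<partial>(lborel \<Otimes>\<^sub>M \<sigma>))"
    by (rule nn_integral_levels) measurable
  also have "\<dots> \<le> (\<integral>\<^sup>+p. ?f p \<partial>(lborel \<Otimes>\<^sub>M \<sigma>))"
    by (intro nn_integral_mono) (auto split: split_indicator)
  also note fin
  finally have "(\<integral>\<^sup>+\<omega>. (\<Sum>n. ?f (arrival E n \<omega>, V n \<omega>)) \<partial>P) \<noteq> \<infinity>" by simp
  then have "AE \<omega> in P. (\<Sum>n. ?f (arrival E n \<omega>, V n \<omega>)) \<noteq> \<infinity>"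
    by (intro nn_integral_PInf_AE) measurable
  then show ?thesis
    using AE_space
  proof eventually_elim
    case (elim \<omega>)
    have nonneg: "0 \<le> tail_quantile \<rho> (arrival E n \<omega>, V n \<omega>)" for n
      using measurable_space[OF V_measurable elim(2)] by (intro tail_quantile_nonneg[OF rf]) (simp add: space_sigma)
    have "?f (arrival E n \<omega>, V n \<omega>) = ennreal (min 1 (?a \<omega> n))" for n
      by (simp add: indicator_def)
    with elim(1) have "(\<Sum>n. ennreal (min 1 (?a \<omega> n))) \<noteq> \<infinity>" by simp
    then have s: "summable (\<lambda>n. min 1 (?a \<omega> n))"
      by (intro summable_suminf_not_top) (auto intro!: mult_nonneg_nonneg nonneg)
    then have "\<forall>\<^sub>F n in sequentially. min 1 (?a \<omega> n) < 1"
      by (intro order_tendstoD(2)[OF summable_LIMSEQ_zero]) auto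
    then have "\<forall>\<^sub>F n in sequentially. ?a \<omega> n = min 1 (?a \<omega> n)"
      by eventually_elim (simp add: min_def split: if_splits)
    with s show ?case by (simp add: summable_cong)
  qed
qed

lemma AE_kernel_integrable:
  assumes rf: "radial_levy_family \<sigma> \<rho>" and "B \<in> sets borel"
    and fin: "(\<integral>\<^sup>+p. indicator B (fst p) * ennreal (min 1 (tail_quantile \<rho> p)) \<partial>(lborel \<Otimes>\<^sub>M \<sigma>)) < \<infinity>"
  shows "AE \<omega> in P. \<forall>t. integrable (count_space UNIV) (\<lambda>n. kernel \<rho> B t (points \<omega> n))"
  using AE_quantile_summable[OF assms] AE_space
proof eventually_elim
  case (elim \<omega>)
  let ?a = "\<lambda>n. indicator B (arrival E n \<omega>) * tail_quantile \<rho> (arrival E n \<omega>, V n \<omega>)"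
  have v: "norm (V n \<omega>) = 1" for n
    using measurable_space[OF V_measurable elim(2)] by (simp add: space_sigma)
  have nonneg: "0 \<le> ?a n" for n
    using v by (intro mult_nonneg_nonneg tail_quantile_nonneg[OF rf]) auto
  show ?case
  proof
    fix t
    have "summable (\<lambda>n. norm (kernel \<rho> B t (points \<omega> n)))"
    proof (rule summable_comparison_test'[OF elim(1)])
      fix n
      show "norm (norm (kernel \<rho> B t (points \<omega> n))) \<le> ?a n"
        using nonneg[of n] by (auto simp: kernel_def points_def v abs_mult indicator_def)
    qed
    then show "integrable (count_space UNIV) (\<lambda>n. kernel \<rho> B t (points \<omega> n))"
      by (simp add: integrable_count_space_nat_iff)
  qed
qed

lemma big_jump_part_eq:
  assumes "radial_levy_family \<sigma> \<rho>" "\<omega> \<in> space P"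
  shows "big_jump_part \<Xi> \<rho> \<epsilon> t \<omega> = (\<integral>n. kernel \<rho> {x. ereal x < \<epsilon>} t (points \<omega> n) \<partial>count_space UNIV)"
proof -
  have "{x. ereal x < \<epsilon>} \<in> sets borel" by measurable
  from set_integral_jump_measure[OF assms(1) this assms(2)] show ?thesis
    by (simp add: big_jump_part_def)
qed

lemma measurable_big_jump_part:
  assumes "radial_levy_family \<sigma> \<rho>"
  shows "big_jump_part \<Xi> \<rho> \<epsilon> t \<in> borel_measurable P"
proof -
  have "{x. ereal x < \<epsilon>} \<in> sets borel" by measurable
  from measurable_kernel_sum[OF assms this, of t] show ?thesis
    by (rule measurable_cong[THEN iffD1, rotated]) (simp add: big_jump_part_eq[OF assms])
qed

theorem big_jump_bound:
  assumes q: "0 < q" "q \<le> 1"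
    and rX: "radial_levy_family \<sigma> \<rho>X" and rY: "radial_levy_family \<sigma> \<rho>Y"
    and fX: "(\<integral>\<^sup>+p. indicator {x. ereal x < \<epsilon>} (fst p) * ennreal (min 1 (tail_quantile \<rho>X p)) \<partial>(lborel \<Otimes>\<^sub>M \<sigma>)) < \<infinity>"
    and fY: "(\<integral>\<^sup>+p. indicator {x. ereal x < \<epsilon>} (fst p) * ennreal (min 1 (tail_quantile \<rho>Y p)) \<partial>(lborel \<Otimes>\<^sub>M \<sigma>)) < \<infinity>"
  shows "(\<integral>\<^sup>+\<omega>. (SUP t\<in>{0..1}.
      ennreal (norm (big_jump_part \<Xi> \<rho>X \<epsilon> t \<omega> - big_jump_part \<Xi> \<rho>Y \<epsilon> t \<omega>) powr q)) \<partial>P)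
    \<le> (\<integral>\<^sup>+(x, v) \<in> {x. 0 < x \<and> ereal x < \<epsilon>} \<times> sphere 0 1.
      ennreal (\<bar>inverse_tail \<rho>X x v - inverse_tail \<rho>Y x v\<bar> powr q) \<partial>(lborel \<Otimes>\<^sub>M \<sigma>))"
proof -
  note [measurable] = tail_quantile_measurable[OF rX sphere] tail_quantile_measurable[OF rY sphere]
  let ?B = "{x. ereal x < \<epsilon>}"
  have B [measurable]: "?B \<in> sets borel" by measurable
  let ?f = "\<lambda>p. ennreal ((indicator ?B (fst p) * \<bar>tail_quantile \<rho>X p - tail_quantile \<rho>Y p\<bar>) powr q)"
  have "(\<integral>\<^sup>+\<omega>. (SUP t\<in>{0..1}.
      ennreal (norm (big_jump_part \<Xi> \<rho>X \<epsilon> t \<omega> - big_jump_part \<Xi> \<rho>Y \<epsilon> t \<omega>) powr q)) \<partial>P)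
      \<le> (\<integral>\<^sup>+\<omega>. (\<Sum>n. ?f (arrival E n \<omega>, V n \<omega>)) \<partial>P)"
  \<comment> \<open>The nonnegative integral is monotone irrespective of measurability, so the
    uncountable supremum may stay inside it.\<close>
  proof (rule nn_integral_mono_AE)
    show "AE \<omega> in P. (SUP t\<in>{0..1}.
        ennreal (norm (big_jump_part \<Xi> \<rho>X \<epsilon> t \<omega> - big_jump_part \<Xi> \<rho>Y \<epsilon> t \<omega>) powr q))
        \<le> (\<Sum>n. ?f (arrival E n \<omega>, V n \<omega>))"
      using AE_kernel_integrable[OF rX B fX] AE_kernel_integrable[OF rY B fY] AE_space
    proof eventually_elim
      case (elim \<omega>)
      have v: "norm (V n \<omega>) = 1" for n
        using measurable_space[OF V_measurable elim(3)] by (simp add: space_sigma)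
      show ?case
      proof (rule SUP_least)
        fix t :: real
        \<comment> \<open>Both series converge absolutely here; with a default value in one of them
          the difference would not be the series of differences.\<close>
        have "big_jump_part \<Xi> \<rho>X \<epsilon> t \<omega> - big_jump_part \<Xi> \<rho>Y \<epsilon> t \<omega>
            = (\<integral>n. kernel \<rho>X ?B t (points \<omega> n) - kernel \<rho>Y ?B t (points \<omega> n) \<partial>count_space UNIV)"
          using elim by (simp add: big_jump_part_eq rX rY)
        then have "ennreal (norm (big_jump_part \<Xi> \<rho>X \<epsilon> t \<omega> - big_jump_part \<Xi> \<rho>Y \<epsilon> t \<omega>) powr q)
            \<le> (\<integral>\<^sup>+n. ennreal (norm (kernel \<rho>X ?B t (points \<omega> n) - kernel \<rho>Y ?B t (points \<omega> n)) powr q) \<partial>count_space UNIV)"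
          using powr_norm_lebesgue_integral_nat_le[OF q] by simp
        \<comment> \<open>A time window only removes terms, so the bound is the same for all
          \<open>t\<close> and the supremum costs nothing.\<close>
        also have "\<dots> \<le> (\<integral>\<^sup>+n. ?f (arrival E n \<omega>, V n \<omega>) \<partial>count_space UNIV)"
        proof (intro nn_integral_mono ennreal_leI powr_mono2)
          fix n
          show "norm (kernel \<rho>X ?B t (points \<omega> n) - kernel \<rho>Y ?B t (points \<omega> n))
              \<le> indicator ?B (fst (arrival E n \<omega>, V n \<omega>)) * \<bar>tail_quantile \<rho>X (arrival E n \<omega>, V n \<omega>) - tail_quantile \<rho>Y (arrival E n \<omega>, V n \<omega>)\<bar>"
            by (simp add: kernel_def points_def scaleR_left_diff_distrib[symmetric] v indicator_def)
        qed (use q in auto)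
        also have "\<dots> = (\<Sum>n. ?f (arrival E n \<omega>, V n \<omega>))"
          by (rule nn_integral_count_space_nat)
        finally show "ennreal (norm (big_jump_part \<Xi> \<rho>X \<epsilon> t \<omega> - big_jump_part \<Xi> \<rho>Y \<epsilon> t \<omega>) powr q)
            \<le> (\<Sum>n. ?f (arrival E n \<omega>, V n \<omega>))" .
      qed
    qed
  qed
  also have "\<dots> = (\<integral>\<^sup>+p. ?f (fst p, snd (snd p)) \<partial>intensity)"
  proof -
    have "(\<lambda>p. ?f (fst p, snd (snd p))) \<in> borel_measurable point_space" by measurable
    from campbell_formula[OF this] show ?thesis unfolding points_def by (simp only: fst_conv snd_conv)
  qed
  also have "\<dots> = (\<integral>\<^sup>+p. indicator {0..} (fst p) * ?f p \<partial>(lborel \<Otimes>\<^sub>M \<sigma>))"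
    by (rule nn_integral_levels) measurable
  also have "\<dots> \<le> (\<integral>\<^sup>+(x, v) \<in> {x. 0 < x \<and> ereal x < \<epsilon>} \<times> sphere 0 1.
      ennreal (\<bar>inverse_tail \<rho>X x v - inverse_tail \<rho>Y x v\<bar> powr q) \<partial>(lborel \<Otimes>\<^sub>M \<sigma>))"
    using q by (intro nn_integral_mono)
      (auto simp: space_pair_measure space_sigma tail_quantile_def indicator_def)
  finally show ?thesis .
qed

end

section \<open>The Brownian part\<close>

lemma power2_norm_vec:
  fixes x :: "'b::real_normed_vector^'n"
  shows "(norm x)\<^sup>2 = (\<Sum>i\<in>UNIV. (norm (x $ i))\<^sup>2)"
  by (simp add: norm_vec_def L2_set_def sum_nonneg)

text \<open>The norm of a vector of rows is the Frobenius norm, so Cauchy-Schwarz in each row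
  suffices.\<close>

lemma norm_matrix_vector_le:
  fixes A :: "real^'n^'m"
  shows "norm (A *v x) \<le> norm A * norm x"
proof -
  have "(norm (A *v x))\<^sup>2 = (\<Sum>i\<in>UNIV. (A $ i \<bullet> x)\<^sup>2)"
    by (simp add: power2_norm_vec[of "A *v x"] matrix_vector_mul_component)
  also have "\<dots> \<le> (\<Sum>i\<in>UNIV. (norm (A $ i) * norm x)\<^sup>2)"
  proof (rule sum_mono)
    fix i
    have "\<bar>A $ i \<bullet> x\<bar>\<^sup>2 \<le> (norm (A $ i) * norm x)\<^sup>2"
      by (rule power_mono[OF Cauchy_Schwarz_ineq2]) simp
    then show "(A $ i \<bullet> x)\<^sup>2 \<le> (norm (A $ i) * norm x)\<^sup>2" by simp
  qed
  also have "\<dots> = (\<Sum>i\<in>UNIV. (norm (A $ i))\<^sup>2) * (norm x)\<^sup>2"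
    by (simp add: power_mult_distrib sum_distrib_right)
  also have "(\<Sum>i\<in>UNIV. (norm (A $ i))\<^sup>2) = (norm A)\<^sup>2"
    by (rule power2_norm_vec[symmetric])
  finally have "(norm (A *v x))\<^sup>2 \<le> (norm A * norm x)\<^sup>2"
    by (simp add: power_mult_distrib)
  then show ?thesis by (rule power2_le_imp_le) simp
qed

lemma running_max_nonneg:
  assumes "\<And>k. 0 \<le> s k"
  shows "0 \<le> running_max s n"
  using order_trans[OF assms running_max_ge[of 0 n s]] by simp

text \<open>The martingale property in the form used for Doob's inequality: the weight
  \<open>g\<close> may depend on all earlier increments, because a running maximum does.\<close>

lemma (in prob_space) has_bochner_integral_indep_0:
  fixes D :: "nat \<Rightarrow> 'a \<Rightarrow> 'b::{second_countable_topology, real_normed_vector}"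
  assumes ind: "indep_vars (\<lambda>_. borel) D {..<Suc n}"
    and g: "g \<in> borel_measurable (Pi\<^sub>M {..<n} (\<lambda>_. borel))" and ig: "integrable M (\<lambda>\<omega>. g (\<lambda>k\<in>{..<n}. D k \<omega>) :: real)"
    and f: "f \<in> borel_measurable borel" and fi: "has_bochner_integral M (\<lambda>\<omega>. f (D n \<omega>)) (0::real)"
  shows "has_bochner_integral M (\<lambda>\<omega>. g (\<lambda>k\<in>{..<n}. D k \<omega>) * f (D n \<omega>)) 0"
proof -
  have fI: "integrable M (\<lambda>\<omega>. f (D n \<omega>))" "(\<integral>\<omega>. f (D n \<omega>) \<partial>M) = 0"
    using fi by (simp_all add: has_bochner_integral_iff)
  define K where "K = case_bool {..<n} {n}"
  have "indep_vars (\<lambda>j. Pi\<^sub>M (K j) (\<lambda>_. borel)) (\<lambda>j \<omega>. restrict (\<lambda>i. D i \<omega>) (K j)) UNIV"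
  proof (rule indep_vars_restrict[OF ind])
    show "K j \<subseteq> {..<Suc n}" for j by (cases j) (auto simp: K_def)
    show "disjoint_family_on K UNIV"
      by (auto simp: disjoint_family_on_def K_def split: bool.splits)
  qed
  then have "indep_vars (case_bool (Pi\<^sub>M {..<n} (\<lambda>_. borel)) (Pi\<^sub>M {n} (\<lambda>_. borel)))
      (case_bool (\<lambda>\<omega>. \<lambda>i\<in>{..<n}. D i \<omega>) (\<lambda>\<omega>. \<lambda>i\<in>{n}. D i \<omega>)) UNIV"
    by (rule indep_vars_cong[THEN iffD1, rotated 3]) (auto simp: K_def split: bool.split)
  then have iv: "indep_var (Pi\<^sub>M {..<n} (\<lambda>_. borel)) (\<lambda>\<omega>. \<lambda>i\<in>{..<n}. D i \<omega>) (Pi\<^sub>M {n} (\<lambda>_. borel)) (\<lambda>\<omega>. \<lambda>i\<in>{n}. D i \<omega>)"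
    by (simp add: indep_var_def)
  have f': "(\<lambda>s. f (s n)) \<in> borel_measurable (Pi\<^sub>M {n} (\<lambda>_. borel))"
    by (rule measurable_compose[OF _ f]) (rule measurable_component_singleton, simp)
  have iv': "indep_var borel (\<lambda>\<omega>. g (\<lambda>i\<in>{..<n}. D i \<omega>)) borel (\<lambda>\<omega>. f (D n \<omega>))"
    using indep_var_compose[OF iv g f'] by (simp add: comp_def)
  show ?thesis
    unfolding has_bochner_integral_iff
    using indep_var_integrable[OF iv' ig fI(1)] indep_var_lebesgue_integral[OF iv' ig fI(1)] fI(2) by simp
qed

lemma brownian_increment_moments:
  fixes B :: "real \<Rightarrow> 'a \<Rightarrow> real^'d"
  assumes B: "standard_brownian_motion P B" and st: "0 \<le> s" "s \<le> t"
  shows "has_bochner_integral P (\<lambda>\<omega>. (B t \<omega> - B s \<omega>) $ i) 0"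
    and "has_bochner_integral P (\<lambda>\<omega>. ((B t \<omega> - B s \<omega>) $ i)\<^sup>2) (t - s)"
proof -
  interpret prob_space P using B by (simp add: standard_brownian_motion_def)
  have "has_bochner_integral P (\<lambda>\<omega>. (B t \<omega> - B s \<omega>) $ i) 0 \<and>
    has_bochner_integral P (\<lambda>\<omega>. ((B t \<omega> - B s \<omega>) $ i)\<^sup>2) (t - s)"
  \<comment> \<open>The definition of Brownian motion prescribes laws for \<open>s < t\<close> only,
    while grids may repeat a time.\<close>
  proof (cases "s = t")
    case True
    then show ?thesis by (simp add: has_bochner_integral_zero)
  next
    case False
    with st have lt: "s < t" by simp
    let ?X = "\<lambda>\<omega>. (B t \<omega> - B s \<omega>) $ i"
    let ?S = "sqrt (t - s)"
    have S: "0 < ?S" "?S\<^sup>2 = t - s" using lt by simp_all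
    have D: "distributed P lborel ?X (\<lambda>x. ennreal (normal_density 0 ?S x))"
      using B st lt by (simp add: standard_brownian_motion_def)
    have d1: "has_bochner_integral lborel (\<lambda>x. normal_density 0 ?S x * x) 0"
      using normal_moment_odd[OF S(1), of 0 0] by simp
    have d2: "has_bochner_integral lborel (\<lambda>x. normal_density 0 ?S x * x\<^sup>2) (t - s)"
      using normal_moment_even[OF S(1), of 0 1] S by (simp add: fact_numeral diff_divide_distrib)
    have "has_bochner_integral P ?X 0"
      using d1 distributed_integrable[OF D, of "\<lambda>x. x"] distributed_integral[OF D, of "\<lambda>x. x"]
      by (simp add: has_bochner_integral_iff)
    moreover have "has_bochner_integral P (\<lambda>\<omega>. (?X \<omega>)\<^sup>2) (t - s)"
      using d2 distributed_integrable[OF D, of "\<lambda>x. x\<^sup>2"] distributed_integral[OF D, of "\<lambda>x. x\<^sup>2"]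
      by (simp add: has_bochner_integral_iff)
    ultimately show ?thesis ..
  qed
  then show "has_bochner_integral P (\<lambda>\<omega>. (B t \<omega> - B s \<omega>) $ i) 0"
    and "has_bochner_integral P (\<lambda>\<omega>. ((B t \<omega> - B s \<omega>) $ i)\<^sup>2) (t - s)" by simp_all
qed

text \<open>Three factors make up the constant: 4 from Doob's inequality, the dimension as a bound
  for the second moment of Brownian motion up to time 1, and the squared Frobenius norm from the
  matrix.\<close>

lemma brownian_max_bound:
  fixes B :: "real \<Rightarrow> 'a \<Rightarrow> real^'d" and A :: "real^'d^'d"
  assumes B: "standard_brownian_motion P B" and t: "mono t" "0 \<le> t 0" "t n \<le> 1"
  shows "(\<integral>\<^sup>+\<omega>. ennreal ((running_max (\<lambda>k. norm (A *v B (t k) \<omega>)) n)\<^sup>2) \<partial>P)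
    \<le> ennreal (4 * (real CARD('d) * (norm A)\<^sup>2))"
proof -
  interpret prob_space P using B by (simp add: standard_brownian_motion_def)
  have mB: "B u \<in> borel_measurable P" if "0 \<le> u" for u
    using B that by (simp add: standard_brownian_motion_def)
  have t0: "0 \<le> t k" for k using t(1,2) monoD[OF t(1), of 0 k] by simp
  \<comment> \<open>Time 0 is put in front of the grid, so that the sum of the increments with
    indices up to \<open>k\<close> telescopes to the value at \<open>t k\<close> minus the value at
    0.\<close>
  define ts where "ts = (\<lambda>k. case k of 0 \<Rightarrow> 0 | Suc j \<Rightarrow> t j)"
  have ts_mono: "mono ts"
    unfolding ts_def mono_def using t0 monoD[OF t(1)] by (auto split: nat.split)
  have ts0: "0 \<le> ts k" for k using t0 by (simp add: ts_def split: nat.split)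
  have ts_step: "ts k \<le> ts (Suc k)" for k by (rule monoD[OF ts_mono]) simp
  define D where "D = (\<lambda>k \<omega>. B (ts (Suc k)) \<omega> - B (ts k) \<omega>)"
  have mD [measurable]: "D k \<in> borel_measurable P" for k
    unfolding D_def by (rule borel_measurable_diff[OF mB[OF ts0] mB[OF ts0]])
  have ind: "indep_vars (\<lambda>_. borel) D {..<m}" for m
    using B ts_mono ts0[of 0] by (simp add: standard_brownian_motion_def independent_increments_def D_def)
  define S where "S = (\<lambda>k \<omega>. A *v (\<Sum>j\<le>k. D j \<omega>))"
  have tel: "(\<Sum>j\<le>k. D j \<omega>) = B (t k) \<omega> - B 0 \<omega>" for k \<omega>
    by (induction k) (simp_all add: D_def ts_def)
  have lin [measurable]: "(\<lambda>x. A *v x) \<in> borel_measurable borel"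
    by (intro borel_measurable_continuous_onI matrix_vector_mult_linear_continuous_on)
  have mS: "S k \<in> borel_measurable P" for k
    unfolding S_def by (rule measurable_compose[OF _ lin]) measurable
  have S_sq: "has_bochner_integral P (\<lambda>\<omega>. (norm (B (t k) \<omega> - B 0 \<omega>))\<^sup>2) (real CARD('d) * t k)" for k
  proof -
    have "has_bochner_integral P (\<lambda>\<omega>. \<Sum>i\<in>UNIV. ((B (t k) \<omega> - B 0 \<omega>) $ i)\<^sup>2) (\<Sum>i\<in>(UNIV::'d set). t k - 0)"
      by (rule has_bochner_integral_sum) (rule brownian_increment_moments(2)[OF B order_refl t0])
    then show ?thesis
      unfolding power2_norm_vec by simp
  qed
  have S_le: "(norm (S k \<omega>))\<^sup>2 \<le> (norm A)\<^sup>2 * (norm (B (t k) \<omega> - B 0 \<omega>))\<^sup>2" for k \<omega>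
    using power_mono[OF norm_matrix_vector_le[of A "B (t k) \<omega> - B 0 \<omega>"], of 2]
    by (simp add: S_def tel power_mult_distrib)
  have iS2: "integrable P (\<lambda>\<omega>. (norm (S k \<omega>))\<^sup>2)" for k
  proof (rule Bochner_Integration.integrable_bound)
    show "integrable P (\<lambda>\<omega>. (norm A)\<^sup>2 * (norm (B (t k) \<omega> - B 0 \<omega>))\<^sup>2)"
      using S_sq[of k] by (simp add: has_bochner_integral_iff)
    show "(\<lambda>\<omega>. (norm (S k \<omega>))\<^sup>2) \<in> borel_measurable P"
      using mS[of k] by measurable
    show "AE \<omega> in P. norm ((norm (S k \<omega>))\<^sup>2) \<le> norm ((norm A)\<^sup>2 * (norm (B (t k) \<omega> - B 0 \<omega>))\<^sup>2)"
      using S_le[of k] by (intro AE_I2) simp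
  qed
  have iS: "integrable P (\<lambda>\<omega>. norm (S k \<omega>))" for k
    using square_integrable_imp_integrable[of "\<lambda>\<omega>. norm (S k \<omega>)"] mS[of k] iS2[of k] by simp
  have orth: "has_bochner_integral P
      (\<lambda>\<omega>. running_max (\<lambda>k. norm (S k \<omega>)) i * (sgn (S i \<omega>) \<bullet> (S (Suc i) \<omega> - S i \<omega>))) 0" for i
  proof -
    define T :: "nat \<Rightarrow> (nat \<Rightarrow> real^'d) \<Rightarrow> real^'d" where "T = (\<lambda>k s. A *v (\<Sum>j\<le>k. s j :: real^'d))"
    \<comment> \<open>The cut-off at \<open>i\<close> ensures that \<open>G\<close> reads only the
      first \<open>i + 1\<close> increments; later values of \<open>T\<close> would use coordinates
      outside the product space.\<close>
    define G where "G = (\<lambda>c s. running_max (\<lambda>k. if k \<le> i then norm (T k s) else 0) i * sgn (T i s) $ c)"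
    have T_eq: "T k (\<lambda>j\<in>{..<Suc i}. D j \<omega>) = S k \<omega>" if "k \<le> i" for k \<omega>
      using that by (simp add: T_def S_def)
    have mT: "T k \<in> borel_measurable (Pi\<^sub>M {..<Suc i} (\<lambda>_. borel))" if "k \<le> i" for k
      unfolding T_def
    proof (rule measurable_compose[OF borel_measurable_sum lin])
      fix j assume "j \<in> {..k}"
      with that show "(\<lambda>s. s j) \<in> borel_measurable (Pi\<^sub>M {..<Suc i} (\<lambda>_. borel))"
        by (intro measurable_component_singleton) simp
    qed
    have nth [measurable]: "(\<lambda>x::real^'d. x $ c) \<in> borel_measurable borel" for c
      by (intro borel_measurable_continuous_onI continuous_intros)
    have mG: "G c \<in> borel_measurable (Pi\<^sub>M {..<Suc i} (\<lambda>_. borel))" for c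
      unfolding G_def
    proof (rule borel_measurable_times)
      show "(\<lambda>s. running_max (\<lambda>k. if k \<le> i then norm (T k s) else 0) i) \<in> borel_measurable (Pi\<^sub>M {..<Suc i} (\<lambda>_. borel))"
      proof (rule running_max_measurable)
        fix k show "(\<lambda>s. if k \<le> i then norm (T k s) else 0) \<in> borel_measurable (Pi\<^sub>M {..<Suc i} (\<lambda>_. borel))"
          using mT[of k] by (cases "k \<le> i") simp_all
      qed
      have "(\<lambda>x::real^'d. sgn x $ c) \<in> borel_measurable borel"
        by (rule measurable_compose[OF _ nth]) measurable
      then show "(\<lambda>s. sgn (T i s) $ c) \<in> borel_measurable (Pi\<^sub>M {..<Suc i} (\<lambda>_. borel))"
        by (rule measurable_compose[OF mT[OF order_refl]])
    qed
    have rm: "running_max (\<lambda>k. if k \<le> i then norm (S k \<omega>) else 0) m = running_max (\<lambda>k. norm (S k \<omega>)) m" if "m \<le> i" for m \<omega>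
      using that by (induction m) simp_all
    have G_eq: "G c (\<lambda>j\<in>{..<Suc i}. D j \<omega>) = running_max (\<lambda>k. norm (S k \<omega>)) i * sgn (S i \<omega>) $ c" for c \<omega>
    proof -
      have "(\<lambda>k. if k \<le> i then norm (T k (\<lambda>j\<in>{..<Suc i}. D j \<omega>)) else 0) = (\<lambda>k. if k \<le> i then norm (S k \<omega>) else 0)"
        by (rule ext) (simp add: T_eq)
      then show ?thesis unfolding G_def by (simp only: T_eq[OF order_refl] rm[OF order_refl])
    qed
    have mrm: "(\<lambda>\<omega>. running_max (\<lambda>k. norm (S k \<omega>)) i) \<in> borel_measurable P"
      by (rule running_max_measurable) (rule measurable_compose[OF mS borel_measurable_norm])
    have iG: "integrable P (\<lambda>\<omega>. G c (\<lambda>j\<in>{..<Suc i}. D j \<omega>))" for c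
      unfolding G_eq
    proof (rule Bochner_Integration.integrable_bound)
      show "integrable P (\<lambda>\<omega>. \<Sum>k\<le>i. norm (S k \<omega>))"
        by (rule Bochner_Integration.integrable_sum) (rule iS)
      have "(\<lambda>x::real^'d. sgn x $ c) \<in> borel_measurable borel"
        by (rule measurable_compose[OF _ nth]) measurable
      then have "(\<lambda>\<omega>. sgn (S i \<omega>) $ c) \<in> borel_measurable P"
        by (rule measurable_compose[OF mS])
      then show "(\<lambda>\<omega>. running_max (\<lambda>k. norm (S k \<omega>)) i * sgn (S i \<omega>) $ c) \<in> borel_measurable P"
        by (rule borel_measurable_times[OF mrm])
      show "AE \<omega> in P. norm (running_max (\<lambda>k. norm (S k \<omega>)) i * sgn (S i \<omega>) $ c) \<le> norm (\<Sum>k\<le>i. norm (S k \<omega>))"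
      proof (rule AE_I2)
        fix \<omega>
        have "\<bar>sgn (S i \<omega>) $ c\<bar> \<le> 1"
          using component_le_norm_cart[of "sgn (S i \<omega>)" c] by (simp add: norm_sgn split: if_splits)
        moreover have "0 \<le> running_max (\<lambda>k. norm (S k \<omega>)) i" by (rule running_max_nonneg) simp
        ultimately have "\<bar>running_max (\<lambda>k. norm (S k \<omega>)) i * sgn (S i \<omega>) $ c\<bar> \<le> running_max (\<lambda>k. norm (S k \<omega>)) i"
          by (simp add: abs_mult mult_left_le)
        also have "\<dots> \<le> (\<Sum>k\<le>i. norm (S k \<omega>))" by (rule running_max_le_sum) simp
        also have "\<dots> \<le> \<bar>\<Sum>k\<le>i. norm (S k \<omega>)\<bar>" by (rule abs_ge_self)
        finally show "norm (running_max (\<lambda>k. norm (S k \<omega>)) i * sgn (S i \<omega>) $ c) \<le> norm (\<Sum>k\<le>i. norm (S k \<omega>))"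
          by simp
      qed
    qed
    have f0: "has_bochner_integral P (\<lambda>\<omega>. (A *v D (Suc i) \<omega>) $ c) 0" for c
    proof -
      have "has_bochner_integral P (\<lambda>\<omega>. \<Sum>j\<in>UNIV. A $ c $ j * (D (Suc i) \<omega> $ j)) (\<Sum>j\<in>(UNIV::'d set). A $ c $ j * 0)"
        unfolding D_def
        by (rule has_bochner_integral_sum, rule has_bochner_integral_mult_right)
           (rule brownian_increment_moments(1)[OF B ts0 ts_step])
      then show ?thesis by (simp add: matrix_vector_mult_def)
    qed
    have mf: "(\<lambda>x::real^'d. (A *v x) $ c) \<in> borel_measurable borel" for c
      by (rule measurable_compose[OF lin nth])
    have "has_bochner_integral P (\<lambda>\<omega>. \<Sum>c\<in>UNIV. G c (\<lambda>j\<in>{..<Suc i}. D j \<omega>) * (A *v D (Suc i) \<omega>) $ c) (\<Sum>c\<in>(UNIV::'d set). 0)"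
      by (rule has_bochner_integral_sum) (rule has_bochner_integral_indep_0[OF ind mG iG mf f0])
    moreover have "(\<Sum>c\<in>UNIV. G c (\<lambda>j\<in>{..<Suc i}. D j \<omega>) * (A *v D (Suc i) \<omega>) $ c)
        = running_max (\<lambda>k. norm (S k \<omega>)) i * (sgn (S i \<omega>) \<bullet> (S (Suc i) \<omega> - S i \<omega>))" for \<omega>
    proof -
      have "S (Suc i) \<omega> - S i \<omega> = A *v D (Suc i) \<omega>"
        by (simp add: S_def matrix_vector_right_distrib)
      then show ?thesis
        unfolding G_eq by (simp add: inner_vec_def sum_distrib_left mult.assoc)
    qed
    ultimately show ?thesis by simp
  qed
  \<comment> \<open>\<open>S\<close> is built from the increments since time 0 and agrees with the
    process only where it starts at 0.\<close>
  have "AE \<omega> in P. B 0 \<omega> = 0" using B by (simp add: standard_brownian_motion_def)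
  then have "(\<integral>\<^sup>+\<omega>. ennreal ((running_max (\<lambda>k. norm (A *v B (t k) \<omega>)) n)\<^sup>2) \<partial>P)
      = (\<integral>\<^sup>+\<omega>. ennreal ((running_max (\<lambda>k. norm (S k \<omega>)) n)\<^sup>2) \<partial>P)"
    by (intro nn_integral_cong_AE, eventually_elim) (simp add: S_def tel)
  also have "\<dots> \<le> 4 * (\<integral>\<^sup>+\<omega>. ennreal ((norm (S n \<omega>))\<^sup>2) \<partial>P)"
    by (rule doob_L2[OF mS orth])
  also have "\<dots> = 4 * ennreal (\<integral>\<omega>. (norm (S n \<omega>))\<^sup>2 \<partial>P)"
    using iS2[of n] by (subst nn_integral_eq_integral) simp_all
  also have "(\<integral>\<omega>. (norm (S n \<omega>))\<^sup>2 \<partial>P) \<le> real CARD('d) * (norm A)\<^sup>2"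
  proof -
    have "(\<integral>\<omega>. (norm (S n \<omega>))\<^sup>2 \<partial>P) \<le> (\<integral>\<omega>. (norm A)\<^sup>2 * (norm (B (t n) \<omega> - B 0 \<omega>))\<^sup>2 \<partial>P)"
    proof (rule integral_mono[OF iS2 _ S_le])
      show "integrable P (\<lambda>\<omega>. (norm A)\<^sup>2 * (norm (B (t n) \<omega> - B 0 \<omega>))\<^sup>2)"
        using S_sq[of n] by (simp add: has_bochner_integral_iff)
    qed
    also have "\<dots> = (norm A)\<^sup>2 * (real CARD('d) * t n)"
      using S_sq[of n] by (simp add: has_bochner_integral_iff)
    also have "\<dots> \<le> (norm A)\<^sup>2 * (real CARD('d) * 1)"
      using t(3) by (intro mult_left_mono) simp_all
    finally show ?thesis by (simp add: mult.commute)
  qed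
  then have "4 * ennreal (\<integral>\<omega>. (norm (S n \<omega>))\<^sup>2 \<partial>P) \<le> 4 * ennreal (real CARD('d) * (norm A)\<^sup>2)"
    by (intro mult_left_mono ennreal_leI) simp_all
  also have "\<dots> = ennreal (4 * (real CARD('d) * (norm A)\<^sup>2))"
    by (simp add: ennreal_mult)
  finally show ?thesis .
qed

section \<open>The compensated part\<close>

lemma running_max_cong: "(\<And>k. k \<le> n \<Longrightarrow> f k = g k) \<Longrightarrow> running_max f n = running_max g n"
  by (induction n) simp_all

lemma tendsto_running_max:
  assumes "\<And>k. k \<le> n \<Longrightarrow> (\<lambda>j. f j k) \<longlonglongrightarrow> l k"
  shows "(\<lambda>j. running_max (f j) n) \<longlonglongrightarrow> running_max l n"
  using assms by (induction n) (simp_all add: tendsto_max)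

context comonotonic_coupling
begin

definition component :: "(real \<times> (real^'d) \<Rightarrow> real) \<Rightarrow> 'd \<Rightarrow> real \<times> (real^'d) \<Rightarrow> real" where
  "component \<phi> c p = \<phi> p * snd p $ c"

definition windowed :: "(real \<times> (real^'d) \<Rightarrow> real) \<Rightarrow> real set \<Rightarrow> 'd \<Rightarrow> real \<times> real \<times> (real^'d) \<Rightarrow> real" where
  "windowed \<phi> A c p = indicator A (fst (snd p)) * component \<phi> c (fst p, snd (snd p))"

text \<open>Assembled from coordinates, since the moment formulas for \<open>total\<close> are about
  real-valued sums.\<close>

definition compensated :: "(real \<times> (real^'d) \<Rightarrow> real) \<Rightarrow> real \<Rightarrow> (nat \<Rightarrow> real \<times> real \<times> (real^'d)) \<Rightarrow> real^'d" where
  "compensated \<phi> t s = (\<chi> c. total (windowed \<phi> {0..t} c) s - (\<integral>p. windowed \<phi> {0..t} c p \<partial>intensity))"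

definition level_integrand :: "(real \<times> (real^'d) \<Rightarrow> real) \<Rightarrow> bool" where
  "level_integrand \<phi> \<longleftrightarrow> integrable (lborel \<Otimes>\<^sub>M \<sigma>) \<phi> \<and> (\<forall>x v. x \<le> 0 \<longrightarrow> \<phi> (x, v) = 0)"

lemma abs_component_le: "p \<in> space (lborel \<Otimes>\<^sub>M \<sigma>) \<Longrightarrow> \<bar>component \<phi> c p\<bar> \<le> \<bar>\<phi> p\<bar>"
  using component_le_norm_cart[of "snd p" c]
  by (auto simp: component_def abs_mult space_pair_measure space_sigma mult_left_le)

lemma measurable_component:
  assumes "\<phi> \<in> borel_measurable (lborel \<Otimes>\<^sub>M \<sigma>)"
  shows "component \<phi> c \<in> borel_measurable (lborel \<Otimes>\<^sub>M \<sigma>)"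
  unfolding component_def[abs_def]
  by (rule borel_measurable_times[OF assms measurable_compose[OF measurable_snd measurable_direction_nth]])

lemma component_integrable:
  assumes "level_integrand \<phi>"
  shows "level_integrand (component \<phi> c)"
proof -
  have \<phi>: "integrable (lborel \<Otimes>\<^sub>M \<sigma>) \<phi>" using assms by (simp add: level_integrand_def)
  have "integrable (lborel \<Otimes>\<^sub>M \<sigma>) (component \<phi> c)"
  proof (rule Bochner_Integration.integrable_bound[OF \<phi>])
    show "component \<phi> c \<in> borel_measurable (lborel \<Otimes>\<^sub>M \<sigma>)"
      by (rule measurable_component[OF borel_measurable_integrable[OF \<phi>]])
    show "AE p in lborel \<Otimes>\<^sub>M \<sigma>. norm (component \<phi> c p) \<le> norm (\<phi> p)"
      by (rule AE_I2) (simp add: abs_component_le)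
  qed
  with assms show ?thesis by (simp add: level_integrand_def component_def)
qed

lemma windowed_integral:
  assumes "level_integrand \<phi>" "A \<in> sets borel"
  shows "has_bochner_integral intensity (windowed \<phi> A c) (measure uni A * (\<integral>p. component \<phi> c p \<partial>(lborel \<Otimes>\<^sub>M \<sigma>)))"
  using intensity_product[of "component \<phi> c" A] component_integrable[OF assms(1), of c] assms(2)
  unfolding windowed_def[abs_def] level_integrand_def by blast

lemma windowed_integrable:
  assumes "level_integrand \<phi>" "A \<in> sets borel"
  shows "integrable intensity (windowed \<phi> A c)"
  using windowed_integral[OF assms] by (simp add: has_bochner_integral_iff)

lemma measurable_windowed:
  assumes "level_integrand \<phi>" "A \<in> sets borel"
  shows "windowed \<phi> A c \<in> borel_measurable point_space"
  using borel_measurable_integrable[OF windowed_integrable[OF assms]] measurable_cong_sets[OF sets_intensity refl] by blast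

lemma measurable_compensated:
  assumes "level_integrand \<phi>"
  shows "compensated \<phi> t \<in> borel_measurable points_space"
proof (rule borel_measurable_euclidean_space[THEN iffD2], rule ballI)
  fix b :: "real^'d" assume "b \<in> Basis"
  then obtain c where b: "b = axis c 1" by (auto simp: Basis_vec_def)
  have "total (windowed \<phi> {0..t} c) \<in> borel_measurable points_space"
    by (rule borel_measurable_total[OF measurable_windowed[OF assms]]) simp
  then show "(\<lambda>s. compensated \<phi> t s \<bullet> b) \<in> borel_measurable points_space"
    unfolding b by (simp add: inner_axis compensated_def)
qed

lemma measurable_compensated_points:
  assumes "level_integrand \<phi>"
  shows "(\<lambda>\<omega>. compensated \<phi> t (points \<omega>)) \<in> borel_measurable P"
  by (rule measurable_compose[OF z_measurable measurable_compensated[OF assms]])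

text \<open>The variances of the coordinates add up, and because directions are unit vectors the
  squared components sum to \<open>(\<phi> p)\<^sup>2\<close>.\<close>

lemma compensated_variance:
  assumes \<phi>: "level_integrand \<phi>" and \<phi>2: "integrable (lborel \<Otimes>\<^sub>M \<sigma>) (\<lambda>p. (\<phi> p)\<^sup>2)"
  shows "has_bochner_integral P (\<lambda>\<omega>. (norm (compensated \<phi> t (points \<omega>)))\<^sup>2)
    (measure uni {0..t} * (\<integral>p. (\<phi> p)\<^sup>2 \<partial>(lborel \<Otimes>\<^sub>M \<sigma>)))"
proof -
  have m: "\<phi> \<in> borel_measurable (lborel \<Otimes>\<^sub>M \<sigma>)"
    using \<phi> by (simp add: level_integrand_def borel_measurable_integrable)
  have sq: "integrable (lborel \<Otimes>\<^sub>M \<sigma>) (\<lambda>p. (component \<phi> c p)\<^sup>2)" for c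
  proof (rule Bochner_Integration.integrable_bound[OF \<phi>2])
    show "(\<lambda>p. (component \<phi> c p)\<^sup>2) \<in> borel_measurable (lborel \<Otimes>\<^sub>M \<sigma>)"
      by (rule borel_measurable_power[OF measurable_component[OF m]])
    show "AE p in lborel \<Otimes>\<^sub>M \<sigma>. norm ((component \<phi> c p)\<^sup>2) \<le> norm ((\<phi> p)\<^sup>2)"
      by (rule AE_I2) (simp add: abs_component_le abs_le_square_iff[symmetric])
  qed
  have win: "has_bochner_integral intensity (\<lambda>p. (windowed \<phi> {0..t} c p)\<^sup>2)
      (measure uni {0..t} * (\<integral>p. (component \<phi> c p)\<^sup>2 \<partial>(lborel \<Otimes>\<^sub>M \<sigma>)))" for c
  proof -
    have "(windowed \<phi> {0..t} c p)\<^sup>2 = indicator {0..t} (fst (snd p)) * (component \<phi> c (fst p, snd (snd p)))\<^sup>2" for p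
      by (simp add: windowed_def power_mult_distrib indicator_def)
    moreover have "(component \<phi> c (x, v))\<^sup>2 = 0" if "x \<le> 0" for x v
      using component_integrable[OF \<phi>, of c] that by (simp add: level_integrand_def)
    ultimately show ?thesis
      using intensity_product[OF sq, of c "{0..t}"] by simp
  qed
  have "has_bochner_integral P (\<lambda>\<omega>. \<Sum>c\<in>UNIV. (total (windowed \<phi> {0..t} c) (points \<omega>) - (\<integral>p. windowed \<phi> {0..t} c p \<partial>intensity))\<^sup>2)
      (\<Sum>c\<in>UNIV. \<integral>p. (windowed \<phi> {0..t} c p)\<^sup>2 \<partial>intensity)"
    by (rule has_bochner_integral_sum, rule total_variance)
       (use win in \<open>simp_all add: windowed_integrable[OF \<phi>] has_bochner_integral_iff\<close>)
  moreover have "(\<Sum>c\<in>UNIV. \<integral>p. (windowed \<phi> {0..t} c p)\<^sup>2 \<partial>intensity)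
      = measure uni {0..t} * (\<integral>p. (\<phi> p)\<^sup>2 \<partial>(lborel \<Otimes>\<^sub>M \<sigma>))"
  proof -
    have "(\<Sum>c\<in>UNIV. \<integral>p. (windowed \<phi> {0..t} c p)\<^sup>2 \<partial>intensity)
        = measure uni {0..t} * (\<Sum>c\<in>UNIV. \<integral>p. (component \<phi> c p)\<^sup>2 \<partial>(lborel \<Otimes>\<^sub>M \<sigma>))"
      using win by (simp add: has_bochner_integral_iff sum_distrib_left)
    also have "(\<Sum>c\<in>UNIV. \<integral>p. (component \<phi> c p)\<^sup>2 \<partial>(lborel \<Otimes>\<^sub>M \<sigma>)) = (\<integral>p. (\<Sum>c\<in>UNIV. (component \<phi> c p)\<^sup>2) \<partial>(lborel \<Otimes>\<^sub>M \<sigma>))"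
      by (rule Bochner_Integration.integral_sum[symmetric]) (rule sq)
    also have "\<dots> = (\<integral>p. (\<phi> p)\<^sup>2 \<partial>(lborel \<Otimes>\<^sub>M \<sigma>))"
    proof (rule Bochner_Integration.integral_cong[OF refl])
      fix p assume "p \<in> space (lborel \<Otimes>\<^sub>M \<sigma> :: (real \<times> (real^'d)) measure)"
      then have "norm (snd p) = 1" by (auto simp: space_pair_measure space_sigma)
      then have "(\<Sum>c\<in>UNIV. (snd p $ c)\<^sup>2) = 1" using power2_norm_vec[of "snd p"] by simp
      then show "(\<Sum>c\<in>UNIV. (component \<phi> c p)\<^sup>2) = (\<phi> p)\<^sup>2"
        by (simp add: component_def power_mult_distrib sum_distrib_left[symmetric])
    qed
    finally show ?thesis .
  qed
  ultimately show ?thesis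
    by (simp add: compensated_def power2_norm_vec)
qed

lemma compensated_increment:
  assumes \<phi>: "level_integrand \<phi>" and st: "0 \<le> s" "s \<le> t"
  shows "AE \<omega> in P. \<forall>c. compensated \<phi> t (points \<omega>) $ c - compensated \<phi> s (points \<omega>) $ c
    = total (windowed \<phi> {s<..t} c) (points \<omega>) - (\<integral>p. windowed \<phi> {s<..t} c p \<partial>intensity)"
proof -
  have split: "windowed \<phi> {0..t} c p = windowed \<phi> {0..s} c p + windowed \<phi> {s<..t} c p" for c p
    using st by (auto simp: windowed_def indicator_def)
  have i: "integrable intensity (windowed \<phi> {0..s} c)" "integrable intensity (windowed \<phi> {s<..t} c)" for c
    by (rule windowed_integrable[OF \<phi>], simp)+
  have "AE \<omega> in P. \<forall>c. integrable (count_space UNIV) (\<lambda>n. windowed \<phi> {0..s} c (points \<omega> n))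
      \<and> integrable (count_space UNIV) (\<lambda>n. windowed \<phi> {s<..t} c (points \<omega> n))"
  proof (subst AE_all_countable, rule allI)
    fix c
    show "AE \<omega> in P. integrable (count_space UNIV) (\<lambda>n. windowed \<phi> {0..s} c (points \<omega> n))
      \<and> integrable (count_space UNIV) (\<lambda>n. windowed \<phi> {s<..t} c (points \<omega> n))"
      by (rule AE_conjI[OF AE_integrable_total[OF i(1)] AE_integrable_total[OF i(2)]])
  qed
  then show ?thesis
  proof eventually_elim
    case (elim \<omega>)
    have "total (windowed \<phi> {0..t} c) (points \<omega>) = total (windowed \<phi> {0..s} c) (points \<omega>) + total (windowed \<phi> {s<..t} c) (points \<omega>)" for c
      unfolding total_def split using elim by (intro Bochner_Integration.integral_add) simp_all
    moreover have "(\<integral>p. windowed \<phi> {0..t} c p \<partial>intensity) = (\<integral>p. windowed \<phi> {0..s} c p \<partial>intensity) + (\<integral>p. windowed \<phi> {s<..t} c p \<partial>intensity)" for c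
      unfolding split by (rule Bochner_Integration.integral_add[OF i])
    ultimately show ?case by (simp add: compensated_def)
  qed
qed

text \<open>Doob's inequality with \<open>total_orthogonal\<close> in the role of the martingale
  property; the final factor is the probability of the time window, at most 1.\<close>

lemma compensated_max_bound:
  assumes \<phi>: "level_integrand \<phi>" and \<phi>2: "integrable (lborel \<Otimes>\<^sub>M \<sigma>) (\<lambda>p. (\<phi> p)\<^sup>2)"
    and t: "mono t" "\<And>k. 0 \<le> t k"
  shows "(\<integral>\<^sup>+\<omega>. ennreal ((running_max (\<lambda>k. norm (compensated \<phi> (t k) (points \<omega>))) n)\<^sup>2) \<partial>P)
    \<le> ennreal (4 * (\<integral>p. (\<phi> p)\<^sup>2 \<partial>(lborel \<Otimes>\<^sub>M \<sigma>)))"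
proof -
  let ?S = "\<lambda>k \<omega>. compensated \<phi> (t k) (points \<omega>)"
  have mC: "compensated \<phi> u \<in> borel_measurable points_space" for u
    by (rule measurable_compensated[OF \<phi>])
  have mS: "?S k \<in> borel_measurable P" for k
    by (rule measurable_compensated_points[OF \<phi>])
  have iS2: "integrable P (\<lambda>\<omega>. (norm (?S k \<omega>))\<^sup>2)" for k
    using compensated_variance[OF \<phi> \<phi>2, of "t k"] by (simp add: has_bochner_integral_iff)
  have iS: "integrable P (\<lambda>\<omega>. norm (?S k \<omega>))" for k
    by (rule square_integrable_imp_integrable[OF measurable_compose[OF mS borel_measurable_norm] iS2])
  have orth: "has_bochner_integral P
      (\<lambda>\<omega>. running_max (\<lambda>k. norm (?S k \<omega>)) i * (sgn (?S i \<omega>) \<bullet> (?S (Suc i) \<omega> - ?S i \<omega>))) 0" for i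
  proof -
    define G where "G = (\<lambda>c s. running_max (\<lambda>k. norm (compensated \<phi> (t k) s)) i * sgn (compensated \<phi> (t i) s) $ c)"
    have nth: "(\<lambda>x::real^'d. x $ c) \<in> borel_measurable borel" for c
      by (intro borel_measurable_continuous_onI continuous_intros)
    have sgn_nth: "(\<lambda>x::real^'d. sgn x $ c) \<in> borel_measurable borel" for c
      by (rule measurable_compose[OF _ nth]) measurable
    have mG: "G c \<in> borel_measurable points_space" for c
      unfolding G_def
      by (rule borel_measurable_times[OF running_max_measurable measurable_compose[OF mC sgn_nth]])
         (rule measurable_compose[OF mC borel_measurable_norm])
    have iG: "integrable P (\<lambda>\<omega>. G c (points \<omega>))" for c
    proof (rule Bochner_Integration.integrable_bound)
      show "integrable P (\<lambda>\<omega>. \<Sum>k\<le>i. norm (?S k \<omega>))"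
        by (rule Bochner_Integration.integrable_sum) (rule iS)
      show "(\<lambda>\<omega>. G c (points \<omega>)) \<in> borel_measurable P"
        by (rule measurable_compose[OF z_measurable mG])
      show "AE \<omega> in P. norm (G c (points \<omega>)) \<le> norm (\<Sum>k\<le>i. norm (?S k \<omega>))"
      proof (rule AE_I2)
        fix \<omega>
        have "\<bar>sgn (?S i \<omega>) $ c\<bar> \<le> 1"
          using component_le_norm_cart[of "sgn (?S i \<omega>)" c] by (simp add: norm_sgn split: if_splits)
        moreover have "0 \<le> running_max (\<lambda>k. norm (?S k \<omega>)) i" by (rule running_max_nonneg) simp
        ultimately have "\<bar>G c (points \<omega>)\<bar> \<le> running_max (\<lambda>k. norm (?S k \<omega>)) i"
          unfolding G_def by (simp add: abs_mult mult_left_le)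
        also have "\<dots> \<le> (\<Sum>k\<le>i. norm (?S k \<omega>))" by (rule running_max_le_sum) simp
        also have "\<dots> \<le> \<bar>\<Sum>k\<le>i. norm (?S k \<omega>)\<bar>" by (rule abs_ge_self)
        finally show "norm (G c (points \<omega>)) \<le> norm (\<Sum>k\<le>i. norm (?S k \<omega>))" by simp
      qed
    qed
    let ?h = "\<lambda>c. windowed \<phi> {t i<..t (Suc i)} c"
    \<comment> \<open>A point counted in the next increment has a time after \<open>t i\<close>,
      whereas the weight depends only on points with times up to \<open>t i\<close>; deleting it
      leaves the weight unchanged.\<close>
    have ign: "G c (\<lambda>k. s (skip n k)) = G c s" if "?h c' (s n) \<noteq> 0" for c c' s n
    proof -
      have u: "t i < fst (snd (s n))" using that by (auto simp: windowed_def indicator_def split: if_splits)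
      have "compensated \<phi> (t k) (\<lambda>k. s (skip n k)) = compensated \<phi> (t k) s" if "k \<le> i" for k
      proof -
        have "t k < fst (snd (s n))" using monoD[OF t(1) that] u by simp
        then have "windowed \<phi> {0..t k} c (s n) = 0" for c by (simp add: windowed_def)
        then have "total (windowed \<phi> {0..t k} c) (\<lambda>k. s (skip n k)) = total (windowed \<phi> {0..t k} c) s" for c
          by (rule total_skip)
        then show ?thesis by (simp only: compensated_def)
      qed
      then show ?thesis
        unfolding G_def by (intro arg_cong2[where f = "(*)"] running_max_cong) simp_all
    qed
    have "has_bochner_integral P (\<lambda>\<omega>. \<Sum>c\<in>UNIV. G c (points \<omega>) * (total (?h c) (points \<omega>) - (\<integral>p. ?h c p \<partial>intensity))) (\<Sum>c\<in>(UNIV::'d set). 0)"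
    proof (rule has_bochner_integral_sum)
      fix c :: 'd
      show "has_bochner_integral P (\<lambda>\<omega>. G c (points \<omega>) * (total (?h c) (points \<omega>) - (\<integral>p. ?h c p \<partial>intensity))) 0"
        by (rule total_orthogonal[OF mG _ iG ign]) (rule windowed_integrable[OF \<phi>], simp)
    qed
    moreover have "AE \<omega> in P. (\<Sum>c\<in>UNIV. G c (points \<omega>) * (total (?h c) (points \<omega>) - (\<integral>p. ?h c p \<partial>intensity)))
        = running_max (\<lambda>k. norm (?S k \<omega>)) i * (sgn (?S i \<omega>) \<bullet> (?S (Suc i) \<omega> - ?S i \<omega>))"
      using compensated_increment[OF \<phi> t(2)[of i] monoD[OF t(1) le_SucI[OF order_refl]]]
    proof eventually_elim
      case (elim \<omega>)
      show ?case
        unfolding inner_vec_def vector_minus_component sum_distrib_left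
        by (intro sum.cong refl) (simp add: elim[rule_format, symmetric] G_def mult.assoc)
    qed
    ultimately show ?thesis
    proof -
      assume a: "has_bochner_integral P (\<lambda>\<omega>. \<Sum>c\<in>UNIV. G c (points \<omega>) * (total (?h c) (points \<omega>) - (\<integral>p. ?h c p \<partial>intensity))) (\<Sum>c\<in>(UNIV::'d set). 0)"
        and b: "AE \<omega> in P. (\<Sum>c\<in>UNIV. G c (points \<omega>) * (total (?h c) (points \<omega>) - (\<integral>p. ?h c p \<partial>intensity)))
        = running_max (\<lambda>k. norm (?S k \<omega>)) i * (sgn (?S i \<omega>) \<bullet> (?S (Suc i) \<omega> - ?S i \<omega>))"
      have m1: "(\<lambda>\<omega>. running_max (\<lambda>k. norm (?S k \<omega>)) i) \<in> borel_measurable P"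
        by (rule running_max_measurable) (rule measurable_compose[OF mS borel_measurable_norm])
      have m2: "(\<lambda>\<omega>. sgn (?S i \<omega>)) \<in> borel_measurable P"
        by (rule measurable_compose[OF mS]) measurable
      have "(\<lambda>\<omega>. running_max (\<lambda>k. norm (?S k \<omega>)) i * (sgn (?S i \<omega>) \<bullet> (?S (Suc i) \<omega> - ?S i \<omega>))) \<in> borel_measurable P"
        by (rule borel_measurable_times[OF m1 borel_measurable_inner[OF m2 borel_measurable_diff[OF mS mS]]])
      from has_bochner_integral_cong_AE[THEN iffD1, OF _ this b a] show ?thesis
        using a by (simp add: has_bochner_integral_iff borel_measurable_integrable)
    qed
  qed
  have "(\<integral>\<^sup>+\<omega>. ennreal ((running_max (\<lambda>k. norm (?S k \<omega>)) n)\<^sup>2) \<partial>P) \<le> 4 * (\<integral>\<^sup>+\<omega>. ennreal ((norm (?S n \<omega>))\<^sup>2) \<partial>P)"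
    by (rule doob_L2[OF mS orth])
  also have "(\<integral>\<^sup>+\<omega>. ennreal ((norm (?S n \<omega>))\<^sup>2) \<partial>P) = ennreal (measure uni {0..t n} * (\<integral>p. (\<phi> p)\<^sup>2 \<partial>(lborel \<Otimes>\<^sub>M \<sigma>)))"
    using compensated_variance[OF \<phi> \<phi>2, of "t n"] iS2[of n]
    by (subst nn_integral_eq_integral) (simp_all add: has_bochner_integral_iff)
  also have "4 * ennreal (measure uni {0..t n} * (\<integral>p. (\<phi> p)\<^sup>2 \<partial>(lborel \<Otimes>\<^sub>M \<sigma>)))
      \<le> 4 * ennreal (1 * (\<integral>p. (\<phi> p)\<^sup>2 \<partial>(lborel \<Otimes>\<^sub>M \<sigma>)))"
    by (intro mult_left_mono ennreal_leI mult_right_mono uni.prob_le_1) simp_all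
  also have "\<dots> = ennreal (4 * (\<integral>p. (\<phi> p)\<^sup>2 \<partial>(lborel \<Otimes>\<^sub>M \<sigma>)))"
    by (simp add: ennreal_mult)
  finally show ?thesis .
qed

section \<open>Truncated levels and the passage to the limit\<close>

abbreviation trunc_levels :: "ereal \<Rightarrow> nat \<Rightarrow> real set" where
  "trunc_levels \<epsilon> N \<equiv> {x. \<epsilon> \<le> ereal x \<and> x \<le> real N}"

definition trunc_quantile :: "(real^'d \<Rightarrow> real measure) \<Rightarrow> ereal \<Rightarrow> nat \<Rightarrow> real \<times> (real^'d) \<Rightarrow> real" where
  "trunc_quantile \<rho> \<epsilon> N p = indicator (trunc_levels \<epsilon> N) (fst p) * tail_quantile \<rho> p"

lemma trunc_levels_sets: "trunc_levels \<epsilon> N \<in> sets borel"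
  by measurable

lemma measurable_trunc_quantile:
  assumes rf: "radial_levy_family \<sigma> \<rho>"
  shows "trunc_quantile \<rho> \<epsilon> N \<in> borel_measurable (lborel \<Otimes>\<^sub>M \<sigma>)"
proof -
  have "tail_quantile \<rho> \<in> borel_measurable (lborel \<Otimes>\<^sub>M \<sigma>)"
    using tail_quantile_measurable[OF rf sphere] by simp
  moreover have "(\<lambda>p. indicator (trunc_levels \<epsilon> N) (fst p) :: real) \<in> borel_measurable (lborel \<Otimes>\<^sub>M \<sigma>)"
    by (rule measurable_compose[OF measurable_fst]) (simp add: trunc_levels_sets)
  ultimately show ?thesis
    unfolding trunc_quantile_def[abs_def] by (rule borel_measurable_times[rotated])
qed

text \<open>Any \<open>a \<ge> 0\<close> satisfies \<open>a \<le> 1 + min a (a\<^sup>2)\<close>. The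
  constant integrates to at most \<open>N\<close> over levels up to \<open>N\<close>, and the
  minimum is integrable by assumption.\<close>

lemma trunc_quantile_integrand:
  assumes rf: "radial_levy_family \<sigma> \<rho>"
    and fin: "(\<integral>\<^sup>+(x, v) \<in> {x. 0 < x \<and> \<epsilon> \<le> ereal x} \<times> sphere 0 1.
        ennreal (min (inverse_tail \<rho> x v) ((inverse_tail \<rho> x v)\<^sup>2)) \<partial>(lborel \<Otimes>\<^sub>M \<sigma>)) < \<infinity>"
  shows "level_integrand (trunc_quantile \<rho> \<epsilon> N)"
proof -
  have mt: "tail_quantile \<rho> \<in> borel_measurable (lborel \<Otimes>\<^sub>M \<sigma>)"
    using tail_quantile_measurable[OF rf sphere] by simp
  let ?F = "\<lambda>p. indicator {0..real N} (fst p) + (case p of (x, v) \<Rightarrow>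
      ennreal (min (inverse_tail \<rho> x v) ((inverse_tail \<rho> x v)\<^sup>2)) * indicator ({x. 0 < x \<and> \<epsilon> \<le> ereal x} \<times> sphere 0 1) (x, v))"
  let ?G = "\<lambda>p. ennreal (min (tail_quantile \<rho> p) ((tail_quantile \<rho> p)\<^sup>2)) * indicator {x. 0 < x \<and> \<epsilon> \<le> ereal x} (fst p)"
  have G_eq: "?G p = (case p of (x, v) \<Rightarrow> ennreal (min (inverse_tail \<rho> x v) ((inverse_tail \<rho> x v)\<^sup>2))
      * indicator ({x. 0 < x \<and> \<epsilon> \<le> ereal x} \<times> sphere 0 1) (x, v))" if "p \<in> space (lborel \<Otimes>\<^sub>M \<sigma>)" for p
    using that by (auto simp: tail_quantile_def space_pair_measure space_sigma indicator_def)
  have "{x::real. 0 < x \<and> \<epsilon> \<le> ereal x} \<in> sets borel" by measurable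
  then have mi: "(\<lambda>p. indicator {x. 0 < x \<and> \<epsilon> \<le> ereal x} (fst p) :: ennreal) \<in> borel_measurable (lborel \<Otimes>\<^sub>M \<sigma>)"
    by (intro measurable_compose[OF measurable_fst]) simp
  have "(\<lambda>p. min (tail_quantile \<rho> p) ((tail_quantile \<rho> p)\<^sup>2)) \<in> borel_measurable (lborel \<Otimes>\<^sub>M \<sigma>)"
    using mt by measurable
  then have mG: "?G \<in> borel_measurable (lborel \<Otimes>\<^sub>M \<sigma>)"
    by (intro borel_measurable_times_ennreal mi measurable_compose[OF _ measurable_ennreal])
  have m0: "(\<lambda>p. indicator {0..real N} (fst p) :: ennreal) \<in> borel_measurable (lborel \<Otimes>\<^sub>M \<sigma>)"
    by (rule measurable_compose[OF measurable_fst]) simp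
  have "(\<integral>\<^sup>+p. ennreal (norm (trunc_quantile \<rho> \<epsilon> N p)) \<partial>(lborel \<Otimes>\<^sub>M \<sigma>))
      \<le> (\<integral>\<^sup>+p. indicator {0..real N} (fst p) + ?G p \<partial>(lborel \<Otimes>\<^sub>M \<sigma>))"
  proof (rule nn_integral_mono)
    fix p assume p: "p \<in> space (lborel \<Otimes>\<^sub>M \<sigma> :: (real \<times> (real^'d)) measure)"
    define a where "a = tail_quantile \<rho> p"
    have a: "0 \<le> a"
      unfolding a_def using p by (intro tail_quantile_nonneg[OF rf]) (auto simp: space_pair_measure space_sigma)
    show "ennreal (norm (trunc_quantile \<rho> \<epsilon> N p)) \<le> indicator {0..real N} (fst p) + ?G p"
    proof (cases "0 < fst p \<and> fst p \<in> trunc_levels \<epsilon> N")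
      case True
      have "a \<le> 1 + min a (a\<^sup>2)"
      proof (cases "a \<le> 1")
        case False
        then have "a * 1 \<le> a * a" by (intro mult_left_mono) simp_all
        then show ?thesis using a by (simp add: power2_eq_square)
      qed (use a in \<open>simp add: add_increasing2\<close>)
      then have "ennreal a \<le> ennreal (1 + min a (a\<^sup>2))" by (rule ennreal_leI)
      also have "\<dots> = 1 + ennreal (min a (a\<^sup>2))" using a by (subst ennreal_plus) simp_all
      finally show ?thesis using True a by (simp add: trunc_quantile_def a_def[symmetric])
    next
      case False
      then have "trunc_quantile \<rho> \<epsilon> N p = 0" by (auto simp: trunc_quantile_def tail_quantile_def)
      then show ?thesis by simp
    qed
  qed
  also have "\<dots> = (\<integral>\<^sup>+p. indicator {0..real N} (fst p) \<partial>(lborel \<Otimes>\<^sub>M \<sigma>)) + (\<integral>\<^sup>+p. ?G p \<partial>(lborel \<Otimes>\<^sub>M \<sigma>))"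
    by (rule nn_integral_add[OF m0 mG])
  also have "(\<integral>\<^sup>+p. indicator {0..real N} (fst p) \<partial>(lborel \<Otimes>\<^sub>M \<sigma>)) = ennreal (real N)"
    by (subst sig.nn_integral_fst[OF m0, symmetric]) (simp add: sig.emeasure_space_1)
  also have "(\<integral>\<^sup>+p. ?G p \<partial>(lborel \<Otimes>\<^sub>M \<sigma>)) = (\<integral>\<^sup>+(x, v) \<in> {x. 0 < x \<and> \<epsilon> \<le> ereal x} \<times> sphere 0 1.
        ennreal (min (inverse_tail \<rho> x v) ((inverse_tail \<rho> x v)\<^sup>2)) \<partial>(lborel \<Otimes>\<^sub>M \<sigma>))"
    by (rule nn_integral_cong) (simp add: G_eq split_beta)
  also have "ennreal (real N) + \<dots> < \<infinity>" using fin by simp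
  finally have "integrable (lborel \<Otimes>\<^sub>M \<sigma>) (trunc_quantile \<rho> \<epsilon> N)"
    by (rule integrableI_bounded[OF measurable_trunc_quantile[OF rf]])
  then show ?thesis
    by (simp add: level_integrand_def trunc_quantile_def tail_quantile_def)
qed

lemma measure_uni_Icc: "t \<in> {0..1} \<Longrightarrow> measure uni {0..t} = t"
  by (subst measure_uniform_measure) (simp_all add: Int_absorb1 Int_absorb2)

text \<open>The mean measure has Lebesgue time, the intensity uniform time on [0,1]; they give a
  window \<open>{0..t}\<close> the same mass for \<open>t\<close> in that interval. The equality is
  almost sure because coordinates are taken out of an integral that must converge.\<close>

lemma compensated_truncation_eq:
  assumes rf: "radial_levy_family \<sigma> \<rho>" and li: "level_integrand (trunc_quantile \<rho> \<epsilon> N)" and t: "t \<in> {0..1}"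
  shows "AE \<omega> in P. compensated_truncation \<Xi> \<sigma> \<rho> \<epsilon> N t \<omega> = compensated (trunc_quantile \<rho> \<epsilon> N) t (points \<omega>)"
proof -
  let ?\<phi> = "trunc_quantile \<rho> \<epsilon> N" and ?B = "trunc_levels \<epsilon> N"
  let ?A = "{0..t} \<times> {x. 0 < x \<and> \<epsilon> \<le> ereal x \<and> x \<le> real N} \<times> sphere 0 1"
  let ?f = "\<lambda>(s, x, v). inverse_tail \<rho> x v *\<^sub>R v"
  let ?V = "\<lambda>p. ?\<phi> p *\<^sub>R snd p"
  have \<phi>: "integrable (lborel \<Otimes>\<^sub>M \<sigma>) ?\<phi>" using li by (simp add: level_integrand_def)
  have iV: "integrable (lborel \<Otimes>\<^sub>M \<sigma>) ?V"
  proof (rule Bochner_Integration.integrable_bound[OF \<phi>])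
    show "?V \<in> borel_measurable (lborel \<Otimes>\<^sub>M \<sigma>)"
      by (rule borel_measurable_scaleR[OF borel_measurable_integrable[OF \<phi>] measurable_compose[OF measurable_snd measurable_direction]])
    show "AE p in lborel \<Otimes>\<^sub>M \<sigma>. norm (?V p) \<le> norm (?\<phi> p)"
      by (rule AE_I2) (auto simp: space_pair_measure space_sigma)
  qed
  have mean: "set_lebesgue_integral (mean_measure \<sigma>) ?A ?f = t *\<^sub>R (\<integral>p. ?V p \<partial>(lborel \<Otimes>\<^sub>M \<sigma>))"
  proof -
    let ?g = "\<lambda>y::real \<times> real \<times> (real^'d). indicator {0..t} (fst y) *\<^sub>R ?V (snd y)"
    have "set_lebesgue_integral (mean_measure \<sigma>) ?A ?f = (\<integral>y. ?g y \<partial>mean_measure \<sigma>)"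
      unfolding set_lebesgue_integral_def
    proof (rule Bochner_Integration.integral_cong[OF refl])
      fix y assume "y \<in> space (mean_measure \<sigma>)"
      then have "snd (snd y) \<in> sphere 0 1" by (auto simp: space_pair_measure space_sigma)
      then show "indicator ?A y *\<^sub>R (case y of (s, x, v) \<Rightarrow> inverse_tail \<rho> x v *\<^sub>R v) = ?g y"
        by (auto simp: trunc_quantile_def tail_quantile_def indicator_def split: prod.split)
    qed
    also have "\<dots> = (\<integral>s. \<integral>p. indicator {0..t} s *\<^sub>R ?V p \<partial>(lborel \<Otimes>\<^sub>M \<sigma>) \<partial>lborel)"
    proof -
      have "integrable (mean_measure \<sigma>) ?g"
      proof (rule mean_pair.Fubini_integrable)
        have "(\<lambda>y. indicator {0..t} (fst y) :: real) \<in> borel_measurable (mean_measure \<sigma>)"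
          by (rule measurable_compose[OF measurable_fst]) simp
        then show "?g \<in> borel_measurable (mean_measure \<sigma>)"
          by (rule borel_measurable_scaleR[OF _ measurable_compose[OF measurable_snd borel_measurable_integrable[OF iV]]])
        have "(\<lambda>s. \<integral>p. norm (?g (s, p)) \<partial>(lborel \<Otimes>\<^sub>M \<sigma>)) = (\<lambda>s. indicator {0..t} s * (\<integral>p. norm (?V p) \<partial>(lborel \<Otimes>\<^sub>M \<sigma>)))"
          by (rule ext) (simp add: abs_mult mult.assoc)
        moreover have "integrable lborel (indicator {0..t} :: real \<Rightarrow> real)"
          by (rule integrable_real_indicator) (simp_all add: emeasure_lborel_Icc_eq)
        ultimately show "integrable lborel (\<lambda>s. \<integral>p. norm (?g (s, p)) \<partial>(lborel \<Otimes>\<^sub>M \<sigma>))" by simp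
        show "AE s in lborel. integrable (lborel \<Otimes>\<^sub>M \<sigma>) (\<lambda>p. ?g (s, p))"
          by (rule AE_I2) (simp only: fst_conv snd_conv, rule integrable_scaleR_right, rule iV)
      qed
      from mean_pair.integral_fst'[OF this] show ?thesis by simp
    qed
    also have "\<dots> = (\<integral>s. indicator {0..t} s *\<^sub>R (\<integral>p. ?V p \<partial>(lborel \<Otimes>\<^sub>M \<sigma>)) \<partial>lborel)"
      by (simp only: fst_conv snd_conv integral_scaleR_right)
    also have "\<dots> = t *\<^sub>R (\<integral>p. ?V p \<partial>(lborel \<Otimes>\<^sub>M \<sigma>))"
    proof -
      have "integrable lborel (indicator {0..t} :: real \<Rightarrow> real)"
        by (rule integrable_real_indicator) (simp_all add: emeasure_lborel_Icc_eq)
      then show ?thesis using t by (subst integral_scaleR_left) simp_all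
    qed
    finally show ?thesis .
  qed
  have mean_c: "(t *\<^sub>R (\<integral>p. ?V p \<partial>(lborel \<Otimes>\<^sub>M \<sigma>))) $ c = (\<integral>p. windowed ?\<phi> {0..t} c p \<partial>intensity)" for c
  proof -
    have "(\<integral>p. ?V p \<partial>(lborel \<Otimes>\<^sub>M \<sigma>)) $ c = (\<integral>p. ?V p $ c \<partial>(lborel \<Otimes>\<^sub>M \<sigma>))"
      by (rule integral_bounded_linear[OF bounded_linear_vec_nth iV, symmetric])
    also have "\<dots> = (\<integral>p. component ?\<phi> c p \<partial>(lborel \<Otimes>\<^sub>M \<sigma>))"
      by (simp add: component_def)
    finally show ?thesis
      using windowed_integral[OF li, of "{0..t}" c] measure_uni_Icc[OF t] by (simp add: has_bochner_integral_iff)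
  qed
  have fin: "(\<integral>\<^sup>+p. indicator ?B (fst p) * ennreal (min 1 (tail_quantile \<rho> p)) \<partial>(lborel \<Otimes>\<^sub>M \<sigma>)) < \<infinity>"
  proof -
    have "(\<integral>\<^sup>+p. indicator ?B (fst p) * ennreal (min 1 (tail_quantile \<rho> p)) \<partial>(lborel \<Otimes>\<^sub>M \<sigma>)) \<le> (\<integral>\<^sup>+p. ennreal (norm (?\<phi> p)) \<partial>(lborel \<Otimes>\<^sub>M \<sigma>))"
      by (intro nn_integral_mono)
         (auto simp: trunc_quantile_def indicator_def space_pair_measure space_sigma intro!: ennreal_leI)
    also have "\<dots> < \<infinity>" using \<phi> by (simp add: integrable_iff_bounded)
    finally show ?thesis .
  qed
  show ?thesis
    using AE_kernel_integrable[OF rf trunc_levels_sets fin] AE_space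
  proof eventually_elim
    case (elim \<omega>)
    have set_eq: "{x. 0 < x \<and> \<epsilon> \<le> ereal x \<and> x \<le> real N} = {x. 0 < x \<and> x \<in> ?B}" by auto
    have sum: "set_lebesgue_integral (\<Xi> \<omega>) ?A ?f = (\<integral>n. kernel \<rho> ?B t (points \<omega> n) \<partial>count_space UNIV)"
      unfolding set_eq by (rule set_integral_jump_measure[OF rf trunc_levels_sets elim(2)])
    have sum_c: "(\<integral>n. kernel \<rho> ?B t (points \<omega> n) \<partial>count_space UNIV) $ c = total (windowed ?\<phi> {0..t} c) (points \<omega>)" for c
    proof -
      have "(\<integral>n. kernel \<rho> ?B t (points \<omega> n) \<partial>count_space UNIV) $ c = (\<integral>n. kernel \<rho> ?B t (points \<omega> n) $ c \<partial>count_space UNIV)"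
        by (rule integral_bounded_linear[OF bounded_linear_vec_nth elim(1)[THEN spec], symmetric])
      also have "\<dots> = total (windowed ?\<phi> {0..t} c) (points \<omega>)"
        unfolding total_def by (rule Bochner_Integration.integral_cong[OF refl])
          (simp add: kernel_def windowed_def component_def trunc_quantile_def)
      finally show ?thesis .
    qed
    show ?case
      unfolding compensated_truncation_def Let_def sum mean vec_eq_iff vector_minus_component sum_c mean_c
      by (simp add: compensated_def)
  qed
qed

lemma compensated_diff:
  assumes X: "level_integrand \<phi>" and Y: "level_integrand \<psi>"
  shows "AE \<omega> in P. compensated \<phi> t (points \<omega>) - compensated \<psi> t (points \<omega>) = compensated (\<lambda>p. \<phi> p - \<psi> p) t (points \<omega>)"
proof -
  have iX: "integrable intensity (windowed \<phi> {0..t} c)" and iY: "integrable intensity (windowed \<psi> {0..t} c)" for c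
    by (rule windowed_integrable[OF X], simp, rule windowed_integrable[OF Y], simp)
  have eq: "windowed (\<lambda>p. \<phi> p - \<psi> p) {0..t} c p = windowed \<phi> {0..t} c p - windowed \<psi> {0..t} c p" for c p
    by (simp add: windowed_def component_def algebra_simps)
  have "AE \<omega> in P. \<forall>c. integrable (count_space UNIV) (\<lambda>n. windowed \<phi> {0..t} c (points \<omega> n))
      \<and> integrable (count_space UNIV) (\<lambda>n. windowed \<psi> {0..t} c (points \<omega> n))"
  proof (subst AE_all_countable, rule allI)
    fix c
    show "AE \<omega> in P. integrable (count_space UNIV) (\<lambda>n. windowed \<phi> {0..t} c (points \<omega> n))
      \<and> integrable (count_space UNIV) (\<lambda>n. windowed \<psi> {0..t} c (points \<omega> n))"
      by (rule AE_conjI[OF AE_integrable_total[OF iX] AE_integrable_total[OF iY]])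
  qed
  then show ?thesis
  proof eventually_elim
    case (elim \<omega>)
    have "total (windowed (\<lambda>p. \<phi> p - \<psi> p) {0..t} c) (points \<omega>) = total (windowed \<phi> {0..t} c) (points \<omega>) - total (windowed \<psi> {0..t} c) (points \<omega>)" for c
      unfolding total_def eq using elim by (intro Bochner_Integration.integral_diff) simp_all
    moreover have "(\<integral>p. windowed (\<lambda>p. \<phi> p - \<psi> p) {0..t} c p \<partial>intensity) = (\<integral>p. windowed \<phi> {0..t} c p \<partial>intensity) - (\<integral>p. windowed \<psi> {0..t} c p \<partial>intensity)" for c
      unfolding eq by (rule Bochner_Integration.integral_diff[OF iX iY])
    ultimately show ?case by (simp add: compensated_def vec_eq_iff)
  qed
qed

lemma measurable_compensated_truncation:
  assumes rf: "radial_levy_family \<sigma> \<rho>"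
  shows "compensated_truncation \<Xi> \<sigma> \<rho> \<epsilon> N t \<in> borel_measurable P"
proof -
  have set_eq: "{x. 0 < x \<and> \<epsilon> \<le> ereal x \<and> x \<le> real N} = {x. 0 < x \<and> x \<in> trunc_levels \<epsilon> N}" by auto
  have "(\<lambda>\<omega>. (\<integral>n. kernel \<rho> (trunc_levels \<epsilon> N) t (points \<omega> n) \<partial>count_space UNIV) - c) \<in> borel_measurable P" for c
    by (rule borel_measurable_diff[OF measurable_kernel_sum[OF rf trunc_levels_sets] borel_measurable_const])
  then show ?thesis
    by (rule measurable_cong[THEN iffD1, rotated])
       (simp only: compensated_truncation_def Let_def set_eq set_integral_jump_measure[OF rf trunc_levels_sets])
qed

text \<open>The truncations obey a bound uniform in \<open>N\<close>. Being limits in probability at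
  each of finitely many grid times, \<open>MX\<close> and \<open>MY\<close> are almost sure limits
  at all of them along one subsequence, and Fatou's lemma transfers the bound.\<close>

lemma compensated_part_max_bound:
  assumes rX: "radial_levy_family \<sigma> \<rho>X" and rY: "radial_levy_family \<sigma> \<rho>Y"
    and MX: "is_compensated_small_jump_part P \<Xi> \<sigma> \<rho>X \<epsilon> MX"
    and MY: "is_compensated_small_jump_part P \<Xi> \<sigma> \<rho>Y \<epsilon> MY"
    and t: "mono t" "\<And>k. t k \<in> {0..1}"
    and C: "(\<integral>\<^sup>+(x, v) \<in> {x. 0 < x \<and> \<epsilon> \<le> ereal x} \<times> sphere 0 1.
        ennreal ((inverse_tail \<rho>X x v - inverse_tail \<rho>Y x v)\<^sup>2) \<partial>(lborel \<Otimes>\<^sub>M \<sigma>)) \<le> ennreal C" and C0: "0 \<le> C"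
  shows "(\<integral>\<^sup>+\<omega>. ennreal ((running_max (\<lambda>k. norm (MX (t k) \<omega> - MY (t k) \<omega>)) n)\<^sup>2) \<partial>P) \<le> ennreal (4 * C)"
proof -
  let ?\<phi> = "\<lambda>N p. trunc_quantile \<rho>X \<epsilon> N p - trunc_quantile \<rho>Y \<epsilon> N p"
  let ?tX = "\<lambda>N k. compensated_truncation \<Xi> \<sigma> \<rho>X \<epsilon> N (t k)" and ?tY = "\<lambda>N k. compensated_truncation \<Xi> \<sigma> \<rho>Y \<epsilon> N (t k)"
  have liX: "level_integrand (trunc_quantile \<rho>X \<epsilon> N)" and liY: "level_integrand (trunc_quantile \<rho>Y \<epsilon> N)" for N
    using MX MY unfolding is_compensated_small_jump_part_def
    by (auto intro!: trunc_quantile_integrand rX rY)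
  have li: "level_integrand (?\<phi> N)" for N
    using liX[of N] liY[of N] by (simp add: level_integrand_def)
  have mX: "MX (t k) \<in> borel_measurable P" and mY: "MY (t k) \<in> borel_measurable P" for k
    using MX MY t(2)[of k] by (simp_all add: is_compensated_small_jump_part_def)
  have cX: "(\<lambda>N. measure P {\<omega> \<in> space P. dist (?tX N k \<omega>) (MX (t k) \<omega>) > \<delta>}) \<longlonglongrightarrow> 0"
    and cY: "(\<lambda>N. measure P {\<omega> \<in> space P. dist (?tY N k \<omega>) (MY (t k) \<omega>) > \<delta>}) \<longlonglongrightarrow> 0" if "0 < \<delta>" for k \<delta>
    using MX MY t(2)[of k] that by (simp_all add: is_compensated_small_jump_part_def)
  have bound: "(\<integral>\<^sup>+\<omega>. ennreal ((running_max (\<lambda>k. norm (?tX N k \<omega> - ?tY N k \<omega>)) n)\<^sup>2) \<partial>P) \<le> ennreal (4 * C)" for N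
  proof -
    have m: "?\<phi> N \<in> borel_measurable (lborel \<Otimes>\<^sub>M \<sigma>)"
      using li[of N] by (simp add: level_integrand_def borel_measurable_integrable)
    \<comment> \<open>Both quantiles are truncated to the same levels, so truncation can only shrink
      their difference and \<open>C\<close> serves every \<open>N\<close>.\<close>
    have le: "(\<integral>\<^sup>+p. ennreal ((?\<phi> N p)\<^sup>2) \<partial>(lborel \<Otimes>\<^sub>M \<sigma>)) \<le> ennreal C"
      by (rule order_trans[OF _ C], rule nn_integral_mono)
         (auto simp: trunc_quantile_def tail_quantile_def indicator_def space_pair_measure space_sigma)
    have \<phi>2: "integrable (lborel \<Otimes>\<^sub>M \<sigma>) (\<lambda>p. (?\<phi> N p)\<^sup>2)"
    proof (rule integrableI_bounded[OF borel_measurable_power[OF m]])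
      show "(\<integral>\<^sup>+p. ennreal (norm ((?\<phi> N p)\<^sup>2)) \<partial>(lborel \<Otimes>\<^sub>M \<sigma>)) < \<infinity>"
        using le_less_trans[OF le, of \<infinity>] by simp
    qed
    have le': "(\<integral>p. (?\<phi> N p)\<^sup>2 \<partial>(lborel \<Otimes>\<^sub>M \<sigma>)) \<le> C"
      using le nn_integral_eq_integral[OF \<phi>2] C0 by simp
    have ae1: "AE \<omega> in P. ?tX N k \<omega> - ?tY N k \<omega> = compensated (?\<phi> N) (t k) (points \<omega>)" for k
      using compensated_truncation_eq[OF rX liX[of N] t(2)[of k]] compensated_truncation_eq[OF rY liY[of N] t(2)[of k]]
        compensated_diff[OF liX[of N] liY[of N], of "t k"]
      by eventually_elim simp
    have "AE \<omega> in P. \<forall>k. ?tX N k \<omega> - ?tY N k \<omega> = compensated (?\<phi> N) (t k) (points \<omega>)"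
      unfolding AE_all_countable using ae1 by blast
    then have "(\<integral>\<^sup>+\<omega>. ennreal ((running_max (\<lambda>k. norm (?tX N k \<omega> - ?tY N k \<omega>)) n)\<^sup>2) \<partial>P)
        = (\<integral>\<^sup>+\<omega>. ennreal ((running_max (\<lambda>k. norm (compensated (?\<phi> N) (t k) (points \<omega>))) n)\<^sup>2) \<partial>P)"
      by (intro nn_integral_cong_AE, eventually_elim) simp
    also have "\<dots> \<le> ennreal (4 * (\<integral>p. (?\<phi> N p)\<^sup>2 \<partial>(lborel \<Otimes>\<^sub>M \<sigma>)))"
      by (rule compensated_max_bound[OF li \<phi>2 t(1)]) (use t(2) in simp)
    also have "\<dots> \<le> ennreal (4 * C)"
      using le' by (intro ennreal_leI) simp
    finally show ?thesis .
  qed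
  \<comment> \<open>Some truncation deviates by more than \<open>\<delta>\<close> at some grid time.
    Choosing \<open>N j\<close> such that this has probability below \<open>(1 / 2) ^ j\<close> for
    \<open>\<delta> = (1 / 2) ^ j\<close> makes Borel-Cantelli applicable.\<close>
  define bad where "bad = (\<lambda>N \<delta>. \<Union>k\<in>{..n}. {\<omega> \<in> space P. dist (?tX N k \<omega>) (MX (t k) \<omega>) > \<delta>}
      \<union> {\<omega> \<in> space P. dist (?tY N k \<omega>) (MY (t k) \<omega>) > \<delta>})"
  have sX: "{\<omega> \<in> space P. dist (?tX N k \<omega>) (MX (t k) \<omega>) > \<delta>} \<in> sets P" for N k \<delta>
    by (rule borel_measurable_less[OF borel_measurable_const borel_measurable_dist[OF measurable_compensated_truncation[OF rX] mX]])
  have sY: "{\<omega> \<in> space P. dist (?tY N k \<omega>) (MY (t k) \<omega>) > \<delta>} \<in> sets P" for N k \<delta>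
    by (rule borel_measurable_less[OF borel_measurable_const borel_measurable_dist[OF measurable_compensated_truncation[OF rY] mY]])
  have bad_sets: "bad N \<delta> \<in> sets P" for N \<delta>
    unfolding bad_def by (rule sets.finite_UN) (simp_all add: sX sY sets.Un)
  have "\<exists>N. measure P (bad N ((1 / 2) ^ j)) < (1 / 2) ^ j" for j :: nat
  proof -
    let ?d = "(1 / 2 :: real) ^ j"
    have d: "0 < ?d" by simp
    have "(\<lambda>N. \<Sum>k\<in>{..n}. measure P {\<omega> \<in> space P. dist (?tX N k \<omega>) (MX (t k) \<omega>) > ?d}
        + measure P {\<omega> \<in> space P. dist (?tY N k \<omega>) (MY (t k) \<omega>) > ?d}) \<longlonglongrightarrow> (\<Sum>k\<in>{..n}. 0 + 0)"
      by (intro tendsto_sum tendsto_add cX cY d)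
    then have "\<forall>\<^sub>F N in sequentially. (\<Sum>k\<in>{..n}. measure P {\<omega> \<in> space P. dist (?tX N k \<omega>) (MX (t k) \<omega>) > ?d}
        + measure P {\<omega> \<in> space P. dist (?tY N k \<omega>) (MY (t k) \<omega>) > ?d}) < ?d"
      by (rule order_tendstoD(2)) simp
    then obtain N where N: "(\<Sum>k\<in>{..n}. measure P {\<omega> \<in> space P. dist (?tX N k \<omega>) (MX (t k) \<omega>) > ?d}
        + measure P {\<omega> \<in> space P. dist (?tY N k \<omega>) (MY (t k) \<omega>) > ?d}) < ?d"
      by (auto simp: eventually_sequentially)
    have "measure P (bad N ?d) \<le> (\<Sum>k\<in>{..n}. measure P ({\<omega> \<in> space P. dist (?tX N k \<omega>) (MX (t k) \<omega>) > ?d}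
        \<union> {\<omega> \<in> space P. dist (?tY N k \<omega>) (MY (t k) \<omega>) > ?d}))"
      unfolding bad_def by (rule finite_measure_subadditive_finite) (auto intro: sets.Un sX sY)
    also have "\<dots> \<le> (\<Sum>k\<in>{..n}. measure P {\<omega> \<in> space P. dist (?tX N k \<omega>) (MX (t k) \<omega>) > ?d}
        + measure P {\<omega> \<in> space P. dist (?tY N k \<omega>) (MY (t k) \<omega>) > ?d})"
      by (intro sum_mono measure_Un_le sX sY)
    also note N
    finally show ?thesis by blast
  qed
  then obtain N where N: "\<And>j. measure P (bad (N j) ((1 / 2) ^ j)) < (1 / 2) ^ j" by metis
  have "AE \<omega> in P. \<forall>\<^sub>F j in sequentially. \<omega> \<in> space P - bad (N j) ((1 / 2) ^ j)"
  proof (rule borel_cantelli_AE1)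
    show "summable (\<lambda>j. measure P (bad (N j) ((1 / 2) ^ j)))"
      by (rule summable_comparison_test'[where g = "\<lambda>j. (1 / 2) ^ j" and N = 0])
         (use N in \<open>auto intro: less_imp_le\<close>)
  qed (simp_all add: bad_sets emeasure_eq_measure)
  then have conv: "AE \<omega> in P. (\<lambda>j. (running_max (\<lambda>k. norm (?tX (N j) k \<omega> - ?tY (N j) k \<omega>)) n)\<^sup>2)
      \<longlonglongrightarrow> (running_max (\<lambda>k. norm (MX (t k) \<omega> - MY (t k) \<omega>)) n)\<^sup>2"
  proof eventually_elim
    case (elim \<omega>)
    have z: "(\<lambda>j. (1 / 2 :: real) ^ j) \<longlonglongrightarrow> 0" by (rule LIMSEQ_power_zero) simp
    have X: "(\<lambda>j. ?tX (N j) k \<omega>) \<longlonglongrightarrow> MX (t k) \<omega>" if "k \<le> n" for k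
    proof (rule tendsto_dist_iff[THEN iffD2], rule tendsto_sandwich[OF _ _ tendsto_const z])
      show "\<forall>\<^sub>F j in sequentially. dist (?tX (N j) k \<omega>) (MX (t k) \<omega>) \<le> (1 / 2) ^ j"
        using elim by eventually_elim (use that in \<open>auto simp: bad_def not_less\<close>)
    qed simp
    have Y: "(\<lambda>j. ?tY (N j) k \<omega>) \<longlonglongrightarrow> MY (t k) \<omega>" if "k \<le> n" for k
    proof (rule tendsto_dist_iff[THEN iffD2], rule tendsto_sandwich[OF _ _ tendsto_const z])
      show "\<forall>\<^sub>F j in sequentially. dist (?tY (N j) k \<omega>) (MY (t k) \<omega>) \<le> (1 / 2) ^ j"
        using elim by eventually_elim (use that in \<open>auto simp: bad_def not_less\<close>)
    qed simp
    show ?case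
      by (intro tendsto_power tendsto_running_max tendsto_norm tendsto_diff X Y)
  qed
  have mR: "(\<lambda>\<omega>. ennreal ((running_max (\<lambda>k. norm (?tX (N j) k \<omega> - ?tY (N j) k \<omega>)) n)\<^sup>2)) \<in> borel_measurable P" for j
  proof -
    have "(\<lambda>\<omega>. norm (?tX (N j) k \<omega> - ?tY (N j) k \<omega>)) \<in> borel_measurable P" for k
      by (rule measurable_compose[OF borel_measurable_diff[OF measurable_compensated_truncation[OF rX] measurable_compensated_truncation[OF rY]] borel_measurable_norm])
    then show ?thesis
      by (intro measurable_compose[OF borel_measurable_power measurable_ennreal] running_max_measurable)
  qed
  have "(\<integral>\<^sup>+\<omega>. ennreal ((running_max (\<lambda>k. norm (MX (t k) \<omega> - MY (t k) \<omega>)) n)\<^sup>2) \<partial>P)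
      = (\<integral>\<^sup>+\<omega>. liminf (\<lambda>j. ennreal ((running_max (\<lambda>k. norm (?tX (N j) k \<omega> - ?tY (N j) k \<omega>)) n)\<^sup>2)) \<partial>P)"
  proof (rule nn_integral_cong_AE)
    show "AE \<omega> in P. ennreal ((running_max (\<lambda>k. norm (MX (t k) \<omega> - MY (t k) \<omega>)) n)\<^sup>2)
        = liminf (\<lambda>j. ennreal ((running_max (\<lambda>k. norm (?tX (N j) k \<omega> - ?tY (N j) k \<omega>)) n)\<^sup>2))"
      using conv
    proof eventually_elim
      case (elim \<omega>)
      from lim_imp_Liminf[OF sequentially_bot tendsto_ennrealI[OF elim]] show ?case by (rule sym)
    qed
  qed
  also have "\<dots> \<le> liminf (\<lambda>j. \<integral>\<^sup>+\<omega>. ennreal ((running_max (\<lambda>k. norm (?tX (N j) k \<omega> - ?tY (N j) k \<omega>)) n)\<^sup>2) \<partial>P)"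
    by (rule nn_integral_liminf[OF mR])
  also have "\<dots> \<le> liminf (\<lambda>j::nat. ennreal (4 * C))"
    by (rule Liminf_mono) (simp add: bound)
  also have "\<dots> = ennreal (4 * C)"
    by (simp add: Liminf_const)
  finally show ?thesis .
qed

end

section \<open>Cadlag modifications and couplings\<close>

definition dyadics :: "real set" where
  "dyadics = (\<Union>m. (\<lambda>k. real k / 2 ^ m) ` {..2 ^ m})"

lemma countable_dyadics: "countable dyadics"
  unfolding dyadics_def by (intro countable_UN countable_image) auto

lemma dyadics_bounds: "t \<in> dyadics \<Longrightarrow> 0 \<le> t" "t \<in> dyadics \<Longrightarrow> t \<le> 1"
proof -
  have "real k / 2 ^ m \<le> 1" if "k \<le> 2 ^ m" for k m
  proof -
    have "real k \<le> real (2 ^ m)" using that by (simp only: of_nat_le_iff)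
    then show ?thesis by simp
  qed
  then show "t \<in> dyadics \<Longrightarrow> 0 \<le> t" "t \<in> dyadics \<Longrightarrow> t \<le> 1"
    by (auto simp: dyadics_def)
qed

lemma one_in_dyadics: "1 \<in> dyadics"
  unfolding dyadics_def by (rule UN_I[of 0], simp, rule image_eqI[of _ _ 1]) simp_all

text \<open>The floor plus 1, not the ceiling: the value is strictly larger than \<open>t\<close>
  even for dyadic \<open>t\<close>, so \<open>t\<close> is always approached strictly from the
  right.\<close>

definition upper_dyadic :: "nat \<Rightarrow> real \<Rightarrow> real" where
  "upper_dyadic n t = (of_int \<lfloor>2 ^ n * t\<rfloor> + 1) / 2 ^ n"

lemma upper_dyadic_gt: "t < upper_dyadic n t"
proof -
  have "2 ^ n * t < of_int \<lfloor>2 ^ n * t\<rfloor> + 1" by linarith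
  then show ?thesis by (simp add: upper_dyadic_def field_simps)
qed

lemma upper_dyadic_le: "upper_dyadic n t \<le> t + (1 / 2) ^ n"
proof -
  have "of_int \<lfloor>2 ^ n * t\<rfloor> + 1 \<le> 2 ^ n * t + 1" by linarith
  then have "upper_dyadic n t \<le> (2 ^ n * t + 1) / 2 ^ n"
    unfolding upper_dyadic_def by (intro divide_right_mono) auto
  also have "\<dots> = t + (1 / 2) ^ n" by (simp add: field_simps power_one_over)
  finally show ?thesis .
qed

lemma upper_dyadic_in:
  assumes "0 \<le> t" "t < 1"
  shows "upper_dyadic n t \<in> dyadics"
proof -
  define k where "k = nat (\<lfloor>2 ^ n * t\<rfloor> + 1)"
  have f: "0 \<le> \<lfloor>2 ^ n * t\<rfloor>" using assms by simp
  have "\<lfloor>2 ^ n * t\<rfloor> < 2 ^ n"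
    using assms by (simp add: floor_less_iff)
  then have "k \<le> 2 ^ n" unfolding k_def using f
    by (simp add: nat_le_iff)
  moreover have "upper_dyadic n t = real k / 2 ^ n"
    using f by (simp add: upper_dyadic_def k_def)
  ultimately show ?thesis unfolding dyadics_def by blast
qed

lemma upper_dyadic_tendsto: "(\<lambda>n. upper_dyadic n t) \<longlonglongrightarrow> t"
proof (rule tendsto_sandwich[OF _ _ tendsto_const])
  show "(\<lambda>n. t + (1 / 2) ^ n) \<longlonglongrightarrow> t"
    using tendsto_add[OF tendsto_const[of t] LIMSEQ_power_zero[of "1 / 2 :: real"]] by simp
  show "\<forall>\<^sub>F n in sequentially. t \<le> upper_dyadic n t"
    by (rule always_eventually) (simp add: less_imp_le[OF upper_dyadic_gt])
  show "\<forall>\<^sub>F n in sequentially. upper_dyadic n t \<le> t + (1 / 2) ^ n"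
    by (rule always_eventually) (simp add: upper_dyadic_le)
qed

text \<open>A function on the dyadics extends to a cadlag function precisely if, for every \<open>e > 0\<close>, the
  length of chains with all steps larger than \<open>e\<close> is bounded.  Unlike the existence of one-sided
  limits at all times, this involves countably many conditions only.\<close>

definition bounded_oscillations :: "(real \<Rightarrow> 'b::metric_space) \<Rightarrow> bool" where
  "bounded_oscillations x \<longleftrightarrow> (\<forall>j::nat. \<exists>m::nat. \<forall>ts\<in>lists dyadics.
     length ts = Suc m \<and> sorted_wrt (<) ts \<longrightarrow>
     (\<exists>i<m. dist (x (ts ! Suc i)) (x (ts ! i)) \<le> 1 / real (Suc j)))"

lemma bounded_oscillations_cong:
  "(\<And>t. t \<in> dyadics \<Longrightarrow> x t = y t) \<Longrightarrow> bounded_oscillations x \<longleftrightarrow> bounded_oscillations y"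
proof -
  assume eq: "\<And>t. t \<in> dyadics \<Longrightarrow> x t = y t"
  have "dist (x (ts ! Suc i)) (x (ts ! i)) = dist (y (ts ! Suc i)) (y (ts ! i))"
    if "ts \<in> lists dyadics" "length ts = Suc m" "i < m" for ts m i
    using that by (simp add: eq in_lists_conv_set)
  then have eq2: "(\<exists>i<m. dist (x (ts ! Suc i)) (x (ts ! i)) \<le> c) \<longleftrightarrow> (\<exists>i<m. dist (y (ts ! Suc i)) (y (ts ! i)) \<le> c)"
    if "ts \<in> lists dyadics" "length ts = Suc m" for ts m c
    using that by metis
  show ?thesis
    unfolding bounded_oscillations_def
    by (rule iff_allI, rule arg_cong[where f = Ex], rule ext, rule ball_cong[OF refl], rule imp_cong[OF refl],
        rule eq2, assumption, simp)
qed

text \<open>A neighbourhood of \<open>t\<close> is split at \<open>t\<close>, which belongs to the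
  right half; a jump at \<open>t\<close> then occurs in neither half.\<close>

lemma cadlag_local_oscillation:
  fixes x :: "real \<Rightarrow> 'b::metric_space"
  assumes x: "cadlag_on T x" and t: "t \<in> T" and e: "0 < e"
  shows "\<exists>d>0. (\<forall>r\<in>T. \<forall>s\<in>T. t - d < r \<and> r < t \<and> t - d < s \<and> s < t \<longrightarrow> dist (x r) (x s) < e)
    \<and> (\<forall>r\<in>T. \<forall>s\<in>T. t \<le> r \<and> r < t + d \<and> t \<le> s \<and> s < t + d \<longrightarrow> dist (x r) (x s) < e)"
proof -
  have half: "0 < e / 2" using e by simp
  have R: "(x \<longlongrightarrow> x t) (at t within T \<inter> {t<..})" using x t by (simp add: cadlag_on_def)
  obtain l where L: "(x \<longlongrightarrow> l) (at t within T \<inter> {..<t})" using x t by (auto simp: cadlag_on_def)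
  obtain d1 where d1: "0 < d1" "\<And>s. s \<in> T \<Longrightarrow> t < s \<Longrightarrow> s < t + d1 \<Longrightarrow> dist (x s) (x t) < e / 2"
    using tendstoD[OF R half] unfolding eventually_at by (fastforce simp: dist_real_def)
  obtain d2 where d2: "0 < d2" "\<And>s. s \<in> T \<Longrightarrow> t - d2 < s \<Longrightarrow> s < t \<Longrightarrow> dist (x s) l < e / 2"
    using tendstoD[OF L half] unfolding eventually_at by (fastforce simp: dist_real_def)
  have d1': "dist (x s) (x t) < e / 2" if "s \<in> T" "t \<le> s" "s < t + d1" for s
    using d1(2)[of s] that half by (cases "s = t") auto
  show ?thesis
  proof (intro exI conjI ballI impI)
    show "0 < min d1 d2" using d1 d2 by simp
  next
    fix r s assume "r \<in> T" "s \<in> T" and h: "t - min d1 d2 < r \<and> r < t \<and> t - min d1 d2 < s \<and> s < t"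
    then have "dist (x r) l < e / 2" "dist (x s) l < e / 2"
      using \<open>r \<in> T\<close> \<open>s \<in> T\<close> h d2(2)[of r] d2(2)[of s] by (simp_all add: min_def split: if_splits)
    then show "dist (x r) (x s) < e" by (rule dist_triangle_half_l)
  next
    fix r s assume "r \<in> T" "s \<in> T" and h: "t \<le> r \<and> r < t + min d1 d2 \<and> t \<le> s \<and> s < t + min d1 d2"
    then have "dist (x r) (x t) < e / 2" "dist (x s) (x t) < e / 2"
      using \<open>r \<in> T\<close> \<open>s \<in> T\<close> h d1'[of r] d1'[of s] by (simp_all add: min_def split: if_splits)
    then show "dist (x r) (x s) < e" by (rule dist_triangle_half_l)
  qed
qed

text \<open>Compactness covers the interval by finitely many balls, each with two halves of small
  oscillation. A chain with one point more than there are halves has two points in the same half by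
  the pigeonhole principle, and the step that leaves the first of these is small.\<close>

lemma cadlag_bounded_oscillations:
  fixes x :: "real \<Rightarrow> 'b::metric_space"
  assumes x: "cadlag_on T x" and T: "{0..1} \<subseteq> T"
  shows "bounded_oscillations x"
  unfolding bounded_oscillations_def
proof
  fix j :: nat
  define e where "e = 1 / real (Suc j)"
  have e: "0 < e" by (simp add: e_def)
  have "\<forall>t\<in>{0..1}. \<exists>d>0. (\<forall>r\<in>T. \<forall>s\<in>T. t - d < r \<and> r < t \<and> t - d < s \<and> s < t \<longrightarrow> dist (x r) (x s) < e)
    \<and> (\<forall>r\<in>T. \<forall>s\<in>T. t \<le> r \<and> r < t + d \<and> t \<le> s \<and> s < t + d \<longrightarrow> dist (x r) (x s) < e)"
    using cadlag_local_oscillation[OF x _ e] T by blast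
  from bchoice[OF this] obtain d where dd: "\<And>t. t \<in> {0..1} \<Longrightarrow> 0 < d t \<and>
      (\<forall>r\<in>T. \<forall>s\<in>T. t - d t < r \<and> r < t \<and> t - d t < s \<and> s < t \<longrightarrow> dist (x r) (x s) < e) \<and>
      (\<forall>r\<in>T. \<forall>s\<in>T. t \<le> r \<and> r < t + d t \<and> t \<le> s \<and> s < t + d t \<longrightarrow> dist (x r) (x s) < e)"
    by blast
  have d: "0 < d t" if "t \<in> {0..1}" for t
    using dd[OF that] by blast
  have left: "dist (x r) (x s) < e" if "t \<in> {0..1}" "r \<in> T" "s \<in> T" "t - d t < r" "r < t" "t - d t < s" "s < t" for t r s
    using dd[OF that(1)] that by blast
  have right: "dist (x r) (x s) < e" if "t \<in> {0..1}" "r \<in> T" "s \<in> T" "t \<le> r" "r < t + d t" "t \<le> s" "s < t + d t" for t r s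
    using dd[OF that(1)] that by blast
  have "{0..1} \<subseteq> (\<Union>t\<in>{0..1}. ball t (d t))"
    using d by force
  then obtain C where C: "C \<subseteq> {0..1}" "finite C" "{0..1} \<subseteq> (\<Union>t\<in>C. ball t (d t))"
    using compactE_image[OF compact_Icc, of "{0..1}" "\<lambda>t. ball t (d t)" 0 1] by auto
  show "\<exists>m::nat. \<forall>ts\<in>lists dyadics. length ts = Suc m \<and> sorted_wrt (<) ts \<longrightarrow>
     (\<exists>i<m. dist (x (ts ! Suc i)) (x (ts ! i)) \<le> 1 / real (Suc j))"
  proof (rule exI[of _ "2 * card C"], intro ballI impI)
    fix ts assume ts: "ts \<in> lists dyadics" and l: "length ts = Suc (2 * card C) \<and> sorted_wrt (<) ts"
    have in01: "ts ! i \<in> {0..1}" if "i \<le> 2 * card C" for i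
      using ts l that dyadics_bounds[of "ts ! i"] by (auto simp: in_lists_conv_set)
    have mono: "ts ! i < ts ! k" if "i < k" "k \<le> 2 * card C" for i k
      using l that by (auto intro: sorted_wrt_nth_less)
    have "\<forall>i\<in>{..2 * card C}. \<exists>t. t \<in> C \<and> ts ! i \<in> ball t (d t)"
      using in01 C(3) by blast
    then obtain c where c: "\<And>i. i \<le> 2 * card C \<Longrightarrow> c i \<in> C \<and> ts ! i \<in> ball (c i) (d (c i))"
      by (metis atMost_iff)
    let ?f = "\<lambda>i. (c i, ts ! i < c i)"
    have "?f ` {..2 * card C} \<subseteq> C \<times> (UNIV :: bool set)" using c by auto
    then have "card (?f ` {..2 * card C}) \<le> card (C \<times> (UNIV :: bool set))"
      using C(2) by (intro card_mono) auto
    also have "\<dots> < card {..2 * card C}" by (simp add: card_cartesian_product)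
    finally have "\<not> inj_on ?f {..2 * card C}" by (rule pigeonhole)
    then obtain i' k' where ik': "i' \<le> 2 * card C" "k' \<le> 2 * card C" "i' \<noteq> k'" "?f i' = ?f k'"
      by (auto simp: inj_on_def)
    define i k where "i = min i' k'" and "k = max i' k'"
    have ik: "i < k" "k \<le> 2 * card C" "c i = c k" "(ts ! i < c i) = (ts ! k < c k)"
      using ik' by (auto simp: i_def k_def min_def max_def)
    define t where "t = c i"
    have t: "t \<in> {0..1}" using c[of i] ik C(1) by (auto simp: t_def)
    have bi: "ts ! i \<in> ball t (d t)" and bk: "ts ! k \<in> ball t (d t)"
      using c[of i] c[of k] ik by (auto simp: t_def)
    have le: "ts ! Suc i \<le> ts ! k"
      using mono[of "Suc i" k] ik by (cases "Suc i = k") auto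
    have lt: "ts ! i < ts ! Suc i" using mono[of i "Suc i"] ik by simp
    have T': "ts ! i \<in> T" "ts ! Suc i \<in> T" using in01[of i] in01[of "Suc i"] ik T by auto
    have close: "dist (x (ts ! Suc i)) (x (ts ! i)) < e"
    proof (cases "ts ! i < t")
      case True
      then have "ts ! k < t" using ik by (simp add: t_def)
      then show ?thesis
        using True bi le lt by (intro left[OF t T'(2,1)]) (auto simp: dist_real_def)
    next
      case False
      then show ?thesis
        using bk le lt by (intro right[OF t T'(2,1)]) (auto simp: dist_real_def)
    qed
    show "\<exists>i<2 * card C. dist (x (ts ! Suc i)) (x (ts ! i)) \<le> 1 / real (Suc j)"
    proof (intro exI[of _ i] conjI)
      show "i < 2 * card C" using ik by linarith
      show "dist (x (ts ! Suc i)) (x (ts ! i)) \<le> 1 / real (Suc j)"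
        using close unfolding e_def by (rule less_imp_le)
    qed
  qed
qed

text \<open>Admits both directions, because limits from the left are tested with increasing and
  limits from the right with decreasing sequences.\<close>

lemma no_large_chain:
  assumes x: "bounded_oscillations x" and e: "0 < e"
    and u: "\<And>n. u n \<in> dyadics" and mono: "(\<forall>m n. m < n \<longrightarrow> u m < u n) \<or> (\<forall>m n. m < n \<longrightarrow> u n < u m)"
  shows "\<exists>n. dist (x (u (Suc n))) (x (u n)) \<le> e"
proof -
  obtain j where j: "1 / real (Suc j) < e"
    using nat_approx_posE[OF e] by blast
  from x[unfolded bounded_oscillations_def, THEN spec, of j]
  obtain m where mm: "\<forall>ts\<in>lists dyadics. length ts = Suc m \<and> sorted_wrt (<) ts \<longrightarrow>
     (\<exists>i<m. dist (x (ts ! Suc i)) (x (ts ! i)) \<le> 1 / real (Suc j))"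
    by (rule exE)
  have m: "\<exists>i<m. dist (x (ts ! Suc i)) (x (ts ! i)) \<le> 1 / real (Suc j)"
    if "ts \<in> lists dyadics" "length ts = Suc m" "sorted_wrt (<) ts" for ts
    using bspec[OF mm that(1)] that(2,3) by blast
  from mono show ?thesis
  proof
    assume inc: "\<forall>m n. m < n \<longrightarrow> u m < u n"
    let ?ts = "map u [0..<Suc m]"
    have "\<exists>i<m. dist (x (?ts ! Suc i)) (x (?ts ! i)) \<le> 1 / real (Suc j)"
    proof (rule m[of ?ts])
      show "?ts \<in> lists dyadics" using u by (simp add: in_lists_conv_set del: upt_Suc)
      show "sorted_wrt (<) ?ts"
        unfolding sorted_wrt_map
      proof (rule sorted_wrt_mono_rel[OF _ sorted_wrt_upt])
        fix i k :: nat assume "i < k"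
        with inc show "u i < u k" by blast
      qed
    qed simp
    then obtain i where i: "i < m" "dist (x (?ts ! Suc i)) (x (?ts ! i)) \<le> 1 / real (Suc j)" by blast
    have "?ts ! Suc i = u (Suc i)" "?ts ! i = u i"
      using i(1) by (simp_all add: nth_map_upt del: upt_Suc)
    with i(2) have "dist (x (u (Suc i))) (x (u i)) \<le> 1 / real (Suc j)"
      by (simp only:)
    with j show ?thesis by (intro exI[of _ i]) simp
  next
    assume dec: "\<forall>m n. m < n \<longrightarrow> u n < u m"
    \<comment> \<open>An initial segment of the decreasing sequence, read backwards to form an
      increasing chain.\<close>
    let ?ts = "map (\<lambda>i. u (m - i)) [0..<Suc m]"
    have "\<exists>i<m. dist (x (?ts ! Suc i)) (x (?ts ! i)) \<le> 1 / real (Suc j)"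
    proof (rule m[of ?ts])
      show "?ts \<in> lists dyadics" using u by (simp add: in_lists_conv_set del: upt_Suc)
      show "sorted_wrt (<) ?ts"
        unfolding sorted_wrt_map
      proof (rule sorted_wrt_mono_rel[OF _ sorted_wrt_upt])
        fix i k assume "i \<in> set [0..<Suc m]" "k \<in> set [0..<Suc m]" "i < k"
        then have "m - k < m - i" by auto
        with dec show "u (m - i) < u (m - k)" by blast
      qed
    qed simp
    then obtain i where i: "i < m" "dist (x (?ts ! Suc i)) (x (?ts ! i)) \<le> 1 / real (Suc j)" by blast
    have "?ts ! Suc i = u (m - Suc i)" "?ts ! i = u (Suc (m - Suc i))"
      using i(1) by (simp_all add: nth_map_upt Suc_diff_Suc del: upt_Suc)
    with i(2) have "dist (x (u (m - Suc i))) (x (u (Suc (m - Suc i)))) \<le> 1 / real (Suc j)"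
      by (simp only:)
    with j show ?thesis by (intro exI[of _ "m - Suc i"]) (simp add: dist_commute)
  qed
qed

section \<open>One-sided limits along the dyadic times\<close>

lemma far_from_one:
  fixes p q u :: "'b::metric_space"
  assumes "2 * e < dist p q"
  shows "e < dist p u \<or> e < dist q u"
  using dist_triangle2[of p q u] assms by linarith

text \<open>Otherwise every right neighbourhood of \<open>t\<close> contains two dyadic times with
  values more than \<open>e\<close> apart. One of the two is more than \<open>e / 2\<close> away
  from the current value, so a decreasing chain of such steps could be continued forever.\<close>

lemma right_oscillation:
  assumes x: "bounded_oscillations x" and t: "0 \<le> t" "t < 1" and e: "0 < e"
  shows "\<exists>d>0. \<forall>r\<in>dyadics. \<forall>s\<in>dyadics. t < r \<and> r < t + d \<and> t < s \<and> s < t + d \<longrightarrow> dist (x r) (x s) \<le> e"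
proof (rule ccontr)
  assume "\<not> ?thesis"
  then have neg: "\<exists>r\<in>dyadics. \<exists>s\<in>dyadics. t < r \<and> r < t + d \<and> t < s \<and> s < t + d \<and> e < dist (x r) (x s)" if "0 < d" for d
    using that by (meson not_le)
  have "\<exists>u. \<forall>n. (u n \<in> dyadics \<and> t < u n) \<and> (u (Suc n) < u n \<and> e / 2 < dist (x (u (Suc n))) (x (u n)))"
  proof (rule dependent_nat_choice)
    show "\<exists>u. u \<in> dyadics \<and> t < u" using one_in_dyadics t by blast
    fix u :: real and n :: nat assume u: "u \<in> dyadics \<and> t < u"
    then obtain r s where rs: "r \<in> dyadics" "s \<in> dyadics" "t < r" "r < t + (u - t)" "t < s" "s < t + (u - t)" "e < dist (x r) (x s)"
      using neg[of "u - t"] by auto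
    then have "e / 2 < dist (x r) (x u) \<or> e / 2 < dist (x s) (x u)"
      by (intro far_from_one) simp
    with rs show "\<exists>v. (v \<in> dyadics \<and> t < v) \<and> v < u \<and> e / 2 < dist (x v) (x u)" by auto
  qed
  then obtain u where u: "\<And>n. u n \<in> dyadics" "\<And>n. u (Suc n) < u n" "\<And>n. e / 2 < dist (x (u (Suc n))) (x (u n))"
    by blast
  have "u n < u m" if "m < n" for m n
    using that by (induction n) (auto simp: less_Suc_eq intro: less_trans[OF u(2)] u(2))
  then have "\<exists>n. dist (x (u (Suc n))) (x (u n)) \<le> e / 2"
    using e by (intro no_large_chain[OF x _ u(1)] disjI2) simp_all
  with u(3) show False by (meson not_le)
qed

lemma left_oscillation:
  assumes x: "bounded_oscillations x" and t: "0 < t" "t \<le> 1" and e: "0 < e"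
  shows "\<exists>d>0. \<forall>r\<in>dyadics. \<forall>s\<in>dyadics. t - d < r \<and> r < t \<and> t - d < s \<and> s < t \<longrightarrow> dist (x r) (x s) \<le> e"
proof (rule ccontr)
  assume "\<not> ?thesis"
  then have neg: "\<exists>r\<in>dyadics. \<exists>s\<in>dyadics. t - d < r \<and> r < t \<and> t - d < s \<and> s < t \<and> e < dist (x r) (x s)" if "0 < d" for d
    using that by (meson not_le)
  have "\<exists>u. \<forall>n. (u n \<in> dyadics \<and> u n < t) \<and> (u n < u (Suc n) \<and> e / 2 < dist (x (u (Suc n))) (x (u n)))"
  proof (rule dependent_nat_choice)
    show "\<exists>u. u \<in> dyadics \<and> u < t" using neg[of 1] by auto
    fix u :: real and n :: nat assume u: "u \<in> dyadics \<and> u < t"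
    then obtain r s where rs: "r \<in> dyadics" "s \<in> dyadics" "t - (t - u) < r" "r < t" "t - (t - u) < s" "s < t" "e < dist (x r) (x s)"
      using neg[of "t - u"] by auto
    then have "e / 2 < dist (x r) (x u) \<or> e / 2 < dist (x s) (x u)"
      by (intro far_from_one) simp
    with rs show "\<exists>v. (v \<in> dyadics \<and> v < t) \<and> u < v \<and> e / 2 < dist (x v) (x u)" by auto
  qed
  then obtain u where u: "\<And>n. u n \<in> dyadics" "\<And>n. u n < u (Suc n)" "\<And>n. e / 2 < dist (x (u (Suc n))) (x (u n))"
    by blast
  have "u m < u n" if "m < n" for m n
    using that by (induction n) (auto simp: less_Suc_eq intro: less_trans[OF _ u(2)] u(2))
  then have "\<exists>n. dist (x (u (Suc n))) (x (u n)) \<le> e / 2"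
    using e by (intro no_large_chain[OF x _ u(1)] disjI1) simp_all
  with u(3) show False by (meson not_le)
qed

text \<open>No dyadic time lies beyond 1, so the endpoint keeps its own value.\<close>

definition right_limits :: "(real \<Rightarrow> 'b::t2_space) \<Rightarrow> real \<Rightarrow> 'b" where
  "right_limits x t = (if t < 1 then lim (\<lambda>n. x (upper_dyadic n t)) else x 1)"

lemma upper_dyadic_convergent:
  fixes x :: "real \<Rightarrow> 'b::complete_space"
  assumes x: "bounded_oscillations x" and t: "0 \<le> t" "t < 1"
  shows "(\<lambda>n. x (upper_dyadic n t)) \<longlonglongrightarrow> right_limits x t"
proof -
  have "Cauchy (\<lambda>n. x (upper_dyadic n t))"
  proof (rule metric_CauchyI)
    fix e :: real assume "0 < e"
    then have "0 < e / 2" by simp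
    from right_oscillation[OF x t this] obtain d where d: "0 < d"
      "\<And>r s. r \<in> dyadics \<Longrightarrow> s \<in> dyadics \<Longrightarrow> t < r \<Longrightarrow> r < t + d \<Longrightarrow> t < s \<Longrightarrow> s < t + d \<Longrightarrow> dist (x r) (x s) \<le> e / 2"
      by blast
    have "\<forall>\<^sub>F n in sequentially. upper_dyadic n t < t + d"
      using upper_dyadic_tendsto d(1) by (intro order_tendstoD(2)) auto
    then obtain N where N: "\<And>n. N \<le> n \<Longrightarrow> upper_dyadic n t < t + d"
      by (auto simp: eventually_sequentially)
    have "dist (x (upper_dyadic m t)) (x (upper_dyadic n t)) < e" if "N \<le> m" "N \<le> n" for m n
    proof -
      have "dist (x (upper_dyadic m t)) (x (upper_dyadic n t)) \<le> e / 2"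
        by (intro d(2) upper_dyadic_in t upper_dyadic_gt N that)
      with \<open>0 < e\<close> show ?thesis by simp
    qed
    then show "\<exists>M. \<forall>m\<ge>M. \<forall>n\<ge>M. dist (x (upper_dyadic m t)) (x (upper_dyadic n t)) < e" by blast
  qed
  then show ?thesis
    using t by (simp add: right_limits_def Cauchy_convergent_iff convergent_LIMSEQ_iff)
qed

text \<open>Transfers an estimate from dyadic times in an open interval to the extended function.
  The left end may be \<open>t\<close> itself, since for \<open>t < 1\<close> only values strictly
  to the right of \<open>t\<close> are consulted.\<close>

lemma right_limits_close:
  fixes x :: "real \<Rightarrow> 'b::complete_space"
  assumes x: "bounded_oscillations x" and t: "0 \<le> t" "t \<le> 1" and b: "t < b \<or> t = 1 \<and> 1 < b"
    and a: "a < t \<or> a = t \<and> t < 1"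
    and le: "\<And>s. s \<in> dyadics \<Longrightarrow> a < s \<Longrightarrow> s < b \<Longrightarrow> dist (x s) l \<le> e"
  shows "dist (right_limits x t) l \<le> e"
proof (cases "t < 1")
  case False
  then show ?thesis using t a b by (auto simp: right_limits_def intro!: le one_in_dyadics)
next
  case True
  have "(\<lambda>n. dist (x (upper_dyadic n t)) l) \<longlonglongrightarrow> dist (right_limits x t) l"
    by (intro tendsto_dist upper_dyadic_convergent[OF x t(1) True] tendsto_const)
  moreover have "\<forall>\<^sub>F n in sequentially. upper_dyadic n t < b"
    using upper_dyadic_tendsto b True by (intro order_tendstoD(2)) auto
  then have "\<forall>\<^sub>F n in sequentially. dist (x (upper_dyadic n t)) l \<le> e"
  proof eventually_elim
    case (elim n)
    show ?case
      using elim a upper_dyadic_gt[of t n] by (intro le upper_dyadic_in t True) auto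
  qed
  ultimately show ?thesis by (rule tendsto_upperbound) simp
qed

lemma right_limits_cadlag:
  fixes x :: "real \<Rightarrow> 'b::complete_space"
  assumes x: "bounded_oscillations x"
  shows "cadlag_on {0..1} (right_limits x)"
  unfolding cadlag_on_def
proof (intro ballI conjI)
  fix t :: real assume t: "t \<in> {0..1}"
  show "(right_limits x \<longlongrightarrow> right_limits x t) (at t within {0..1} \<inter> {t<..})"
  proof (cases "t < 1")
    case False
    with t have "{0..1} \<inter> {t<..} = {}" by auto
    then show ?thesis by simp
  next
    case True
    show ?thesis
    proof (rule tendstoI)
      fix e :: real assume e: "0 < e"
      then have e2: "0 < e / 2" by simp
      obtain d where d: "0 < d"
        "\<And>r s. r \<in> dyadics \<Longrightarrow> s \<in> dyadics \<Longrightarrow> t < r \<Longrightarrow> r < t + d \<Longrightarrow> t < s \<Longrightarrow> s < t + d \<Longrightarrow> dist (x r) (x s) \<le> e / 2"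
        using right_oscillation[OF x _ True e2] t by auto
      have near: "dist (right_limits x s) (right_limits x t) \<le> e / 2" if s: "t < s" "s < t + d" "s \<le> 1" for s
      proof (rule right_limits_close[OF x, where a = t and b = "t + d"])
        fix r assume r: "r \<in> dyadics" "t < r" "r < t + d"
        have "dist (right_limits x t) (x r) \<le> e / 2"
          by (rule right_limits_close[OF x, where a = t and b = "t + d"])
             (use t True d r in \<open>auto intro!: d(2)\<close>)
        then show "dist (x r) (right_limits x t) \<le> e / 2" by (simp add: dist_commute)
      qed (use s t in auto)
      show "\<forall>\<^sub>F s in at t within {0..1} \<inter> {t<..}. dist (right_limits x s) (right_limits x t) < e"
        unfolding eventually_at
      proof (intro exI conjI ballI impI)
        show "0 < d" by fact
        fix s assume "s \<in> {0..1} \<inter> {t<..}" "s \<noteq> t \<and> dist s t < d"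
        then have "dist (right_limits x s) (right_limits x t) \<le> e / 2"
          by (intro near) (auto simp: dist_real_def)
        then show "dist (right_limits x s) (right_limits x t) < e" using e by simp
      qed
    qed
  qed
  show "\<exists>l. (right_limits x \<longlongrightarrow> l) (at t within {0..1} \<inter> {..<t})"
  proof (cases "0 < t")
    case False
    with t have "{0..1} \<inter> {..<t} = {}" by auto
    then show ?thesis by simp
  next
    case True
    have t1: "t \<le> 1" using t by simp
    \<comment> \<open>Times below \<open>t\<close> that tend to it and are kept nonnegative; a
      dyadic time between \<open>u n\<close> and \<open>t\<close> provides a sequence that
      determines the left limit.\<close>
    define u where "u = (\<lambda>n. max 0 (t - (1 / 2) ^ n))"
    have u0: "0 \<le> u n" "u n < t" for n using True by (auto simp: u_def)
    have ud: "\<exists>s. s \<in> dyadics \<and> u n < s \<and> s < t" for n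
    proof -
      have "\<forall>\<^sub>F k in sequentially. upper_dyadic k (u n) < t"
        using upper_dyadic_tendsto u0[of n] by (intro order_tendstoD(2)) auto
      then obtain k where "upper_dyadic k (u n) < t" by (auto simp: eventually_sequentially)
      then show ?thesis
        using upper_dyadic_gt[of "u n" k] upper_dyadic_in[of "u n" k] u0[of n] t1 by auto
    qed
    then obtain v where v: "\<And>n. v n \<in> dyadics" "\<And>n. u n < v n" "\<And>n. v n < t" by metis
    have lower: "(\<lambda>n. t - (1 / 2) ^ n) \<longlonglongrightarrow> t"
      using tendsto_diff[OF tendsto_const[of t] LIMSEQ_power_zero[of "1 / 2 :: real"]] by simp
    have vt: "v \<longlonglongrightarrow> t"
    proof (rule tendsto_sandwich[OF _ _ lower tendsto_const])
      show "\<forall>\<^sub>F n in sequentially. t - (1 / 2) ^ n \<le> v n"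
      proof (rule always_eventually, rule allI)
        fix n show "t - (1 / 2) ^ n \<le> v n" using v(2)[of n] by (simp add: u_def)
      qed
      show "\<forall>\<^sub>F n in sequentially. v n \<le> t"
        using v(3) by (intro always_eventually allI less_imp_le)
    qed
    have "Cauchy (\<lambda>n. x (v n))"
    proof (rule metric_CauchyI)
      fix e :: real assume "0 < e"
      then have "0 < e / 2" by simp
      from left_oscillation[OF x True t1 this] obtain d where d: "0 < d"
        "\<And>r s. r \<in> dyadics \<Longrightarrow> s \<in> dyadics \<Longrightarrow> t - d < r \<Longrightarrow> r < t \<Longrightarrow> t - d < s \<Longrightarrow> s < t \<Longrightarrow> dist (x r) (x s) \<le> e / 2"
        by blast
      have "\<forall>\<^sub>F n in sequentially. t - d < v n"
        using vt d(1) by (intro order_tendstoD(1)) auto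
      then obtain N where N: "\<And>n. N \<le> n \<Longrightarrow> t - d < v n"
        by (auto simp: eventually_sequentially)
      have "dist (x (v m)) (x (v n)) < e" if "N \<le> m" "N \<le> n" for m n
      proof -
        have "dist (x (v m)) (x (v n)) \<le> e / 2"
          by (intro d(2) v N that)
        with \<open>0 < e\<close> show ?thesis by simp
      qed
      then show "\<exists>M. \<forall>m\<ge>M. \<forall>n\<ge>M. dist (x (v m)) (x (v n)) < e" by blast
    qed
    then obtain l where l: "(\<lambda>n. x (v n)) \<longlonglongrightarrow> l"
      by (auto simp: Cauchy_convergent_iff convergent_def)
    show ?thesis
    proof (rule exI[of _ l], rule tendstoI)
      fix e :: real assume e: "0 < e"
      then have e2: "0 < e / 2" by simp
      from left_oscillation[OF x True t1 e2] obtain d where d: "0 < d"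
        "\<And>r s. r \<in> dyadics \<Longrightarrow> s \<in> dyadics \<Longrightarrow> t - d < r \<Longrightarrow> r < t \<Longrightarrow> t - d < s \<Longrightarrow> s < t \<Longrightarrow> dist (x r) (x s) \<le> e / 2"
        by blast
      have near_l: "dist (x s) l \<le> e / 2" if s: "s \<in> dyadics" "t - d < s" "s < t" for s
      proof (rule tendsto_upperbound)
        show "(\<lambda>n. dist (x s) (x (v n))) \<longlonglongrightarrow> dist (x s) l"
          by (intro tendsto_dist tendsto_const l)
        have "\<forall>\<^sub>F n in sequentially. t - d < v n"
          using vt d(1) by (intro order_tendstoD(1)) auto
        then show "\<forall>\<^sub>F n in sequentially. dist (x s) (x (v n)) \<le> e / 2"
          by eventually_elim (intro d(2) s v)
      qed simp
      show "\<forall>\<^sub>F s in at t within {0..1} \<inter> {..<t}. dist (right_limits x s) l < e"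
        unfolding eventually_at
      proof (intro exI conjI ballI impI)
        show "0 < d" by fact
        fix s assume s: "s \<in> {0..1} \<inter> {..<t}" "s \<noteq> t \<and> dist s t < d"
        then have s': "t - d < s" "s < t" "s < 1" "0 \<le> s" using t1 by (auto simp: dist_real_def)
        have "dist (right_limits x s) l \<le> e / 2"
        proof (rule right_limits_close[OF x, where a = s and b = t])
          fix r assume r: "r \<in> dyadics" "s < r" "r < t"
          show "dist (x r) l \<le> e / 2"
            by (rule near_l) (use r s' in simp_all)
        qed (use s' in simp_all)
        then show "dist (right_limits x s) l < e" using e by simp
      qed
    qed
  qed
qed

lemma cadlag_right_limits_eq:
  fixes x :: "real \<Rightarrow> 'b::metric_space"
  assumes x: "cadlag_on T x" and T: "{0..1} \<subseteq> T" and t: "t \<in> {0..1}"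
  shows "right_limits x t = x t"
proof (cases "t < 1")
  case False
  with t show ?thesis by (auto simp: right_limits_def)
next
  case True
  have "(x \<longlongrightarrow> x t) (at t within T \<inter> {t<..})" using x t T by (auto simp: cadlag_on_def)
  moreover have "filterlim (\<lambda>n. upper_dyadic n t) (at t within T \<inter> {t<..}) sequentially"
    unfolding filterlim_at
  proof
    show "\<forall>\<^sub>F n in sequentially. upper_dyadic n t \<in> T \<inter> {t<..} \<and> upper_dyadic n t \<noteq> t"
    proof (rule always_eventually, rule allI)
      fix n
      have "upper_dyadic n t \<in> dyadics" using t True by (intro upper_dyadic_in) auto
      then have "upper_dyadic n t \<in> T" using dyadics_bounds T by force
      then show "upper_dyadic n t \<in> T \<inter> {t<..} \<and> upper_dyadic n t \<noteq> t"
        using upper_dyadic_gt[of t n] by auto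
    qed
  qed (rule upper_dyadic_tendsto)
  ultimately have "(\<lambda>n. x (upper_dyadic n t)) \<longlonglongrightarrow> x t"
    by (rule filterlim_compose)
  then show ?thesis using True by (simp add: right_limits_def limI)
qed

section \<open>Cadlag versions, path laws and couplings\<close>

lemma measurable_bounded_oscillations:
  fixes Z :: "real \<Rightarrow> 'a \<Rightarrow> 'b::{metric_space, second_countable_topology}"
  assumes Z: "\<And>t. t \<in> dyadics \<Longrightarrow> Z t \<in> borel_measurable M"
  shows "{\<omega> \<in> space M. bounded_oscillations (\<lambda>t. Z t \<omega>)} \<in> sets M"
  unfolding bounded_oscillations_def
proof (intro sets.sets_Collect_countable_All sets.sets_Collect_countable_Ex sets.sets_Collect_countable_All')
  show "countable (lists dyadics)" using countable_dyadics by (rule countable_lists)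
  fix j m :: nat and ts assume ts: "ts \<in> lists dyadics"
  show "{\<omega> \<in> space M. length ts = Suc m \<and> sorted_wrt (<) ts \<longrightarrow>
     (\<exists>i<m. dist (Z (ts ! Suc i) \<omega>) (Z (ts ! i) \<omega>) \<le> 1 / real (Suc j))} \<in> sets M"
  proof (cases "length ts = Suc m \<and> sorted_wrt (<) ts")
    case True
    have Zi: "Z (ts ! i) \<in> borel_measurable M" if "i \<le> m" for i
      using ts True that by (intro Z) (auto simp: in_lists_conv_set)
    have "{\<omega> \<in> space M. \<exists>i\<in>{..<m}. dist (Z (ts ! Suc i) \<omega>) (Z (ts ! i) \<omega>) \<le> 1 / real (Suc j)} \<in> sets M"
    proof (rule sets.sets_Collect_finite_Ex)
      fix i assume "i \<in> {..<m}"
      then have "Suc i \<le> m" "i \<le> m" by simp_all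
      note Zs = Zi[OF this(1)] Zi[OF this(2)]
      show "{\<omega> \<in> space M. dist (Z (ts ! Suc i) \<omega>) (Z (ts ! i) \<omega>) \<le> 1 / real (Suc j)} \<in> sets M"
        by (rule borel_measurable_le[OF borel_measurable_dist[OF Zs] borel_measurable_const])
    qed simp
    moreover have "(length ts = Suc m \<and> sorted_wrt (<) ts \<longrightarrow> Q) \<longleftrightarrow> Q" for Q using True by simp
    ultimately show ?thesis by (simp only: Bex_def lessThan_iff)
  next
    case False
    then have "{\<omega> \<in> space M. length ts = Suc m \<and> sorted_wrt (<) ts \<longrightarrow>
        (\<exists>i<m. dist (Z (ts ! Suc i) \<omega>) (Z (ts ! i) \<omega>) \<le> 1 / real (Suc j))} = space M"
      by blast
    then show ?thesis by (simp only: sets.top)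
  qed
qed

text \<open>The value 0 on the exceptional event makes every path cadlag, not just almost every one,
  because couplings are measures on the space of cadlag paths.\<close>

definition cadlag_version :: "(real \<Rightarrow> 'a \<Rightarrow> 'b::{t2_space,zero,metric_space}) \<Rightarrow> real \<Rightarrow> 'a \<Rightarrow> 'b" where
  "cadlag_version Z t \<omega> = (if bounded_oscillations (\<lambda>t. Z t \<omega>) then right_limits (\<lambda>t. Z t \<omega>) t else 0)"

lemma cadlag_version_cadlag:
  fixes Z :: "real \<Rightarrow> 'a \<Rightarrow> 'b::{complete_space,zero}"
  shows "cadlag_on {0..1} (\<lambda>t. cadlag_version Z t \<omega>)"
proof (cases "bounded_oscillations (\<lambda>t. Z t \<omega>)")
  case True
  then show ?thesis
    using right_limits_cadlag[OF True] by (simp add: cadlag_version_def)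
next
  case False
  then show ?thesis by (auto simp: cadlag_version_def cadlag_on_def)
qed

lemma measurable_right_limits:
  fixes Z :: "real \<Rightarrow> 'a \<Rightarrow> 'b::{banach, second_countable_topology}"
  assumes Z: "\<And>t. t \<in> {0..1} \<Longrightarrow> Z t \<in> borel_measurable M" and t: "t \<in> {0..1}"
  shows "(\<lambda>\<omega>. right_limits (\<lambda>t. Z t \<omega>) t) \<in> borel_measurable M"
proof (cases "t < 1")
  case True
  have "Z (upper_dyadic n t) \<in> borel_measurable M" for n
    using dyadics_bounds[OF upper_dyadic_in[of t n]] t True by (intro Z) auto
  then show ?thesis
    using True unfolding right_limits_def by (simp add: borel_measurable_lim_metric)
next
  case False
  then show ?thesis using Z[of 1] by (simp add: right_limits_def)
qed

lemma measurable_cadlag_version: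
  fixes Z :: "real \<Rightarrow> 'a \<Rightarrow> 'b::{banach, second_countable_topology}"
  assumes Z: "\<And>t. t \<in> {0..1} \<Longrightarrow> Z t \<in> borel_measurable M" and t: "t \<in> {0..1}"
  shows "cadlag_version Z t \<in> borel_measurable M"
proof -
  have osc: "{\<omega> \<in> space M. bounded_oscillations (\<lambda>t. Z t \<omega>)} \<in> sets M"
  proof (rule measurable_bounded_oscillations)
    fix t assume "t \<in> dyadics"
    then show "Z t \<in> borel_measurable M" by (intro Z) (simp add: dyadics_bounds)
  qed
  have rl: "(\<lambda>\<omega>. right_limits (\<lambda>t. Z t \<omega>) t) \<in> borel_measurable M"
    by (rule measurable_right_limits[OF Z t])
  show ?thesis
    unfolding cadlag_version_def[abs_def]
    by (rule measurable_If[OF rl borel_measurable_const osc])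
qed

text \<open>The modification coincides with the process at every fixed time, because this is an event
  of the law on the product \<open>\<sigma>\<close>-algebra and holds for the cadlag process of the same law.\<close>

lemma cadlag_version_AE_eq:
  fixes X :: "real \<Rightarrow> 'a \<Rightarrow> real^'d" and Z :: "real \<Rightarrow> 'b \<Rightarrow> real^'d"
  assumes X: "\<And>t. t \<in> {0..1} \<Longrightarrow> X t \<in> borel_measurable Q" and cX: "AE \<omega> in Q. cadlag_on {0..} (\<lambda>t. X t \<omega>)"
    and Z: "\<And>t. t \<in> {0..1} \<Longrightarrow> Z t \<in> borel_measurable M"
    and law: "path_law Q X = path_law M Z" and t: "t \<in> {0..1}"
  shows "AE \<omega> in M. cadlag_version Z t \<omega> = Z t \<omega>"
proof -
  let ?S = "Pi\<^sub>M {0..1} (\<lambda>_. borel) :: (real \<Rightarrow> real^'d) measure"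
  define A where "A = {x \<in> space ?S. bounded_oscillations x \<and> right_limits x t = x t}"
  have ev: "(\<lambda>x. x s) \<in> borel_measurable ?S" if "s \<in> {0..1}" for s
    using that by measurable
  have "{x \<in> space ?S. bounded_oscillations (\<lambda>s. x s)} \<in> sets ?S"
  proof (rule measurable_bounded_oscillations[where Z = "\<lambda>s x. x s"])
    fix t assume "t \<in> dyadics"
    then show "(\<lambda>x. x t) \<in> borel_measurable ?S" by (intro ev) (simp add: dyadics_bounds)
  qed
  moreover have "{x \<in> space ?S. right_limits x t = x t} \<in> sets ?S"
  proof -
    have "(\<lambda>x. right_limits x t) \<in> borel_measurable ?S"
      by (rule measurable_right_limits[where Z = "\<lambda>s x. x s", OF _ t]) (rule ev)
    from borel_measurable_eq[OF borel_measurable_dist[OF this ev[OF t]] borel_measurable_const[of 0]]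
    show ?thesis by simp
  qed
  ultimately have A: "A \<in> sets ?S"
    unfolding A_def by (intro sets.sets_Collect_conj) simp_all
  have rX: "(\<lambda>\<omega>. \<lambda>s\<in>{0..1}. X s \<omega>) \<in> Q \<rightarrow>\<^sub>M ?S"
    by (rule measurable_restrict[OF X])
  have rZ: "(\<lambda>\<omega>. \<lambda>s\<in>{0..1}. Z s \<omega>) \<in> M \<rightarrow>\<^sub>M ?S"
    by (rule measurable_restrict[OF Z])
  \<comment> \<open>A path law sees only the restriction of a path to [0,1]; both notions evaluate a
    path at dyadic times of that interval.\<close>
  have restr: "bounded_oscillations (\<lambda>s\<in>{0..1}. x s) = bounded_oscillations x"
    "right_limits (\<lambda>s\<in>{0..1}. x s) t = right_limits x t" for x :: "real \<Rightarrow> real^'d"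
  proof -
    show "bounded_oscillations (\<lambda>s\<in>{0..1}. x s) = bounded_oscillations x"
      by (rule bounded_oscillations_cong) (simp add: dyadics_bounds)
    show "right_limits (\<lambda>s\<in>{0..1}. x s) t = right_limits x t"
    proof (cases "t < 1")
      case True
      have "upper_dyadic n t \<in> {0..1}" for n
        using dyadics_bounds[OF upper_dyadic_in[of t n]] t True by auto
      then show ?thesis using True by (simp add: right_limits_def)
    qed (simp add: right_limits_def)
  qed
  have "AE x in path_law Q X. x \<in> A"
    unfolding path_law_def
  proof (rule AE_distr_iff[OF rX, THEN iffD2])
    show "{x \<in> space ?S. x \<in> A} \<in> sets ?S"
      using A sets.sets_into_space[OF A] by (simp add: Int_absorb1 Collect_conj_eq)
    show "AE \<omega> in Q. (\<lambda>s\<in>{0..1}. X s \<omega>) \<in> A"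
      using cX AE_space
    proof eventually_elim
      case (elim \<omega>)
      have sub: "{0..1::real} \<subseteq> {0..}" by auto
      have "(\<lambda>s\<in>{0..1}. X s \<omega>) \<in> space ?S"
        by (rule measurable_space[OF rX elim(2)])
      moreover have "bounded_oscillations (\<lambda>s\<in>{0..1}. X s \<omega>)"
        unfolding restr by (rule cadlag_bounded_oscillations[OF elim(1) sub])
      moreover have "right_limits (\<lambda>s\<in>{0..1}. X s \<omega>) t = (\<lambda>s\<in>{0..1}. X s \<omega>) t"
        unfolding restr using cadlag_right_limits_eq[OF elim(1) sub t] t by simp
      ultimately show ?case by (simp add: A_def)
    qed
  qed
  then have "AE x in distr M ?S (\<lambda>\<omega>. \<lambda>s\<in>{0..1}. Z s \<omega>). x \<in> A"
    unfolding law unfolding path_law_def .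
  then have "AE \<omega> in M. (\<lambda>s\<in>{0..1}. Z s \<omega>) \<in> A"
    by (rule AE_distrD[OF rZ])
  then show ?thesis
  proof eventually_elim
    case (elim \<omega>)
    then have "bounded_oscillations (\<lambda>s. Z s \<omega>)" "right_limits (\<lambda>s. Z s \<omega>) t = Z t \<omega>"
      using t by (auto simp: A_def restr)
    then show ?case by (simp add: cadlag_version_def)
  qed
qed

text \<open>The exceptional null set may vary with \<open>t\<close>: cylinder sets involve finitely
  many times, and they determine the law.\<close>

lemma path_law_cong_AE:
  fixes Z Z' :: "real \<Rightarrow> 'a \<Rightarrow> real^'d"
  assumes M: "prob_space M" and Z: "\<And>t. t \<in> {0..1} \<Longrightarrow> Z t \<in> borel_measurable M"
    and Z': "\<And>t. t \<in> {0..1} \<Longrightarrow> Z' t \<in> borel_measurable M"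
    and eq: "\<And>t. t \<in> {0..1} \<Longrightarrow> AE \<omega> in M. Z t \<omega> = Z' t \<omega>"
  shows "path_law M Z = path_law M Z'"
proof (rule measure_eqI_PiM_infinite[where I = "{0..1}" and M = "\<lambda>_. borel"])
  have rZ: "(\<lambda>\<omega>. \<lambda>s\<in>{0..1}. Z s \<omega>) \<in> M \<rightarrow>\<^sub>M Pi\<^sub>M {0..1} (\<lambda>_. borel)"
    by (rule measurable_restrict[OF Z])
  have rZ': "(\<lambda>\<omega>. \<lambda>s\<in>{0..1}. Z' s \<omega>) \<in> M \<rightarrow>\<^sub>M Pi\<^sub>M {0..1} (\<lambda>_. borel)"
    by (rule measurable_restrict[OF Z'])
  show "sets (path_law M Z) = sets (Pi\<^sub>M {0..1} (\<lambda>_. borel))" "sets (path_law M Z') = sets (Pi\<^sub>M {0..1} (\<lambda>_. borel))"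
    by (simp_all add: path_law_def)
  show "finite_measure (path_law M Z)"
    unfolding path_law_def
    by (rule finite_measure.finite_measure_distr[OF _ rZ]) (rule prob_space.finite_measure[OF M])
  fix J :: "real set" and A :: "real \<Rightarrow> (real^'d) set"
  assume J: "finite J" "J \<subseteq> {0..1}" and A: "\<And>i. i \<in> J \<Longrightarrow> A i \<in> sets borel"
  let ?E = "prod_emb {0..1} (\<lambda>_. borel) J (Pi\<^sub>E J A)"
  have E: "?E \<in> sets (Pi\<^sub>M {0..1} (\<lambda>_. borel))"
    by (rule sets_PiM_I) (use J A in auto)
  have mem: "(\<lambda>s\<in>{0..1}. z s) \<in> ?E \<longleftrightarrow> (\<forall>s\<in>J. z s \<in> A s)" for z :: "real \<Rightarrow> real^'d"
    using J(2) by (auto simp: prod_emb_iff PiE_iff subset_iff)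
  have "AE \<omega> in M. \<forall>s\<in>J. Z s \<omega> = Z' s \<omega>"
    using J eq by (intro AE_finite_allI) auto
  then have "AE \<omega> in M. \<omega> \<in> (\<lambda>\<omega>. \<lambda>s\<in>{0..1}. Z s \<omega>) -` ?E \<inter> space M \<longleftrightarrow> \<omega> \<in> (\<lambda>\<omega>. \<lambda>s\<in>{0..1}. Z' s \<omega>) -` ?E \<inter> space M"
    by eventually_elim (auto simp: mem)
  then have "emeasure M ((\<lambda>\<omega>. \<lambda>s\<in>{0..1}. Z s \<omega>) -` ?E \<inter> space M) = emeasure M ((\<lambda>\<omega>. \<lambda>s\<in>{0..1}. Z' s \<omega>) -` ?E \<inter> space M)"
    using measurable_sets[OF rZ E] measurable_sets[OF rZ' E] by (rule emeasure_eq_AE)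
  then show "emeasure (path_law M Z) ?E = emeasure (path_law M Z') ?E"
    unfolding path_law_def by (simp add: emeasure_distr[OF rZ E] emeasure_distr[OF rZ' E])
qed

text \<open>Right continuity reduces the supremum to countably many times, which makes the transport
  cost measurable.\<close>

lemma SUP_cadlag_dyadics:
  fixes x y :: "real \<Rightarrow> real^'d"
  assumes x: "cadlag_on {0..1} x" and y: "cadlag_on {0..1} y" and q: "0 < q"
  shows "(SUP t\<in>{0..1}. ennreal (norm (x t - y t) powr q)) = (SUP t\<in>dyadics. ennreal (norm (x t - y t) powr q))"
proof (rule antisym)
  show "(SUP t\<in>{0..1}. ennreal (norm (x t - y t) powr q)) \<le> (SUP t\<in>dyadics. ennreal (norm (x t - y t) powr q))"
  proof (rule SUP_least)
    fix t :: real assume t: "t \<in> {0..1}"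
    show "ennreal (norm (x t - y t) powr q) \<le> (SUP t\<in>dyadics. ennreal (norm (x t - y t) powr q))"
    proof (cases "t < 1")
      case True
      have lx: "(\<lambda>n. x (upper_dyadic n t)) \<longlonglongrightarrow> x t"
        using upper_dyadic_convergent[OF cadlag_bounded_oscillations[OF x order_refl], of t]
          cadlag_right_limits_eq[OF x order_refl t] t True by simp
      have ly: "(\<lambda>n. y (upper_dyadic n t)) \<longlonglongrightarrow> y t"
        using upper_dyadic_convergent[OF cadlag_bounded_oscillations[OF y order_refl], of t]
          cadlag_right_limits_eq[OF y order_refl t] t True by simp
      have "(\<lambda>n. ennreal (norm (x (upper_dyadic n t) - y (upper_dyadic n t)) powr q)) \<longlonglongrightarrow> ennreal (norm (x t - y t) powr q)"
        using q by (intro tendsto_ennrealI tendsto_powr' tendsto_norm tendsto_diff lx ly tendsto_const) auto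
      then show ?thesis
      proof (rule LIMSEQ_le_const2, intro exI allI impI)
        fix n
        have "upper_dyadic n t \<in> dyadics" using t True by (intro upper_dyadic_in) auto
        then show "ennreal (norm (x (upper_dyadic n t) - y (upper_dyadic n t)) powr q)
            \<le> (SUP t\<in>dyadics. ennreal (norm (x t - y t) powr q))"
          by (rule SUP_upper)
      qed
    next
      case False
      with t have "t = 1" by auto
      show ?thesis unfolding \<open>t = 1\<close> by (rule SUP_upper[OF one_in_dyadics])
    qed
  qed
  show "(SUP t\<in>dyadics. ennreal (norm (x t - y t) powr q)) \<le> (SUP t\<in>{0..1}. ennreal (norm (x t - y t) powr q))"
    by (rule SUP_subset_mono) (auto dest: dyadics_bounds)
qed

text \<open>The versions agree almost surely with \<open>Z\<close> and \<open>W\<close> at each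
  time, hence have the prescribed laws, and their joint law is a coupling on cadlag paths. Its cost
  involves dyadic times only and can be expressed through \<open>Z\<close> and \<open>W\<close>
  again.\<close>

theorem wasserstein_le:
  fixes X :: "real \<Rightarrow> 'a \<Rightarrow> real^'d" and Y :: "real \<Rightarrow> 'b \<Rightarrow> real^'d" and Z W :: "real \<Rightarrow> 'c \<Rightarrow> real^'d"
  assumes q: "0 < q" and X: "levy_process PX X" and Y: "levy_process PY Y" and M: "prob_space M"
    and Z: "\<And>t. t \<in> {0..1} \<Longrightarrow> Z t \<in> borel_measurable M" and W: "\<And>t. t \<in> {0..1} \<Longrightarrow> W t \<in> borel_measurable M"
    and lX: "path_law PX X = path_law M Z" and lY: "path_law PY Y = path_law M W"
  shows "wasserstein q (path_law PX X) (path_law PY Y)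
    \<le> (\<integral>\<^sup>+\<omega>. (SUP t\<in>dyadics. ennreal (norm (Z t \<omega> - W t \<omega>) powr q)) \<partial>M)"
proof -
  let ?S = "Pi\<^sub>M {0..1} (\<lambda>_. borel) :: (real \<Rightarrow> real^'d) measure"
  let ?C = "cadlag_space :: (real \<Rightarrow> real^'d) measure"
  interpret M: prob_space M by (rule M)
  define Z' where "Z' = cadlag_version Z"
  define W' where "W' = cadlag_version W"
  have mZ': "Z' t \<in> borel_measurable M" if "t \<in> {0..1}" for t
    unfolding Z'_def by (rule measurable_cadlag_version[OF Z that])
  have mW': "W' t \<in> borel_measurable M" if "t \<in> {0..1}" for t
    unfolding W'_def by (rule measurable_cadlag_version[OF W that])
  have eZ: "AE \<omega> in M. Z' t \<omega> = Z t \<omega>" if "t \<in> {0..1}" for t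
    unfolding Z'_def using X by (intro cadlag_version_AE_eq[OF _ _ Z lX that]) (auto simp: levy_process_def)
  have eW: "AE \<omega> in M. W' t \<omega> = W t \<omega>" if "t \<in> {0..1}" for t
    unfolding W'_def using Y by (intro cadlag_version_AE_eq[OF _ _ W lY that]) (auto simp: levy_process_def)
  define f where "f = (\<lambda>\<omega>. \<lambda>t\<in>{0..1}. Z' t \<omega>)"
  define g where "g = (\<lambda>\<omega>. \<lambda>t\<in>{0..1}. W' t \<omega>)"
  have cad: "cadlag_on {0..1} (\<lambda>t\<in>{0..1}. x t)" if x: "cadlag_on {0..1} x" for x :: "real \<Rightarrow> real^'d"
  proof -
    have *: "((\<lambda>t\<in>{0..1}. x t) \<longlongrightarrow> l) (at t within {0..1} \<inter> A) \<longleftrightarrow> (x \<longlongrightarrow> l) (at t within {0..1} \<inter> A)" for l t A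
      by (rule filterlim_cong) (auto simp: eventually_at_filter)
    show ?thesis
      unfolding cadlag_on_def * using x by (auto simp: cadlag_on_def)
  qed
  have fS: "f \<in> M \<rightarrow>\<^sub>M ?S" and gS: "g \<in> M \<rightarrow>\<^sub>M ?S"
    unfolding f_def g_def by (rule measurable_restrict[OF mZ'], assumption, rule measurable_restrict[OF mW'], assumption)
  have fc: "cadlag_on {0..1} (f \<omega>)" and gc: "cadlag_on {0..1} (g \<omega>)" for \<omega>
    unfolding f_def g_def Z'_def W'_def by (rule cad[OF cadlag_version_cadlag])+
  have fC: "f \<in> M \<rightarrow>\<^sub>M ?C" and gC: "g \<in> M \<rightarrow>\<^sub>M ?C"
    unfolding cadlag_space_def using fc gc by (auto intro!: measurable_restrict_space2 fS gS)
  have CS: "(\<lambda>x. x) \<in> ?C \<rightarrow>\<^sub>M ?S"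
    unfolding cadlag_space_def by (rule measurable_restrict_space1) simp
  have fst: "fst \<in> ?C \<Otimes>\<^sub>M ?C \<rightarrow>\<^sub>M ?S" and snd: "snd \<in> ?C \<Otimes>\<^sub>M ?C \<rightarrow>\<^sub>M ?S"
    by (rule measurable_compose[OF measurable_fst CS], rule measurable_compose[OF measurable_snd CS])
  define \<pi> where "\<pi> = distr M (?C \<Otimes>\<^sub>M ?C) (\<lambda>\<omega>. (f \<omega>, g \<omega>))"
  have fg: "(\<lambda>\<omega>. (f \<omega>, g \<omega>)) \<in> M \<rightarrow>\<^sub>M ?C \<Otimes>\<^sub>M ?C"
    by (rule measurable_Pair[OF fC gC])
  have "\<pi> \<in> couplings (path_law PX X) (path_law PY Y)"
    unfolding couplings_def mem_Collect_eq
  proof (intro conjI)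
    show "prob_space \<pi>" unfolding \<pi>_def by (rule M.prob_space_distr[OF fg])
    show "sets \<pi> = sets (?C \<Otimes>\<^sub>M ?C)" by (simp add: \<pi>_def)
    have "distr \<pi> ?S fst = distr M ?S (fst \<circ> (\<lambda>\<omega>. (f \<omega>, g \<omega>)))"
      unfolding \<pi>_def by (rule distr_distr[OF fst fg])
    also have "\<dots> = path_law M Z'" by (simp add: path_law_def f_def comp_def)
    also have "\<dots> = path_law M Z" by (rule path_law_cong_AE[OF M mZ' Z eZ])
    finally show "distr \<pi> ?S fst = path_law PX X" by (simp only: lX)
    have "distr \<pi> ?S snd = distr M ?S (snd \<circ> (\<lambda>\<omega>. (f \<omega>, g \<omega>)))"
      unfolding \<pi>_def by (rule distr_distr[OF snd fg])
    also have "\<dots> = path_law M W'" by (simp add: path_law_def g_def comp_def)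
    also have "\<dots> = path_law M W" by (rule path_law_cong_AE[OF M mW' W eW])
    finally show "distr \<pi> ?S snd = path_law PY Y" by (simp only: lY)
  qed
  then have "wasserstein q (path_law PX X) (path_law PY Y) \<le> (\<integral>\<^sup>+(x, y). (SUP t\<in>{0..1}. ennreal (norm (x t - y t) powr q)) \<partial>\<pi>)"
    unfolding wasserstein_def by (rule INF_lower)
  also have "\<dots> = (\<integral>\<^sup>+z. (SUP t\<in>dyadics. ennreal (norm (fst z t - snd z t) powr q)) \<partial>\<pi>)"
  proof (rule nn_integral_cong)
    fix z assume "z \<in> space \<pi>"
    then have "cadlag_on {0..1} (fst z)" "cadlag_on {0..1} (snd z)"
      by (auto simp: \<pi>_def space_pair_measure cadlag_space_def space_restrict_space)
    from SUP_cadlag_dyadics[OF this q]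
    show "(case z of (x, y) \<Rightarrow> SUP t\<in>{0..1}. ennreal (norm (x t - y t) powr q)) = (SUP t\<in>dyadics. ennreal (norm (fst z t - snd z t) powr q))"
      by (simp add: split_beta)
  qed
  also have "\<dots> = (\<integral>\<^sup>+\<omega>. (SUP t\<in>dyadics. ennreal (norm (f \<omega> t - g \<omega> t) powr q)) \<partial>M)"
  proof -
    have "(\<lambda>z. SUP t\<in>dyadics. ennreal (norm (fst z t - snd z t) powr q)) \<in> borel_measurable (?C \<Otimes>\<^sub>M ?C)"
    proof (rule borel_measurable_SUP[OF countable_dyadics])
      fix t assume "t \<in> dyadics"
      then have t: "t \<in> {0..1}" using dyadics_bounds by auto
      have ev: "(\<lambda>x. x t) \<in> borel_measurable ?S" using t by measurable
      have "(\<lambda>v::real^'d. ennreal (norm v powr q)) \<in> borel_measurable borel" by measurable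
      then show "(\<lambda>z. ennreal (norm (fst z t - snd z t) powr q)) \<in> borel_measurable (?C \<Otimes>\<^sub>M ?C)"
        by (rule measurable_compose[OF borel_measurable_diff[OF measurable_compose[OF fst ev] measurable_compose[OF snd ev]]])
    qed
    then show ?thesis
      unfolding \<pi>_def by (subst nn_integral_distr[OF fg]) simp_all
  qed
  also have "\<dots> = (\<integral>\<^sup>+\<omega>. (SUP t\<in>dyadics. ennreal (norm (Z t \<omega> - W t \<omega>) powr q)) \<partial>M)"
  proof (rule nn_integral_cong_AE)
    \<comment> \<open>A single null set for all dyadic times; this is where countability of the
      reduced supremum is essential.\<close>
    have "AE \<omega> in M. \<forall>t\<in>dyadics. Z' t \<omega> = Z t \<omega> \<and> W' t \<omega> = W t \<omega>"
    proof (rule AE_ball_countable'[OF _ countable_dyadics])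
      fix t assume "t \<in> dyadics"
      then have t: "t \<in> {0..1}" using dyadics_bounds by auto
      show "AE \<omega> in M. Z' t \<omega> = Z t \<omega> \<and> W' t \<omega> = W t \<omega>"
        using eZ[OF t] eW[OF t] by eventually_elim simp
    qed
    then show "AE \<omega> in M. (SUP t\<in>dyadics. ennreal (norm (f \<omega> t - g \<omega> t) powr q)) = (SUP t\<in>dyadics. ennreal (norm (Z t \<omega> - W t \<omega>) powr q))"
    proof eventually_elim
      case (elim \<omega>)
      then show ?case
        by (intro SUP_cong refl) (simp add: f_def g_def dyadics_bounds)
    qed
  qed
  finally show ?thesis .
qed

section \<open>The Wasserstein bound\<close>

lemma power2_powr_half: "0 \<le> (x::real) \<Longrightarrow> x\<^sup>2 powr (q / 2) = x powr q"
  by (cases "x = 0") (simp_all add: powr_def ln_realpow)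

lemma (in prob_space) nn_integral_powr_le_of_square:
  fixes R :: "'a \<Rightarrow> real"
  assumes R: "R \<in> borel_measurable M" "\<And>x. 0 \<le> R x" and q: "0 < q" "q \<le> 1" and C: "0 \<le> C"
    and le: "(\<integral>\<^sup>+x. ennreal ((R x)\<^sup>2) \<partial>M) \<le> ennreal C"
  shows "(\<integral>\<^sup>+x. ennreal (R x powr q) \<partial>M) \<le> ennreal (C powr (q / 2))"
proof -
  have "(\<integral>\<^sup>+x. ennreal (((R x)\<^sup>2) powr (q / 2)) \<partial>M) \<le> ennreal (C powr (q / 2))"
    by (rule nn_integral_powr_le[OF borel_measurable_power[OF R(1)] zero_le_power2 _ _ C le]) (use q in simp_all)
  then show ?thesis by (simp add: power2_powr_half R(2))
qed

lemma running_max_least: "(\<And>k. k \<le> n \<Longrightarrow> s k \<le> c) \<Longrightarrow> running_max s n \<le> c"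
  by (induction n) auto

lemma running_max_attained: "\<exists>k\<le>n. running_max s n = s k"
proof (induction n)
  case (Suc n)
  then obtain k where "k \<le> n" "running_max s n = s k" by blast
  then show ?case by (cases "s k \<le> s (Suc n)") (auto simp: max_def intro: le_SucI)
qed simp

text \<open>Frozen at 1 after index \<open>2 ^ m\<close>, so that it is an infinite monotone
  sequence inside [0,1].\<close>

definition dyadic_grid :: "nat \<Rightarrow> nat \<Rightarrow> real" where
  "dyadic_grid m k = min 1 (real k / 2 ^ m)"

lemma dyadic_grid_bounds: "dyadic_grid m k \<in> {0..1}"
  by (simp add: dyadic_grid_def)

lemma mono_dyadic_grid: "mono (dyadic_grid m)"
  unfolding dyadic_grid_def by (intro monoI min.mono order_refl divide_right_mono) simp_all

lemma dyadic_grid_refine: "dyadic_grid (Suc m) (2 * k) = dyadic_grid m k"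
  by (simp add: dyadic_grid_def)

lemma dyadics_in_grid:
  assumes "t \<in> dyadics"
  obtains m k where "k \<le> 2 ^ m" "t = dyadic_grid m k"
proof -
  from assms obtain m k where "k \<le> 2 ^ m" "t = real k / 2 ^ m" by (auto simp: dyadics_def)
  with dyadics_bounds(2)[OF assms] show ?thesis by (intro that[of k m]) (simp_all add: dyadic_grid_def)
qed

text \<open>The grids are nested, so the maxima over them increase to at least the supremum over all
  dyadic times; a bound uniform in \<open>m\<close> passes to it by monotone convergence.\<close>

lemma nn_integral_SUP_dyadics_le:
  fixes D :: "real \<Rightarrow> 'a \<Rightarrow> real^'d"
  assumes q: "0 < q" and D: "\<And>t. t \<in> {0..1} \<Longrightarrow> D t \<in> borel_measurable M"
    and K: "\<And>m. (\<integral>\<^sup>+\<omega>. ennreal (running_max (\<lambda>k. norm (D (dyadic_grid m k) \<omega>)) (2 ^ m) powr q) \<partial>M) \<le> K"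
  shows "(\<integral>\<^sup>+\<omega>. (SUP t\<in>dyadics. ennreal (norm (D t \<omega>) powr q)) \<partial>M) \<le> K"
proof -
  let ?r = "\<lambda>m \<omega>. running_max (\<lambda>k. norm (D (dyadic_grid m k) \<omega>)) (2 ^ m)"
  let ?H = "\<lambda>m \<omega>. ennreal (?r m \<omega> powr q)"
  have mr: "?r m \<in> borel_measurable M" for m
    by (rule running_max_measurable) (rule measurable_compose[OF D[OF dyadic_grid_bounds] borel_measurable_norm])
  then have mH: "?H m \<in> borel_measurable M" for m
    by measurable
  have r0: "0 \<le> ?r m \<omega>" for m \<omega> by (rule running_max_nonneg) simp
  have step: "?r m \<omega> \<le> ?r (Suc m) \<omega>" for m \<omega>
  proof (rule running_max_least)
    fix k :: nat assume "k \<le> 2 ^ m"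
    then have "2 * k \<le> 2 ^ Suc m" by simp
    from running_max_ge[OF this, of "\<lambda>k. norm (D (dyadic_grid (Suc m) k) \<omega>)"]
    show "norm (D (dyadic_grid m k) \<omega>) \<le> ?r (Suc m) \<omega>" by (simp only: dyadic_grid_refine)
  qed
  have inc: "incseq ?H"
    by (intro incseq_SucI le_funI ennreal_leI powr_mono2 step r0) (use q in simp)
  have "(SUP t\<in>dyadics. ennreal (norm (D t \<omega>) powr q)) \<le> (SUP m. ?H m \<omega>)" for \<omega>
  proof (rule SUP_least)
    fix t assume "t \<in> dyadics"
    then obtain m k where k: "k \<le> 2 ^ m" "t = dyadic_grid m k" by (rule dyadics_in_grid)
    have "norm (D t \<omega>) \<le> ?r m \<omega>"
      unfolding k(2) by (rule running_max_ge[OF k(1), of "\<lambda>k. norm (D (dyadic_grid m k) \<omega>)"])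
    then have "ennreal (norm (D t \<omega>) powr q) \<le> ?H m \<omega>"
      using q by (intro ennreal_leI powr_mono2) simp_all
    also have "\<dots> \<le> (SUP m. ?H m \<omega>)" by (rule SUP_upper) simp
    finally show "ennreal (norm (D t \<omega>) powr q) \<le> (SUP m. ?H m \<omega>)" .
  qed
  then have "(\<integral>\<^sup>+\<omega>. (SUP t\<in>dyadics. ennreal (norm (D t \<omega>) powr q)) \<partial>M) \<le> (\<integral>\<^sup>+\<omega>. (SUP m. ?H m \<omega>) \<partial>M)"
    by (rule nn_integral_mono)
  also have "\<dots> = (SUP m. \<integral>\<^sup>+\<omega>. ?H m \<omega> \<partial>M)"
    by (rule nn_integral_monotone_convergence_SUP[OF inc mH])
  also have "\<dots> \<le> K" by (rule SUP_least) (rule K)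
  finally show ?thesis .
qed

context comonotonic_coupling
begin

text \<open>For finite \<open>\<epsilon>\<close> the integrand is at most 1 on a set of levels of
  measure \<open>\<epsilon>\<close>. For \<open>\<epsilon> = \<infinity>\<close> infinitely many
  points contribute, and integrability comes from the Levy measure.\<close>

lemma big_jump_levels_finite:
  assumes lm: "levy_measure \<nu>" and rd: "radial_decomposition \<nu> \<sigma> \<rho>" and \<epsilon>: "0 < \<epsilon>"
    and fv: "\<epsilon> = \<infinity> \<Longrightarrow> (\<integral>\<^sup>+w. ennreal (min 1 (norm w)) \<partial>\<nu>) < \<infinity>"
  shows "(\<integral>\<^sup>+p. indicator {x. ereal x < \<epsilon>} (fst p) * ennreal (min 1 (tail_quantile \<rho> p)) \<partial>(lborel \<Otimes>\<^sub>M \<sigma>)) < \<infinity>"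
proof (cases \<epsilon>)
  case (real e)
  have m0: "(\<lambda>p. indicator {0..e} (fst p) :: ennreal) \<in> borel_measurable (lborel \<Otimes>\<^sub>M \<sigma>)"
    by (rule measurable_compose[OF measurable_fst]) simp
  have "(\<integral>\<^sup>+p. indicator {x. ereal x < \<epsilon>} (fst p) * ennreal (min 1 (tail_quantile \<rho> p)) \<partial>(lborel \<Otimes>\<^sub>M \<sigma>))
      \<le> (\<integral>\<^sup>+p. indicator {0..e} (fst p) \<partial>(lborel \<Otimes>\<^sub>M \<sigma>))"
  proof (rule nn_integral_mono)
    fix p :: "real \<times> (real^'d)"
    have "ennreal (min 1 (tail_quantile \<rho> p)) \<le> ennreal 1" by (rule ennreal_leI) simp
    then show "indicator {x. ereal x < \<epsilon>} (fst p) * ennreal (min 1 (tail_quantile \<rho> p)) \<le> indicator {0..e} (fst p)"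
      by (cases "0 < fst p") (auto simp: real indicator_def tail_quantile_def)
  qed
  also have "\<dots> = ennreal e"
    using \<epsilon> real by (subst sig.nn_integral_fst[OF m0, symmetric]) (simp add: sig.emeasure_space_1)
  also have "\<dots> < \<infinity>" by simp
  finally show ?thesis .
next
  case PInf
  have "(\<integral>\<^sup>+p. indicator {x. ereal x < \<epsilon>} (fst p) * ennreal (min 1 (tail_quantile \<rho> p)) \<partial>(lborel \<Otimes>\<^sub>M \<sigma>))
      \<le> (\<integral>\<^sup>+p. ennreal (min 1 (tail_quantile \<rho> p)) \<partial>(lborel \<Otimes>\<^sub>M \<sigma>))"
    by (rule nn_integral_mono) (simp add: indicator_def)
  also have "\<dots> \<le> 4 * (\<integral>\<^sup>+w. ennreal (min 1 (norm w)) \<partial>\<nu>)"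
    by (rule tail_quantile_min_one_le[OF sphere lm rd])
  also have "\<dots> < \<infinity>"
    using fv[OF PInf] by (simp add: ennreal_mult_less_top)
  finally show ?thesis .
next
  case MInf
  with \<epsilon> show ?thesis by simp
qed

text \<open>Drift, Gaussian part, small jumps and big jumps are separated by subadditivity of the
  power \<open>q\<close>. The two middle parts are bounded in mean square and lowered to exponent
  \<open>q\<close>, which yields the exponent \<open>q / 2\<close> on the squared quantities. An
  infinite small-jump integral makes the claim trivial.\<close>

theorem wasserstein_comonotonic_bound:
  fixes X :: "real \<Rightarrow> 'b \<Rightarrow> real^'d" and Y :: "real \<Rightarrow> 'c \<Rightarrow> real^'d" and SX SY :: "real^'d^'d"
  assumes q: "0 < q" "q \<le> 1" and X: "levy_process PX X" and Y: "levy_process PY Y"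
    and rX: "radial_levy_family \<sigma> \<rho>X" and rY: "radial_levy_family \<sigma> \<rho>Y"
    and fX: "(\<integral>\<^sup>+p. indicator {x. ereal x < \<epsilon>} (fst p) * ennreal (min 1 (tail_quantile \<rho>X p)) \<partial>(lborel \<Otimes>\<^sub>M \<sigma>)) < \<infinity>"
    and fY: "(\<integral>\<^sup>+p. indicator {x. ereal x < \<epsilon>} (fst p) * ennreal (min 1 (tail_quantile \<rho>Y p)) \<partial>(lborel \<Otimes>\<^sub>M \<sigma>)) < \<infinity>"
    and B: "standard_brownian_motion P B"
    and MX: "is_compensated_small_jump_part P \<Xi> \<sigma> \<rho>X \<epsilon> MX"
    and MY: "is_compensated_small_jump_part P \<Xi> \<sigma> \<rho>Y \<epsilon> MY"
    and lX: "path_law PX X = path_law P (\<lambda>t \<omega>. t *\<^sub>R dX + SX *v B t \<omega> + MX t \<omega> + big_jump_part \<Xi> \<rho>X \<epsilon> t \<omega>)"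
    and lY: "path_law PY Y = path_law P (\<lambda>t \<omega>. t *\<^sub>R dY + SY *v B t \<omega> + MY t \<omega> + big_jump_part \<Xi> \<rho>Y \<epsilon> t \<omega>)"
  shows "wasserstein q (path_law PX X) (path_law PY Y)
    \<le> ennreal (norm (dX - dY) powr q)
      + ennreal_power
          (4 * (\<integral>\<^sup>+(x, v) \<in> {x. 0 < x \<and> \<epsilon> \<le> ereal x} \<times> sphere 0 1.
                  ennreal ((inverse_tail \<rho>X x v - inverse_tail \<rho>Y x v)\<^sup>2) \<partial>(lborel \<Otimes>\<^sub>M \<sigma>)))
          (q / 2)
      + ennreal (2 powr q * real CARD('d) powr (q / 2) * norm (SX - SY) powr q)
      + (\<integral>\<^sup>+(x, v) \<in> {x. 0 < x \<and> ereal x < \<epsilon>} \<times> sphere 0 1.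
           ennreal (\<bar>inverse_tail \<rho>X x v - inverse_tail \<rho>Y x v\<bar> powr q) \<partial>(lborel \<Otimes>\<^sub>M \<sigma>))"
    (is "_ \<le> ?drift + ennreal_power (4 * ?I2) (q / 2) + ?gauss + ?I1")
proof (cases "?I2 = \<infinity>")
  case True
  then have "ennreal_power (4 * ?I2) (q / 2) = \<infinity>"
    by (simp add: ennreal_power_def ennreal_mult_eq_top_iff)
  then show ?thesis by simp
next
  case False
  define C where "C = enn2real ?I2"
  have C: "?I2 = ennreal C" and C0: "0 \<le> C"
    using False by (simp_all add: C_def less_top[symmetric])
  have I2: "ennreal_power (4 * ?I2) (q / 2) = ennreal ((4 * C) powr (q / 2))"
  proof -
    have "4 * ?I2 = ennreal (4 * C)" unfolding C using C0 by (simp add: ennreal_mult)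
    then show ?thesis using C0 by (simp add: ennreal_power_def)
  qed
  let ?BX = "\<lambda>t \<omega>. t *\<^sub>R dX + SX *v B t \<omega> + MX t \<omega> + big_jump_part \<Xi> \<rho>X \<epsilon> t \<omega>"
  let ?BY = "\<lambda>t \<omega>. t *\<^sub>R dY + SY *v B t \<omega> + MY t \<omega> + big_jump_part \<Xi> \<rho>Y \<epsilon> t \<omega>"
  have mB: "(\<lambda>\<omega>. A *v B t \<omega>) \<in> borel_measurable P" if "t \<in> {0..1}" for A t
  proof (rule measurable_compose[of "B t" P borel])
    show "B t \<in> borel_measurable P" using B that by (simp add: standard_brownian_motion_def)
    show "(*v) A \<in> borel_measurable borel"
      by (rule borel_measurable_continuous_onI) (rule matrix_vector_mult_linear_continuous_on)
  qed
  have mM: "MX t \<in> borel_measurable P" "MY t \<in> borel_measurable P" if "t \<in> {0..1}" for t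
    using MX MY that by (simp_all add: is_compensated_small_jump_part_def)
  have mL: "big_jump_part \<Xi> \<rho>X \<epsilon> t \<in> borel_measurable P" "big_jump_part \<Xi> \<rho>Y \<epsilon> t \<in> borel_measurable P" for t
    by (rule measurable_big_jump_part[OF rX], rule measurable_big_jump_part[OF rY])
  have mX: "?BX t \<in> borel_measurable P" if "t \<in> {0..1}" for t
    by (rule borel_measurable_add[OF borel_measurable_add[OF borel_measurable_add[OF borel_measurable_const mB[OF that]] mM(1)[OF that]] mL(1)])
  have mY: "?BY t \<in> borel_measurable P" if "t \<in> {0..1}" for t
    by (rule borel_measurable_add[OF borel_measurable_add[OF borel_measurable_add[OF borel_measurable_const mB[OF that]] mM(2)[OF that]] mL(2)])
  have "wasserstein q (path_law PX X) (path_law PY Y)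
      \<le> (\<integral>\<^sup>+\<omega>. (SUP t\<in>dyadics. ennreal (norm (?BX t \<omega> - ?BY t \<omega>) powr q)) \<partial>P)"
    by (rule wasserstein_le[OF q(1) X Y prob_space_axioms mX mY lX lY])
  also have "\<dots> \<le> ?drift + ennreal ((4 * C) powr (q / 2)) + ?gauss + ?I1"
  proof (rule nn_integral_SUP_dyadics_le[OF q(1)])
    show "(\<lambda>\<omega>. ?BX t \<omega> - ?BY t \<omega>) \<in> borel_measurable P" if "t \<in> {0..1}" for t
      by (rule borel_measurable_diff[OF mX[OF that] mY[OF that]])
    fix m :: nat
    let ?t = "dyadic_grid m" and ?n = "2 ^ m :: nat"
    let ?D = "\<lambda>k \<omega>. ?BX (?t k) \<omega> - ?BY (?t k) \<omega>"
    define RG where "RG = (\<lambda>\<omega>. running_max (\<lambda>k. norm ((SX - SY) *v B (?t k) \<omega>)) ?n)"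
    define RM where "RM = (\<lambda>\<omega>. running_max (\<lambda>k. norm (MX (?t k) \<omega> - MY (?t k) \<omega>)) ?n)"
    define RL where "RL = (\<lambda>\<omega>. running_max (\<lambda>k. norm (big_jump_part \<Xi> \<rho>X \<epsilon> (?t k) \<omega> - big_jump_part \<Xi> \<rho>Y \<epsilon> (?t k) \<omega>)) ?n)"
    have nonneg: "0 \<le> RG \<omega>" "0 \<le> RM \<omega>" "0 \<le> RL \<omega>" for \<omega>
      unfolding RG_def RM_def RL_def by (rule running_max_nonneg, simp)+
    have mRG: "RG \<in> borel_measurable P"
      unfolding RG_def
      by (rule running_max_measurable) (rule measurable_compose[OF mB[OF dyadic_grid_bounds] borel_measurable_norm])
    have mRM: "RM \<in> borel_measurable P"
      unfolding RM_def
      by (rule running_max_measurable)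
         (rule measurable_compose[OF borel_measurable_diff[OF mM[OF dyadic_grid_bounds]] borel_measurable_norm])
    have mRL: "RL \<in> borel_measurable P"
      unfolding RL_def
      by (rule running_max_measurable) (rule measurable_compose[OF borel_measurable_diff[OF mL] borel_measurable_norm])
    have pw: "(\<lambda>\<omega>. ennreal (R \<omega> powr q)) \<in> borel_measurable P" if "R \<in> borel_measurable P" for R :: "'a \<Rightarrow> real"
      using that by measurable
    have le: "running_max (\<lambda>k. norm (?D k \<omega>)) ?n \<le> norm (dX - dY) + RM \<omega> + RG \<omega> + RL \<omega>" for \<omega>
    proof (rule running_max_least)
      fix k assume k: "k \<le> ?n"
      have "?D k \<omega> = ?t k *\<^sub>R (dX - dY) + (MX (?t k) \<omega> - MY (?t k) \<omega>) + (SX - SY) *v B (?t k) \<omega>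
          + (big_jump_part \<Xi> \<rho>X \<epsilon> (?t k) \<omega> - big_jump_part \<Xi> \<rho>Y \<epsilon> (?t k) \<omega>)"
        by (simp add: algebra_simps matrix_vector_mult_diff_rdistrib)
      also have "norm \<dots> \<le> norm (?t k *\<^sub>R (dX - dY)) + norm (MX (?t k) \<omega> - MY (?t k) \<omega>) + norm ((SX - SY) *v B (?t k) \<omega>)
          + norm (big_jump_part \<Xi> \<rho>X \<epsilon> (?t k) \<omega> - big_jump_part \<Xi> \<rho>Y \<epsilon> (?t k) \<omega>)"
        by (rule norm_triangle_le[OF add_right_mono[OF norm_triangle_le[OF add_right_mono[OF norm_triangle_ineq]]]])
      also have "\<dots> \<le> norm (dX - dY) + RM \<omega> + RG \<omega> + RL \<omega>"
      proof (intro add_mono)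
        show "norm (?t k *\<^sub>R (dX - dY)) \<le> norm (dX - dY)"
          using dyadic_grid_bounds[of m k] by (simp add: mult_left_le_one_le)
        show "norm (MX (?t k) \<omega> - MY (?t k) \<omega>) \<le> RM \<omega>"
          unfolding RM_def by (rule running_max_ge[OF k])
        show "norm ((SX - SY) *v B (?t k) \<omega>) \<le> RG \<omega>"
          unfolding RG_def by (rule running_max_ge[OF k])
        show "norm (big_jump_part \<Xi> \<rho>X \<epsilon> (?t k) \<omega> - big_jump_part \<Xi> \<rho>Y \<epsilon> (?t k) \<omega>) \<le> RL \<omega>"
          unfolding RL_def by (rule running_max_ge[OF k])
      qed
      finally show "norm (?D k \<omega>) \<le> norm (dX - dY) + RM \<omega> + RG \<omega> + RL \<omega>" .
    qed
    have powr_le: "ennreal (running_max (\<lambda>k. norm (?D k \<omega>)) ?n powr q)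
        \<le> ?drift + ennreal (RM \<omega> powr q) + ennreal (RG \<omega> powr q) + ennreal (RL \<omega> powr q)" for \<omega>
    proof -
      have "running_max (\<lambda>k. norm (?D k \<omega>)) ?n powr q \<le> (norm (dX - dY) + RM \<omega> + RG \<omega> + RL \<omega>) powr q"
        using q by (intro powr_mono2 le running_max_nonneg) simp_all
      also have "\<dots> \<le> (norm (dX - dY) + RM \<omega> + RG \<omega>) powr q + RL \<omega> powr q"
        using q nonneg[of \<omega>] by (intro powr_add_le) simp_all
      also have "(norm (dX - dY) + RM \<omega> + RG \<omega>) powr q \<le> (norm (dX - dY) + RM \<omega>) powr q + RG \<omega> powr q"
        using q nonneg[of \<omega>] by (intro powr_add_le) simp_all
      also have "(norm (dX - dY) + RM \<omega>) powr q \<le> norm (dX - dY) powr q + RM \<omega> powr q"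
        using q nonneg[of \<omega>] by (intro powr_add_le) simp_all
      finally have "running_max (\<lambda>k. norm (?D k \<omega>)) ?n powr q
          \<le> norm (dX - dY) powr q + RM \<omega> powr q + RG \<omega> powr q + RL \<omega> powr q" by simp
      from ennreal_leI[OF this] show ?thesis by simp
    qed
    have RM: "(\<integral>\<^sup>+\<omega>. ennreal (RM \<omega> powr q) \<partial>P) \<le> ennreal ((4 * C) powr (q / 2))"
    proof (rule nn_integral_powr_le_of_square[OF mRM nonneg(2) q])
      show "(\<integral>\<^sup>+\<omega>. ennreal ((RM \<omega>)\<^sup>2) \<partial>P) \<le> ennreal (4 * C)"
        unfolding RM_def
        by (rule compensated_part_max_bound[OF rX rY MX MY mono_dyadic_grid dyadic_grid_bounds eq_refl[OF C] C0])
    qed (use C0 in simp)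
    have RG: "(\<integral>\<^sup>+\<omega>. ennreal (RG \<omega> powr q) \<partial>P) \<le> ?gauss"
    proof -
      let ?c = "4 * (real CARD('d) * (norm (SX - SY))\<^sup>2)"
      have "(\<integral>\<^sup>+\<omega>. ennreal (RG \<omega> powr q) \<partial>P) \<le> ennreal (?c powr (q / 2))"
      proof (rule nn_integral_powr_le_of_square[OF mRG nonneg(1) q])
        show "(\<integral>\<^sup>+\<omega>. ennreal ((RG \<omega>)\<^sup>2) \<partial>P) \<le> ennreal ?c"
          unfolding RG_def
          by (rule brownian_max_bound[OF B mono_dyadic_grid]) (use dyadic_grid_bounds in auto)
      qed simp
      \<comment> \<open>Under the exponent \<open>q / 2\<close> the factor 4 becomes
        \<open>2 powr q\<close>, and the squared norm becomes its power \<open>q\<close>.\<close>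
      also have "?c powr (q / 2) = 2 powr q * real CARD('d) powr (q / 2) * norm (SX - SY) powr q"
        using power2_powr_half[of "2" q] by (simp add: powr_mult power2_powr_half)
      finally show ?thesis .
    qed
    have RL: "(\<integral>\<^sup>+\<omega>. ennreal (RL \<omega> powr q) \<partial>P) \<le> ?I1"
    proof (rule order_trans[OF nn_integral_mono big_jump_bound[OF q rX rY fX fY]])
      fix \<omega>
      obtain k where k: "RL \<omega> = norm (big_jump_part \<Xi> \<rho>X \<epsilon> (?t k) \<omega> - big_jump_part \<Xi> \<rho>Y \<epsilon> (?t k) \<omega>)"
        unfolding RL_def using running_max_attained by blast
      show "ennreal (RL \<omega> powr q)
          \<le> (SUP t\<in>{0..1}. ennreal (norm (big_jump_part \<Xi> \<rho>X \<epsilon> t \<omega> - big_jump_part \<Xi> \<rho>Y \<epsilon> t \<omega>) powr q))"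
        unfolding k by (rule SUP_upper[OF dyadic_grid_bounds])
    qed
    have "(\<integral>\<^sup>+\<omega>. ennreal (running_max (\<lambda>k. norm (?D k \<omega>)) ?n powr q) \<partial>P)
        \<le> (\<integral>\<^sup>+\<omega>. ?drift + ennreal (RM \<omega> powr q) + ennreal (RG \<omega> powr q) + ennreal (RL \<omega> powr q) \<partial>P)"
      by (rule nn_integral_mono) (rule powr_le)
    also have "\<dots> = (\<integral>\<^sup>+\<omega>. ?drift \<partial>P) + (\<integral>\<^sup>+\<omega>. ennreal (RM \<omega> powr q) \<partial>P)
        + (\<integral>\<^sup>+\<omega>. ennreal (RG \<omega> powr q) \<partial>P) + (\<integral>\<^sup>+\<omega>. ennreal (RL \<omega> powr q) \<partial>P)"
      using pw[OF mRM] pw[OF mRG] pw[OF mRL] by (simp add: nn_integral_add)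
    also have "\<dots> \<le> ?drift + ennreal ((4 * C) powr (q / 2)) + ?gauss + ?I1"
      using RM RG RL by (intro add_mono) (simp_all add: emeasure_space_1)
    finally show "(\<integral>\<^sup>+\<omega>. ennreal (running_max (\<lambda>k. norm (?D k \<omega>)) ?n powr q) \<partial>P)
        \<le> ?drift + ennreal ((4 * C) powr (q / 2)) + ?gauss + ?I1" .
  qed
  finally show ?thesis unfolding I2 .
qed

end

theorem proposition3p4:
  fixes q :: real and \<epsilon> :: ereal
    and PX :: "'a measure" and X :: "real \<Rightarrow> 'a \<Rightarrow> real^'d"
    and PY :: "'b measure" and Y :: "real \<Rightarrow> 'b \<Rightarrow> real^'d"
    and \<gamma>X \<gamma>Y :: "real^'d" and \<Sigma>X \<Sigma>Y :: "real^'d^'d"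
    and \<nu>X \<nu>Y \<sigma> :: "(real^'d) measure"
    and \<rho>X \<rho>Y :: "real^'d \<Rightarrow> real measure"
    and P :: "'c measure" and U E :: "nat \<Rightarrow> 'c \<Rightarrow> real" and V :: "nat \<Rightarrow> 'c \<Rightarrow> real^'d"
    and \<Xi> :: "'c \<Rightarrow> (real \<times> real \<times> (real^'d)) measure"
  assumes "0 < q" and "q \<le> 1"
    and "levy_process PX X"
    and "has_characteristic_triplet PX X \<gamma>X (\<Sigma>X ** transpose \<Sigma>X) \<nu>X"
    and "levy_process PY Y"
    and "has_characteristic_triplet PY Y \<gamma>Y (\<Sigma>Y ** transpose \<Sigma>Y) \<nu>Y"
    and "sphere_prob \<sigma>"
    and "radial_decomposition \<nu>X \<sigma> \<rho>X"
    and "radial_decomposition \<nu>Y \<sigma> \<rho>Y"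
    and "0 < \<epsilon>"
    and "\<epsilon> = \<infinity> \<Longrightarrow> finite_variation PX X \<and> finite_variation PY Y"
    and "coupling_sequences P \<sigma> U E V"
    and "\<Xi> = jump_measure \<sigma> U (arrival E) V"
  shows
    "(\<integral>\<^sup>+\<omega>. (SUP t\<in>{0..1}.
          ennreal (norm (big_jump_part \<Xi> \<rho>X \<epsilon> t \<omega> - big_jump_part \<Xi> \<rho>Y \<epsilon> t \<omega>) powr q)) \<partial>P)
      \<le> (\<integral>\<^sup>+(x, v) \<in> {x. 0 < x \<and> ereal x < \<epsilon>} \<times> sphere 0 1.
            ennreal (\<bar>inverse_tail \<rho>X x v - inverse_tail \<rho>Y x v\<bar> powr q) \<partial>(lborel \<Otimes>\<^sub>M \<sigma>)) \<and>
     (\<forall>(B :: real \<Rightarrow> 'c \<Rightarrow> real^'d) MX MY driftX driftY.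
        standard_brownian_motion P B \<and>
        independent_of_jump_measure P \<sigma> \<Xi> B \<and>
        is_compensated_small_jump_part P \<Xi> \<sigma> \<rho>X \<epsilon> MX \<and>
        is_compensated_small_jump_part P \<Xi> \<sigma> \<rho>Y \<epsilon> MY \<and>
        path_law PX X =
          path_law P (\<lambda>t \<omega>. t *\<^sub>R driftX + \<Sigma>X *v B t \<omega> + MX t \<omega> + big_jump_part \<Xi> \<rho>X \<epsilon> t \<omega>) \<and>
        path_law PY Y =
          path_law P (\<lambda>t \<omega>. t *\<^sub>R driftY + \<Sigma>Y *v B t \<omega> + MY t \<omega> + big_jump_part \<Xi> \<rho>Y \<epsilon> t \<omega>) \<longrightarrow>
        wasserstein q (path_law PX X) (path_law PY Y)
          \<le> ennreal (norm (driftX - driftY) powr q)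
            + ennreal_power
                (4 * (\<integral>\<^sup>+(x, v) \<in> {x. 0 < x \<and> \<epsilon> \<le> ereal x} \<times> sphere 0 1.
                        ennreal ((inverse_tail \<rho>X x v - inverse_tail \<rho>Y x v)\<^sup>2) \<partial>(lborel \<Otimes>\<^sub>M \<sigma>)))
                (q / 2)
            + ennreal (2 powr q * real CARD('d) powr (q / 2) * norm (\<Sigma>X - \<Sigma>Y) powr q)
            + (\<integral>\<^sup>+(x, v) \<in> {x. 0 < x \<and> ereal x < \<epsilon>} \<times> sphere 0 1.
                 ennreal (\<bar>inverse_tail \<rho>X x v - inverse_tail \<rho>Y x v\<bar> powr q) \<partial>(lborel \<Otimes>\<^sub>M \<sigma>)))"
proof -
  interpret comonotonic_coupling P \<sigma> U E V
    using assms(7,12) by unfold_locales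
  have lm: "levy_measure \<nu>X" "levy_measure \<nu>Y"
    using assms(4,6) by (simp_all add: has_characteristic_triplet_def)
  have r: "radial_levy_family \<sigma> \<rho>X" "radial_levy_family \<sigma> \<rho>Y"
    using assms(8,9) by (simp_all add: radial_decomposition_def)
  \<comment> \<open>This finiteness gives the almost sure absolute convergence of the series behind
    the big-jump part of \<open>X\<close>; finite variation is invoked for
    \<open>\<epsilon> = \<infinity>\<close>.\<close>
  have fX: "(\<integral>\<^sup>+p. indicator {x. ereal x < \<epsilon>} (fst p) * ennreal (min 1 (tail_quantile \<rho>X p)) \<partial>(lborel \<Otimes>\<^sub>M \<sigma>)) < \<infinity>"
    using finite_variation_small_jumps[OF assms(3,4)] assms(11)
    by (intro big_jump_levels_finite[OF lm(1) assms(8,10)]) blast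
  have fY: "(\<integral>\<^sup>+p. indicator {x. ereal x < \<epsilon>} (fst p) * ennreal (min 1 (tail_quantile \<rho>Y p)) \<partial>(lborel \<Otimes>\<^sub>M \<sigma>)) < \<infinity>"
    using finite_variation_small_jumps[OF assms(5,6)] assms(11)
    by (intro big_jump_levels_finite[OF lm(2) assms(9,10)]) blast
  show ?thesis
    unfolding assms(13)
  proof (intro conjI allI impI, goal_cases)
    case 1
    show ?case by (rule big_jump_bound[OF assms(1,2) r fX fY])
  next
    case (2 B MX MY driftX driftY)
    then have B: "standard_brownian_motion P B"
      and MX: "is_compensated_small_jump_part P (jump_measure \<sigma> U (arrival E) V) \<sigma> \<rho>X \<epsilon> MX" and MY: "is_compensated_small_jump_part P (jump_measure \<sigma> U (arrival E) V) \<sigma> \<rho>Y \<epsilon> MY"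
      and lX: "path_law PX X = path_law P (\<lambda>t \<omega>. t *\<^sub>R driftX + \<Sigma>X *v B t \<omega> + MX t \<omega> + big_jump_part (jump_measure \<sigma> U (arrival E) V) \<rho>X \<epsilon> t \<omega>)"
      and lY: "path_law PY Y = path_law P (\<lambda>t \<omega>. t *\<^sub>R driftY + \<Sigma>Y *v B t \<omega> + MY t \<omega> + big_jump_part (jump_measure \<sigma> U (arrival E) V) \<rho>Y \<epsilon> t \<omega>)"
      by blast+
    show ?case
      by (rule wasserstein_comonotonic_bound[OF assms(1,2,3,5) r fX fY B MX MY lX lY])
  qed
qed

end
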